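(* Let $p>1$, $\frac1p+\frac1{p'}=1$, $n\ge2$, let $\Omega\subset\mathbb{R}^n$ be a bounded domain with $C^1$ smooth boundary and $0\in\Omega$, and let $l\in\mathbb{R}$, $l\ne p-n$. Then for every $u\in\hat W^{1,p}_l(\Omega)$, $u\not\equiv0$, $$\left(\int_\Omega|x|^l\left|\frac{\langle x,\nabla u\rangle}{|x|}\right|^pdx\right)^{1/p}\ge\left|\frac{p-l-n}{p}\right|\left(\int_\Omega|x|^{l-p}|u|^pdx\right)^{1/p}+\frac1p\operatorname{sgn}(p-l-n)\int_{\partial\Omega}|x|^{l-p}\langle x,\eta\rangle|Tu|^p\,dS\left(\int_\Omega|x|^{l-p}|u|^pdx\right)^{-1/p'},$$ where $\eta$ is the unit outward normal vector to $\partial\Omega$.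
   Context: $Tu$ denotes the trace of $u$ on $\partial\Omega$. Put $\partial\Omega_-=\{x\in\partial\Omega:\operatorname{sgn}(p-l-n)\langle x,\eta\rangle<0\}$ and consider the norm $$\left(\int_\Omega|x|^l|\nabla u|^pdx\right)^{1/p}+\left(\left(\tfrac{p-1}{p}\right)^{p-1}\int_{\partial\Omega_-}|\langle x,\eta\rangle||x|^{l-p}|u|^p\,dS\right)^{1/p}.$$ The space $\hat W^{1,p}_l(\Omega)$ is the completion, in this norm, of the functions in $C^\infty(\Omega)\cap C(\overline\Omega)$ with finite norm which satisfy $$\lim_{\varepsilon\to0}\varepsilon^{l-p+1}\int_{S_\varepsilon}|u|^p\,dS=0,\qquad S_\varepsilon=\{x\in\Omega:|x|=\varepsilon\}$$ ($u$ being understood on $S_\varepsilon$ in the trace sense for general elements). *)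

theory Defs
  imports "HOL-Analysis.Analysis"
begin

section \<open>Smooth functions and gradients\<close>

primrec Ck_on :: "nat \<Rightarrow> 'a::real_normed_vector set \<Rightarrow> ('a \<Rightarrow> real) \<Rightarrow> bool" where
  "Ck_on 0 S f \<longleftrightarrow> continuous_on S f"
| "Ck_on (Suc k) S f \<longleftrightarrow> (\<forall>x\<in>S. f differentiable (at x)) \<and>
     (\<forall>v. Ck_on k S (\<lambda>x. frechet_derivative f (at x) v))"

definition smooth_on :: "'a::real_normed_vector set \<Rightarrow> ('a \<Rightarrow> real) \<Rightarrow> bool" where
  "smooth_on S f \<longleftrightarrow> (\<forall>k. Ck_on k S f)"

definition gradient :: "('a::euclidean_space \<Rightarrow> real) \<Rightarrow> 'a \<Rightarrow> 'a" where
  "gradient f x = (THE D. GDERIV f x :> D)"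

definition test_function :: "'a::euclidean_space set \<Rightarrow> ('a \<Rightarrow> real) \<Rightarrow> bool" where
  "test_function U \<psi> \<longleftrightarrow> smooth_on UNIV \<psi> \<and>
     (\<exists>K. compact K \<and> K \<subseteq> U \<and> (\<forall>x. x \<notin> K \<longrightarrow> \<psi> x = 0))"

definition has_weak_gradient ::
  "'a::euclidean_space set \<Rightarrow> ('a \<Rightarrow> real) \<Rightarrow> ('a \<Rightarrow> 'a) \<Rightarrow> bool" where
  "has_weak_gradient U u G \<longleftrightarrow>
     (\<forall>K. compact K \<and> K \<subseteq> U \<longrightarrow>
        set_integrable lebesgue K u \<and> set_integrable lebesgue K G) \<and>
     (\<forall>\<psi>. test_function U \<psi> \<longrightarrow>
        (LINT x:U|lebesgue. u x *\<^sub>R gradient \<psi> x) = - (LINT x:U|lebesgue. \<psi> x *\<^sub>R G x))"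

text \<open>The choice matters only on a null set.\<close>

definition weak_gradient ::
  "'a::euclidean_space set \<Rightarrow> ('a \<Rightarrow> real) \<Rightarrow> 'a \<Rightarrow> 'a" where
  "weak_gradient U u = (SOME G. has_weak_gradient U u G)"


section \<open>Hypersurfaces and domains of class C1\<close>

text \<open>
  A C1 function of the coordinates other than the one in the direction \<open>b\<close> is represented by a
  C1 function \<open>\<gamma>\<close> on the whole space that is constant along \<open>b\<close>; its gradient \<open>D\<close> is then
  orthogonal to \<open>b\<close>. The graph is the set of all \<open>x\<close> with \<open>x \<bullet> b = \<gamma> x\<close>.
\<close>

definition C1_graph ::
  "'a::euclidean_space \<Rightarrow> ('a \<Rightarrow> real) \<Rightarrow> ('a \<Rightarrow> 'a) \<Rightarrow> bool" where
  "C1_graph b \<gamma> D \<longleftrightarrow> b \<in> Basis \<and> (\<forall>x t. \<gamma> (x + t *\<^sub>R b) = \<gamma> x) \<and>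
     (\<forall>x. GDERIV \<gamma> x :> D x) \<and> continuous_on UNIV D"

definition local_graph_domain ::
  "'a::euclidean_space set \<Rightarrow> 'a \<Rightarrow> real \<Rightarrow> 'a \<Rightarrow> ('a \<Rightarrow> real) \<Rightarrow> ('a \<Rightarrow> 'a) \<Rightarrow> real \<Rightarrow> bool" where
  "local_graph_domain \<Omega> z r b \<gamma> D s \<longleftrightarrow> 0 < r \<and> C1_graph b \<gamma> D \<and> s \<in> {-1, 1} \<and>
     \<Omega> \<inter> ball z r = {x \<in> ball z r. 0 < s * (x \<bullet> b - \<gamma> x)}"

definition C1_boundary :: "'a::euclidean_space set \<Rightarrow> bool" where
  "C1_boundary \<Omega> \<longleftrightarrow> (\<forall>z\<in>frontier \<Omega>. \<exists>r b \<gamma> D s. local_graph_domain \<Omega> z r b \<gamma> D s)"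

text \<open>For a set with C1 boundary the normal does not depend on the local representation.\<close>

definition outward_normal :: "'a::euclidean_space set \<Rightarrow> 'a \<Rightarrow> 'a" where
  "outward_normal \<Omega> z = (SOME \<nu>. \<exists>r b \<gamma> D s. local_graph_domain \<Omega> z r b \<gamma> D s \<and>
     \<nu> = (s / sqrt (1 + (norm (D z))\<^sup>2)) *\<^sub>R (D z - b))"

text \<open>
  The surface measure of a C1 hypersurface \<open>S\<close> is the Borel measure concentrated on \<open>S\<close> with
  \<open>dS = sqrt (1 + |D|\<^sup>2) dx'\<close> on every piece of \<open>S\<close> that is a graph over a coordinate hyperplane.
  The point \<open>x + (\<gamma> x - x \<bullet> b) *\<^sub>R b\<close> is the point of the graph above (or below) \<open>x\<close>. Since it and
  \<open>D x\<close> do not depend on \<open>x \<bullet> b\<close>, the integral over the (n-1)-dimensional coordinate hyperplane is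
  written as an n-dimensional one over the slab \<open>0 \<le> x \<bullet> b \<le> 1\<close>. The measure is unique, as
  countably many such pieces cover \<open>S\<close>.
\<close>

definition is_surface_measure :: "'a::euclidean_space set \<Rightarrow> 'a measure \<Rightarrow> bool" where
  "is_surface_measure S M \<longleftrightarrow> sets M = sets borel \<and> (AE x in M. x \<in> S) \<and>
     (\<forall>U b \<gamma> D. open U \<and> C1_graph b \<gamma> D \<and> S \<inter> U = {x \<in> U. x \<bullet> b = \<gamma> x} \<longrightarrow>
       (\<forall>B\<in>sets borel. B \<subseteq> U \<longrightarrow>
         emeasure M B =
           (\<integral>\<^sup>+x\<in>{x. 0 \<le> x \<bullet> b \<and> x \<bullet> b \<le> 1 \<and> x + (\<gamma> x - x \<bullet> b) *\<^sub>R b \<in> B}.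
              ennreal (sqrt (1 + (norm (D x))\<^sup>2)) \<partial>lborel)))"

definition surface_measure :: "'a::euclidean_space set \<Rightarrow> 'a measure" where
  "surface_measure S = (SOME M. is_surface_measure S M)"


section \<open>Traces\<close>

text \<open>
  The trace of a function that is of class \<open>W\<^sup>1\<^sup>,\<^sup>p\<close> in \<open>\<Omega> \<inter> U\<close> for some neighbourhood \<open>U\<close> of the
  boundary: the extension by continuity of the restriction to the boundary. Nothing is required
  away from the boundary, where a weight may be singular.
\<close>

definition has_trace ::
  "'a::euclidean_space set \<Rightarrow> real \<Rightarrow> ('a \<Rightarrow> real) \<Rightarrow> ('a \<Rightarrow> real) \<Rightarrow> bool" where
  "has_trace \<Omega> p u g \<longleftrightarrow>
     set_borel_measurable (surface_measure (frontier \<Omega>)) (frontier \<Omega>) g \<and>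
     (\<exists>U G \<phi>. open U \<and> frontier \<Omega> \<subseteq> U \<and> has_weak_gradient (\<Omega> \<inter> U) u G \<and>
        (\<forall>k::nat. smooth_on \<Omega> (\<phi> k) \<and> continuous_on (closure \<Omega>) (\<phi> k)) \<and>
        (\<lambda>k. \<integral>\<^sup>+x\<in>\<Omega> \<inter> U. ennreal (\<bar>\<phi> k x - u x\<bar> powr p) \<partial>lebesgue) \<longlonglongrightarrow> 0 \<and>
        (\<lambda>k. \<integral>\<^sup>+x\<in>\<Omega> \<inter> U. ennreal (norm (gradient (\<phi> k) x - G x) powr p) \<partial>lebesgue) \<longlonglongrightarrow> 0 \<and>
        (\<lambda>k. \<integral>\<^sup>+x\<in>frontier \<Omega>. ennreal (\<bar>\<phi> k x - g x\<bar> powr p)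
                \<partial>surface_measure (frontier \<Omega>)) \<longlonglongrightarrow> 0)"

definition trace_of ::
  "'a::euclidean_space set \<Rightarrow> real \<Rightarrow> ('a \<Rightarrow> real) \<Rightarrow> 'a \<Rightarrow> real" where
  "trace_of \<Omega> p u = (SOME g. has_trace \<Omega> p u g)"


section \<open>The weighted Sobolev space\<close>

definition boundary_minus ::
  "'a::euclidean_space set \<Rightarrow> real \<Rightarrow> real \<Rightarrow> 'a set" where
  "boundary_minus \<Omega> p l =
     {x \<in> frontier \<Omega>. sgn (p - l - real DIM('a)) * (x \<bullet> outward_normal \<Omega> x) < 0}"

definition hatW_norm ::
  "'a::euclidean_space set \<Rightarrow> real \<Rightarrow> real \<Rightarrow> ('a \<Rightarrow> real) \<Rightarrow> real" where
  "hatW_norm \<Omega> p l u =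
     (LINT x:\<Omega>|lebesgue. norm x powr l * norm (gradient u x) powr p) powr (1/p) +
     (((p - 1) / p) powr (p - 1) *
        (LINT x:boundary_minus \<Omega> p l|surface_measure (frontier \<Omega>).
           \<bar>x \<bullet> outward_normal \<Omega> x\<bar> * norm x powr (l - p) * \<bar>u x\<bar> powr p)) powr (1/p)"

definition hatW_finite_norm ::
  "'a::euclidean_space set \<Rightarrow> real \<Rightarrow> real \<Rightarrow> ('a \<Rightarrow> real) \<Rightarrow> bool" where
  "hatW_finite_norm \<Omega> p l u \<longleftrightarrow>
     set_integrable lebesgue \<Omega> (\<lambda>x. norm x powr l * norm (gradient u x) powr p) \<and>
     set_integrable (surface_measure (frontier \<Omega>)) (boundary_minus \<Omega> p l)
       (\<lambda>x. \<bar>x \<bullet> outward_normal \<Omega> x\<bar> * norm x powr (l - p) * \<bar>u x\<bar> powr p)"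

definition sphere_in :: "'a::euclidean_space set \<Rightarrow> real \<Rightarrow> 'a set" where
  "sphere_in \<Omega> \<epsilon> = {x \<in> \<Omega>. norm x = \<epsilon>}"

definition hatW_pre ::
  "'a::euclidean_space set \<Rightarrow> real \<Rightarrow> real \<Rightarrow> ('a \<Rightarrow> real) set" where
  "hatW_pre \<Omega> p l = {u. smooth_on \<Omega> u \<and> continuous_on (closure \<Omega>) u \<and> hatW_finite_norm \<Omega> p l u \<and>
     ((\<lambda>\<epsilon>. \<epsilon> powr (l - p + 1) *
        (LINT x:sphere_in \<Omega> \<epsilon>|surface_measure (sphere_in \<Omega> \<epsilon>). \<bar>u x\<bar> powr p)) \<longlongrightarrow> 0) (at_right 0)}"

text \<open>
  The completion of \<open>hatW_pre\<close>, realised as a space of (representatives of classes of) functions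
  on \<open>\<Omega>\<close>: the limits almost everywhere of sequences that are Cauchy in the norm. Every Cauchy
  sequence in \<open>hatW_pre\<close> has a subsequence converging almost everywhere, because for
  \<open>l \<noteq> p - n\<close> the norm controls the \<open>L\<^sup>p\<close> norm with weight \<open>|x|\<close> to the power \<open>l - p\<close>, and the limit
  function determines the class of the sequence, because it determines the limits of the
  gradients (as its weak gradient) and of the boundary values (as its trace).
\<close>

definition hatW :: "'a::euclidean_space set \<Rightarrow> real \<Rightarrow> real \<Rightarrow> ('a \<Rightarrow> real) set" where
  "hatW \<Omega> p l = {u. \<exists>\<phi>. (\<forall>k::nat. \<phi> k \<in> hatW_pre \<Omega> p l) \<and>
     (\<forall>e>0. \<exists>N. \<forall>i\<ge>N. \<forall>j\<ge>N. hatW_norm \<Omega> p l (\<lambda>x. \<phi> i x - \<phi> j x) < e) \<and>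
     (AE x in lebesgue. x \<in> \<Omega> \<longrightarrow> (\<lambda>k. \<phi> k x) \<longlonglongrightarrow> u x)}"

text \<open>
  The gradient of an element of the completion is its weak gradient away from the origin: for
  some exponents neither the function nor its gradient need be locally integrable at the origin.
\<close>

definition hatW_gradient :: "'a::euclidean_space set \<Rightarrow> ('a \<Rightarrow> real) \<Rightarrow> 'a \<Rightarrow> 'a" where
  "hatW_gradient \<Omega> u = weak_gradient (\<Omega> - {0}) u"

end

theory Submission imports Defs begin

text \<open>
  For smooth \<open>u\<close> and \<open>\<kappa> = p - l - n\<close>, the divergence theorem for the field \<open>|x|\<^sup>l\<^sup>-\<^sup>p |u|\<^sup>p x\<close> on \<open>\<Omega>\<close>
  without a small ball around the origin gives
  \<open>\<kappa> \<integral> |x|\<^sup>l\<^sup>-\<^sup>p |u|\<^sup>p + \<integral>\<^sub>\<partial>\<^sub>\<Omega> |x|\<^sup>l\<^sup>-\<^sup>p \<langle>x,\<eta>\<rangle> |u|\<^sup>p dS = \<integral> |x|\<^sup>l\<^sup>-\<^sup>p \<langle>x, \<nabla>|u|\<^sup>p\<rangle>\<close>, the condition on small spheres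
  disposing of the inner boundary. Hoelder's inequality bounds the right-hand side by the radial
  energy, which is the claim multiplied by \<open>p (\<integral> |x|\<^sup>l\<^sup>-\<^sup>p |u|\<^sup>p)\<close> to the power \<open>1 / p'\<close>. Dropping the part
  of the boundary integral with the good sign, the same inequality bounds the weighted \<open>L\<^sup>p\<close> norm
  by the norm of the space; hence for a Cauchy sequence the functions, their gradients and, by a
  trace inequality, their boundary values converge in \<open>L\<^sup>p\<close>, and the limits are the function, its
  weak gradient and its trace.
\<close>

section \<open>Smooth functions\<close>

text \<open>\<open>surface_measure\<close>, \<open>outward_normal\<close>,
  \<open>weak_gradient\<close> and \<open>trace_of\<close> are choices by \<open>SOME\<close>;
  nothing can be computed with them before existence and, except for the measure, uniqueness is
  proved. For the surface measure the obstacle is that graph patches over different coordinate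
  hyperplanes must give the same measure on their overlap; integration over the two slabs reduces
  this to a change of variables on a line. The divergence theorem is proved for open sets with
  compact C1 boundary, so that it covers both \<Omega> and the exterior of a ball; the set between
  them is never treated as a domain. Finiteness of the integral of |x|^(l-p) |u|^p is itself a
  conclusion: if a denotes this integral outside a small ball, the identity and Hoelder give
  |\<kappa>| a \<le> c + d a^(1-1/p) with c and d bounded as the ball shrinks; the exponent is below
  1 and \<kappa> is nonzero, so a stays bounded. Convergence of the boundary values and uniqueness
  of the trace rest on one trace inequality, which sees \<Omega> only near its boundary and so
  avoids the singularity of the weights.\<close>

lemma frechet_derivative_cong_open:
  assumes "open S" "x \<in> S" "\<And>y. y \<in> S \<Longrightarrow> f y = g y"
  shows "frechet_derivative f (at x) = frechet_derivative g (at x)"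
    and "f differentiable (at x) \<longleftrightarrow> g differentiable (at x)"
proof -
  have *: "(f has_derivative D) (at x) \<longleftrightarrow> (g has_derivative D) (at x)" for D
    using has_derivative_transform_within_open[OF _ assms(1,2), of f D UNIV g]
      has_derivative_transform_within_open[OF _ assms(1,2), of g D UNIV f] assms(3) by auto
  then show "frechet_derivative f (at x) = frechet_derivative g (at x)"
    by (simp add: frechet_derivative_def)
  show "f differentiable (at x) \<longleftrightarrow> g differentiable (at x)"
    using * by (simp add: differentiable_def)
qed

lemma Ck_on_cong:
  assumes "open S" "\<And>x. x \<in> S \<Longrightarrow> f x = g x"
  shows "Ck_on k S f \<longleftrightarrow> Ck_on k S g"
  using assms(2)
proof (induction k arbitrary: f g)
  case 0
  then show ?case by (simp cong: continuous_on_cong)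
next
  case (Suc k)
  have "Ck_on k S (\<lambda>x. frechet_derivative f (at x) v) = Ck_on k S (\<lambda>x. frechet_derivative g (at x) v)" for v
    by (rule Suc.IH) (simp add: frechet_derivative_cong_open(1)[OF assms(1) _ Suc.prems])
  then show ?case
    by (simp add: frechet_derivative_cong_open(2)[OF assms(1) _ Suc.prems])
qed

lemma Ck_on_SucD:
  assumes "Ck_on (Suc k) S f"
  shows "Ck_on k S f"
  using assms
proof (induction k arbitrary: f)
  case 0
  then show ?case
    by (auto intro!: continuous_at_imp_continuous_on differentiable_imp_continuous_within)
next
  case (Suc k)
  then show ?case by (metis Ck_on.simps(2))
qed

lemma Ck_on_const: "open S \<Longrightarrow> Ck_on k S (\<lambda>x. c)"
proof (induction k arbitrary: c)
  case (Suc k)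
  then show ?case by (simp add: frechet_derivative_const)
qed simp

lemma Ck_on_add:
  assumes "open S" "Ck_on k S f" "Ck_on k S g"
  shows "Ck_on k S (\<lambda>x. f x + g x)"
  using assms(2,3)
proof (induction k arbitrary: f g)
  case 0
  then show ?case by (simp add: continuous_on_add)
next
  case (Suc k)
  have "frechet_derivative (\<lambda>x. f x + g x) (at x) v =
      frechet_derivative f (at x) v + frechet_derivative g (at x) v" if "x \<in> S" for x v
  proof -
    have "((\<lambda>x. f x + g x) has_derivative
      (\<lambda>v. frechet_derivative f (at x) v + frechet_derivative g (at x) v)) (at x)"
      using Suc.prems that by (intro has_derivative_add) (auto simp: frechet_derivative_works[symmetric])
    from frechet_derivative_at[OF this] show ?thesis by metis
  qed
  then have "Ck_on k S (\<lambda>x. frechet_derivative (\<lambda>x. f x + g x) (at x) v) \<longleftrightarrow>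
        Ck_on k S (\<lambda>x. frechet_derivative f (at x) v + frechet_derivative g (at x) v)" for v
    by (intro Ck_on_cong[OF assms(1)]) auto
  then show ?case using Suc by (auto intro!: Suc.IH)
qed

lemma Ck_on_mult:
  assumes "open S" "Ck_on k S f" "Ck_on k S g"
  shows "Ck_on k S (\<lambda>x. f x * g x)"
  using assms(2,3)
proof (induction k arbitrary: f g)
  case 0
  then show ?case by (simp add: continuous_on_mult)
next
  case (Suc k)
  have "frechet_derivative (\<lambda>x. f x * g x) (at x) v =
      f x * frechet_derivative g (at x) v + frechet_derivative f (at x) v * g x" if "x \<in> S" for x v
  proof -
    have "((\<lambda>x. f x * g x) has_derivative
      (\<lambda>v. f x * frechet_derivative g (at x) v + frechet_derivative f (at x) v * g x)) (at x)"
      using Suc.prems that by (intro has_derivative_mult) (auto simp: frechet_derivative_works[symmetric])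
    from frechet_derivative_at[OF this] show ?thesis by metis
  qed
  then have "Ck_on k S (\<lambda>x. frechet_derivative (\<lambda>x. f x * g x) (at x) v) \<longleftrightarrow>
    Ck_on k S (\<lambda>x. f x * frechet_derivative g (at x) v + frechet_derivative f (at x) v * g x)" for v
    by (intro Ck_on_cong[OF assms(1)]) auto
  moreover have "Ck_on k S f" "Ck_on k S g" using Suc.prems Ck_on_SucD by blast+
  ultimately show ?case using Suc by (auto intro!: Ck_on_add[OF assms(1)] Suc.IH)
qed

lemma Ck_on_diff:
  assumes "open S" "Ck_on k S f" "Ck_on k S g"
  shows "Ck_on k S (\<lambda>x. f x - g x)"
  using Ck_on_add[OF assms(1,2) Ck_on_mult[OF assms(1) Ck_on_const[OF assms(1), of k "-1"] assms(3)]]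
  by simp

lemma Ck_on_inner: 
  assumes "open S" shows "Ck_on k S (\<lambda>x. x \<bullet> w)"
proof (cases k)
  case (Suc j)
  have d: "((\<lambda>x. x \<bullet> w) has_derivative (\<lambda>v. v \<bullet> w)) (at x)" for x :: 'a
    by (intro derivative_eq_intros) auto
  have "frechet_derivative (\<lambda>x. x \<bullet> w) (at x) = (\<lambda>v. v \<bullet> w)" for x :: 'a
    using frechet_derivative_at[OF d] by metis
  then show ?thesis using d assms Suc by (auto simp: Ck_on_const differentiable_def)
qed (auto intro!: continuous_intros)

lemma Ck_on_prod:
  assumes "open S" "\<And>i. i \<in> I \<Longrightarrow> Ck_on k S (f i)"
  shows "Ck_on k S (\<lambda>x. \<Prod>i\<in>I. f i x)"
  using assms(2)
  by (induction I rule: infinite_finite_induct) (auto intro!: Ck_on_const Ck_on_mult assms(1))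

lemma smooth_on_diff: "open S \<Longrightarrow> smooth_on S f \<Longrightarrow> smooth_on S g \<Longrightarrow> smooth_on S (\<lambda>x. f x - g x)"
  by (simp add: smooth_on_def Ck_on_diff)

text \<open>The family is closed under differentiation, up to linear combinations.\<close>

definition exp_recip :: "nat \<Rightarrow> real \<Rightarrow> real" where
  "exp_recip m t = (if 0 < t then exp (- (1 / t)) / t ^ m else 0)"

text \<open>From the right, the substitution of 1/t turns this into the exponential beating every
  power; from the left the function is zero.\<close>

lemma tendsto_exp_recip_0: "(exp_recip m \<longlongrightarrow> 0) (at 0)"
proof -
  have "((\<lambda>x::real. x ^ m / exp x) \<longlongrightarrow> 0) at_top"
    by (rule tendsto_power_div_exp_0)
  then have "((\<lambda>t::real. (inverse t) ^ m / exp (inverse t)) \<longlongrightarrow> 0) (at_right 0)"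
    by (rule filterlim_compose[OF _ filterlim_inverse_at_top_right])
  then have "(exp_recip m \<longlongrightarrow> 0) (at_right 0)"
    by (rule Lim_transform_eventually)
      (auto simp: eventually_at_right_less exp_recip_def exp_minus field_simps
        intro!: eventually_mono[OF eventually_at_right_less])
  moreover have "(exp_recip m \<longlongrightarrow> 0) (at_left 0)"
    by (rule tendsto_eventually)
      (auto simp: eventually_at_left_field exp_recip_def intro!: exI[of _ "-1"])
  ultimately show ?thesis by (rule filterlim_split_at_real[rotated])
qed

text \<open>Differentiating exp(-1/t) / t^m produces the exponents m + 2 and m + 1, so the family
  reproduces itself. The delicate point is t = 0.\<close>

lemma DERIV_exp_recip:
  "(exp_recip m has_real_derivative exp_recip (m + 2) t - real m * exp_recip (Suc m) t) (at t)"
proof -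
  consider "t > 0" | "t < 0" | "t = 0" by linarith
  then show ?thesis
  proof cases
    case 1
    have "((\<lambda>t. exp (- (1 / t)) / t ^ m) has_real_derivative
      (exp (- (1 / t)) * (1 / t\<^sup>2) * t ^ m - exp (- (1 / t)) * (real m * t ^ (m - 1))) / (t ^ m * t ^ m)) (at t)"
      using 1 by (auto intro!: derivative_eq_intros simp: power2_eq_square)
    also have "(exp (- (1 / t)) * (1 / t\<^sup>2) * t ^ m - exp (- (1 / t)) * (real m * t ^ (m - 1))) / (t ^ m * t ^ m)
      = exp_recip (m + 2) t - real m * exp_recip (Suc m) t"
      using 1 by (cases m) (auto simp: exp_recip_def field_simps power2_eq_square)
    finally have "((\<lambda>t. exp (- (1 / t)) / t ^ m) has_real_derivative
      exp_recip (m + 2) t - real m * exp_recip (Suc m) t) (at t)" .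
    then show ?thesis
      by (rule has_field_derivative_transform_within_open[of _ _ _ "{0<..}"])
         (use 1 in \<open>auto simp: exp_recip_def\<close>)
  next
    case 2
    have "((\<lambda>t. 0) has_real_derivative 0) (at t)" by simp
    then have "(exp_recip m has_real_derivative 0) (at t)"
      by (rule has_field_derivative_transform_within_open[of _ _ _ "{..<0}"])
         (use 2 in \<open>auto simp: exp_recip_def\<close>)
    then show ?thesis using 2 by (simp add: exp_recip_def)
  next
    case 3
    \<comment> \<open>The difference quotient of \<open>exp_recip m\<close> at 0 is
      \<open>exp_recip (Suc m)\<close>, whose limit there is known.\<close>
    have "((\<lambda>h. (exp_recip m (0 + h) - exp_recip m 0) / h) \<longlongrightarrow> 0) (at 0)"
      by (rule Lim_transform_eventually[OF tendsto_exp_recip_0[of "Suc m"]])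
         (auto simp: exp_recip_def field_simps intro!: always_eventually)
    then show ?thesis using 3 by (simp add: DERIV_def exp_recip_def)
  qed
qed

text \<open>The derivative contains members of the family with larger \<open>m\<close> and a
  derivative of \<open>q\<close>; hence the induction runs over all \<open>m\<close> at once, and
  \<open>q\<close> is assumed to be C^k for every k.\<close>

lemma Ck_on_exp_recip:
  assumes "open S" "\<And>k. Ck_on k S q"
  shows "Ck_on k S (\<lambda>x. exp_recip m (q x))"
proof (induction k arbitrary: m)
  case 0
  have "continuous_on UNIV (exp_recip m)"
    using DERIV_exp_recip DERIV_isCont continuous_at_imp_continuous_on by blast
  then show ?case
    using assms(2)[of 0] continuous_on_compose2[of UNIV "exp_recip m" S q] by simp
next
  case (Suc k)
  have q: "(q has_derivative frechet_derivative q (at x)) (at x)" if "x \<in> S" for x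
    using assms(2)[of "Suc 0"] that by (auto simp: frechet_derivative_works)
  let ?d = "\<lambda>x. exp_recip (m + 2) (q x) + (- real m) * exp_recip (Suc m) (q x)"
  have d: "((\<lambda>x. exp_recip m (q x)) has_derivative (\<lambda>v. ?d x * frechet_derivative q (at x) v)) (at x)"
    if "x \<in> S" for x
    using has_derivative_compose[OF q[OF that] DERIV_exp_recip[unfolded has_field_derivative_def]]
    by (simp add: has_field_derivative_def mult.commute)
  have "frechet_derivative (\<lambda>x. exp_recip m (q x)) (at x) v = ?d x * frechet_derivative q (at x) v"
    if "x \<in> S" for x v
    using frechet_derivative_at[OF d[OF that]] by metis
  then have "Ck_on k S (\<lambda>x. frechet_derivative (\<lambda>x. exp_recip m (q x)) (at x) v) \<longleftrightarrow>
     Ck_on k S (\<lambda>x. ?d x * frechet_derivative q (at x) v)" for v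
    by (intro Ck_on_cong assms) auto
  moreover have "Ck_on k S (\<lambda>x. frechet_derivative q (at x) v)" for v
    using assms(2)[of "Suc k"] by simp
  ultimately show ?case using d
    by (auto simp: differentiable_def simp del: mult_minus_left intro!: Ck_on_mult Ck_on_diff Ck_on_const assms(1) Suc.IH)
qed

lemma exp_recip_nonneg: "0 \<le> exp_recip m t" and exp_recip_0_le_1: "exp_recip 0 t \<le> 1"
  and exp_recip_pos_iff: "0 < exp_recip m t \<longleftrightarrow> 0 < t"
  and exp_recip_eq_0: "t \<le> 0 \<Longrightarrow> exp_recip m t = 0"
  by (auto simp: exp_recip_def)

section \<open>Gradients of differentiable functions\<close>

lemma GDERIV_unique: "GDERIV f x :> D \<Longrightarrow> GDERIV f x :> D' \<Longrightarrow> D = D'"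
  unfolding gderiv_def by (drule (1) has_derivative_unique) (metis inner_commute vector_eq_ldot)

lemma gradient_eq: "GDERIV f x :> D \<Longrightarrow> gradient f x = D"
  unfolding gradient_def by (rule the_equality) (auto intro: GDERIV_unique)

lemma frechet_derivative_GDERIV:
  assumes "f differentiable (at x)"
  shows "GDERIV f x :> (\<Sum>b\<in>Basis. frechet_derivative f (at x) b *\<^sub>R b)"
proof -
  have f: "(f has_derivative frechet_derivative f (at x)) (at x)"
    using assms frechet_derivative_works by blast
  interpret linear "frechet_derivative f (at x)"
    using f by (rule has_derivative_linear)
  have *: "frechet_derivative f (at x) h = h \<bullet> (\<Sum>b\<in>Basis. frechet_derivative f (at x) b *\<^sub>R b)" for h
  proof -
    have "frechet_derivative f (at x) (\<Sum>b\<in>Basis. (h \<bullet> b) *\<^sub>R b) = (\<Sum>b\<in>Basis. (h \<bullet> b) * frechet_derivative f (at x) b)"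
      by (simp add: sum scale)
    then show ?thesis by (simp add: euclidean_representation inner_sum_right mult.commute)
  qed
  show ?thesis using f unfolding gderiv_def by (rule has_derivative_eq_rhs) (rule ext, rule *)
qed

lemma smooth_on_GDERIV:
  assumes "smooth_on S f"
  shows "\<And>x. x \<in> S \<Longrightarrow> GDERIV f x :> gradient f x" and "continuous_on S (gradient f)"
    and "continuous_on S f"
proof -
  have 0: "Ck_on (Suc 0) S f" "Ck_on 0 S f" using assms unfolding smooth_on_def by blast+
  have *: "GDERIV f x :> (\<Sum>b\<in>Basis. frechet_derivative f (at x) b *\<^sub>R b)" if "x \<in> S" for x
    using 0 that by (intro frechet_derivative_GDERIV) auto
  then show "\<And>x. x \<in> S \<Longrightarrow> GDERIV f x :> gradient f x" using gradient_eq by metis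
  have "continuous_on S (\<lambda>x. \<Sum>b\<in>Basis. frechet_derivative f (at x) b *\<^sub>R b)"
    using 0 by (auto intro!: continuous_intros)
  then show "continuous_on S (gradient f)"
    by (rule continuous_on_eq) (use * gradient_eq in metis)
  show "continuous_on S f" using 0 by simp
qed

lemma GDERIV_imp_continuous_on: "(\<And>x. x \<in> S \<Longrightarrow> GDERIV f x :> g x) \<Longrightarrow> continuous_on S f"
  unfolding gderiv_def by (meson continuous_at_imp_continuous_on has_derivative_continuous)

lemma GDERIV_cong_open:
  assumes "GDERIV f x :> D" "open S" "x \<in> S" "\<And>y. y \<in> S \<Longrightarrow> f y = g y"
  shows "GDERIV g x :> D"
  using assms has_derivative_transform_within_open[of f _ x UNIV S g] unfolding gderiv_def by auto

lemma GDERIV_along_line: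
  assumes "GDERIV f (x + t *\<^sub>R e) :> D"
  shows "((\<lambda>t. f (x + t *\<^sub>R e)) has_real_derivative e \<bullet> D) (at t)"
proof -
  have "((\<lambda>t. x + t *\<^sub>R e) has_derivative (\<lambda>h. h *\<^sub>R e)) (at t)"
    by (auto intro!: derivative_eq_intros)
  from has_derivative_compose[OF this assms[unfolded gderiv_def]]
  show ?thesis by (simp add: has_field_derivative_def mult_commute_abs)
qed

section \<open>Divergence theorem below a graph\<close>

text \<open>The slab has thickness 1, so for functions that are constant along \<open>b\<close>
  integration over it stands for integration over the coordinate hyperplane orthogonal to
  \<open>b\<close>.\<close>

definition slab :: "'a::euclidean_space \<Rightarrow> 'a set" where
  "slab b = {x. 0 \<le> x \<bullet> b \<and> x \<bullet> b \<le> 1}"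

lemma slab_measurable [measurable]: "slab b \<in> sets borel"
  unfolding slab_def by measurable

lemma nn_integral_lborel_shift:
  fixes c :: "'a::euclidean_space"
  assumes [measurable]: "f \<in> borel_measurable borel"
  shows "(\<integral>\<^sup>+x. f (x + c) \<partial>lborel) = (\<integral>\<^sup>+x. f x \<partial>lborel)"
proof -
  have "(\<integral>\<^sup>+x. f x \<partial>lborel) = (\<integral>\<^sup>+x. f x \<partial>distr lborel borel ((+) c))"
    by (simp add: lborel_distr_plus)
  also have "\<dots> = (\<integral>\<^sup>+x. f (x + c) \<partial>lborel)"
    by (subst nn_integral_distr) (auto simp: add.commute)
  finally show ?thesis by simp
qed

text \<open>
  Integrating \<open>f (x + t b)\<close> over \<open>x\<close> in the slab and all \<open>t\<close> counts every point with the length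
  of a unit interval; so no coordinate splitting of the space is necessary.
\<close>

lemma nn_integral_slab_pair:
  fixes b :: "'a::euclidean_space" and f :: "'a \<Rightarrow> ennreal"
  assumes b: "b \<in> Basis" and [measurable]: "f \<in> borel_measurable borel"
  shows "(\<integral>\<^sup>+z. indicator (slab b) (fst z) * f (fst z + snd z *\<^sub>R b) \<partial>(lborel \<Otimes>\<^sub>M lborel)) = (\<integral>\<^sup>+x. f x \<partial>lborel)"
proof -
  have [measurable]: "(\<lambda>z::'a \<times> real. indicator (slab b) (fst z) * f (fst z + snd z *\<^sub>R b)) \<in> borel_measurable (lborel \<Otimes>\<^sub>M lborel)"
    "(\<lambda>z::'a \<times> real. indicator (slab b) (fst z - snd z *\<^sub>R b) * f (fst z)) \<in> borel_measurable (lborel \<Otimes>\<^sub>M lborel)"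
    by measurable
  have "(\<integral>\<^sup>+z. indicator (slab b) (fst z) * f (fst z + snd z *\<^sub>R b) \<partial>(lborel \<Otimes>\<^sub>M lborel))
    = (\<integral>\<^sup>+t. \<integral>\<^sup>+x. indicator (slab b) x * f (x + t *\<^sub>R b) \<partial>lborel \<partial>lborel)"
    by (subst lborel_pair.nn_integral_snd[symmetric]) auto
  also have "\<dots> = (\<integral>\<^sup>+t. \<integral>\<^sup>+x. indicator (slab b) (x - t *\<^sub>R b) * f x \<partial>lborel \<partial>lborel)"
  proof (rule nn_integral_cong)
    fix t :: real
    show "(\<integral>\<^sup>+x. indicator (slab b) x * f (x + t *\<^sub>R b) \<partial>lborel) = (\<integral>\<^sup>+x. indicator (slab b) (x - t *\<^sub>R b) * f x \<partial>lborel)"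
      using nn_integral_lborel_shift[of "\<lambda>x. indicator (slab b) (x - t *\<^sub>R b) * f x" "t *\<^sub>R b"] by simp
  qed
  also have "\<dots> = (\<integral>\<^sup>+x. \<integral>\<^sup>+t. indicator (slab b) (x - t *\<^sub>R b) * f x \<partial>lborel \<partial>lborel)"
    by (rule lborel_pair.Fubini') measurable
  also have "\<dots> = (\<integral>\<^sup>+x. f x \<partial>lborel)"
  proof (rule nn_integral_cong)
    fix x :: 'a
    \<comment> \<open>The parameters t for which x - t b lies in the slab form an interval of length
      1, ending at x \<bullet> b.\<close>
    have "(\<integral>\<^sup>+t. indicator (slab b) (x - t *\<^sub>R b) * f x \<partial>lborel)
      = (\<integral>\<^sup>+t. indicator {x \<bullet> b - 1 .. x \<bullet> b} t * f x \<partial>lborel)"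
      by (intro nn_integral_cong) (use b in \<open>auto simp: indicator_def slab_def inner_diff_left inner_Basis\<close>)
    also have "\<dots> = f x" by (simp add: nn_integral_multc)
    finally show "(\<integral>\<^sup>+t. indicator (slab b) (x - t *\<^sub>R b) * f x \<partial>lborel) = f x" .
  qed
  finally show ?thesis .
qed

lemma nn_integral_slab:
  fixes b :: "'a::euclidean_space" and f :: "'a \<Rightarrow> ennreal"
  assumes b: "b \<in> Basis" and [measurable]: "f \<in> borel_measurable borel"
  shows "(\<integral>\<^sup>+x. f x \<partial>lborel) = (\<integral>\<^sup>+x\<in>slab b. (\<integral>\<^sup>+t. f (x + t *\<^sub>R b) \<partial>lborel) \<partial>lborel)"
proof -
  have [measurable]: "(\<lambda>z::'a \<times> real. indicator (slab b) (fst z) * f (fst z + snd z *\<^sub>R b)) \<in> borel_measurable (lborel \<Otimes>\<^sub>M lborel)"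
    by measurable
  have "(\<integral>\<^sup>+x. f x \<partial>lborel) = (\<integral>\<^sup>+x. \<integral>\<^sup>+t. indicator (slab b) x * f (x + t *\<^sub>R b) \<partial>lborel \<partial>lborel)"
    by (subst nn_integral_slab_pair[OF assms, symmetric], subst lborel.nn_integral_fst[symmetric]) auto
  also have "\<dots> = (\<integral>\<^sup>+x\<in>slab b. (\<integral>\<^sup>+t. f (x + t *\<^sub>R b) \<partial>lborel) \<partial>lborel)"
    by (intro nn_integral_cong) (auto simp: nn_integral_cmult mult.commute)
  finally show ?thesis .
qed

text \<open>The positive part, the negative part and the norm of \<open>f\<close> each pass through
  the identity for nonnegative functions; the function on pairs is therefore integrable with the
  same integral, and Fubini applies to it.\<close>

lemma integral_slab:
  fixes b :: "'a::euclidean_space" and f :: "'a \<Rightarrow> real"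
  assumes b: "b \<in> Basis" and f: "integrable lborel f"
  shows "AE x in lborel. x \<in> slab b \<longrightarrow> integrable lborel (\<lambda>t. f (x + t *\<^sub>R b))"
    and "set_integrable lborel (slab b) (\<lambda>x. LINT t|lborel. f (x + t *\<^sub>R b))"
    and "(LINT x|lborel. f x) = (LINT x:slab b|lborel. (LINT t|lborel. f (x + t *\<^sub>R b)))"
proof -
  have [measurable]: "f \<in> borel_measurable borel" using f by auto
  let ?g = "\<lambda>z::'a \<times> real. indicator (slab b) (fst z) * f (fst z + snd z *\<^sub>R b)"
  have [measurable]: "?g \<in> borel_measurable (lborel \<Otimes>\<^sub>M lborel)" by measurable
  have n: "(\<integral>\<^sup>+z. ennreal (?g z) \<partial>(lborel \<Otimes>\<^sub>M lborel)) = (\<integral>\<^sup>+x. ennreal (f x) \<partial>lborel)"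
    "(\<integral>\<^sup>+z. ennreal (- ?g z) \<partial>(lborel \<Otimes>\<^sub>M lborel)) = (\<integral>\<^sup>+x. ennreal (- f x) \<partial>lborel)"
    "(\<integral>\<^sup>+z. ennreal (norm (?g z)) \<partial>(lborel \<Otimes>\<^sub>M lborel)) = (\<integral>\<^sup>+x. ennreal (norm (f x)) \<partial>lborel)"
    by (subst nn_integral_slab_pair[OF b, symmetric];
        auto intro!: nn_integral_cong simp: indicator_def)+
  have i: "integrable (lborel \<Otimes>\<^sub>M lborel) ?g"
    using f n(3) by (intro integrableI_bounded) (auto simp: integrable_iff_bounded)
  have eq: "(LINT z|(lborel \<Otimes>\<^sub>M lborel). ?g z) = (LINT x|lborel. f x)"
    using i f n by (simp add: real_lebesgue_integral_def)
  show "AE x in lborel. x \<in> slab b \<longrightarrow> integrable lborel (\<lambda>t. f (x + t *\<^sub>R b))"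
    using lborel_pair.AE_integrable_fst'[OF i] by eventually_elim (auto simp: indicator_def)
  show "set_integrable lborel (slab b) (\<lambda>x. LINT t|lborel. f (x + t *\<^sub>R b))"
    using lborel_pair.integrable_fst'[OF i] by (simp add: set_integrable_def)
  show "(LINT x|lborel. f x) = (LINT x:slab b|lborel. (LINT t|lborel. f (x + t *\<^sub>R b)))"
    using lborel_pair.integral_fst'[OF i] eq by (simp add: set_lebesgue_integral_def)
qed

text \<open>The form in which Fubini is used below: the line integrals have to be evaluated only on
  lines along which \<open>f\<close> is integrable, since the remaining lines in the slab form a
  null set.\<close>

lemma integral_slab_eq:
  fixes b :: "'a::euclidean_space" and f :: "'a \<Rightarrow> real"
  assumes b: "b \<in> Basis" and f: "integrable lborel f"
    and h: "\<And>x. integrable lborel (\<lambda>t. f (x + t *\<^sub>R b)) \<Longrightarrow> (LINT t|lborel. f (x + t *\<^sub>R b)) = h x"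
    and [measurable]: "h \<in> borel_measurable borel"
  shows "set_integrable lborel (slab b) h" "(LINT x|lborel. f x) = (LINT x:slab b|lborel. h x)"
proof -
  have ae: "AE x in lborel. x \<in> slab b \<longrightarrow> (LINT t|lborel. f (x + t *\<^sub>R b)) = h x"
    using integral_slab(1)[OF b f] by eventually_elim (use h in auto)
  have [measurable]: "f \<in> borel_measurable borel" using f by auto
  have m: "(\<lambda>x. LINT t|lborel. f (x + t *\<^sub>R b)) \<in> borel_measurable lborel"
    by measurable
  have ae': "AE x\<in>slab b in lborel. (LINT t|lborel. f (x + t *\<^sub>R b)) = h x" using ae by simp
  show "set_integrable lborel (slab b) h"
    using set_integrable_cong_AE[OF m _ ae'] integral_slab(2)[OF b f] by simp
  show "(LINT x|lborel. f x) = (LINT x:slab b|lborel. h x)"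
    unfolding integral_slab(3)[OF b f]
    by (rule set_lebesgue_integral_cong_AE) (use ae m in auto)
qed

text \<open>On each line parallel to \<open>b\<close> the map is a translation, because \<gamma> is
  constant there. Slicing along \<open>b\<close> reduces the claim to translation invariance on the
  real line, without any Jacobian.\<close>

lemma distr_lborel_shear:
  fixes b :: "'a::euclidean_space" and \<gamma> :: "'a \<Rightarrow> real"
  assumes b: "b \<in> Basis" and [measurable]: "\<gamma> \<in> borel_measurable borel"
    and inv: "\<And>x t. \<gamma> (x + t *\<^sub>R b) = \<gamma> x"
  shows "distr lborel borel (\<lambda>x. x + \<gamma> x *\<^sub>R b) = lborel"
proof (rule measure_eqI)
  fix A :: "'a set" assume "A \<in> sets (distr lborel borel (\<lambda>x. x + \<gamma> x *\<^sub>R b))"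
  then have [measurable]: "A \<in> sets borel" by simp
  have "emeasure (distr lborel borel (\<lambda>x. x + \<gamma> x *\<^sub>R b)) A = (\<integral>\<^sup>+x. indicator A x \<partial>distr lborel borel (\<lambda>x. x + \<gamma> x *\<^sub>R b))"
    by simp
  also have "\<dots> = (\<integral>\<^sup>+x. indicator A (x + \<gamma> x *\<^sub>R b) \<partial>lborel)"
    by (rule nn_integral_distr) auto
  also have "\<dots> = (\<integral>\<^sup>+x\<in>slab b. (\<integral>\<^sup>+t. indicator A (x + (t + \<gamma> x) *\<^sub>R b) \<partial>lborel) \<partial>lborel)"
    by (subst nn_integral_slab[OF b]) (auto simp: inv algebra_simps)
  also have "\<dots> = (\<integral>\<^sup>+x\<in>slab b. (\<integral>\<^sup>+t. indicator A (x + t *\<^sub>R b) \<partial>lborel) \<partial>lborel)"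
    by (subst nn_integral_lborel_shift[where f="\<lambda>t. indicator A (x + t *\<^sub>R b)" for x]) auto
  also have "\<dots> = emeasure lborel A" by (subst nn_integral_slab[OF b, symmetric]) auto
  finally show "emeasure (distr lborel borel (\<lambda>x. x + \<gamma> x *\<^sub>R b)) A = emeasure lborel A" .
qed simp

section \<open>The fundamental theorem on intervals, half-lines and lines\<close>

lemma integral_FTC_Ioo:
  fixes \<phi> \<psi> :: "real \<Rightarrow> real"
  assumes "A \<le> B" "continuous_on {A..B} \<phi>"
    and "\<And>t. t \<in> {A<..<B} \<Longrightarrow> (\<phi> has_real_derivative \<psi> t) (at t)"
    and "integrable lborel (\<lambda>t. indicator {A<..<B} t * \<psi> t)"
  shows "(LINT t|lborel. indicator {A<..<B} t * \<psi> t) = \<phi> B - \<phi> A"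
proof -
  have "(\<psi> has_integral (\<phi> B - \<phi> A)) {A..B}"
    using assms by (intro fundamental_theorem_of_calculus_interior)
      (auto simp: has_real_derivative_iff_has_vector_derivative)
  then have "(\<psi> has_integral (\<phi> B - \<phi> A)) {A<..<B}"
    by (simp add: has_integral_Icc_iff_Ioo)
  then have "((\<lambda>t. if t \<in> {A<..<B} then \<psi> t else 0) has_integral (\<phi> B - \<phi> A)) UNIV"
    by (simp only: has_integral_restrict_UNIV)
  moreover have "((\<lambda>t. indicator {A<..<B} t * \<psi> t) has_integral (LINT t|lborel. indicator {A<..<B} t * \<psi> t)) UNIV"
    by (rule has_integral_integral_lborel[OF assms(4)])
  moreover have "(\<lambda>t. indicator {A<..<B} t * \<psi> t) = (\<lambda>t. if t \<in> {A<..<B} then \<psi> t else 0)"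
    by (auto simp: indicator_def)
  ultimately show ?thesis by (metis has_integral_unique)
qed

lemma derivative_eq_0_outside:
  fixes \<phi> :: "real \<Rightarrow> real"
  assumes "(\<phi> has_real_derivative d) (at t)" "R < \<bar>t\<bar>" "\<And>t. R < \<bar>t\<bar> \<Longrightarrow> \<phi> t = 0"
  shows "d = 0"
proof -
  have "open {t::real. R < \<bar>t\<bar>}" by (intro open_Collect_less continuous_intros)
  then have "((\<lambda>_. 0) has_real_derivative d) (at t)"
    using has_field_derivative_transform_within_open[OF assms(1), of "{t. R < \<bar>t\<bar>}" "\<lambda>_. 0"] assms(2,3)
    by auto
  then show ?thesis using DERIV_unique DERIV_const by blast
qed

lemma integral_FTC_half_line:
  fixes \<phi> \<psi> :: "real \<Rightarrow> real"
  assumes s: "s \<in> {-1, 1}" and c: "continuous_on {t. 0 \<le> s * (t - a)} \<phi>"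
    and d: "\<And>t. 0 < s * (t - a) \<Longrightarrow> (\<phi> has_real_derivative \<psi> t) (at t)"
    and z: "\<And>t. R < \<bar>t\<bar> \<Longrightarrow> \<phi> t = 0"
    and i: "integrable lborel (\<lambda>t. indicator {t. 0 < s * (t - a)} t * \<psi> t)"
  shows "(LINT t|lborel. indicator {t. 0 < s * (t - a)} t * \<psi> t) = - s * \<phi> a"
proof -
  \<comment> \<open>Beyond \<open>Q\<close> the function vanishes, and the end point
    \<open>a\<close> lies strictly between -Q and Q. So the half-line may be replaced by a bounded
    interval whose far end contributes nothing; the sign of \<open>s\<close> decides which end of it
    is \<open>a\<close>.\<close>
  define Q where "Q = max R \<bar>a\<bar> + 1"
  have Q: "R < \<bar>t\<bar>" if "Q \<le> \<bar>t\<bar>" for t using that by (auto simp: Q_def)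
  have Q0: "\<bar>a\<bar> < Q" by (auto simp: Q_def)
  have \<psi>0: "\<psi> t = 0" if "0 < s * (t - a)" "Q \<le> \<bar>t\<bar>" for t
    using derivative_eq_0_outside[OF d[OF that(1)] Q[OF that(2)] z] by auto
  have 0: "\<phi> Q = 0" "\<phi> (- Q) = 0" by (intro z Q; use Q0 in simp)+
  show ?thesis
  proof (cases "s = 1")
    case True
    have eq: "(\<lambda>t. indicator {t. 0 < s * (t - a)} t * \<psi> t) = (\<lambda>t. indicator {a<..<Q} t * \<psi> t)"
      using True \<psi>0 Q0 by (auto simp: indicator_def fun_eq_iff not_less intro!: \<psi>0)
    show ?thesis unfolding eq
      by (subst integral_FTC_Ioo[where \<phi>=\<phi>]) (use True Q0 d i eq 0 in \<open>auto intro: continuous_on_subset[OF c]\<close>)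
  next
    case False
    then have s: "s = -1" using s by auto
    have eq: "(\<lambda>t. indicator {t. 0 < s * (t - a)} t * \<psi> t) = (\<lambda>t. indicator {-Q<..<a} t * \<psi> t)"
      using s \<psi>0 Q0 by (auto simp: indicator_def fun_eq_iff not_less intro!: \<psi>0)
    show ?thesis unfolding eq
      by (subst integral_FTC_Ioo[where \<phi>=\<phi>]) (use s Q0 d i eq 0 in \<open>auto intro: continuous_on_subset[OF c]\<close>)
  qed
qed

lemma integral_FTC_line:
  fixes \<phi> \<psi> :: "real \<Rightarrow> real"
  assumes d: "\<And>t. (\<phi> has_real_derivative \<psi> t) (at t)"
    and z: "\<And>t. R < \<bar>t\<bar> \<Longrightarrow> \<phi> t = 0"
    and i: "integrable lborel \<psi>"
  shows "(LINT t|lborel. \<psi> t) = 0"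
proof -
  define Q where "Q = max R 0 + 1"
  have Q: "R < \<bar>t\<bar>" if "Q \<le> \<bar>t\<bar>" for t using that by (auto simp: Q_def)
  have "\<psi> t = 0" if "t \<notin> {-Q<..<Q}" for t
  proof (rule derivative_eq_0_outside[OF d, of R])
    show "R < \<bar>t\<bar>" using that by (intro Q) auto
  qed (rule z)
  then have eq: "\<psi> = (\<lambda>t. indicator {-Q<..<Q} t * \<psi> t)"
    by (auto simp: indicator_def fun_eq_iff)
  have "(LINT t|lborel. indicator {-Q<..<Q} t * \<psi> t) = \<phi> Q - \<phi> (- Q)"
    using d eq i by (intro integral_FTC_Ioo)
      (auto simp: Q_def intro!: continuous_at_imp_continuous_on DERIV_isCont)
  moreover have "\<phi> Q = 0" "\<phi> (- Q) = 0" by (auto intro!: z simp: Q_def)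
  ultimately show ?thesis using eq by simp
qed

section \<open>C1 graphs and the divergence identity on one side of a graph\<close>

lemma C1_graphD:
  assumes "C1_graph b \<gamma> D"
  shows "b \<in> Basis" "\<gamma> (x + t *\<^sub>R b) = \<gamma> x" "GDERIV \<gamma> x :> D x" "continuous_on UNIV D"
    "continuous_on UNIV \<gamma>" "D x \<bullet> b = 0" "D (x + t *\<^sub>R b) = D x"
proof -
  show *: "b \<in> Basis" "\<And>x t. \<gamma> (x + t *\<^sub>R b) = \<gamma> x" "\<And>x. GDERIV \<gamma> x :> D x" "continuous_on UNIV D"
    using assms by (auto simp: C1_graph_def)
  show "continuous_on UNIV \<gamma>" using *(3) by (rule GDERIV_imp_continuous_on)
  have "((\<lambda>t. \<gamma> (x + t *\<^sub>R b)) has_real_derivative b \<bullet> D x) (at 0)"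
    by (rule GDERIV_along_line) (simp add: *(3))
  then have "((\<lambda>t. \<gamma> x) has_real_derivative b \<bullet> D x) (at 0)" by (simp only: *(2))
  then show "D x \<bullet> b = 0" by (metis DERIV_const DERIV_unique inner_commute)
  have "GDERIV (\<lambda>y. \<gamma> (y + t *\<^sub>R b)) x :> D (x + t *\<^sub>R b)"
  proof -
    have "((\<lambda>y. y + t *\<^sub>R b) has_derivative (\<lambda>h. h)) (at x)" by (auto intro!: derivative_eq_intros)
    from has_derivative_compose[OF this *(3)[of "x + t *\<^sub>R b", unfolded gderiv_def]]
    show ?thesis by (simp add: gderiv_def)
  qed
  then have "GDERIV \<gamma> x :> D (x + t *\<^sub>R b)" by (simp only: *(2))
  then show "D (x + t *\<^sub>R b) = D x" using GDERIV_unique *(3) by blast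
qed

text \<open>
  The shear \<open>x \<mapsto> x + \<gamma> x b\<close> maps the half space onto the graph domain and preserves the Lebesgue
  measure. In the half space the derivatives are integrated along coordinate lines: those
  orthogonal to \<open>b\<close> contribute nothing, those parallel to \<open>b\<close> contribute their end point.
\<close>

context
  fixes b :: "'a::euclidean_space" and \<gamma> :: "'a \<Rightarrow> real" and D :: "'a \<Rightarrow> 'a" and s :: real
    and f :: "'a \<Rightarrow> real" and g :: "'a \<Rightarrow> 'a" and R :: real and G H :: "'a set" and T :: "'a \<Rightarrow> 'a"
  assumes graph: "C1_graph b \<gamma> D" and s: "s \<in> {-1, 1}"
  defines "G \<equiv> {x. 0 < s * (x \<bullet> b - \<gamma> x)}" and "H \<equiv> {x. 0 < s * (x \<bullet> b)}"
    and "T \<equiv> \<lambda>x. x + \<gamma> x *\<^sub>R b"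
  assumes cont: "continuous_on {x. 0 \<le> s * (x \<bullet> b - \<gamma> x)} f"
    and supp: "\<And>x. R < norm x \<Longrightarrow> f x = 0"
    and der: "\<And>x. x \<in> G \<Longrightarrow> GDERIV f x :> g x"
    and int: "set_integrable lborel G g"
begin

lemmas gr = C1_graphD[OF graph]

lemma bb: "b \<bullet> b = 1" using gr(1) by simp

lemma graph_measurable [measurable]: "\<gamma> \<in> borel_measurable borel" "D \<in> borel_measurable borel"
  using gr(4,5) by (auto intro: borel_measurable_continuous_onI)

lemma graph_domain_measurable [measurable]: "G \<in> sets borel" "H \<in> sets borel"
  unfolding G_def H_def by measurable

lemma \<gamma>_T: "\<gamma> (T x) = \<gamma> x" unfolding T_def by (rule gr(2))

lemma T_in_G: "T x \<in> G \<longleftrightarrow> x \<in> H"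
  unfolding G_def H_def by (simp add: \<gamma>_T) (simp add: T_def inner_add_left bb)

lemma T_measurable [measurable]: "T \<in> borel_measurable borel" unfolding T_def by measurable

lemma integrable_T:
  fixes h :: "'a \<Rightarrow> real"
  assumes "set_integrable lborel G h"
  shows "set_integrable lborel H (\<lambda>x. h (T x))" "(LINT x:G|lborel. h x) = (LINT x:H|lborel. h (T x))"
proof -
  have d: "distr lborel borel T = lborel"
    unfolding T_def by (rule distr_lborel_shear[OF gr(1) _ gr(2)]) measurable
  have eq: "(\<lambda>x. indicator G (T x) *\<^sub>R h (T x)) = (\<lambda>x. indicator H x *\<^sub>R h (T x))"
    using T_in_G by (auto simp: indicator_def fun_eq_iff)
  have i: "integrable lborel (\<lambda>x. indicator G x *\<^sub>R h x)"
    using assms by (simp add: set_integrable_def)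
  from borel_measurable_integrable[OF i]
  have [measurable]: "(\<lambda>x. indicator G x *\<^sub>R h x) \<in> borel_measurable borel"
    by (simp only: measurable_lborel2)
  have "integrable (distr lborel borel T) (\<lambda>x. indicator G x *\<^sub>R h x)" using d i by simp
  then show "set_integrable lborel H (\<lambda>x. h (T x))"
    unfolding set_integrable_def eq[symmetric]
    by (subst (asm) integrable_distr_eq, measurable)
  have "(LINT x|lborel. indicator G x *\<^sub>R h x) = (LINT x|distr lborel borel T. indicator G x *\<^sub>R h x)"
    using d by simp
  also have "\<dots> = (LINT x|lborel. indicator H x *\<^sub>R h (T x))"
    unfolding eq[symmetric] by (rule integral_distr; measurable)
  finally show "(LINT x:G|lborel. h x) = (LINT x:H|lborel. h (T x))"
    by (simp add: set_lebesgue_integral_def)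
qed

text \<open>Compact support survives the shear: if \<open>T x\<close> lies in the ball of radius R,
  then \<gamma> x = \<gamma> (T x) is bounded by the maximum of |\<gamma>| on that ball, and x
  differs from \<open>T x\<close> by at most this amount.\<close>

lemma supp_T: obtains Q where "R < Q" "0 \<le> Q" "\<And>x. Q < norm x \<Longrightarrow> R < norm (T x)"
proof -
  have "bounded (\<gamma> ` cball 0 (max R 0))"
    by (intro compact_imp_bounded compact_continuous_image continuous_on_subset[OF gr(5)]) auto
  then have "\<exists>B. \<forall>x\<in>cball 0 (max R 0). \<bar>\<gamma> x\<bar> \<le> B" by (auto simp: bounded_iff)
  then obtain B where B: "\<And>x. x \<in> cball 0 (max R 0) \<Longrightarrow> \<bar>\<gamma> x\<bar> \<le> B" by blast
  have "\<bar>\<gamma> 0\<bar> \<le> B" by (rule B) simp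
  then have B0: "0 \<le> B" by linarith
  have "R < norm (T x)" if "max R 0 + B + 1 < norm x" for x
  proof (rule ccontr)
    assume "\<not> R < norm (T x)"
    then have *: "T x \<in> cball 0 (max R 0)" by auto
    then have "\<bar>\<gamma> x\<bar> \<le> B" using B \<gamma>_T by metis
    moreover have "norm x \<le> norm (T x) + norm (\<gamma> x *\<^sub>R b)"
      unfolding T_def by (metis add_diff_cancel_right' norm_triangle_ineq4)
    ultimately show False using that * gr(1) by (auto)
  qed
  then show thesis using that[of "max R 0 + B + 1"] B0 by auto
qed

lemma g_eq_0: assumes "x \<in> G" "R < norm x" shows "g x = 0"
proof -
  have "open {x::'a. R < norm x}" by (intro open_Collect_less continuous_intros)
  then have "GDERIV (\<lambda>_. 0) x :> g x"
    using GDERIV_cong_open[OF der[OF assms(1)], of "{x. R < norm x}" "\<lambda>_. 0"] assms(2) supp by auto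
  then show ?thesis using GDERIV_unique GDERIV_const by blast
qed

lemma g_integrable: "set_integrable lborel G (\<lambda>x. g x \<bullet> e)"
  using int by (auto simp: set_integrable_def simp flip: inner_scaleR_left intro!: integrable_inner_left)

text \<open>The factor \<open>w\<close> is merely continuous, but only its values on the ball
  outside which g \<circ> T vanishes on \<open>H\<close> matter, and there it is bounded.\<close>

lemma int_w:
  assumes "continuous_on UNIV w"
  shows "set_integrable lborel H (\<lambda>x. w x * (g (T x) \<bullet> e))"
proof -
  obtain Q where Q: "R < Q" "0 \<le> Q" "\<And>x. Q < norm x \<Longrightarrow> R < norm (T x)" using supp_T by blast
  have "bounded (w ` cball 0 Q)"
    by (intro compact_imp_bounded compact_continuous_image continuous_on_subset[OF assms]) auto
  then have "\<exists>B. \<forall>x\<in>cball 0 Q. \<bar>w x\<bar> \<le> B" by (auto simp: bounded_iff)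
  then obtain B where B: "\<And>x. x \<in> cball 0 Q \<Longrightarrow> \<bar>w x\<bar> \<le> B" by blast
  have [measurable]: "w \<in> borel_measurable borel" using assms by (rule borel_measurable_continuous_onI)
  have i: "integrable lborel (\<lambda>x. indicator H x *\<^sub>R (g (T x) \<bullet> e))"
    using integrable_T(1)[OF g_integrable] by (simp add: set_integrable_def)
  from borel_measurable_integrable[OF i]
  have [measurable]: "(\<lambda>x. indicator H x *\<^sub>R (g (T x) \<bullet> e)) \<in> borel_measurable borel"
    by (simp only: measurable_lborel2)
  have "integrable lborel (\<lambda>x. indicator (cball 0 Q) x * (w x) * (indicator H x *\<^sub>R (g (T x) \<bullet> e)))"
  proof (rule Bochner_Integration.integrable_bound[OF integrable_mult_right[OF i, of B]])
    show "(\<lambda>x. indicator (cball 0 Q) x * (w x) * (indicator H x *\<^sub>R (g (T x) \<bullet> e))) \<in> borel_measurable lborel"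
      using borel_closed[OF closed_cball[of "0::'a" Q], measurable] by measurable
    have "\<bar>w x\<bar> * \<bar>y\<bar> \<le> \<bar>B * y\<bar>" if "norm x \<le> Q" for x y
      using B[of x] that by (auto simp: abs_mult intro!: mult_right_mono)
    then show "AE x in lborel. norm (indicator (cball 0 Q) x * (w x) * (indicator H x *\<^sub>R (g (T x) \<bullet> e)))
       \<le> norm (B * (indicator H x *\<^sub>R (g (T x) \<bullet> e)))"
      by (auto simp: indicator_def abs_mult)
  qed
  moreover have "(\<lambda>x. indicator (cball 0 Q) x * (w x) * (indicator H x *\<^sub>R (g (T x) \<bullet> e))) =
    (\<lambda>x. indicator H x *\<^sub>R (w x * (g (T x) \<bullet> e)))"
  proof
    fix x
    show "indicator (cball 0 Q) x * (w x) * (indicator H x *\<^sub>R (g (T x) \<bullet> e)) = indicator H x *\<^sub>R (w x * (g (T x) \<bullet> e))"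
      using g_eq_0[of "T x"] Q(3)[of x] T_in_G[of x] by (auto simp: indicator_def not_le)
  qed
  ultimately show ?thesis by (simp only: set_integrable_def)
qed

lemma f_graph_measurable: "(\<lambda>x. f (x + (\<gamma> x - x \<bullet> b) *\<^sub>R b)) \<in> borel_measurable borel"
proof (rule borel_measurable_continuous_onI, rule continuous_on_compose2[OF cont])
  show "continuous_on UNIV (\<lambda>x. x + (\<gamma> x - x \<bullet> b) *\<^sub>R b)"
    by (intro continuous_intros gr(5))
  show "(\<lambda>x. x + (\<gamma> x - x \<bullet> b) *\<^sub>R b) ` UNIV \<subseteq> {x. 0 \<le> s * (x \<bullet> b - \<gamma> x)}"
    by (auto simp: gr(2) inner_add_left bb)
qed

text \<open>A line parallel to \<open>b\<close> is mapped to a parallel line; it meets the boundary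
  of \<open>H\<close> at the parameter t = -(x \<bullet> b), whose image under \<open>T\<close> is
  the graph point over x. The factor \<open>w\<close> is constant along the line and can be taken
  out. The fundamental theorem on a half-line then leaves the value of \<open>f\<close> at that
  graph point.\<close>

lemma vertical:
  assumes w: "continuous_on UNIV w" and inv: "\<And>x t. w (x + t *\<^sub>R b) = w x"
  shows "set_integrable lborel (slab b) (\<lambda>x. - s * (w x * f (x + (\<gamma> x - x \<bullet> b) *\<^sub>R b)))"
    and "(LINT x:H|lborel. w x * (g (T x) \<bullet> b)) = (LINT x:slab b|lborel. - s * (w x * f (x + (\<gamma> x - x \<bullet> b) *\<^sub>R b)))"
proof -
  have [measurable]: "w \<in> borel_measurable borel" using w by (rule borel_measurable_continuous_onI)
  note [measurable] = f_graph_measurable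
  let ?F = "\<lambda>x. indicator H x * (w x * (g (T x) \<bullet> b))"
  let ?h = "\<lambda>x. - s * (w x * f (x + (\<gamma> x - x \<bullet> b) *\<^sub>R b))"
  have i: "integrable lborel ?F" using int_w[OF w] by (simp add: set_integrable_def)
  have T_line: "T (x + t *\<^sub>R b) = T x + t *\<^sub>R b" for x t by (simp add: T_def gr(2) algebra_simps)
  have H_line: "x + t *\<^sub>R b \<in> H \<longleftrightarrow> 0 < s * (t - (- (x \<bullet> b)))" for x t
    by (simp add: H_def inner_add_left bb add.commute)
  have key: "(LINT t|lborel. ?F (x + t *\<^sub>R b)) = ?h x" if ix: "integrable lborel (\<lambda>t. ?F (x + t *\<^sub>R b))" for x
  proof -
    let ?I = "{t. 0 < s * (t - (- (x \<bullet> b)))}"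
    have eq: "?F (x + t *\<^sub>R b) = indicator ?I t * (w x * (g (T x + t *\<^sub>R b) \<bullet> b))" for t
      using H_line[of x t] by (simp add: indicator_def inv T_line)
    have *: "0 \<le> s * ((T x + t *\<^sub>R b) \<bullet> b - \<gamma> (T x + t *\<^sub>R b)) \<longleftrightarrow> 0 \<le> s * (t - (- (x \<bullet> b)))" for t
      by (simp add: gr(2) \<gamma>_T) (simp add: T_def inner_add_left bb add.commute)
    have "(LINT t|lborel. indicator ?I t * (w x * (g (T x + t *\<^sub>R b) \<bullet> b)))
       = - s * (w x * f (T x + (- (x \<bullet> b)) *\<^sub>R b))"
    proof (rule integral_FTC_half_line[OF s])
      show "continuous_on {t. 0 \<le> s * (t - - (x \<bullet> b))} (\<lambda>t. w x * f (T x + t *\<^sub>R b))"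
        using * by (intro continuous_intros continuous_on_compose2[OF cont]) auto
      show "((\<lambda>t. w x * f (T x + t *\<^sub>R b)) has_real_derivative w x * (g (T x + t *\<^sub>R b) \<bullet> b)) (at t)"
        if "0 < s * (t - - (x \<bullet> b))" for t
        using T_in_G[of "x + t *\<^sub>R b"] that H_line[of x t]
        by (intro DERIV_cmult, subst inner_commute) (intro GDERIV_along_line der, simp add: T_line)
      show "w x * f (T x + t *\<^sub>R b) = 0" if "norm (T x) + R < \<bar>t\<bar>" for t
      proof -
        have "\<bar>t\<bar> \<le> norm (T x + t *\<^sub>R b) + norm (T x)"
          using norm_triangle_ineq4[of "T x + t *\<^sub>R b" "T x"] gr(1) by simp
        then show ?thesis using that supp by auto
      qed
      show "integrable lborel (\<lambda>t. indicator ?I t * (w x * (g (T x + t *\<^sub>R b) \<bullet> b)))"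
        using ix by (simp only: eq)
    qed
    then show ?thesis by (simp only: eq) (simp add: T_def algebra_simps)
  qed
  show "set_integrable lborel (slab b) ?h"
    by (rule integral_slab_eq(1)[OF gr(1) i key]) measurable
  have "(LINT x|lborel. ?F x) = (LINT x:slab b|lborel. ?h x)"
    by (rule integral_slab_eq(2)[OF gr(1) i key]) measurable
  then show "(LINT x:H|lborel. w x * (g (T x) \<bullet> b)) = (LINT x:slab b|lborel. ?h x)"
    by (simp add: set_lebesgue_integral_def)
qed

text \<open>A line in a direction e other than \<open>b\<close> lies entirely inside or entirely
  outside \<open>H\<close>. By the chain rule the integrand is the derivative of f \<circ> T along
  e, and a compactly supported derivative has integral zero over a whole line.\<close>

lemma horizontal:
  assumes e: "e \<in> Basis" "e \<noteq> b"
  shows "(LINT x:H|lborel. (g (T x) \<bullet> e) + (D x \<bullet> e) * (g (T x) \<bullet> b)) = 0"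
proof -
  let ?F = "\<lambda>x. indicator H x * ((g (T x) \<bullet> e) + (D x \<bullet> e) * (g (T x) \<bullet> b))"
  have i: "integrable lborel ?F"
    using set_integral_add(1)[OF int_w[of "\<lambda>_. 1" e] int_w[of "\<lambda>x. D x \<bullet> e" b]] gr(4)
    by (simp add: set_integrable_def continuous_on_inner)
  obtain Q where Q: "R < Q" "0 \<le> Q" "\<And>x. Q < norm x \<Longrightarrow> R < norm (T x)" using supp_T by blast
  have H_line: "x + t *\<^sub>R e \<in> H \<longleftrightarrow> x \<in> H" for x t
    using e gr(1) by (simp add: H_def inner_add_left inner_Basis)
  have key: "(LINT t|lborel. ?F (x + t *\<^sub>R e)) = 0" if ix: "integrable lborel (\<lambda>t. ?F (x + t *\<^sub>R e))" for x
  proof (cases "x \<in> H")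
    case False
    then show ?thesis using H_line[of x] by (simp add: indicator_def)
  next
    case True
    have gd: "GDERIV (\<lambda>x. f (T x)) y :> g (T y) + (g (T y) \<bullet> b) *\<^sub>R D y" if "y \<in> H" for y
    proof -
      have "(T has_derivative (\<lambda>h. h + (h \<bullet> D y) *\<^sub>R b)) (at y)"
        unfolding T_def using gr(3)[of y, unfolded gderiv_def] by (auto intro!: derivative_eq_intros)
      from has_derivative_compose[OF this der[unfolded gderiv_def]] that T_in_G
      have "((\<lambda>x. f (T x)) has_derivative (\<lambda>h. (h + (h \<bullet> D y) *\<^sub>R b) \<bullet> g (T y))) (at y)"
        by auto
      then show ?thesis unfolding gderiv_def
        by (rule has_derivative_eq_rhs) (auto simp: inner_add_left inner_add_right inner_commute)
    qed
    show ?thesis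
    proof (rule integral_FTC_line[where \<phi>="\<lambda>t. f (T (x + t *\<^sub>R e))" and R="norm x + Q"])
      fix t
      have "((\<lambda>t. f (T (x + t *\<^sub>R e))) has_real_derivative
        e \<bullet> (g (T (x + t *\<^sub>R e)) + (g (T (x + t *\<^sub>R e)) \<bullet> b) *\<^sub>R D (x + t *\<^sub>R e))) (at t)"
        by (rule GDERIV_along_line[of "\<lambda>x. f (T x)"], rule gd) (simp add: H_line True)
      then show "((\<lambda>t. f (T (x + t *\<^sub>R e))) has_real_derivative ?F (x + t *\<^sub>R e)) (at t)"
        using True by (simp add: H_line inner_add_right inner_commute mult.commute)
    next
      fix t :: real assume t: "norm x + Q < \<bar>t\<bar>"
      have "\<bar>t\<bar> \<le> norm (x + t *\<^sub>R e) + norm x"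
        using norm_triangle_ineq4[of "x + t *\<^sub>R e" "x"] e(1) by simp
      then show "f (T (x + t *\<^sub>R e)) = 0" using t supp Q(3) by auto
    qed (rule ix)
  qed
  have "(LINT x|lborel. ?F x) = (LINT x:slab e|lborel. 0)"
    by (rule integral_slab_eq(2)[OF e(1) i key]) measurable
  then show ?thesis by (simp add: set_lebesgue_integral_def)
qed

text \<open>For e = b this is \<open>vertical\<close> with w = 1, as D is orthogonal to b. For other
  e, \<open>horizontal\<close> trades the e-component of g for -(D \<bullet> e) times its
  b-component, and \<open>vertical\<close> is applied with w = D \<bullet> e. The vector s (D - b)
  is the outward normal multiplied by the area factor.\<close>

lemma graph_domain_divergence:
  assumes e: "e \<in> Basis"
  shows "set_integrable lborel (slab b) (\<lambda>x. s * ((D x - b) \<bullet> e) * f (x + (\<gamma> x - x \<bullet> b) *\<^sub>R b))"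
    and "(LINT x:G|lborel. g x \<bullet> e) = (LINT x:slab b|lborel. s * ((D x - b) \<bullet> e) * f (x + (\<gamma> x - x \<bullet> b) *\<^sub>R b))"
proof -
  have 1: "(LINT x:G|lborel. g x \<bullet> e) = (LINT x:H|lborel. g (T x) \<bullet> e)"
    by (rule integrable_T(2)[OF g_integrable])
  let ?C = "set_integrable lborel (slab b) (\<lambda>x. s * ((D x - b) \<bullet> e) * f (x + (\<gamma> x - x \<bullet> b) *\<^sub>R b)) \<and>
    (LINT x:G|lborel. g x \<bullet> e) = (LINT x:slab b|lborel. s * ((D x - b) \<bullet> e) * f (x + (\<gamma> x - x \<bullet> b) *\<^sub>R b))"
  have ?C
  proof (cases "e = b")
    case True
    have "(D x - b) \<bullet> e = -1" for x using True by (simp add: inner_diff_left gr(6) bb)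
    then show ?thesis using vertical[of "\<lambda>_. 1"] 1 True by simp
  next
    case False
    have w: "continuous_on UNIV (\<lambda>x. D x \<bullet> e)" "\<And>x t. D (x + t *\<^sub>R b) \<bullet> e = D x \<bullet> e"
      using gr(4) by (auto intro!: continuous_intros simp: gr(7))
    have De: "(D x - b) \<bullet> e = D x \<bullet> e" for x
      using e gr(1) False by (simp add: inner_diff_left inner_Basis)
    have "0 = (LINT x:H|lborel. g (T x) \<bullet> e) + (LINT x:H|lborel. (D x \<bullet> e) * (g (T x) \<bullet> b))"
      using horizontal[OF e False] set_integral_add(2)[OF int_w[of "\<lambda>_. 1" e] int_w[OF w(1), of b]] by simp
    then have "(LINT x:G|lborel. g x \<bullet> e) = - (LINT x:H|lborel. (D x \<bullet> e) * (g (T x) \<bullet> b))"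
      using 1 by linarith
    also have "\<dots> = - (LINT x:slab b|lborel. - (s * (D x \<bullet> e) * f (x + (\<gamma> x - x \<bullet> b) *\<^sub>R b)))"
      using vertical(2)[OF w] by (simp add: mult.assoc)
    also have "\<dots> = (LINT x:slab b|lborel. s * (D x \<bullet> e) * f (x + (\<gamma> x - x \<bullet> b) *\<^sub>R b))"
      by (simp add: set_lebesgue_integral_def)
    finally show ?thesis using vertical(1)[OF w] De by (simp add: set_integrable_def mult.assoc)
  qed
  then show "set_integrable lborel (slab b) (\<lambda>x. s * ((D x - b) \<bullet> e) * f (x + (\<gamma> x - x \<bullet> b) *\<^sub>R b))"
    and "(LINT x:G|lborel. g x \<bullet> e) = (LINT x:slab b|lborel. s * ((D x - b) \<bullet> e) * f (x + (\<gamma> x - x \<bullet> b) *\<^sub>R b))"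
    by auto
qed

end

declare graph_measurable [measurable del] graph_domain_measurable [measurable del] T_measurable [measurable del]

section \<open>Surface measures\<close>

definition graph_pt :: "'a::euclidean_space \<Rightarrow> ('a \<Rightarrow> real) \<Rightarrow> 'a \<Rightarrow> 'a" where
  "graph_pt b \<gamma> x = x + (\<gamma> x - x \<bullet> b) *\<^sub>R b"

definition area_factor :: "('a::euclidean_space \<Rightarrow> 'a) \<Rightarrow> 'a \<Rightarrow> real" where
  "area_factor D x = sqrt (1 + (norm (D x))\<^sup>2)"

text \<open>The values that \<open>is_surface_measure\<close> prescribes on one graph, packaged as a
  measure on the whole space, so that image measures and densities can be used.\<close>

definition patch_measure :: "'a::euclidean_space \<Rightarrow> ('a \<Rightarrow> real) \<Rightarrow> ('a \<Rightarrow> 'a) \<Rightarrow> 'a measure" where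
  "patch_measure b \<gamma> D =
     distr (density lborel (\<lambda>x. indicator (slab b) x * ennreal (area_factor D x))) borel (graph_pt b \<gamma>)"

lemma area_factor_pos: "0 < area_factor D x"
  unfolding area_factor_def by (simp add: add_pos_nonneg)

lemma sets_patch_measure [simp]: "sets (patch_measure b \<gamma> D) = sets borel"
  by (simp add: patch_measure_def)

context
  fixes b :: "'a::euclidean_space" and \<gamma> D
  assumes graph: "C1_graph b \<gamma> D"
begin

lemma C1_graph_measurable [measurable]: "\<gamma> \<in> borel_measurable borel" "D \<in> borel_measurable borel"
  "graph_pt b \<gamma> \<in> borel_measurable borel" "area_factor D \<in> borel_measurable borel"
proof -
  show [measurable]: "\<gamma> \<in> borel_measurable borel" "D \<in> borel_measurable borel"
    using C1_graphD(4,5)[OF graph] by (auto intro: borel_measurable_continuous_onI)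
  show "graph_pt b \<gamma> \<in> borel_measurable borel" "area_factor D \<in> borel_measurable borel"
    unfolding graph_pt_def[abs_def] area_factor_def[abs_def] by measurable
qed

lemma continuous_graph_pt: "continuous_on UNIV (graph_pt b \<gamma>)"
  unfolding graph_pt_def[abs_def] by (intro continuous_intros C1_graphD(5)[OF graph])

lemma continuous_area_factor: "continuous_on UNIV (area_factor D)"
  unfolding area_factor_def[abs_def] by (intro continuous_intros C1_graphD(4)[OF graph])

lemma graph_pt_inner: "graph_pt b \<gamma> x \<bullet> b = \<gamma> x" "\<gamma> (graph_pt b \<gamma> x) = \<gamma> x" "D (graph_pt b \<gamma> x) = D x"
  using C1_graphD(1,2,7)[OF graph] by (simp_all add: graph_pt_def inner_add_left)

lemma graph_pt_fixed: "x \<bullet> b = \<gamma> x \<Longrightarrow> graph_pt b \<gamma> x = x"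
  by (simp add: graph_pt_def)

lemma area_factor_line: "area_factor D (x + t *\<^sub>R b) = area_factor D x"
  "area_factor D (graph_pt b \<gamma> x) = area_factor D x"
  using C1_graphD(7)[OF graph] graph_pt_inner(3) by (simp_all add: area_factor_def)

lemma emeasure_patch_measure:
  assumes [measurable]: "B \<in> sets borel"
  shows "emeasure (patch_measure b \<gamma> D) B =
    (\<integral>\<^sup>+x\<in>{x. 0 \<le> x \<bullet> b \<and> x \<bullet> b \<le> 1 \<and> x + (\<gamma> x - x \<bullet> b) *\<^sub>R b \<in> B}.
              ennreal (sqrt (1 + (norm (D x))\<^sup>2)) \<partial>lborel)"
proof -
  have "emeasure (patch_measure b \<gamma> D) B =
    (\<integral>\<^sup>+x. (indicator (slab b) x * ennreal (area_factor D x)) * indicator (graph_pt b \<gamma> -` B) x \<partial>lborel)"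
    unfolding patch_measure_def using measurable_sets[OF C1_graph_measurable(3) assms]
    by (simp add: emeasure_distr emeasure_density)
  also have "\<dots> = (\<integral>\<^sup>+x\<in>{x. 0 \<le> x \<bullet> b \<and> x \<bullet> b \<le> 1 \<and> x + (\<gamma> x - x \<bullet> b) *\<^sub>R b \<in> B}.
              ennreal (sqrt (1 + (norm (D x))\<^sup>2)) \<partial>lborel)"
    by (intro nn_integral_cong) (auto simp: indicator_def slab_def graph_pt_def area_factor_def)
  finally show ?thesis .
qed

lemma emeasure_patch_measure':
  assumes [measurable]: "B \<in> sets borel"
  shows "emeasure (patch_measure b \<gamma> D) B =
    (\<integral>\<^sup>+x\<in>slab b. ennreal (area_factor D x) * indicator B (graph_pt b \<gamma> x) \<partial>lborel)"
  unfolding emeasure_patch_measure[OF assms]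
  by (intro nn_integral_cong) (auto simp: indicator_def slab_def graph_pt_def area_factor_def)

lemma emeasure_patch_measure_bounded:
  assumes "bounded B" "B \<in> sets borel"
  shows "emeasure (patch_measure b \<gamma> D) B < \<infinity>"
proof -
  obtain R where R: "\<And>x. x \<in> B \<Longrightarrow> norm x \<le> R" using assms(1) by (auto simp: bounded_iff)
  have "bounded (area_factor D ` cball 0 (2 * R + 1))"
    by (intro compact_imp_bounded compact_continuous_image continuous_on_subset[OF continuous_area_factor]) auto
  then obtain K where K: "\<forall>x\<in>cball 0 (2 * R + 1). \<bar>area_factor D x\<bar> \<le> K" by (auto simp: bounded_iff)
  \<comment> \<open>A point of the slab arises from its graph point P by replacing the b-component
    of P, which is at most R, with one in [0, 1].\<close>
  have *: "norm x \<le> 2 * R + 1" if "x \<in> slab b" "graph_pt b \<gamma> x \<in> B" for x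
  proof -
    have "x = graph_pt b \<gamma> x - (graph_pt b \<gamma> x \<bullet> b) *\<^sub>R b + (x \<bullet> b) *\<^sub>R b"
      using graph_pt_inner(1)[of x] by (simp add: graph_pt_def algebra_simps)
    also have "norm \<dots> \<le> norm (graph_pt b \<gamma> x) + norm ((graph_pt b \<gamma> x \<bullet> b) *\<^sub>R b) + norm ((x \<bullet> b) *\<^sub>R b)"
      using norm_triangle_ineq norm_triangle_ineq4 order_trans add_right_mono by blast
    also have "\<dots> \<le> R + R + 1"
      using that R[OF that(2)] Basis_le_norm[OF C1_graphD(1)[OF graph], of "graph_pt b \<gamma> x"] C1_graphD(1)[OF graph]
      by (auto simp: slab_def intro!: add_mono)
    finally show ?thesis by simp
  qed
  have "emeasure (patch_measure b \<gamma> D) B \<le> (\<integral>\<^sup>+x. ennreal K * indicator (cball (0::'a) (2 * R + 1)) x \<partial>lborel)"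
    unfolding emeasure_patch_measure'[OF assms(2)]
  proof (rule nn_integral_mono)
    fix x
    show "ennreal (area_factor D x) * indicator B (graph_pt b \<gamma> x) * indicator (slab b) x
      \<le> ennreal K * indicator (cball 0 (2 * R + 1)) x"
    proof (cases "x \<in> slab b \<and> graph_pt b \<gamma> x \<in> B")
      case True
      then have "norm x \<le> 2 * R + 1" using * by blast
      then have "\<bar>area_factor D x\<bar> \<le> K" using K by simp
      then have "area_factor D x \<le> K" by linarith
      then show ?thesis using True \<open>norm x \<le> 2 * R + 1\<close> by (simp add: ennreal_leI)
    qed auto
  qed
  also have "\<dots> < \<infinity>"
    using emeasure_lborel_cball_finite[of "0::'a" "2 * R + 1"] by (subst nn_integral_cmult_indicator) (simp_all add: ennreal_mult_less_top)
  finally show ?thesis .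
qed

end

declare C1_graph_measurable [measurable del]

text \<open>A direction v tangent to the first graph at P is the velocity of a curve in that graph.
  Near P the curve also lies in the second graph, so v is orthogonal to the second normal. Hence
  whatever is orthogonal to one normal is orthogonal to the other.\<close>

lemma graph_normals_parallel:
  assumes gb: "C1_graph b \<gamma> D" and gc: "C1_graph c \<gamma>' D'" and "open U"
    and eq: "{x \<in> U. x \<bullet> b = \<gamma> x} = {x \<in> U. x \<bullet> c = \<gamma>' x}" and P: "P \<in> U" "P \<bullet> b = \<gamma> P"
  obtains mu where "c - D' P = mu *\<^sub>R (b - D P)"
proof -
  have tangent: "v \<bullet> (c - D' P) = 0" if v: "v \<bullet> (b - D P) = 0" for v
  proof -
    define q where "q t = graph_pt b \<gamma> (P + t *\<^sub>R v)" for t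
    have q0: "q 0 = P" using graph_pt_fixed[OF gb P(2)] by (simp add: q_def)
    have l: "((\<lambda>t. P + t *\<^sub>R v) has_derivative (\<lambda>h. h *\<^sub>R v)) (at 0)"
      by (auto intro!: derivative_eq_intros)
    have "((\<lambda>t. \<gamma> (P + t *\<^sub>R v)) has_derivative (\<lambda>h. h *\<^sub>R v \<bullet> D P)) (at 0)"
      using has_derivative_compose[OF l, of \<gamma> "\<lambda>h. h \<bullet> D P"] C1_graphD(3)[OF gb, of P] by (simp add: gderiv_def)
    then have "(q has_derivative (\<lambda>h. h *\<^sub>R v + (h *\<^sub>R v \<bullet> D P - h *\<^sub>R v \<bullet> b) *\<^sub>R b)) (at 0)"
      unfolding q_def graph_pt_def by (auto intro!: derivative_eq_intros)
    also have "(\<lambda>h. h *\<^sub>R v + (h *\<^sub>R v \<bullet> D P - h *\<^sub>R v \<bullet> b) *\<^sub>R b) = (\<lambda>h. h *\<^sub>R v)"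
      using v by (auto simp: inner_diff_right algebra_simps)
    finally have dq: "(q has_derivative (\<lambda>h. h *\<^sub>R v)) (at 0)" .
    have "((\<lambda>x. x \<bullet> c - \<gamma>' x) has_derivative (\<lambda>h. h \<bullet> c - h \<bullet> D' P)) (at (q 0))"
      unfolding q0 using C1_graphD(3)[OF gc, of P] by (auto simp: gderiv_def intro!: derivative_eq_intros)
    from has_derivative_compose[OF dq this]
    have "((\<lambda>t. q t \<bullet> c - \<gamma>' (q t)) has_derivative (\<lambda>h. h * (v \<bullet> (c - D' P)))) (at 0)"
      by (simp add: inner_diff_right algebra_simps)
    then have "((\<lambda>t. q t \<bullet> c - \<gamma>' (q t)) has_real_derivative v \<bullet> (c - D' P)) (at 0)"
      by (simp add: has_field_derivative_def mult_commute_abs)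
    moreover have "open (q -` U)"
      unfolding q_def
      by (intro open_vimage \<open>open U\<close> continuous_on_compose2[OF continuous_graph_pt[OF gb]] continuous_intros) auto
    moreover have "q t \<bullet> c - \<gamma>' (q t) = 0" if "t \<in> q -` U" for t
    proof -
      have "q t \<in> {x \<in> U. x \<bullet> b = \<gamma> x}" using that graph_pt_inner[OF gb] by (simp add: q_def)
      then show ?thesis using eq by auto
    qed
    ultimately have "((\<lambda>t. 0) has_real_derivative v \<bullet> (c - D' P)) (at 0)"
      using has_field_derivative_transform_within_open[of "\<lambda>t. q t \<bullet> c - \<gamma>' (q t)" _ 0 "q -` U" "\<lambda>t. 0"] q0 P(1)
      by auto
    then show ?thesis using DERIV_unique DERIV_const by blast
  qed
  define w n where "w = c - D' P" and "n = b - D P"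
  have "n \<bullet> b = 1" using C1_graphD(1,6)[OF gb] by (simp add: n_def inner_diff_left)
  then have n0: "n \<bullet> n \<noteq> 0" by auto
  \<comment> \<open>The part of \<open>w\<close> orthogonal to \<open>n\<close>. It is tangent,
    hence also orthogonal to \<open>w\<close>, hence to itself, and must vanish.\<close>
  define v where "v = w - ((w \<bullet> n) / (n \<bullet> n)) *\<^sub>R n"
  have vn: "v \<bullet> n = 0" using n0 by (simp add: v_def inner_diff_left)
  then have "v \<bullet> w = 0" using tangent by (simp add: n_def w_def)
  then have "v \<bullet> v = 0" using vn by (metis v_def inner_diff_right inner_scaleR_right diff_zero mult_zero_right)
  then show thesis using that[of "(w \<bullet> n) / (n \<bullet> n)"] by (simp add: v_def w_def n_def)
qed

lemma norm_graph_normal: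
  assumes "C1_graph b \<gamma> D" shows "norm (b - D x) = area_factor D x"
  using C1_graphD(1,6)[OF assms]
  by (simp add: area_factor_def norm_eq_sqrt_inner inner_diff_left inner_diff_right inner_commute)

text \<open>Boundedness of the image makes the continuous function \<open>k\<close> integrable
  there, so the substitution rule for absolutely integrable functions can be used and translated
  back to nonnegative integrals.\<close>

lemma nn_integral_change_of_variables_1:
  fixes g k :: "real \<Rightarrow> real"
  assumes T: "T \<in> sets borel" and T': "T' \<in> sets borel" "bounded T'" and gT: "g ` T = T'" "inj_on g T"
    and d: "\<And>t. t \<in> T \<Longrightarrow> (g has_real_derivative g' t) (at t)"
    and k: "continuous_on UNIV k" "\<And>t. 0 \<le> k t"
  shows "(\<integral>\<^sup>+t\<in>T. ennreal (\<bar>g' t\<bar> * k (g t)) \<partial>lborel) = (\<integral>\<^sup>+t\<in>T'. ennreal (k t) \<partial>lborel)"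
proof -
  obtain R where R: "T' \<subseteq> {-R..R}" 
  proof -
    obtain R where "\<forall>x\<in>T'. \<bar>x\<bar> \<le> R" using T'(2) by (auto simp: bounded_iff)
    then show thesis by (intro that[of R]) (auto simp: abs_le_iff minus_le_iff)
  qed
  have "k absolutely_integrable_on {-R..R}"
    by (rule absolutely_integrable_continuous_real) (use k(1) continuous_on_subset in blast)
  then have k': "k absolutely_integrable_on g ` T"
    using set_integrable_subset[of lebesgue "{-R..R}" k T'] T'(1) R gT by simp
  have "(\<lambda>x. \<bar>g' x\<bar> * k (g x)) absolutely_integrable_on T \<and>
     integral T (\<lambda>x. \<bar>g' x\<bar> * k (g x)) = integral (g ` T) k"
    using has_absolute_integral_change_of_variables_1'[of T g g' k "integral (g ` T) k"] T gT d k'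
    by (auto intro: DERIV_subset)
  moreover have "(\<integral>\<^sup>+t\<in>A. ennreal (h t) \<partial>lborel) = ennreal (integral A h)"
    if "h absolutely_integrable_on A" "\<And>t. 0 \<le> h t" for h :: "real \<Rightarrow> real" and A
  proof -
    have "(\<integral>\<^sup>+t\<in>A. ennreal (h t) \<partial>lborel) = (\<integral>\<^sup>+t. ennreal (indicator A t *\<^sub>R h t) \<partial>lebesgue)"
      by (auto simp: nn_integral_completion indicator_def intro!: nn_integral_cong)
    also have "\<dots> = ennreal (LINT t:A|lebesgue. h t)"
      unfolding set_lebesgue_integral_def
      by (rule nn_integral_eq_integral) (use that in \<open>auto simp: set_integrable_def\<close>)
    finally show ?thesis using set_lebesgue_integral_eq_integral(2)[OF that(1)] by simp
  qed
  ultimately show ?thesis using k' k(2) gT by simp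
qed

text \<open>If b = c, graph points in \<open>B\<close> and the gradients at them coincide. Otherwise
  both measures are integrated over the common part of the two slabs, and it remains to compare, for
  each x, the line x + t c with the line x + t b. In the plane through x spanned by b and c the
  overlap is a curve that is a graph over either line, and the ratio of the area factors is the
  Jacobian of the passage between the two parameters.\<close>

lemma patch_measures_agree:
  assumes gb: "C1_graph b \<gamma> D" and gc: "C1_graph c \<gamma>' D'" and "open U"
    and eq: "{x \<in> U. x \<bullet> b = \<gamma> x} = {x \<in> U. x \<bullet> c = \<gamma>' x}"
    and B: "B \<in> sets borel" "B \<subseteq> U" "bounded B"
  shows "emeasure (patch_measure b \<gamma> D) B = emeasure (patch_measure c \<gamma>' D') B"
proof (cases "b = c")
  case True
  have "area_factor D x * indicator B (graph_pt b \<gamma> x) = area_factor D' x * indicator B (graph_pt c \<gamma>' x)" for x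
  proof -
    \<comment> \<open>Stated for arbitrary data because it is used a second time with the two graphs
      exchanged.\<close>
    have *: "graph_pt b \<gamma> x = graph_pt c \<gamma>' x \<and> D x = D' x"
      if gb: "C1_graph b \<gamma> D" and gc: "C1_graph c \<gamma>' D'" and eq: "{x \<in> U. x \<bullet> b = \<gamma> x} = {x \<in> U. x \<bullet> c = \<gamma>' x}"
        and PB: "graph_pt b \<gamma> x \<in> B" and True: "b = c" for \<gamma> \<gamma>' D D' b c
    proof -
      define P where "P = graph_pt b \<gamma> x"
      have P: "P \<in> U" "P \<bullet> b = \<gamma> P" using PB B graph_pt_inner[OF gb] by (auto simp: P_def)
      then have "P \<bullet> b = \<gamma>' P" using eq True by blast
      moreover have "\<gamma>' P = \<gamma>' x" using C1_graphD(2)[OF gc] True by (simp add: P_def graph_pt_def)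
      ultimately have 1: "graph_pt b \<gamma> x = graph_pt c \<gamma>' x"
        using P graph_pt_inner[OF gb, of x] True by (simp add: P_def graph_pt_def)
      obtain mu where mu: "c - D' P = mu *\<^sub>R (b - D P)"
        using graph_normals_parallel[OF gb gc \<open>open U\<close> eq P] .
      have "mu = 1"
        using arg_cong[OF mu, of "\<lambda>v. v \<bullet> b"] C1_graphD(1,6)[OF gb] C1_graphD(6)[OF gc] True
        by (simp add: inner_diff_left)
      then have "D P = D' P" using mu True by simp
      then show ?thesis using 1 graph_pt_inner(3)[OF gb, of x] graph_pt_inner(3)[OF gc, of x] by (simp add: P_def)
    qed
    show ?thesis
    proof (cases "graph_pt b \<gamma> x \<in> B \<or> graph_pt c \<gamma>' x \<in> B")
      case True': True
      then show ?thesis using *[OF gb gc eq _ True] *[OF gc gb eq[symmetric] _ True[symmetric]]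
        by (auto simp: area_factor_def)
    qed auto
  qed
  then have "ennreal (area_factor D x) * indicator B (graph_pt b \<gamma> x) = ennreal (area_factor D' x) * indicator B (graph_pt c \<gamma>' x)" for x
    by (metis (no_types, lifting) area_factor_pos less_eq_real_def ennreal_indicator ennreal_mult' indicator_pos_le)
  then show ?thesis
    unfolding emeasure_patch_measure'[OF gb B(1)] emeasure_patch_measure'[OF gc B(1)] using True by simp
next
  case False
  note [measurable] = C1_graph_measurable[OF gb] C1_graph_measurable[OF gc] B(1)
  have bc: "b \<bullet> c = 0" "c \<bullet> b = 0" "b \<bullet> b = 1" "c \<bullet> c = 1" "b \<in> Basis" "c \<in> Basis"
    using C1_graphD(1)[OF gb] C1_graphD(1)[OF gc] False by (auto simp: inner_Basis)
  let ?kb = "\<lambda>x. ennreal (area_factor D x) * indicator B (graph_pt b \<gamma> x)"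
  let ?kc = "\<lambda>x. ennreal (area_factor D' x) * indicator B (graph_pt c \<gamma>' x)"
  have slabs: "indicator (slab b) (x + t *\<^sub>R c) = indicator (slab b) x" 
    "indicator (slab c) (x + t *\<^sub>R b) = indicator (slab c) x" for x t
    using bc by (auto simp: indicator_def slab_def inner_add_left)
  have line: "(\<integral>\<^sup>+t. ?kb (x + t *\<^sub>R c) \<partial>lborel) = (\<integral>\<^sup>+t. ?kc (x + t *\<^sub>R b) \<partial>lborel)" for x
  proof -
    define T where "T = {t. graph_pt b \<gamma> (x + t *\<^sub>R c) \<in> B}"
    define T' where "T' = {t. graph_pt c \<gamma>' (x + t *\<^sub>R b) \<in> B}"
    \<comment> \<open>The curve in the plane through x: over the parameter t in direction c it has
      offset \<open>g t\<close> in direction b, and over t in direction b it has offset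
      \<open>h t\<close> in direction c. On \<open>T\<close> and \<open>T'\<close> the two functions
      are mutually inverse.\<close>
    define g where "g t = \<gamma> (x + t *\<^sub>R c) - x \<bullet> b" for t
    define g' where "g' t = D (x + t *\<^sub>R c) \<bullet> c" for t
    define h where "h t = \<gamma>' (x + t *\<^sub>R b) - x \<bullet> c" for t
    have Tm: "T \<in> sets borel" "T' \<in> sets borel" unfolding T_def T'_def by measurable
    have gp: "graph_pt b \<gamma> (x + t *\<^sub>R c) = x + t *\<^sub>R c + g t *\<^sub>R b"
      "graph_pt c \<gamma>' (x + t *\<^sub>R b) = x + t *\<^sub>R b + h t *\<^sub>R c" for t
      using bc by (auto simp: graph_pt_def g_def h_def inner_add_left)
    have hg: "h (g t) = t \<and> g t \<in> T'" if "t \<in> T" for t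
    proof -
      let ?P = "graph_pt b \<gamma> (x + t *\<^sub>R c)"
      have "?P \<in> {x \<in> U. x \<bullet> b = \<gamma> x}" using that B graph_pt_inner[OF gb] by (auto simp: T_def)
      then have "?P \<bullet> c = \<gamma>' ?P" using eq by auto
      moreover have "\<gamma>' ?P = \<gamma>' (x + g t *\<^sub>R b)"
        using C1_graphD(2)[OF gc, of "x + g t *\<^sub>R b" t] by (simp add: gp algebra_simps)
      ultimately have "h (g t) = t" using bc by (simp add: h_def gp inner_add_left)
      then show ?thesis using that by (simp add: T_def T'_def gp algebra_simps)
    qed
    have gh: "g (h t) = t \<and> h t \<in> T" if "t \<in> T'" for t
    proof -
      let ?P = "graph_pt c \<gamma>' (x + t *\<^sub>R b)"
      have "?P \<in> {x \<in> U. x \<bullet> c = \<gamma>' x}" using that B graph_pt_inner[OF gc] by (auto simp: T'_def)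
      then have "?P \<bullet> b = \<gamma> ?P" using eq by auto
      moreover have "\<gamma> ?P = \<gamma> (x + h t *\<^sub>R c)"
        using C1_graphD(2)[OF gb, of "x + h t *\<^sub>R c" t] by (simp add: gp algebra_simps)
      ultimately have "g (h t) = t" using bc by (simp add: g_def gp inner_add_left)
      then show ?thesis using that by (simp add: T_def T'_def gp algebra_simps)
    qed
    have "bounded T'"
    proof -
      obtain R where R: "\<And>x. x \<in> B \<Longrightarrow> norm x \<le> R" using B(3) by (auto simp: bounded_iff)
      have "\<bar>t\<bar> \<le> R + \<bar>x \<bullet> b\<bar>" if "t \<in> T'" for t
      proof -
        have "\<bar>(x + t *\<^sub>R b + h t *\<^sub>R c) \<bullet> b\<bar> \<le> R"
          using that Basis_le_norm[OF bc(5)] R order_trans by (fastforce simp: T'_def gp)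
        then show ?thesis using bc by (simp add: inner_add_left)
      qed
      then show ?thesis by (auto simp: bounded_iff)
    qed
    \<comment> \<open>The factor \<open>mu\<close> relates the two normals. Their c-components give
      1 = |mu| |g'|, and their norms are the area factors.\<close>
    have Jac: "area_factor D (x + t *\<^sub>R c) = \<bar>g' t\<bar> * area_factor D' (x + g t *\<^sub>R b)" if "t \<in> T" for t
    proof -
      define P where "P = graph_pt b \<gamma> (x + t *\<^sub>R c)"
      have P: "P \<in> U" "P \<bullet> b = \<gamma> P" using that B graph_pt_inner[OF gb] by (auto simp: P_def T_def)
      obtain mu where mu: "c - D' P = mu *\<^sub>R (b - D P)"
        using graph_normals_parallel[OF gb gc \<open>open U\<close> eq P] .
      have DP: "D P = D (x + t *\<^sub>R c)" by (simp add: P_def graph_pt_inner(3)[OF gb])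
      have "P = (x + g t *\<^sub>R b) + t *\<^sub>R c" by (simp add: P_def gp algebra_simps)
      then have DP': "area_factor D' P = area_factor D' (x + g t *\<^sub>R b)"
        by (simp only: area_factor_line(1)[OF gc])
      have "1 = \<bar>mu\<bar> * \<bar>g' t\<bar>"
        using arg_cong[OF mu, of "\<lambda>v. \<bar>v \<bullet> c\<bar>"] bc C1_graphD(6)[OF gc]
        by (simp add: inner_diff_left g'_def DP abs_mult)
      moreover have "area_factor D' P = \<bar>mu\<bar> * area_factor D P"
        using arg_cong[OF mu, of norm] by (simp add: norm_graph_normal[OF gb] norm_graph_normal[OF gc])
      ultimately have "area_factor D P = \<bar>g' t\<bar> * area_factor D' P"
        by (metis mult.commute mult.left_commute mult.right_neutral)
      then show ?thesis using DP DP' by (simp add: area_factor_def)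
    qed
    have "(\<integral>\<^sup>+t. ?kb (x + t *\<^sub>R c) \<partial>lborel) = (\<integral>\<^sup>+t\<in>T. ennreal (\<bar>g' t\<bar> * area_factor D' (x + g t *\<^sub>R b)) \<partial>lborel)"
      by (intro nn_integral_cong) (auto simp: indicator_def Jac, auto simp: T_def)
    also have "\<dots> = (\<integral>\<^sup>+t\<in>T'. ennreal (area_factor D' (x + t *\<^sub>R b)) \<partial>lborel)"
    proof (rule nn_integral_change_of_variables_1[OF Tm \<open>bounded T'\<close>])
      show "g ` T = T'" using hg gh by force
      show "inj_on g T" using hg by (metis inj_onI)
      show "(g has_real_derivative g' t) (at t)" if "t \<in> T" for t
      proof -
        have "((\<lambda>t. \<gamma> (x + t *\<^sub>R c)) has_real_derivative c \<bullet> D (x + t *\<^sub>R c)) (at t)"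
          by (rule GDERIV_along_line) (rule C1_graphD(3)[OF gb])
        from DERIV_diff[OF this DERIV_const[of "x \<bullet> b"]] show ?thesis
          by (simp add: g_def[abs_def] g'_def inner_commute)
      qed
      show "continuous_on UNIV (\<lambda>t. area_factor D' (x + t *\<^sub>R b))"
        by (intro continuous_on_compose2[OF continuous_area_factor[OF gc]] continuous_intros) auto
    qed (use area_factor_pos less_imp_le in blast)
    also have "\<dots> = (\<integral>\<^sup>+t. ?kc (x + t *\<^sub>R b) \<partial>lborel)"
      by (intro nn_integral_cong) (auto simp: indicator_def T'_def)
    finally show ?thesis .
  qed
  have "emeasure (patch_measure b \<gamma> D) B = (\<integral>\<^sup>+x\<in>slab c. (\<integral>\<^sup>+t. ?kb (x + t *\<^sub>R c) * indicator (slab b) (x + t *\<^sub>R c) \<partial>lborel) \<partial>lborel)"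
    unfolding emeasure_patch_measure'[OF gb B(1)] by (rule nn_integral_slab[OF bc(6)]) measurable
  also have "\<dots> = (\<integral>\<^sup>+x. (\<integral>\<^sup>+t. ?kb (x + t *\<^sub>R c) \<partial>lborel) * indicator (slab b) x * indicator (slab c) x \<partial>lborel)"
    unfolding slabs by (intro nn_integral_cong arg_cong2[where f="(*)"] nn_integral_multc) auto
  also have "\<dots> = (\<integral>\<^sup>+x. (\<integral>\<^sup>+t. ?kc (x + t *\<^sub>R b) \<partial>lborel) * indicator (slab c) x * indicator (slab b) x \<partial>lborel)"
    unfolding line by (simp add: ac_simps)
  also have "\<dots> = (\<integral>\<^sup>+x\<in>slab b. (\<integral>\<^sup>+t. ?kc (x + t *\<^sub>R b) * indicator (slab c) (x + t *\<^sub>R b) \<partial>lborel) \<partial>lborel)"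
    unfolding slabs by (intro nn_integral_cong arg_cong2[where f="(*)"] nn_integral_multc[symmetric]) auto
  also have "\<dots> = emeasure (patch_measure c \<gamma>' D') B"
    unfolding emeasure_patch_measure'[OF gc B(1)] by (rule nn_integral_slab[OF bc(5), symmetric]) measurable
  finally show ?thesis .
qed

section \<open>Existence and finiteness of the surface measure\<close>

definition C1_hypersurface :: "'a::euclidean_space set \<Rightarrow> bool" where
  "C1_hypersurface S \<longleftrightarrow> (\<forall>z\<in>S. \<exists>U b \<gamma> D. open U \<and> z \<in> U \<and> C1_graph b \<gamma> D \<and>
     S \<inter> U = {x \<in> U. x \<bullet> b = \<gamma> x})"

text \<open>Indexing the cover by an initial segment of the natural numbers, not by points, lets the
  pieces be made disjoint by removing the earlier ones.\<close>

lemma C1_hypersurface_finite_cover: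
  assumes "compact S" "C1_hypersurface S"
  obtains n :: nat and U b \<gamma> D where "S \<subseteq> (\<Union>i<n. U i)"
    and "\<And>i. i < n \<Longrightarrow> open (U i) \<and> C1_graph (b i) (\<gamma> i) (D i) \<and> S \<inter> U i = {x \<in> U i. x \<bullet> b i = \<gamma> i x}"
proof -
  let ?P = "\<lambda>z q. open (fst q) \<and> z \<in> fst q \<and> C1_graph (fst (snd q)) (fst (snd (snd q))) (snd (snd (snd q))) \<and>
     S \<inter> fst q = {x \<in> fst q. x \<bullet> fst (snd q) = fst (snd (snd q)) x}"
  have "\<forall>z\<in>S. \<exists>q. ?P z q"
  proof
    fix z assume "z \<in> S"
    from bspec[OF assms(2)[unfolded C1_hypersurface_def] this]
    obtain U b \<gamma> D where "open U \<and> z \<in> U \<and> C1_graph b \<gamma> D \<and> S \<inter> U = {x \<in> U. x \<bullet> b = \<gamma> x}"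
      by (elim exE) (rule that)
    then show "\<exists>q. ?P z q" by (intro exI[of _ "(U, b, \<gamma>, D)"]) simp
  qed
  from bchoice[OF this] obtain q where q: "\<forall>z\<in>S. ?P z (q z)" by (elim exE) (rule that)
  define U b \<gamma> D where "U z = fst (q z)" and "b z = fst (snd (q z))" and "\<gamma> z = fst (snd (snd (q z)))"
    and "D z = snd (snd (snd (q z)))" for z
  have *: "open (U z) \<and> z \<in> U z \<and> C1_graph (b z) (\<gamma> z) (D z) \<and> S \<inter> U z = {x \<in> U z. x \<bullet> b z = \<gamma> z x}"
    if "z \<in> S" for z
    unfolding U_def b_def \<gamma>_def D_def by (rule bspec[OF q that])
  note U = *[THEN conjunct1] *[THEN conjunct2, THEN conjunct1]
  obtain C where C: "C \<subseteq> S" "finite C" "S \<subseteq> (\<Union>z\<in>C. U z)"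
  proof (rule compactE_image[OF assms(1), of S U])
    show "open (U z)" if "z \<in> S" for z using that by (rule U(1))
    show "S \<subseteq> (\<Union>z\<in>S. U z)" using U(2) by blast
  qed (rule that)
  obtain e where e: "bij_betw e {..<card C} C"
    using ex_bij_betw_nat_finite[OF C(2)] by (auto simp: atLeast0LessThan)
  then have im: "e ` {..<card C} = C" by (simp add: bij_betw_def)
  show thesis
  proof (rule that[where n="card C" and U="U \<circ> e" and b="b \<circ> e" and \<gamma>="\<gamma> \<circ> e" and D="D \<circ> e"])
    show "S \<subseteq> (\<Union>i<card C. (U \<circ> e) i)" 
    proof
      fix x assume "x \<in> S"
      then obtain z where z: "z \<in> C" "x \<in> U z" using C(3) by blast
      then have "z \<in> e ` {..<card C}" by (simp only: im)
      then obtain i where "i < card C" "z = e i" by auto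
      then show "x \<in> (\<Union>i<card C. (U \<circ> e) i)" using z(2) by (intro UN_I[of i]) simp_all
    qed
    fix i assume "i < card C"
    then have "e i \<in> S" using im C(1) by blast
    then show "open ((U \<circ> e) i) \<and> C1_graph ((b \<circ> e) i) ((\<gamma> \<circ> e) i) ((D \<circ> e) i) \<and>
      S \<inter> (U \<circ> e) i = {x \<in> (U \<circ> e) i. x \<bullet> (b \<circ> e) i = (\<gamma> \<circ> e) i x}"
      unfolding comp_def by (intro conjI *[THEN conjunct1] *[THEN conjunct2, THEN conjunct2, THEN conjunct1] *[THEN conjunct2, THEN conjunct2, THEN conjunct2])
  qed
qed

text \<open>The hypersurface is cut into finitely many disjoint Borel pieces, each inside one patch,
  and the patch measures restricted to their pieces are added. For a competing graph,
  \<open>patch_measures_agree\<close> replaces every summand by the competitor's own patch measure,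
  and the sum reassembles.\<close>

theorem surface_measure_exists:
  fixes S :: "'a::euclidean_space set"
  assumes S: "compact S" "C1_hypersurface S"
  shows "\<exists>M. is_surface_measure S M"
proof -
  obtain n :: nat and U b \<gamma> D where cover: "S \<subseteq> (\<Union>i<n. U i)"
    and *: "\<And>i. i < n \<Longrightarrow> open (U i) \<and> C1_graph (b i) (\<gamma> i) (D i) \<and> S \<inter> U i = {x \<in> U i. x \<bullet> b i = \<gamma> i x}"
    by (rule C1_hypersurface_finite_cover[OF S], rule that)
  define A where "A i = S \<inter> U i - (\<Union>j<i. U j)" for i
  have A_un: "(\<Union>i<n. A i) = S"
  proof
    show "S \<subseteq> (\<Union>i<n. A i)"
    proof
      fix x assume x: "x \<in> S"
      then obtain i where "i < n" "x \<in> U i" using cover by blast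
      from \<open>x \<in> U i\<close> obtain k where k: "x \<in> U k" "\<And>j. j < k \<Longrightarrow> x \<notin> U j"
        using exists_least_iff[of "\<lambda>i. x \<in> U i"] by blast
      then have "k \<le> i" using \<open>x \<in> U i\<close> by (meson not_le)
      then have "k < n" "x \<in> A k" using \<open>i < n\<close> k x by (auto simp: A_def)
      then show "x \<in> (\<Union>i<n. A i)" by blast
    qed
  qed (auto simp: A_def)
  have disj: "disjoint_family_on A {..<n}"
  proof -
    have "A i \<inter> A j = {}" if "i < j" for i j using that by (auto simp: A_def)
    then show ?thesis unfolding disjoint_family_on_def by (metis Int_commute linorder_neqE_nat)
  qed
  have S_borel: "S \<in> sets borel" using S(1) by (simp add: borel_compact)
  have A_borel [measurable]: "A i \<in> sets borel" if "i < n" for i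
    unfolding A_def using that * S_borel by (intro sets.Diff sets.Int sets.finite_UN) auto
  have bS: "bounded S" using S(1) by (rule compact_imp_bounded)
  let ?m = "\<lambda>i. patch_measure (b i) (\<gamma> i) (D i)"
  define \<mu> where "\<mu> B = (\<Sum>i<n. emeasure (?m i) (B \<inter> A i))" for B
  define M where "M = measure_of UNIV (sets borel) \<mu>"
  have sM: "sets M = sets borel"
    unfolding M_def using sets.sets_measure_of_eq[of "borel :: 'a measure"] by simp
  have eM: "emeasure M B = \<mu> B" if "B \<in> sets borel" for B
    unfolding M_def
  proof (rule emeasure_measure_of_sigma)
    show "sigma_algebra UNIV (sets (borel :: 'a measure))" using sets.sigma_algebra_axioms[of "borel :: 'a measure"] by simp
    show "positive (sets borel) \<mu>" by (simp add: positive_def \<mu>_def)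
    show "countably_additive (sets borel) \<mu>"
    proof (rule countably_additiveI)
      fix F :: "nat \<Rightarrow> 'a set" assume F: "range F \<subseteq> sets borel" "disjoint_family F"
      have "(\<Sum>k. \<mu> (F k)) = (\<Sum>i<n. \<Sum>k. emeasure (?m i) (F k \<inter> A i))"
        unfolding \<mu>_def by (rule suminf_sum) auto
      also have "\<dots> = \<mu> (\<Union>k. F k)"
        unfolding \<mu>_def
      proof (rule sum.cong)
        fix i assume i: "i \<in> {..<n}"
        have "(\<Sum>k. emeasure (?m i) (F k \<inter> A i)) = emeasure (?m i) (\<Union>k. F k \<inter> A i)"
          using F i A_borel by (intro suminf_emeasure) (auto simp: disjoint_family_on_def)
        then show "(\<Sum>k. emeasure (?m i) (F k \<inter> A i)) = emeasure (?m i) ((\<Union>k. F k) \<inter> A i)"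
          by (simp add: Int_UN_distrib2 SUP_UNION)
      qed simp
      finally show "(\<Sum>k. \<mu> (F k)) = \<mu> (\<Union>k. F k)" .
    qed
  qed (use that in auto)
  have "is_surface_measure S M"
    unfolding is_surface_measure_def
  proof (intro conjI allI impI ballI)
    show "sets M = sets borel" by (rule sM)
    have "emeasure M (- S) = 0"
    proof -
      have "- S \<inter> A i = {}" for i by (auto simp: A_def)
      then show ?thesis using S_borel by (subst eM) (auto simp: \<mu>_def)
    qed
    then have "- S \<in> null_sets M" using S_borel sM by (auto simp: null_sets_def)
    from AE_not_in[OF this] show "AE x in M. x \<in> S" by simp
    fix V c \<gamma>' D' B
    assume V: "open V \<and> C1_graph c \<gamma>' D' \<and> S \<inter> V = {x \<in> V. x \<bullet> c = \<gamma>' x}"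
      and B: "B \<in> sets borel" "B \<subseteq> V"
    let ?m' = "patch_measure c \<gamma>' D'"
    have V': "open V" "C1_graph c \<gamma>' D'" "S \<inter> V = {x \<in> V. x \<bullet> c = \<gamma>' x}" using V by auto
    have "emeasure M B = (\<Sum>i<n. emeasure ?m' (B \<inter> A i))"
      unfolding eM[OF B(1)] \<mu>_def
    proof (rule sum.cong)
      fix i assume "i \<in> {..<n}"
      then have i: "i < n" by simp
      have "{x \<in> U i \<inter> V. x \<bullet> b i = \<gamma> i x} = {x \<in> U i \<inter> V. x \<bullet> c = \<gamma>' x}"
      proof -
        have "x \<bullet> b i = \<gamma> i x \<longleftrightarrow> x \<bullet> c = \<gamma>' x" if "x \<in> U i" "x \<in> V" for x
          using that *[OF i, THEN conjunct2, THEN conjunct2, THEN arg_cong, of "\<lambda>A. x \<in> A"]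
            arg_cong[OF V'(3), of "\<lambda>A. x \<in> A"] by simp
        then show ?thesis by auto
      qed
      then show "emeasure (?m i) (B \<inter> A i) = emeasure ?m' (B \<inter> A i)"
        using *[OF i] V'(1,2) B A_borel[OF i]
        by (intro patch_measures_agree[where U="U i \<inter> V"])
          (auto simp: A_def intro: bounded_subset[OF bS])
    qed simp
    also have "\<dots> = emeasure ?m' (\<Union>i<n. B \<inter> A i)"
      using B A_borel disj by (intro sum_emeasure) (auto simp: disjoint_family_on_def)
    also have "(\<Union>i<n. B \<inter> A i) = B \<inter> S" using A_un by blast
    \<comment> \<open>The patch measure lives on its graph, and the graph points in \<open>B\<close>
      lie in \<open>V\<close>, hence in \<open>S\<close>.\<close>
    also have "emeasure ?m' (B \<inter> S) = emeasure ?m' B"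
    proof -
      have "graph_pt c \<gamma>' x \<in> S" if "graph_pt c \<gamma>' x \<in> B" for x
      proof -
        have "graph_pt c \<gamma>' x \<in> {x \<in> V. x \<bullet> c = \<gamma>' x}"
          using that B(2) graph_pt_inner[OF V'(2)] by auto
        then show ?thesis unfolding V'(3)[symmetric] by simp
      qed
      then have "indicator (B \<inter> S) (graph_pt c \<gamma>' x) = (indicator B (graph_pt c \<gamma>' x) :: ennreal)" for x
        by (auto simp: indicator_def)
      then show ?thesis using B S_borel by (simp add: emeasure_patch_measure'[OF V'(2)])
    qed
    finally show "emeasure M B =
           (\<integral>\<^sup>+x\<in>{x. 0 \<le> x \<bullet> c \<and> x \<bullet> c \<le> 1 \<and> x + (\<gamma>' x - x \<bullet> c) *\<^sub>R c \<in> B}.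
              ennreal (sqrt (1 + (norm (D' x))\<^sup>2)) \<partial>lborel)"
      unfolding emeasure_patch_measure[OF V'(2) B(1)] .
  qed
  then show ?thesis by blast
qed

lemma is_surface_measure_surface_measure:
  "compact S \<Longrightarrow> C1_hypersurface S \<Longrightarrow> is_surface_measure S (surface_measure S)"
  unfolding surface_measure_def by (rule someI_ex) (rule surface_measure_exists)

context
  fixes S :: "'a::euclidean_space set" and M
  assumes M: "is_surface_measure S M"
begin

lemma sets_surface_measure: "sets M = sets borel"
  using M by (simp add: is_surface_measure_def)

lemma space_surface_measure: "space M = UNIV"
  using sets_eq_imp_space_eq[OF sets_surface_measure] by simp

lemma AE_surface_measure: "AE x in M. x \<in> S"
  using M by (simp add: is_surface_measure_def)

lemma emeasure_surface_measure_patch: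
  assumes "open U" "C1_graph b \<gamma> D" "S \<inter> U = {x \<in> U. x \<bullet> b = \<gamma> x}" "B \<in> sets borel" "B \<subseteq> U"
  shows "emeasure M B = emeasure (patch_measure b \<gamma> D) B"
  using M assms unfolding emeasure_patch_measure[OF assms(2,4)] is_surface_measure_def by blast

lemma finite_surface_measure:
  assumes "compact S" "C1_hypersurface S"
  shows "finite_measure M"
proof (rule finite_measureI)
  obtain n :: nat and U b \<gamma> D where cover: "S \<subseteq> (\<Union>i<n. U i)"
    and *: "\<And>i. i < n \<Longrightarrow> open (U i) \<and> C1_graph (b i) (\<gamma> i) (D i) \<and> S \<inter> U i = {x \<in> U i. x \<bullet> b i = \<gamma> i x}"
    by (rule C1_hypersurface_finite_cover[OF assms], rule that)
  have S': "S \<in> sets borel" using assms(1) by (rule borel_compact)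
  then have m: "S \<in> sets M" "\<And>i. i < n \<Longrightarrow> S \<inter> U i \<in> sets M"
    unfolding sets_surface_measure using sets.Int[OF S' borel_open[OF *[THEN conjunct1]]] by auto
  have "emeasure M (space M) = emeasure M S"
    using AE_surface_measure m by (intro emeasure_eq_AE) auto
  also have "S = (\<Union>i<n. S \<inter> U i)" using cover by blast
  also have "emeasure M \<dots> \<le> (\<Sum>i<n. emeasure M (S \<inter> U i))"
    using m by (intro emeasure_subadditive_finite) auto
  also have "\<dots> = (\<Sum>i<n. emeasure (patch_measure (b i) (\<gamma> i) (D i)) (S \<inter> U i))"
  proof (rule sum.cong)
    fix i assume "i \<in> {..<n}"
    then have i: "i < n" by simp
    show "emeasure M (S \<inter> U i) = emeasure (patch_measure (b i) (\<gamma> i) (D i)) (S \<inter> U i)"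
      by (rule emeasure_surface_measure_patch[of "U i"])
        (use *[OF i] m(2)[OF i] sets_surface_measure in simp_all)
  qed simp
  also have "\<dots> < \<infinity>"
  proof -
    have "emeasure (patch_measure (b i) (\<gamma> i) (D i)) (S \<inter> U i) < \<infinity>" if "i < n" for i
      using *[OF that] m(2)[OF that] bounded_subset[OF compact_imp_bounded[OF assms(1)], of "S \<inter> U i"]
      by (intro emeasure_patch_measure_bounded) (auto simp: sets_surface_measure)
    then show ?thesis by (simp add: less_top[symmetric])
  qed
  finally show "emeasure M (space M) \<noteq> \<infinity>" by simp
qed

text \<open>Inside \<open>U\<close> the surface measure and the patch measure agree on all Borel
  sets, so integrals over \<open>U\<close> may be computed with the image of a density on the
  slab.\<close>

lemma surface_integral_patch:
  fixes f :: "'a \<Rightarrow> real"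
  assumes U: "open U" "C1_graph b \<gamma> D" "S \<inter> U = {x \<in> U. x \<bullet> b = \<gamma> x}"
    and [measurable]: "f \<in> borel_measurable borel"
  shows "(LINT x:U|M. f x) = (LINT x:slab b|lborel. area_factor D x * (indicator U (graph_pt b \<gamma> x) * f (graph_pt b \<gamma> x)))"
proof -
  note [measurable] = C1_graph_measurable[OF U(2)] borel_open[OF U(1)]
  have r: "restrict_space M U = restrict_space (patch_measure b \<gamma> D) U"
  proof (rule measure_eqI)
    show s: "sets (restrict_space M U) = sets (restrict_space (patch_measure b \<gamma> D) U)"
      by (simp add: sets_restrict_space sets_surface_measure)
    fix A assume "A \<in> sets (restrict_space M U)"
    then have A: "A \<in> sets borel" "A \<subseteq> U"
      using U(1) by (auto simp: sets_restrict_space sets_surface_measure)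
    then show "emeasure (restrict_space M U) A = emeasure (restrict_space (patch_measure b \<gamma> D) U) A"
      using U by (simp add: emeasure_restrict_space sets_surface_measure emeasure_surface_measure_patch)
  qed
  have "(LINT x:U|M. f x) = (LINT x|restrict_space M U. f x)"
    unfolding set_lebesgue_integral_def
    by (rule integral_restrict_space[symmetric]) (simp add: sets_surface_measure space_surface_measure)
  also have "\<dots> = (LINT x:U|patch_measure b \<gamma> D. f x)"
    unfolding set_lebesgue_integral_def r
    by (rule integral_restrict_space) (simp add: patch_measure_def)
  also have "\<dots> = (LINT x|density lborel (\<lambda>x. ennreal (indicator (slab b) x * area_factor D x)). indicator U (graph_pt b \<gamma> x) * f (graph_pt b \<gamma> x))"
    unfolding set_lebesgue_integral_def patch_measure_def
    by (subst integral_distr) (auto simp: ennreal_mult' ennreal_indicator area_factor_pos less_imp_le)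
  also have "\<dots> = (LINT x|lborel. (indicator (slab b) x * area_factor D x) *\<^sub>R (indicator U (graph_pt b \<gamma> x) * f (graph_pt b \<gamma> x)))"
    by (rule integral_density) (auto simp: area_factor_pos less_imp_le)
  finally show ?thesis by (simp add: set_lebesgue_integral_def mult.assoc)
qed

end

section \<open>Local graph representations and the outward normal\<close>

lemma local_graph_domain_mem:
  assumes "local_graph_domain \<Omega> z r b \<gamma> D s" "x \<in> ball z r"
  shows "x \<in> \<Omega> \<longleftrightarrow> 0 < s * (x \<bullet> b - \<gamma> x)"
proof -
  have "\<Omega> \<inter> ball z r = {x \<in> ball z r. 0 < s * (x \<bullet> b - \<gamma> x)}"
    using assms(1) by (simp add: local_graph_domain_def)
  from arg_cong[OF this, of "\<lambda>A. x \<in> A"] show ?thesis using assms(2) by simp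
qed

lemma local_graph_domain_subset:
  assumes "local_graph_domain \<Omega> z r b \<gamma> D s" "0 < r'" "ball x r' \<subseteq> ball z r"
  shows "local_graph_domain \<Omega> x r' b \<gamma> D s"
proof -
  have "\<Omega> \<inter> ball x r' = {y \<in> ball x r'. 0 < s * (y \<bullet> b - \<gamma> y)}"
  proof (rule set_eqI)
    fix y
    show "y \<in> \<Omega> \<inter> ball x r' \<longleftrightarrow> y \<in> {y \<in> ball x r'. 0 < s * (y \<bullet> b - \<gamma> y)}"
      using local_graph_domain_mem[OF assms(1), of y] subsetD[OF assms(3), of y] by auto
  qed
  then show ?thesis using assms by (simp add: local_graph_domain_def)
qed

lemma local_graph_domain_closure:
  assumes L: "local_graph_domain \<Omega> z r b \<gamma> D s" and x: "x \<in> ball z r"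
  shows "x \<in> closure \<Omega> \<longleftrightarrow> 0 \<le> s * (x \<bullet> b - \<gamma> x)"
proof
  note g = C1_graphD[of b \<gamma> D]
  have G: "C1_graph b \<gamma> D" and s: "s * s = 1" and eq: "\<Omega> \<inter> ball z r = {x \<in> ball z r. 0 < s * (x \<bullet> b - \<gamma> x)}"
    using L by (auto simp: local_graph_domain_def)
  {
    assume "x \<in> closure \<Omega>"
    show "0 \<le> s * (x \<bullet> b - \<gamma> x)"
    proof (rule ccontr)
      assume "\<not> 0 \<le> s * (x \<bullet> b - \<gamma> x)"
      moreover have "open (ball z r \<inter> {x. s * (x \<bullet> b - \<gamma> x) < 0})"
        by (intro open_Int open_ball open_Collect_less continuous_intros g(5)[OF G])
      ultimately have "\<Omega> \<inter> (ball z r \<inter> {x. s * (x \<bullet> b - \<gamma> x) < 0}) \<noteq> {}"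
        using \<open>x \<in> closure \<Omega>\<close> x open_Int_closure_eq_empty[of "ball z r \<inter> {x. s * (x \<bullet> b - \<gamma> x) < 0}" \<Omega>]
        by auto
      then show False using local_graph_domain_mem[OF L] by auto
    qed
  }
  assume x0: "0 \<le> s * (x \<bullet> b - \<gamma> x)"
  show "x \<in> closure \<Omega>"
    unfolding closure_approachable
  proof (intro allI impI)
    fix e :: real assume e: "0 < e"
    \<comment> \<open>Moving x by d in the direction s b raises s (x \<bullet> b - \<gamma> x) by
      exactly d > 0; the bound on \<open>d\<close> keeps the new point within e of x and inside the
      ball.\<close>
    define d where "d = min (e / 2) ((r - dist z x) / 2)"
    have d: "0 < d" "d < e" "d < r - dist z x" using e x by (auto simp: d_def min_def)
    define y where "y = x + (d * s) *\<^sub>R b"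
    have "\<bar>s\<bar> = 1" using L by (auto simp: local_graph_domain_def)
    then have dy: "dist y x = d" using d(1) g(1)[OF G] by (simp add: y_def dist_norm abs_mult)
    have "s * (y \<bullet> b - \<gamma> y) = s * (x \<bullet> b - \<gamma> x) + d * (s * s)"
      using g(1,2)[OF G] by (simp add: y_def inner_add_left algebra_simps)
    then have "0 < s * (y \<bullet> b - \<gamma> y)" using x0 d(1) s by simp
    moreover have "dist z y < r" using dist_triangle[of z y x] dy d(3) by (simp add: dist_commute)
    ultimately have "y \<in> \<Omega>" using local_graph_domain_mem[OF L] by auto
    then show "\<exists>y\<in>\<Omega>. dist y x < e" using dy d(2) by auto
  qed
qed

lemma local_graph_domain_frontier:
  assumes "open \<Omega>" "local_graph_domain \<Omega> z r b \<gamma> D s"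
  shows "frontier \<Omega> \<inter> ball z r = {x \<in> ball z r. x \<bullet> b = \<gamma> x}"
proof -
  have s: "s \<in> {-1, 1}" and eq: "\<Omega> \<inter> ball z r = {x \<in> ball z r. 0 < s * (x \<bullet> b - \<gamma> x)}"
    using assms(2) by (simp_all add: local_graph_domain_def)
  have "frontier \<Omega> = closure \<Omega> - \<Omega>" using assms(1) by (simp add: frontier_def interior_open)
  moreover have "0 \<le> s * (x \<bullet> b - \<gamma> x) \<and> \<not> 0 < s * (x \<bullet> b - \<gamma> x) \<longleftrightarrow> x \<bullet> b = \<gamma> x" for x
    using s by auto
  moreover have "x \<in> \<Omega> \<longleftrightarrow> 0 < s * (x \<bullet> b - \<gamma> x)" if "x \<in> ball z r" for x
    using that local_graph_domain_mem[OF assms(2)] by simp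
  ultimately show ?thesis using local_graph_domain_closure[OF assms(2)] by auto
qed

lemma C1_boundary_hypersurface:
  assumes "open \<Omega>" "C1_boundary \<Omega>"
  shows "C1_hypersurface (frontier \<Omega>)"
  unfolding C1_hypersurface_def
proof
  fix z assume "z \<in> frontier \<Omega>"
  then obtain r b \<gamma> D s where L: "local_graph_domain \<Omega> z r b \<gamma> D s"
    using assms(2) by (auto simp: C1_boundary_def)
  then have "C1_graph b \<gamma> D" "0 < r" by (auto simp: local_graph_domain_def)
  then show "\<exists>U b \<gamma> D. open U \<and> z \<in> U \<and> C1_graph b \<gamma> D \<and> frontier \<Omega> \<inter> U = {x \<in> U. x \<bullet> b = \<gamma> x}"
    using local_graph_domain_frontier[OF assms(1) L] by (intro exI[of _ "ball z r"] exI) auto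
qed

text \<open>
  A description of the outward normal by directions pointing into and out of the domain, which
  does not mention graphs.
\<close>

definition is_outer_normal :: "'a::euclidean_space set \<Rightarrow> 'a \<Rightarrow> 'a \<Rightarrow> bool" where
  "is_outer_normal \<Omega> z \<nu> \<longleftrightarrow> norm \<nu> = 1 \<and>
     (\<forall>v. v \<bullet> \<nu> < 0 \<longrightarrow> (\<forall>\<^sub>F t in at_right 0. z + t *\<^sub>R v \<in> \<Omega>)) \<and>
     (\<forall>v. 0 < v \<bullet> \<nu> \<longrightarrow> (\<forall>\<^sub>F t in at_right 0. z + t *\<^sub>R v \<notin> \<Omega>))"

text \<open>For distinct unit vectors the difference \<nu>' - \<nu> makes an obtuse angle with \<nu>
  and an acute one with \<nu>', so it would point both into and out of the domain.\<close>

lemma is_outer_normal_unique: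
  assumes "is_outer_normal \<Omega> z \<nu>" "is_outer_normal \<Omega> z \<nu>'"
  shows "\<nu> = \<nu>'"
proof (rule ccontr)
  assume ne: "\<nu> \<noteq> \<nu>'"
  have 1: "\<nu> \<bullet> \<nu> = 1" "\<nu>' \<bullet> \<nu>' = 1" using assms by (auto simp: is_outer_normal_def norm_eq_1)
  have "0 < (\<nu> - \<nu>') \<bullet> (\<nu> - \<nu>')" using ne by simp
  then have "\<nu> \<bullet> \<nu>' < 1" using 1 by (simp add: inner_diff_left inner_diff_right inner_commute)
  then have "(\<nu>' - \<nu>) \<bullet> \<nu> < 0" "0 < (\<nu>' - \<nu>) \<bullet> \<nu>'"
    using 1 by (simp_all add: inner_diff_left inner_diff_right inner_commute)
  then have "\<forall>\<^sub>F t in at_right 0. z + t *\<^sub>R (\<nu>' - \<nu>) \<in> \<Omega>" "\<forall>\<^sub>F t in at_right 0. z + t *\<^sub>R (\<nu>' - \<nu>) \<notin> \<Omega>"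
    using assms by (auto simp: is_outer_normal_def)
  then have "\<forall>\<^sub>F t::real in at_right 0. False" by eventually_elim auto
  then show False by simp
qed

text \<open>At a frontier point the function s (x \<bullet> b - \<gamma> x) vanishes, and its
  derivative in a direction v has the sign opposite to that of v \<bullet> \<nu>. So the sign of v
  \<bullet> \<nu> decides on which side of the graph the ray starts.\<close>

lemma local_graph_domain_outer_normal:
  assumes "open \<Omega>" and L: "local_graph_domain \<Omega> z r b \<gamma> D s" and x: "x \<in> frontier \<Omega>" "x \<in> ball z r"
  shows "is_outer_normal \<Omega> x ((s / area_factor D x) *\<^sub>R (D x - b))"
proof -
  have G: "C1_graph b \<gamma> D" and s: "s \<in> {-1, 1}" and eq: "\<Omega> \<inter> ball z r = {x \<in> ball z r. 0 < s * (x \<bullet> b - \<gamma> x)}"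
    using L by (auto simp: local_graph_domain_def)
  have x0: "x \<bullet> b = \<gamma> x" using local_graph_domain_frontier[OF assms(1) L, THEN arg_cong, of "\<lambda>A. x \<in> A"] x by simp
  have near: "\<forall>\<^sub>F t in at_right 0. x + t *\<^sub>R v \<in> ball z r" for v
  proof -
    have "((\<lambda>t. x + t *\<^sub>R v) \<longlongrightarrow> x + 0 *\<^sub>R v) (at_right 0)" by (intro tendsto_intros)
    then show ?thesis using x(2) by (intro topological_tendstoD) auto
  qed
  have inc: "\<forall>\<^sub>F t in at_right 0. 0 < \<sigma> * ((x + t *\<^sub>R v) \<bullet> b - \<gamma> (x + t *\<^sub>R v))"
    if "0 < \<sigma> * (v \<bullet> b - v \<bullet> D x)" for v and \<sigma> :: real
  proof -
    have "((\<lambda>t. \<gamma> (x + t *\<^sub>R v)) has_real_derivative v \<bullet> D x) (at 0)"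
      by (rule GDERIV_along_line) (simp add: C1_graphD(3)[OF G])
    then have "((\<lambda>t. \<sigma> * ((x + t *\<^sub>R v) \<bullet> b - \<gamma> (x + t *\<^sub>R v))) has_real_derivative \<sigma> * (v \<bullet> b - v \<bullet> D x)) (at 0)"
      unfolding inner_add_left inner_scaleR_left by (auto intro!: derivative_eq_intros)
    from DERIV_pos_inc_right[OF this that] show ?thesis
      using x0 by (auto simp: eventually_at_right_field)
  qed
  have pos: "0 < area_factor D x" by (rule area_factor_pos)
  have "norm ((s / area_factor D x) *\<^sub>R (D x - b)) = 1"
    using norm_graph_normal[OF G, of x] s pos by (auto simp: norm_minus_commute)
  moreover have "\<forall>\<^sub>F t in at_right 0. x + t *\<^sub>R v \<in> \<Omega>" if "v \<bullet> ((s / area_factor D x) *\<^sub>R (D x - b)) < 0" for v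
  proof -
    have "0 < s * (v \<bullet> b - v \<bullet> D x)" using that pos s by (auto simp: inner_diff_right field_simps)
    from inc[OF this] near[of v] show ?thesis by eventually_elim (use local_graph_domain_mem[OF L] in auto)
  qed
  moreover have "\<forall>\<^sub>F t in at_right 0. x + t *\<^sub>R v \<notin> \<Omega>" if "0 < v \<bullet> ((s / area_factor D x) *\<^sub>R (D x - b))" for v
  proof -
    have "0 < (- s) * (v \<bullet> b - v \<bullet> D x)" using that pos s by (auto simp: inner_diff_right field_simps)
    from inc[OF this] near[of v] show ?thesis by eventually_elim (use local_graph_domain_mem[OF L] in force)
  qed
  ultimately show ?thesis unfolding is_outer_normal_def by blast
qed

text \<open>Whichever local graph the choice in \<open>outward_normal\<close> picks, its vector is
  an outer normal in the sense of directions, and of those there is only one.\<close>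

lemma outward_normal_eqI:
  assumes "open \<Omega>" "C1_boundary \<Omega>" "z \<in> frontier \<Omega>" "is_outer_normal \<Omega> z \<nu>"
  shows "outward_normal \<Omega> z = \<nu>"
proof -
  let ?P = "\<lambda>\<nu>. \<exists>r b \<gamma> D s. local_graph_domain \<Omega> z r b \<gamma> D s \<and> \<nu> = (s / sqrt (1 + (norm (D z))\<^sup>2)) *\<^sub>R (D z - b)"
  have *: "is_outer_normal \<Omega> z \<nu>'" if "?P \<nu>'" for \<nu>'
  proof -
    from that obtain r b \<gamma> D s where "local_graph_domain \<Omega> z r b \<gamma> D s" "\<nu>' = (s / sqrt (1 + (norm (D z))\<^sup>2)) *\<^sub>R (D z - b)" by blast
    then show ?thesis
      using local_graph_domain_outer_normal[OF assms(1), of z r b \<gamma> D s z] assms(3)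
      by (simp add: local_graph_domain_def area_factor_def)
  qed
  have "\<exists>\<nu>. ?P \<nu>" using assms(2,3) unfolding C1_boundary_def by blast
  from someI_ex[OF this] have "?P (outward_normal \<Omega> z)" unfolding outward_normal_def .
  from *[OF this] show ?thesis using assms(4) is_outer_normal_unique by blast
qed

lemma outward_normal_local:
  assumes "open \<Omega>" "C1_boundary \<Omega>" "local_graph_domain \<Omega> z r b \<gamma> D s" "x \<in> frontier \<Omega>" "x \<in> ball z r"
  shows "outward_normal \<Omega> x = (s / area_factor D x) *\<^sub>R (D x - b)"
  using assms by (intro outward_normal_eqI local_graph_domain_outer_normal)

lemma continuous_on_outward_normal:
  assumes "open \<Omega>" "C1_boundary \<Omega>"
  shows "continuous_on (frontier \<Omega>) (outward_normal \<Omega>)"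
  unfolding continuous_on_def
proof
  fix z assume z: "z \<in> frontier \<Omega>"
  then obtain r b \<gamma> D s where L: "local_graph_domain \<Omega> z r b \<gamma> D s"
    using assms(2) by (auto simp: C1_boundary_def)
  then have G: "C1_graph b \<gamma> D" "0 < r" by (auto simp: local_graph_domain_def)
  let ?n = "\<lambda>x. (s / area_factor D x) *\<^sub>R (D x - b)"
  have "continuous_on UNIV ?n"
    using area_factor_pos[of D] by (intro continuous_intros continuous_area_factor[OF G(1)] C1_graphD(4)[OF G(1)]) (metis less_irrefl)
  then have "isCont ?n z" by (simp add: continuous_on_eq_continuous_at)
  then have "(?n \<longlongrightarrow> ?n z) (at z within frontier \<Omega>)"
    unfolding isCont_def by (rule tendsto_within_subset) simp
  moreover have "\<forall>\<^sub>F x in at z within frontier \<Omega>. ?n x = outward_normal \<Omega> x"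
    using G(2) outward_normal_local[OF assms L] by (auto simp: eventually_at dist_commute intro!: exI[of _ r])
  ultimately show "(outward_normal \<Omega> \<longlongrightarrow> outward_normal \<Omega> z) (at z within frontier \<Omega>)"
    using outward_normal_local[OF assms L z] G(2) by (simp add: Lim_transform_eventually)
qed

section \<open>The divergence theorem\<close>

definition bump :: "'a::euclidean_space \<Rightarrow> real \<Rightarrow> 'a \<Rightarrow> real" where
  "bump z r x = exp_recip 0 (r\<^sup>2 - (norm (x - z))\<^sup>2)"

text \<open>The gradient of \<open>bump\<close>: \<open>exp_recip 2\<close> is the derivative of
  \<open>exp_recip 0\<close>, and -2 (x - z) comes from the quadratic inside.\<close>

definition dbump :: "'a::euclidean_space \<Rightarrow> real \<Rightarrow> 'a \<Rightarrow> 'a" where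
  "dbump z r x = (- 2 * exp_recip 2 (r\<^sup>2 - (norm (x - z))\<^sup>2)) *\<^sub>R (x - z)"

lemma GDERIV_bump: "GDERIV (bump z r) x :> dbump z r x"
proof -
  have "((\<lambda>x. r\<^sup>2 - (norm (x - z))\<^sup>2) has_derivative (\<lambda>h. - 2 * (h \<bullet> (x - z)))) (at x)"
    unfolding power2_norm_eq_inner by (auto intro!: derivative_eq_intros simp: inner_commute)
  then have "GDERIV (\<lambda>x. r\<^sup>2 - (norm (x - z))\<^sup>2) x :> (- 2) *\<^sub>R (x - z)" by (simp add: gderiv_def)
  moreover have "(exp_recip 0 has_real_derivative exp_recip 2 t) (at t)" for t
    using DERIV_exp_recip[of 0 t] by (simp add: numeral_2_eq_2)
  ultimately have "GDERIV (\<lambda>x. exp_recip 0 (r\<^sup>2 - (norm (x - z))\<^sup>2)) x :>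
      exp_recip 2 (r\<^sup>2 - (norm (x - z))\<^sup>2) *\<^sub>R (- 2) *\<^sub>R (x - z)"
    by (rule GDERIV_DERIV_compose)
  then show ?thesis by (simp add: bump_def[abs_def] dbump_def mult.commute)
qed

lemma continuous_bump: "continuous_on A (bump z r)" and continuous_dbump: "continuous_on A (dbump z r)"
proof -
  have c: "continuous_on UNIV (exp_recip m)" for m
    using DERIV_exp_recip DERIV_isCont continuous_at_imp_continuous_on by blast
  show "continuous_on A (bump z r)" unfolding bump_def[abs_def]
    by (intro continuous_on_compose2[OF c] continuous_intros) auto
  show "continuous_on A (dbump z r)" unfolding dbump_def[abs_def]
    by (intro continuous_intros continuous_on_compose2[OF c]) auto
qed

lemma bump_pos_iff: "0 \<le> r \<Longrightarrow> 0 < bump z r x \<longleftrightarrow> x \<in> ball z r"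
  using power2_less_imp_less[of "norm (x - z)" r] power_strict_mono[of "norm (x - z)" r 2]
  by (auto simp: bump_def exp_recip_pos_iff dist_norm norm_minus_commute)

lemma bump_nonneg: "0 \<le> bump z r x"
  by (simp add: bump_def exp_recip_nonneg)

lemma bump_eq_0: "0 \<le> r \<Longrightarrow> x \<notin> ball z r \<Longrightarrow> bump z r x = 0" and dbump_eq_0: "0 \<le> r \<Longrightarrow> x \<notin> ball z r \<Longrightarrow> dbump z r x = 0"
proof -
  assume "0 \<le> r" "x \<notin> ball z r"
  then have "r\<^sup>2 - (norm (x - z))\<^sup>2 \<le> 0" by (simp add: dist_norm norm_minus_commute power_mono)
  then show "bump z r x = 0" "dbump z r x = 0" by (simp_all add: bump_def dbump_def exp_recip_eq_0)
qed

lemma bounded_image_compact_real: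
  fixes f :: "'a::metric_space \<Rightarrow> real"
  assumes "compact K" "continuous_on K f"
  obtains B where "0 \<le> B" "\<And>x. x \<in> K \<Longrightarrow> \<bar>f x\<bar> \<le> B"
proof -
  have "bounded (f ` K)" using assms by (intro compact_imp_bounded compact_continuous_image)
  then obtain B where "\<forall>y\<in>f ` K. norm y \<le> B" by (auto simp: bounded_iff)
  then show thesis by (intro that[of "max B 0"]) auto
qed

lemma set_integrable_bounded_mult:
  fixes h :: "'a::euclidean_space \<Rightarrow> 'b::euclidean_space" and c :: "'a \<Rightarrow> real"
  assumes "set_integrable M A h" "set_borel_measurable M A c" "\<And>x. x \<in> A \<Longrightarrow> \<bar>c x\<bar> \<le> B"
  shows "set_integrable M A (\<lambda>x. c x *\<^sub>R h x)"
  unfolding set_integrable_def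
proof (rule Bochner_Integration.integrable_bound)
  have i: "integrable M (\<lambda>x. indicator A x *\<^sub>R h x)" using assms(1) by (simp add: set_integrable_def)
  show "integrable M (\<lambda>x. B *\<^sub>R norm (indicator A x *\<^sub>R h x))"
    by (intro integrable_scaleR_right integrable_norm i)
  have "(\<lambda>x. (indicator A x *\<^sub>R c x) *\<^sub>R (indicator A x *\<^sub>R h x)) \<in> borel_measurable M"
    using borel_measurable_scaleR[OF assms(2)[unfolded set_borel_measurable_def] borel_measurable_integrable[OF i]] .
  also have "(\<lambda>x. (indicator A x *\<^sub>R c x) *\<^sub>R (indicator A x *\<^sub>R h x)) = (\<lambda>x. indicator A x *\<^sub>R c x *\<^sub>R h x)"
    by (auto simp: indicator_def)
  finally show "(\<lambda>x. indicator A x *\<^sub>R c x *\<^sub>R h x) \<in> borel_measurable M" .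
  show "AE x in M. norm (indicator A x *\<^sub>R c x *\<^sub>R h x) \<le> norm (B *\<^sub>R norm (indicator A x *\<^sub>R h x))"
    using assms(3) by (auto simp: indicator_def abs_mult intro!: AE_I2 mult_right_mono order_trans[OF assms(3)])
qed

lemma set_integrable_continuous_finite:
  fixes h :: "'a::euclidean_space \<Rightarrow> 'b::euclidean_space"
  assumes "A \<in> sets borel" "sets M = sets borel" "emeasure M A < \<infinity>" "continuous_on A h" "\<And>x. x \<in> A \<Longrightarrow> norm (h x) \<le> B"
  shows "set_integrable M A h"
  unfolding set_integrable_def
proof (rule integrableI_bounded_set[of A _ _ B])
  have "(\<lambda>x. indicator A x *\<^sub>R h x) \<in> borel_measurable borel"
    by (rule borel_measurable_continuous_on_indicator) (use assms in auto)
  then show "(\<lambda>x. indicator A x *\<^sub>R h x) \<in> borel_measurable M"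
    using assms(2) measurable_cong_sets by blast
qed (use assms in auto)

lemma set_integrable_scaleR_inner:
  fixes h :: "'a \<Rightarrow> 'b::euclidean_space"
  shows "set_integrable M A h \<Longrightarrow> set_integrable M A (\<lambda>x. h x \<bullet> e)"
  unfolding set_integrable_def by (simp flip: inner_scaleR_left)

text \<open>Interior points fit the same pattern as frontier points: a flat graph placed at the
  lower edge of a ball inside \<Omega> has the whole ball on its positive side. One covering
  argument can then treat all points of the closure alike.\<close>

lemma local_graph_domain_exists:
  assumes "open \<Omega>" "C1_boundary \<Omega>" "z \<in> closure \<Omega>"
  obtains r b \<gamma> D s where "local_graph_domain \<Omega> z r b \<gamma> D s"
proof (cases "z \<in> \<Omega>")
  case False
  then have "z \<in> frontier \<Omega>" using assms(1,3) by (simp add: frontier_def interior_open)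
  then show thesis using assms(2) that unfolding C1_boundary_def by blast
next
  case True
  then obtain r where r: "0 < r" "ball z r \<subseteq> \<Omega>" using assms(1) open_contains_ball by blast
  obtain b :: 'a where b: "b \<in> Basis" using nonempty_Basis by blast
  have "C1_graph b (\<lambda>_. z \<bullet> b - r) (\<lambda>_. 0)" using b by (auto simp: C1_graph_def GDERIV_const)
  moreover have "0 < 1 * (x \<bullet> b - (z \<bullet> b - r))" if "x \<in> ball z r" for x
    using Basis_le_norm[OF b, of "z - x"] that by (auto simp: dist_norm inner_diff_left)
  ultimately have "local_graph_domain \<Omega> z r b (\<lambda>_. z \<bullet> b - r) (\<lambda>_. 0) 1"
    using r by (auto simp: local_graph_domain_def)
  then show thesis by (rule that)
qed

lemma divergence_frontier_integrable:
  fixes h :: "'a::euclidean_space \<Rightarrow> real"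
  assumes \<Omega>: "open \<Omega>" "C1_boundary \<Omega>" "compact (frontier \<Omega>)"
    and M: "is_surface_measure (frontier \<Omega>) M" and h: "continuous_on (frontier \<Omega>) h"
  shows "set_integrable M (frontier \<Omega>) (\<lambda>x. h x * (outward_normal \<Omega> x \<bullet> e))"
proof -
  have c: "continuous_on (frontier \<Omega>) (\<lambda>x. h x * (outward_normal \<Omega> x \<bullet> e))"
    by (intro continuous_intros h continuous_on_outward_normal \<Omega>(1,2))
  obtain B where "\<And>x. x \<in> frontier \<Omega> \<Longrightarrow> \<bar>h x * (outward_normal \<Omega> x \<bullet> e)\<bar> \<le> B"
    by (rule bounded_image_compact_real[OF \<Omega>(3) c], rule that)
  moreover have "finite_measure M"
    by (rule finite_surface_measure[OF M \<Omega>(3) C1_boundary_hypersurface[OF \<Omega>(1,2)]])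
  ultimately show ?thesis
    using c \<Omega>(3) sets_surface_measure[OF M]
    by (intro set_integrable_continuous_finite) (auto simp: borel_compact less_top[symmetric] finite_measure.emeasure_finite)
qed

context
  fixes \<Omega> :: "'a::euclidean_space set" and M :: "'a measure" and f :: "'a \<Rightarrow> real" and g :: "'a \<Rightarrow> 'a" and e :: 'a
  assumes \<Omega>: "open \<Omega>" "C1_boundary \<Omega>" "compact (frontier \<Omega>)"
    and M: "is_surface_measure (frontier \<Omega>) M"
    and f: "continuous_on (closure \<Omega>) f"
    and der: "\<And>x. x \<in> \<Omega> \<Longrightarrow> GDERIV f x :> g x"
    and int: "set_integrable lborel \<Omega> g"
    and e: "e \<in> Basis"
begin

lemma frontier_subset_closure: "frontier \<Omega> \<subseteq> closure \<Omega>" by (simp add: frontier_def)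

text \<open>The bump is supported strictly inside the ball in which \<Omega> is a graph domain, so
  the product extends by zero to the whole side of the global graph, where
  \<open>graph_domain_divergence\<close> holds. The boundary term over the slab becomes a surface
  integral because the area factor is the density and s (D - b) is the normal times that
  factor.\<close>

lemma divergence_bump:
  assumes L: "local_graph_domain \<Omega> z r b \<gamma> D s" and r': "0 < r'" "r' < r"
  defines "\<psi> \<equiv> bump z r'" and "d\<psi> \<equiv> dbump z r'"
  shows "set_integrable lborel \<Omega> (\<lambda>x. \<psi> x *\<^sub>R g x + f x *\<^sub>R d\<psi> x)"
    and "(LINT x:\<Omega>|lborel. (\<psi> x *\<^sub>R g x + f x *\<^sub>R d\<psi> x) \<bullet> e) =
      (LINT x:frontier \<Omega>|M. \<psi> x * f x * (outward_normal \<Omega> x \<bullet> e))"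
proof -
  have G: "C1_graph b \<gamma> D" and s: "s \<in> {-1, 1}" and eq: "\<Omega> \<inter> ball z r = {x \<in> ball z r. 0 < s * (x \<bullet> b - \<gamma> x)}"
    using L by (simp_all add: local_graph_domain_def)
  note gr = C1_graphD[OF G]
  have [measurable]: "\<gamma> \<in> borel_measurable borel" "\<Omega> \<in> sets borel" "frontier \<Omega> \<in> sets borel"
    using C1_graph_measurable[OF G] \<Omega> by (auto simp: borel_compact)
  have sub: "cball z r' \<subseteq> ball z r" "ball z r' \<subseteq> ball z r" "ball z r' \<subseteq> cball z r'" using r' by auto
  have \<psi>0: "\<psi> x = 0" "d\<psi> x = 0" if "x \<notin> ball z r'" for x
    using that r' by (auto simp: \<psi>_def d\<psi>_def bump_eq_0 dbump_eq_0)
  define A where "A = {x. 0 \<le> s * (x \<bullet> b - \<gamma> x)}"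
  define H where "H = {x. 0 < s * (x \<bullet> b - \<gamma> x)}"
  have [measurable]: "H \<in> sets borel" unfolding H_def by measurable
  have cl: "closure \<Omega> \<inter> ball z r = A \<inter> ball z r" using local_graph_domain_closure[OF L] by (auto simp: A_def)
  have H_ball: "\<Omega> \<inter> ball z r = H \<inter> ball z r" using local_graph_domain_mem[OF L] by (auto simp: H_def)
  \<comment> \<open>Extension by zero from the ball. Continuity is checked on two relatively open
    pieces, the ball of radius \<open>r\<close> and the exterior of the ball of radius r'; the
    strict inequality r' < r makes them overlap.\<close>
  define F where "F x = (if x \<in> ball z r then \<psi> x * f x else 0)" for x
  define F' where "F' x = (if x \<in> ball z r then \<psi> x *\<^sub>R g x + f x *\<^sub>R d\<psi> x else 0)" for x
  have cF: "continuous_on A F"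
  proof -
    have 1: "A = (A \<inter> ball z r) \<union> (A \<inter> - cball z r')" using sub by blast
    have c1: "continuous_on (A \<inter> ball z r) F"
    proof -
      have "continuous_on (A \<inter> ball z r) (\<lambda>x. \<psi> x * f x)"
        unfolding \<psi>_def cl[symmetric]
        by (intro continuous_intros continuous_bump continuous_on_subset[OF f]) auto
      then show ?thesis by (rule continuous_on_eq) (simp add: F_def)
    qed
    have c2: "continuous_on (A \<inter> - cball z r') F"
    proof -
      have "continuous_on (A \<inter> - cball z r') (\<lambda>x. 0 :: real)" by simp
      then show ?thesis by (rule continuous_on_eq) (use \<psi>0 in \<open>auto simp: F_def\<close>)
    qed
    have o: "openin (top_of_set A) (A \<inter> ball z r)" "openin (top_of_set A) (A \<inter> - cball z r')"
      by (auto intro!: openin_open_Int)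
    show ?thesis
      using continuous_on_Un_local_open[of "A \<inter> ball z r" "A \<inter> - cball z r'" F] o c1 c2 1 by auto
  qed
  have dF: "GDERIV F x :> F' x" if "x \<in> H" for x
  proof (cases "x \<in> ball z r")
    case True
    then have x: "x \<in> \<Omega> \<inter> ball z r" using that H_ball by blast
    then have "GDERIV (\<lambda>x. \<psi> x * f x) x :> \<psi> x *\<^sub>R g x + f x *\<^sub>R d\<psi> x"
      unfolding \<psi>_def d\<psi>_def by (intro GDERIV_mult GDERIV_bump der) auto
    then have "GDERIV F x :> \<psi> x *\<^sub>R g x + f x *\<^sub>R d\<psi> x"
      by (rule GDERIV_cong_open[of _ _ _ "ball z r"]) (use True in \<open>auto simp: F_def\<close>)
    then show ?thesis using True by (simp add: F'_def)
  next
    case False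
    have "GDERIV F x :> 0"
      by (rule GDERIV_cong_open[OF GDERIV_const[of 0], of "- cball z r'"])
         (use False sub \<psi>0 in \<open>auto simp: F_def\<close>)
    then show ?thesis using False by (simp add: F'_def)
  qed
  have iF: "set_integrable lborel \<Omega> (\<lambda>x. \<psi> x *\<^sub>R g x + f x *\<^sub>R d\<psi> x)"
  proof (rule set_integral_add(1))
    show "set_integrable lborel \<Omega> (\<lambda>x. \<psi> x *\<^sub>R g x)"
    proof (rule set_integrable_bounded_mult[OF int, of _ 1])
      have "\<psi> \<in> borel_measurable borel"
        unfolding \<psi>_def by (intro borel_measurable_continuous_onI continuous_bump)
      then show "set_borel_measurable lborel \<Omega> \<psi>" by (simp add: set_borel_measurable_def)
      show "\<bar>\<psi> x\<bar> \<le> 1" for x by (simp add: \<psi>_def bump_def exp_recip_nonneg exp_recip_0_le_1)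
    qed
    let ?K = "closure \<Omega> \<inter> cball z r'"
    have K: "compact ?K" by (intro closed_Int_compact) auto
    have c: "continuous_on ?K (\<lambda>x. f x *\<^sub>R d\<psi> x)"
      unfolding d\<psi>_def by (intro continuous_intros continuous_on_subset[OF f] continuous_dbump) auto
    obtain B where B: "\<And>x. x \<in> ?K \<Longrightarrow> \<bar>norm (f x *\<^sub>R d\<psi> x)\<bar> \<le> B"
      by (rule bounded_image_compact_real[OF K continuous_on_norm[OF c]], rule that)
    have "emeasure lborel ?K < \<infinity>" using K by (rule emeasure_compact_finite)
    then have "set_integrable lborel ?K (\<lambda>x. f x *\<^sub>R d\<psi> x)"
      using K c B by (intro set_integrable_continuous_finite[of ?K _ _ B]) (auto simp: borel_compact)
    then have "set_integrable lborel (\<Omega> \<inter> cball z r') (\<lambda>x. f x *\<^sub>R d\<psi> x)"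
      by (rule set_integrable_subset) (use closure_subset in auto)
    moreover have "(\<lambda>x. indicator (\<Omega> \<inter> cball z r') x *\<^sub>R f x *\<^sub>R d\<psi> x) = (\<lambda>x. indicator \<Omega> x *\<^sub>R f x *\<^sub>R d\<psi> x)"
    proof
      fix x show "indicator (\<Omega> \<inter> cball z r') x *\<^sub>R f x *\<^sub>R d\<psi> x = indicator \<Omega> x *\<^sub>R f x *\<^sub>R d\<psi> x"
        using \<psi>0(2)[of x] by (cases "x \<in> ball z r'") (auto simp: indicator_def)
    qed
    ultimately show "set_integrable lborel \<Omega> (\<lambda>x. f x *\<^sub>R d\<psi> x)" by (simp add: set_integrable_def)
  qed
  then show "set_integrable lborel \<Omega> (\<lambda>x. \<psi> x *\<^sub>R g x + f x *\<^sub>R d\<psi> x)" .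
  have ind: "indicator H x *\<^sub>R F' x = indicator \<Omega> x *\<^sub>R (\<psi> x *\<^sub>R g x + f x *\<^sub>R d\<psi> x)" for x
  proof (cases "x \<in> ball z r")
    case True
    then show ?thesis using arg_cong[OF H_ball, of "\<lambda>A. x \<in> A"] by (auto simp: F'_def indicator_def)
  next
    case False
    then have "\<psi> x = 0" "d\<psi> x = 0" using \<psi>0[of x] sub(2) by blast+
    then show ?thesis using False by (simp add: F'_def)
  qed
  have iH: "set_integrable lborel H F'" using iF by (simp add: set_integrable_def ind)
  have supp: "F x = 0" if "norm z + r < norm x" for x
  proof -
    have "norm x \<le> norm z + dist z x" by (metis dist_norm norm_minus_commute norm_triangle_sub)
    then show ?thesis using that by (simp add: F_def)
  qed
  define k where "k x = indicator (frontier \<Omega>) x *\<^sub>R (\<psi> x * f x * (outward_normal \<Omega> x \<bullet> e))" for x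
  have [measurable]: "k \<in> borel_measurable borel"
    unfolding k_def \<psi>_def
    by (intro borel_measurable_continuous_on_indicator continuous_intros continuous_bump continuous_on_outward_normal[OF \<Omega>(1,2)]
      continuous_on_subset[OF f frontier_subset_closure]) (use \<Omega> in auto)
  have "(LINT x:\<Omega>|lborel. (\<psi> x *\<^sub>R g x + f x *\<^sub>R d\<psi> x) \<bullet> e) = (LINT x:H|lborel. F' x \<bullet> e)"
  proof -
    have "indicator \<Omega> x *\<^sub>R ((\<psi> x *\<^sub>R g x + f x *\<^sub>R d\<psi> x) \<bullet> e) = indicator H x *\<^sub>R (F' x \<bullet> e)" for x
      using arg_cong[OF ind[of x], of "\<lambda>v. v \<bullet> e"] by simp
    then show ?thesis unfolding set_lebesgue_integral_def by (simp only:)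
  qed
  also have "\<dots> = (LINT x:slab b|lborel. s * ((D x - b) \<bullet> e) * F (x + (\<gamma> x - x \<bullet> b) *\<^sub>R b))"
    unfolding H_def
    by (rule graph_domain_divergence(2)[OF G s cF[unfolded A_def] supp dF[unfolded H_def] iH[unfolded H_def] e])
  also have "\<dots> = (LINT x:slab b|lborel. area_factor D x * (indicator (ball z r) (graph_pt b \<gamma> x) * k (graph_pt b \<gamma> x)))"
  proof -
    have "s * ((D x - b) \<bullet> e) * F (x + (\<gamma> x - x \<bullet> b) *\<^sub>R b) =
      area_factor D x * (indicator (ball z r) (graph_pt b \<gamma> x) * k (graph_pt b \<gamma> x))" for x
    proof (cases "graph_pt b \<gamma> x \<in> ball z r")
      case True
      let ?P = "graph_pt b \<gamma> x"
      have "?P \<in> frontier \<Omega>"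
        using local_graph_domain_frontier[OF \<Omega>(1) L] True graph_pt_inner[OF G] by auto
      moreover from outward_normal_local[OF \<Omega>(1,2) L this True]
      have "outward_normal \<Omega> ?P = (s / area_factor D x) *\<^sub>R (D x - b)"
        by (simp add: graph_pt_inner(3)[OF G] area_factor_line(2)[OF G])
      ultimately show ?thesis using True area_factor_pos[of D x]
        by (simp add: k_def F_def flip: graph_pt_def)
    next
      case False
      then show ?thesis by (simp add: F_def flip: graph_pt_def)
    qed
    then show ?thesis by simp
  qed
  also have "\<dots> = (LINT x:ball z r|M. k x)"
    by (rule surface_integral_patch[OF M _ G _, symmetric])
       (use local_graph_domain_frontier[OF \<Omega>(1) L] in auto)
  also have "\<dots> = (LINT x:frontier \<Omega>|M. \<psi> x * f x * (outward_normal \<Omega> x \<bullet> e))"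
    unfolding set_lebesgue_integral_def k_def
    by (intro Bochner_Integration.integral_cong) (use \<psi>0(1)[OF contra_subsetD[OF sub(2)]] in \<open>auto simp: indicator_def\<close>)
  finally show "(LINT x:\<Omega>|lborel. (\<psi> x *\<^sub>R g x + f x *\<^sub>R d\<psi> x) \<bullet> e) =
      (LINT x:frontier \<Omega>|M. \<psi> x * f x * (outward_normal \<Omega> x \<bullet> e))" .
qed

end

text \<open>
  Globalisation: \<open>f\<close> is divided by a positive finite sum of bumps, so that it becomes a sum of
  bumps times one function.
\<close>

theorem divergence_theorem:
  fixes \<Omega> :: "'a::euclidean_space set" and f :: "'a \<Rightarrow> real" and g :: "'a \<Rightarrow> 'a"
  assumes \<Omega>: "open \<Omega>" "C1_boundary \<Omega>" "compact (frontier \<Omega>)"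
    and M: "is_surface_measure (frontier \<Omega>) M"
    and f: "continuous_on (closure \<Omega>) f"
    and K: "compact K" "\<And>x. x \<in> closure \<Omega> \<Longrightarrow> x \<notin> K \<Longrightarrow> f x = 0"
    and der: "\<And>x. x \<in> \<Omega> \<Longrightarrow> GDERIV f x :> g x"
    and int: "set_integrable lborel \<Omega> g"
    and e: "e \<in> Basis"
  shows "(LINT x:\<Omega>|lborel. g x \<bullet> e) = (LINT x:frontier \<Omega>|M. f x * (outward_normal \<Omega> x \<bullet> e))"
proof -
  have [measurable]: "\<Omega> \<in> sets borel" "K \<in> sets borel" "frontier \<Omega> \<in> sets borel"
    using \<Omega> K by (auto simp: borel_compact)
  have fr: "frontier \<Omega> \<subseteq> closure \<Omega>" by (simp add: frontier_def)
  define C where "C = closure \<Omega> \<inter> K"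
  have C: "compact C" unfolding C_def using K(1) by (intro closed_Int_compact) auto
  have "\<forall>z\<in>C. \<exists>r. 0 < r \<and> (\<exists>b \<gamma> D s. local_graph_domain \<Omega> z r b \<gamma> D s)"
    by (metis C_def IntD1 \<Omega>(1,2) local_graph_domain_def local_graph_domain_exists)
  from bchoice[OF this] obtain r where r: "\<forall>z\<in>C. 0 < r z \<and> (\<exists>b \<gamma> D s. local_graph_domain \<Omega> z (r z) b \<gamma> D s)"
    by (elim exE) (rule that)
  \<comment> \<open>The cover uses half the radii, as \<open>divergence_bump\<close> requires bumps
    supported in a strictly smaller ball than the local graph representation.\<close>
  obtain Z where Z: "Z \<subseteq> C" "finite Z" "C \<subseteq> (\<Union>z\<in>Z. ball z (r z / 2))"
  proof (rule compactE_image[OF C, of C "\<lambda>z. ball z (r z / 2)"])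
    show "C \<subseteq> (\<Union>z\<in>C. ball z (r z / 2))" using r by force
  qed (auto intro: that)
  define \<psi> d\<psi> where "\<psi> z = bump z (r z / 2)" and "d\<psi> z = dbump z (r z / 2)" for z
  define P where "P x = (\<Sum>z\<in>Z. \<psi> z x)" for x
  define dP where "dP x = (\<Sum>z\<in>Z. d\<psi> z x)" for x
  have cP: "continuous_on A P" "continuous_on A dP" for A
    unfolding P_def dP_def \<psi>_def d\<psi>_def by (intro continuous_intros continuous_bump continuous_dbump)+
  have [measurable]: "P \<in> borel_measurable borel" "dP \<in> borel_measurable borel"
    using cP by (auto intro: borel_measurable_continuous_onI)
  have dP: "GDERIV P x :> dP x" for x
    using GDERIV_bump unfolding gderiv_def P_def dP_def \<psi>_def d\<psi>_def inner_sum_right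
    by (intro has_derivative_sum) auto
  have P_pos: "0 < P x" if "x \<in> C" for x
  proof -
    from subsetD[OF Z(3) that] obtain z where z: "z \<in> Z" "x \<in> ball z (r z / 2)" by blast
    then have "0 < \<psi> z x" using Z(1) r bump_pos_iff[of "r z / 2" z x] by (force simp: \<psi>_def)
    then show ?thesis unfolding P_def using Z(2) z(1)
      by (intro sum_pos2[of Z z]) (auto simp: \<psi>_def bump_nonneg)
  qed
  \<comment> \<open>Dividing \<open>f\<close> by \<open>P\<close> once replaces a partition of
    unity: the sum of the products \<psi> z * f' is P f' = f.\<close>
  define f' where "f' x = (if x \<in> K then f x / P x else 0)" for x
  define g' where "g' x = (if x \<in> K then inverse (P x) *\<^sub>R g x - (f x / (P x)\<^sup>2) *\<^sub>R dP x else 0)" for x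
  have f'_eq: "f' x = f x / P x" if "x \<in> closure \<Omega>" for x using K(2)[OF that] by (simp add: f'_def)
  \<comment> \<open>\<open>P\<close> is known to be positive only near \<open>C\<close>. The open
    sets \<open>W\<close> and - K cover the closure; on the first \<open>f'\<close> is an honest
    quotient, on the second it is zero.\<close>
  define W where "W = {x. 0 < P x}"
  have W: "open W" "C \<subseteq> W" unfolding W_def using P_pos cP by (auto intro!: open_Collect_less continuous_intros)
  have K': "open (- K)" using K(1) by (simp add: compact_imp_closed open_Compl)
  have cf': "continuous_on (closure \<Omega>) f'"
  proof -
    have 1: "closure \<Omega> = (closure \<Omega> \<inter> W) \<union> (closure \<Omega> \<inter> - K)" using W(2) by (auto simp: C_def)
    have "continuous_on (closure \<Omega> \<inter> W) (\<lambda>x. f x / P x)"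
      by (intro continuous_intros cP continuous_on_subset[OF f]) (auto simp: W_def)
    then have c1: "continuous_on (closure \<Omega> \<inter> W) f'" by (rule continuous_on_eq) (simp add: f'_eq)
    have "continuous_on (closure \<Omega> \<inter> - K) (\<lambda>x. 0::real)" by simp
    then have c2: "continuous_on (closure \<Omega> \<inter> - K) f'" by (rule continuous_on_eq) (simp add: f'_def)
    have o: "openin (top_of_set (closure \<Omega>)) (closure \<Omega> \<inter> W)" "openin (top_of_set (closure \<Omega>)) (closure \<Omega> \<inter> - K)"
      using W K' by (auto intro!: openin_open_Int)
    show ?thesis using continuous_on_Un_local_open[of "closure \<Omega> \<inter> W" "closure \<Omega> \<inter> - K" f'] o c1 c2 1 by auto
  qed
  have df': "GDERIV f' x :> g' x" if x: "x \<in> \<Omega>" for x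
  proof (cases "x \<in> K")
    case True
    then have "x \<in> C" using x closure_subset by (auto simp: C_def)
    then have "x \<in> \<Omega> \<inter> W" "P x \<noteq> 0" using W(2) P_pos[of x] x by auto
    have "GDERIV (\<lambda>x. f x * inverse (P x)) x :> f x *\<^sub>R (- (inverse (P x))\<^sup>2 *\<^sub>R dP x) + inverse (P x) *\<^sub>R g x"
      by (intro GDERIV_mult GDERIV_inverse der dP x \<open>P x \<noteq> 0\<close>)
    then have "GDERIV f' x :> f x *\<^sub>R (- (inverse (P x))\<^sup>2 *\<^sub>R dP x) + inverse (P x) *\<^sub>R g x"
      by (rule GDERIV_cong_open[of _ _ _ "\<Omega> \<inter> W"])
         (use W \<open>x \<in> \<Omega> \<inter> W\<close> \<Omega>(1) in \<open>auto simp: f'_eq[OF subsetD[OF closure_subset]] divide_inverse\<close>)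
    then show ?thesis using True by (simp add: g'_def divide_inverse power_inverse)
  next
    case False
    have "GDERIV f' x :> 0"
      by (rule GDERIV_cong_open[OF GDERIV_const[of 0], of "- K"]) (use False K' in \<open>auto simp: f'_def\<close>)
    then show ?thesis using False by (simp add: g'_def)
  qed
  have ig': "set_integrable lborel \<Omega> g'"
  proof -
    have c: "continuous_on C (\<lambda>x. inverse (P x))" "continuous_on C (\<lambda>x. (f x / (P x)\<^sup>2) *\<^sub>R dP x)"
      using P_pos by (auto intro!: continuous_intros cP continuous_on_subset[OF f] simp: C_def less_imp_neq[symmetric])
    obtain B1 where B1: "0 \<le> B1" "\<And>x. x \<in> C \<Longrightarrow> \<bar>inverse (P x)\<bar> \<le> B1"
      by (rule bounded_image_compact_real[OF C c(1)], rule that)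
    obtain B2 where B2: "\<And>x. x \<in> C \<Longrightarrow> \<bar>norm ((f x / (P x)\<^sup>2) *\<^sub>R dP x)\<bar> \<le> B2"
      by (rule bounded_image_compact_real[OF C continuous_on_norm[OF c(2)]], rule that)
    have "set_integrable lborel C (\<lambda>x. (f x / (P x)\<^sup>2) *\<^sub>R dP x)"
      using C c(2) B2 emeasure_compact_finite[OF C]
      by (intro set_integrable_continuous_finite[of C _ _ B2]) (auto simp: borel_compact)
    then have 2: "set_integrable lborel (\<Omega> \<inter> K) (\<lambda>x. (f x / (P x)\<^sup>2) *\<^sub>R dP x)"
      by (rule set_integrable_subset) (use closure_subset in \<open>auto simp: C_def\<close>)
    have "set_integrable lborel (\<Omega> \<inter> K) g" using int by (rule set_integrable_subset) auto
    then have 1: "set_integrable lborel (\<Omega> \<inter> K) (\<lambda>x. inverse (P x) *\<^sub>R g x)"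
      by (rule set_integrable_bounded_mult[where B=B1])
         (use B1 closure_subset in \<open>auto simp: C_def set_borel_measurable_def\<close>)
    have "set_integrable lborel (\<Omega> \<inter> K) (\<lambda>x. inverse (P x) *\<^sub>R g x - (f x / (P x)\<^sup>2) *\<^sub>R dP x)"
      by (rule set_integral_diff(1)[OF 1 2])
    moreover have "(\<lambda>x. indicator (\<Omega> \<inter> K) x *\<^sub>R (inverse (P x) *\<^sub>R g x - (f x / (P x)\<^sup>2) *\<^sub>R dP x)) = (\<lambda>x. indicator \<Omega> x *\<^sub>R g' x)"
      by (auto simp: indicator_def g'_def fun_eq_iff)
    ultimately show ?thesis by (simp only: set_integrable_def)
  qed
  have f_sum: "f x = (\<Sum>z\<in>Z. \<psi> z x * f' x)" if "x \<in> closure \<Omega>" for x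
  proof (cases "x \<in> K")
    case True
    then have "P x \<noteq> 0" using that P_pos[of x] by (auto simp: C_def)
    then have "f x = P x * f' x" using True by (simp add: f'_def)
    then show ?thesis by (simp add: P_def sum_distrib_right)
  qed (use K(2) that in \<open>auto simp: f'_def\<close>)
  have g_sum: "g x = (\<Sum>z\<in>Z. \<psi> z x *\<^sub>R g' x + f' x *\<^sub>R d\<psi> z x)" if x: "x \<in> \<Omega>" for x
  proof -
    have "GDERIV (\<lambda>x. \<Sum>z\<in>Z. \<psi> z x * f' x) x :> (\<Sum>z\<in>Z. \<psi> z x *\<^sub>R g' x + f' x *\<^sub>R d\<psi> z x)"
      using GDERIV_mult[OF GDERIV_bump df'[OF x]] unfolding gderiv_def inner_sum_right \<psi>_def d\<psi>_def
      by (intro has_derivative_sum) auto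
    then have "GDERIV f x :> (\<Sum>z\<in>Z. \<psi> z x *\<^sub>R g' x + f' x *\<^sub>R d\<psi> z x)"
      by (rule GDERIV_cong_open[OF _ \<Omega>(1) x]) (rule f_sum[symmetric, OF subsetD[OF closure_subset]])
    then show ?thesis using der[OF x] GDERIV_unique by blast
  qed
  have loc: "set_integrable lborel \<Omega> (\<lambda>x. \<psi> z x *\<^sub>R g' x + f' x *\<^sub>R d\<psi> z x)"
    "(LINT x:\<Omega>|lborel. (\<psi> z x *\<^sub>R g' x + f' x *\<^sub>R d\<psi> z x) \<bullet> e) =
      (LINT x:frontier \<Omega>|M. \<psi> z x * f' x * (outward_normal \<Omega> x \<bullet> e))" if z: "z \<in> Z" for z
  proof -
    have "0 < r z \<and> (\<exists>b \<gamma> D s. local_graph_domain \<Omega> z (r z) b \<gamma> D s)" using r Z(1) z by blast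
    then obtain b \<gamma> D s where L: "local_graph_domain \<Omega> z (r z) b \<gamma> D s" and "0 < r z / 2" "r z / 2 < r z"
      by auto
    then show "set_integrable lborel \<Omega> (\<lambda>x. \<psi> z x *\<^sub>R g' x + f' x *\<^sub>R d\<psi> z x)"
      "(LINT x:\<Omega>|lborel. (\<psi> z x *\<^sub>R g' x + f' x *\<^sub>R d\<psi> z x) \<bullet> e) =
        (LINT x:frontier \<Omega>|M. \<psi> z x * f' x * (outward_normal \<Omega> x \<bullet> e))"
      unfolding \<psi>_def d\<psi>_def using divergence_bump[OF \<Omega> M cf' df' ig' e L] by blast+
  qed
  have "(LINT x:\<Omega>|lborel. g x \<bullet> e) = (LINT x:\<Omega>|lborel. (\<Sum>z\<in>Z. (\<psi> z x *\<^sub>R g' x + f' x *\<^sub>R d\<psi> z x) \<bullet> e))"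
    by (rule set_lebesgue_integral_cong) (auto simp: g_sum inner_sum_left)
  also have "\<dots> = (\<Sum>z\<in>Z. LINT x:\<Omega>|lborel. (\<psi> z x *\<^sub>R g' x + f' x *\<^sub>R d\<psi> z x) \<bullet> e)"
    using set_integrable_scaleR_inner[OF loc(1)]
    by (simp add: set_lebesgue_integral_def set_integrable_def sum_distrib_left Bochner_Integration.integral_sum)
  also have "\<dots> = (\<Sum>z\<in>Z. LINT x:frontier \<Omega>|M. \<psi> z x * f' x * (outward_normal \<Omega> x \<bullet> e))"
    by (intro sum.cong loc(2)) auto
  also have "\<dots> = (LINT x:frontier \<Omega>|M. (\<Sum>z\<in>Z. \<psi> z x * f' x * (outward_normal \<Omega> x \<bullet> e)))"
  proof -
    have "set_integrable M (frontier \<Omega>) (\<lambda>x. \<psi> z x * f' x * (outward_normal \<Omega> x \<bullet> e))" for z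
      unfolding \<psi>_def
      by (rule divergence_frontier_integrable[OF \<Omega> M])
         (intro continuous_intros continuous_bump continuous_on_subset[OF cf' fr])
    then show ?thesis
      by (simp add: set_lebesgue_integral_def set_integrable_def sum_distrib_left Bochner_Integration.integral_sum)
  qed
  also have "\<dots> = (LINT x:frontier \<Omega>|M. f x * (outward_normal \<Omega> x \<bullet> e))"
    by (rule set_lebesgue_integral_cong)
       (use f_sum fr sets_surface_measure[OF M] in \<open>auto simp: sum_distrib_right[symmetric]\<close>)
  finally show ?thesis .
qed

text \<open>The square root, continued to the left of (c/2)^2 by its tangent there, whose slope is
  1/c. It is C1 on the whole line, and this allows a sphere to be described near a point by a
  globally defined C1 graph.\<close>

definition sqrt_ext :: "real \<Rightarrow> real \<Rightarrow> real" where
  "sqrt_ext c y = (if (c / 2)\<^sup>2 \<le> y then sqrt y else c / 2 + (y - (c / 2)\<^sup>2) / c)"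

lemma DERIV_sqrt_ext:
  assumes "0 < c"
  shows "(sqrt_ext c has_real_derivative (if (c / 2)\<^sup>2 \<le> y then 1 / (2 * sqrt y) else 1 / c)) (at y)"
proof -
  have "((\<lambda>y. if y \<in> {(c / 2)\<^sup>2..} then sqrt y else c / 2 + (y - (c / 2)\<^sup>2) / c) has_vector_derivative
      (if y \<in> {(c / 2)\<^sup>2..} then 1 / (2 * sqrt y) else 1 / c)) (at y within UNIV)"
  proof (rule has_vector_derivative_If_within_closures[where T="{..(c / 2)\<^sup>2}"])
    show "UNIV = {(c / 2)\<^sup>2..} \<union> {..(c / 2)\<^sup>2}" by auto
    show "(sqrt has_vector_derivative 1 / (2 * sqrt y)) (at y within {(c / 2)\<^sup>2..} \<union> closure {(c / 2)\<^sup>2..} \<inter> closure {..(c / 2)\<^sup>2})"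
      if "y \<in> {(c / 2)\<^sup>2..} \<union> closure {(c / 2)\<^sup>2..} \<inter> closure {..(c / 2)\<^sup>2}"
    proof -
      have "0 < (c / 2)\<^sup>2" using assms by simp
      moreover have "(c / 2)\<^sup>2 \<le> y" using that by auto
      ultimately have "0 < y" by (rule less_le_trans)
      then have "(sqrt has_real_derivative 1 / (2 * sqrt y)) (at y)"
        using DERIV_real_sqrt[of y] by (simp add: inverse_eq_divide mult.commute)
      then show ?thesis
        using has_real_derivative_iff_has_vector_derivative has_vector_derivative_at_within by blast
    qed
    show "((\<lambda>y. c / 2 + (y - (c / 2)\<^sup>2) / c) has_vector_derivative 1 / c) (at y within {..(c / 2)\<^sup>2} \<union> closure {(c / 2)\<^sup>2..} \<inter> closure {..(c / 2)\<^sup>2})"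
      unfolding has_real_derivative_iff_has_vector_derivative[symmetric]
      using assms by (auto intro!: derivative_eq_intros)
    have sq: "sqrt ((c / 2)\<^sup>2) = c / 2" using assms by (simp only: real_sqrt_abs)
    assume "y \<in> closure {(c / 2)\<^sup>2..}" "y \<in> closure {..(c / 2)\<^sup>2}"
    then have y: "y = (c / 2)\<^sup>2" by simp
    show "sqrt y = c / 2 + (y - (c / 2)\<^sup>2) / c" "1 / (2 * sqrt y) = 1 / c"
      unfolding y sq by simp_all
  qed auto
  moreover have "sqrt_ext c = (\<lambda>y. if y \<in> {(c / 2)\<^sup>2..} then sqrt y else c / 2 + (y - (c / 2)\<^sup>2) / c)"
    by (auto simp: sqrt_ext_def)
  ultimately show ?thesis
    unfolding has_real_derivative_iff_has_vector_derivative by (simp only: atLeast_iff)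
qed

lemma continuous_sqrt_ext_deriv:
  assumes "0 < c"
  shows "continuous_on UNIV (\<lambda>y. if (c / 2)\<^sup>2 \<le> y then 1 / (2 * sqrt y) else 1 / c)"
proof -
  have pos: "0 < y" if "(c / 2)\<^sup>2 \<le> y" for y
    by (rule less_le_trans[OF _ that]) (use assms in simp)
  have sq: "sqrt ((c / 2)\<^sup>2) = c / 2" using assms by (simp only: real_sqrt_abs)
  have "continuous_on ({(c / 2)\<^sup>2..} \<union> {..(c / 2)\<^sup>2}) (\<lambda>y. if (c / 2)\<^sup>2 \<le> y then 1 / (2 * sqrt y) else 1 / c)"
  proof (rule continuous_on_If)
    show "continuous_on {(c / 2)\<^sup>2..} (\<lambda>y. 1 / (2 * sqrt y))"
      using pos by (force intro!: continuous_intros)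
    fix y assume "y \<in> {..(c / 2)\<^sup>2}" "(c / 2)\<^sup>2 \<le> y"
    then have "y = (c / 2)\<^sup>2" by simp
    then show "1 / (2 * sqrt y) = 1 / c" using sq by simp
  qed auto
  moreover have "{(c / 2)\<^sup>2..} \<union> {..(c / 2)\<^sup>2} = UNIV" by auto
  ultimately show ?thesis by simp
qed

text \<open>In a coordinate direction b with z \<bullet> b nonzero, the sphere near z is the graph
  of s times the square root of \<open>q\<close>, where \<open>q\<close> is \<epsilon>^2 minus the
  squared norm of the part orthogonal to b. At z this root equals c = |z \<bullet> b|.
  \<open>sqrt_ext\<close> leaves it unchanged where q \<ge> (c/2)^2 and makes it C1
  everywhere.\<close>

lemma exterior_ball_local_graph:
  fixes z :: "'a::euclidean_space"
  assumes "0 < \<epsilon>" "norm z = \<epsilon>"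
  shows "\<exists>r b \<gamma> D s. local_graph_domain (- cball 0 \<epsilon>) z r b \<gamma> D s"
proof -
  have "z \<noteq> 0" using assms by auto
  then obtain b where b: "b \<in> Basis" "z \<bullet> b \<noteq> 0" using euclidean_all_zero_iff[of z] by blast
  define s where "s = sgn (z \<bullet> b)"
  define c where "c = \<bar>z \<bullet> b\<bar>"
  have c: "0 < c" and s: "s \<in> {-1, 1}" and sz: "s * (z \<bullet> b) = c"
    using b(2) by (auto simp: c_def s_def sgn_if)
  have bb: "b \<bullet> b = 1" using b(1) by simp
  define q where "q x = \<epsilon>\<^sup>2 - (x \<bullet> x - (x \<bullet> b)\<^sup>2)" for x
  define h' where "h' y = (if (c / 2)\<^sup>2 \<le> y then 1 / (2 * sqrt y) else 1 / c)" for y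
  define \<gamma> where "\<gamma> x = s * sqrt_ext c (q x)" for x
  define D where "D x = (s * h' (q x)) *\<^sub>R (- 2) *\<^sub>R (x - (x \<bullet> b) *\<^sub>R b)" for x
  have cq: "continuous_on UNIV q" unfolding q_def by (intro continuous_intros)
  have q_line: "q (x + t *\<^sub>R b) = q x" for x t
    using bb by (simp add: q_def inner_add_left inner_add_right power2_eq_square inner_commute algebra_simps)
  have "GDERIV q x :> (- 2) *\<^sub>R (x - (x \<bullet> b) *\<^sub>R b)" for x
    unfolding gderiv_def q_def
    by (auto intro!: derivative_eq_intros simp: inner_diff_right inner_commute algebra_simps)
  from GDERIV_DERIV_compose[OF this DERIV_sqrt_ext[OF c]]
  have "GDERIV (\<lambda>x. sqrt_ext c (q x)) x :> h' (q x) *\<^sub>R (- 2) *\<^sub>R (x - (x \<bullet> b) *\<^sub>R b)" for x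
    by (simp add: h'_def)
  from GDERIV_mult[OF GDERIV_const[of s] this]
  have d\<gamma>: "GDERIV \<gamma> x :> D x" for x by (simp add: \<gamma>_def[abs_def] D_def mult.assoc)
  have G: "C1_graph b \<gamma> D"
    unfolding C1_graph_def
  proof (intro conjI allI b(1) d\<gamma>)
    show "\<gamma> (x + t *\<^sub>R b) = \<gamma> x" for x t by (simp add: \<gamma>_def q_line)
    have "continuous_on UNIV h'" using continuous_sqrt_ext_deriv[OF c] by (simp add: h'_def[abs_def])
    then show "continuous_on UNIV D" unfolding D_def
      by (intro continuous_intros continuous_on_compose2[of UNIV h' _ q] cq) auto
  qed
  have "q z = c\<^sup>2" using assms(2) by (simp add: q_def c_def power2_norm_eq_inner[symmetric])
  moreover have "(c / 2)\<^sup>2 < c\<^sup>2" using c by (intro power_strict_mono) auto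
  moreover have "open {x. (c / 2)\<^sup>2 < q x}" by (intro open_Collect_less continuous_intros cq)
  moreover from calculation have "z \<in> {x. (c / 2)\<^sup>2 < q x}" by simp
  ultimately obtain r1 where r1: "0 < r1" "ball z r1 \<subseteq> {x. (c / 2)\<^sup>2 < q x}"
    using openE[of "{x. (c / 2)\<^sup>2 < q x}" z] by metis
  \<comment> \<open>The radius \<open>r1\<close> keeps \<open>q\<close> above (c/2)^2, where
    \<open>sqrt_ext\<close> is the true root; the bound c/2 keeps s (x \<bullet> b) positive, so
    that comparing squares is legitimate.\<close>
  define r where "r = min r1 (c / 2)"
  have "x \<in> - cball 0 \<epsilon> \<longleftrightarrow> 0 < s * (x \<bullet> b - \<gamma> x)" if x: "x \<in> ball z r" for x
  proof -
    have q: "(c / 2)\<^sup>2 < q x" using x r1 by (auto simp: r_def)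
    have "\<bar>s * (z \<bullet> b - x \<bullet> b)\<bar> < c / 2"
      using Basis_le_norm[OF b(1), of "z - x"] x s by (auto simp: r_def dist_norm inner_diff_left abs_minus_commute)
    then have pos: "0 < s * (x \<bullet> b)" using sz c by (simp only: right_diff_distrib abs_less_iff) linarith
    have ss: "s * s = 1" using s by auto
    have sq: "(s * (x \<bullet> b))\<^sup>2 = (x \<bullet> b)\<^sup>2" using ss by (simp add: power_mult_distrib power2_eq_square)
    have "x \<in> - cball 0 \<epsilon> \<longleftrightarrow> \<epsilon>\<^sup>2 < (norm x)\<^sup>2"
      using assms(1) power2_less_imp_less[of \<epsilon> "norm x"] power_strict_mono[of \<epsilon> "norm x" 2] by auto
    also have "\<dots> \<longleftrightarrow> q x < (s * (x \<bullet> b))\<^sup>2" unfolding sq by (auto simp: q_def power2_norm_eq_inner)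
    also have "\<dots> \<longleftrightarrow> sqrt (q x) < s * (x \<bullet> b)"
      using pos real_sqrt_less_iff[of "q x" "(s * (x \<bullet> b))\<^sup>2"] by (simp add: real_sqrt_abs)
    also have "\<dots> \<longleftrightarrow> 0 < s * (x \<bullet> b - \<gamma> x)"
    proof -
      have "s * (x \<bullet> b - \<gamma> x) = s * (x \<bullet> b) - (s * s) * sqrt_ext c (q x)" by (simp add: \<gamma>_def algebra_simps)
      then show ?thesis using q ss by (simp add: sqrt_ext_def)
    qed
    finally show ?thesis .
  qed
  then have "(- cball 0 \<epsilon>) \<inter> ball z r = {x \<in> ball z r. 0 < s * (x \<bullet> b - \<gamma> x)}"
    by (intro set_eqI) (simp only: Int_iff mem_Collect_eq, blast)
  moreover have "0 < r" using r1 c by (simp add: r_def)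
  ultimately have "local_graph_domain (- cball 0 \<epsilon>) z r b \<gamma> D s"
    using G s unfolding local_graph_domain_def by blast
  then show ?thesis by blast
qed

lemma frontier_exterior_ball: "0 < \<epsilon> \<Longrightarrow> frontier (- cball (0::'a::euclidean_space) \<epsilon>) = sphere 0 \<epsilon>"
  by (simp add: frontier_complement)

lemma exterior_ball_C1_boundary: "0 < \<epsilon> \<Longrightarrow> C1_boundary (- cball (0::'a::euclidean_space) \<epsilon>)"
  unfolding C1_boundary_def by (auto simp: frontier_exterior_ball intro: exterior_ball_local_graph)

text \<open>Outward from the exterior means towards the origin. The difference of the squared norm
  of x + t v and \<epsilon>^2 is t (2 (v \<bullet> x) + t (v \<bullet> v)), which for small t > 0
  has the sign of v \<bullet> x.\<close>

lemma outward_normal_exterior_ball: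
  fixes x :: "'a::euclidean_space"
  assumes "0 < \<epsilon>" "norm x = \<epsilon>"
  shows "outward_normal (- cball 0 \<epsilon>) x = - (1 / \<epsilon>) *\<^sub>R x"
proof (rule outward_normal_eqI)
  show "open (- cball (0::'a) \<epsilon>)" by (simp add: open_Compl)
  show "C1_boundary (- cball (0::'a) \<epsilon>)" using assms by (simp add: exterior_ball_C1_boundary)
  show "x \<in> frontier (- cball (0::'a) \<epsilon>)" using assms by (simp add: frontier_exterior_ball)
  have n: "(norm (x + t *\<^sub>R v))\<^sup>2 = \<epsilon>\<^sup>2 + t * (2 * (v \<bullet> x) + t * (v \<bullet> v))" for t v
  proof -
    have "x \<bullet> x = \<epsilon>\<^sup>2" using assms by (simp flip: power2_norm_eq_inner)
    then show ?thesis unfolding power2_norm_eq_inner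
      by (simp add: inner_add_left inner_add_right inner_commute algebra_simps)
  qed
  have out: "x + t *\<^sub>R v \<in> - cball 0 \<epsilon> \<longleftrightarrow> 0 < t * (2 * (v \<bullet> x) + t * (v \<bullet> v))" for t v
  proof -
    have "x + t *\<^sub>R v \<in> - cball 0 \<epsilon> \<longleftrightarrow> \<epsilon>\<^sup>2 < (norm (x + t *\<^sub>R v))\<^sup>2"
      using assms(1) power2_less_imp_less[of \<epsilon> "norm (x + t *\<^sub>R v)"] power_strict_mono[of \<epsilon> "norm (x + t *\<^sub>R v)" 2] by auto
    then show ?thesis unfolding n by simp
  qed
  have ev: "\<forall>\<^sub>F t in at_right 0. 0 < t * (\<sigma> * (2 * (v \<bullet> x) + t * (v \<bullet> v)))" if "0 < \<sigma> * (v \<bullet> x)" for \<sigma> :: real and v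
  proof -
    have "((\<lambda>t. \<sigma> * (2 * (v \<bullet> x) + t * (v \<bullet> v))) \<longlongrightarrow> \<sigma> * (2 * (v \<bullet> x) + 0 * (v \<bullet> v))) (at_right 0)"
      by (intro tendsto_intros)
    then have "\<forall>\<^sub>F t in at_right 0. 0 < \<sigma> * (2 * (v \<bullet> x) + t * (v \<bullet> v))"
      by (rule order_tendstoD) (use that in \<open>simp add: mult.left_commute\<close>)
    moreover have "\<forall>\<^sub>F t::real in at_right 0. 0 < t" by (rule eventually_at_right_less)
    ultimately show ?thesis by eventually_elim simp
  qed
  show "is_outer_normal (- cball 0 \<epsilon>) x (- (1 / \<epsilon>) *\<^sub>R x)"
    unfolding is_outer_normal_def
  proof (intro conjI allI impI)
    show "norm (- (1 / \<epsilon>) *\<^sub>R x) = 1" using assms by simp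
    fix v
    {
      assume "v \<bullet> (- (1 / \<epsilon>) *\<^sub>R x) < 0"
      then have "0 < 1 * (v \<bullet> x)" using assms by (simp add: zero_less_divide_iff zero_less_mult_iff)
      from ev[OF this] show "\<forall>\<^sub>F t in at_right 0. x + t *\<^sub>R v \<in> - cball 0 \<epsilon>"
        by eventually_elim (use out in auto)
    next
      assume "0 < v \<bullet> (- (1 / \<epsilon>) *\<^sub>R x)"
      then have "0 < (- 1) * (v \<bullet> x)" using assms by (simp add: divide_less_0_iff mult_less_0_iff)
      from ev[OF this] show "\<forall>\<^sub>F t in at_right 0. x + t *\<^sub>R v \<notin> - cball 0 \<epsilon>"
      proof eventually_elim
        case (elim t)
        then have "t * (2 * (v \<bullet> x) + t * (v \<bullet> v)) < 0"
          by (simp only: mult_minus1 mult_minus_right neg_0_less_iff_less)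
        then show ?case unfolding out by linarith
      qed
    }
  qed
qed

lemma surface_measure_sphere:
  "0 < \<epsilon> \<Longrightarrow> is_surface_measure (sphere (0::'a::euclidean_space) \<epsilon>) (surface_measure (sphere 0 \<epsilon>))"
  using C1_boundary_hypersurface[OF _ exterior_ball_C1_boundary, of \<epsilon>]
  by (intro is_surface_measure_surface_measure) (auto simp: frontier_exterior_ball open_Compl)

section \<open>Weak gradients\<close>

lemma set_integrable_lebesgue_lborel:
  fixes f :: "'a::euclidean_space \<Rightarrow> 'b::euclidean_space"
  assumes "(\<lambda>x. indicator A x *\<^sub>R f x) \<in> borel_measurable borel"
  shows "set_integrable lebesgue A f \<longleftrightarrow> set_integrable lborel A f"
    and "(LINT x:A|lebesgue. f x) = (LINT x:A|lborel. f x)"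
  using assms by (auto simp: set_integrable_def set_lebesgue_integral_def integrable_completion integral_completion)

lemma test_functionD:
  fixes \<psi> :: "'a::euclidean_space \<Rightarrow> real"
  assumes "test_function U \<psi>"
  obtains K where "compact K" "K \<subseteq> U" "\<And>x. x \<notin> K \<Longrightarrow> \<psi> x = 0" "\<And>x. x \<notin> K \<Longrightarrow> gradient \<psi> x = 0"
    "\<And>x. GDERIV \<psi> x :> gradient \<psi> x" "continuous_on UNIV (gradient \<psi>)" "continuous_on UNIV \<psi>"
proof -
  have sm: "smooth_on UNIV \<psi>" using assms by (simp add: test_function_def)
  obtain K where K: "compact K" "K \<subseteq> U" "\<And>x. x \<notin> K \<Longrightarrow> \<psi> x = 0" using assms by (auto simp: test_function_def)
  have "gradient \<psi> x = 0" if "x \<notin> K" for x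
  proof (rule gradient_eq, rule GDERIV_cong_open[OF GDERIV_const[of 0]])
    show "open (- K)" using K(1) by (simp add: compact_imp_closed open_Compl)
  qed (use that K(3) in auto)
  then show thesis using that[OF K] smooth_on_GDERIV[OF sm] by auto
qed

text \<open>Smooth approximations of the indicator of an open box: inside, each factor is exp(-1/(k
  t)) with t > 0 and tends to 1 as k grows; outside, some factor vanishes for every k.\<close>

definition box_bump :: "'a::euclidean_space \<Rightarrow> 'a \<Rightarrow> real \<Rightarrow> 'a \<Rightarrow> real" where
  "box_bump a c k x = (\<Prod>b\<in>Basis. exp_recip 0 (k * (x \<bullet> b - a \<bullet> b)) * exp_recip 0 (k * (c \<bullet> b - x \<bullet> b)))"

lemma smooth_box_bump: "smooth_on UNIV (box_bump a c k)"
proof -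
  have "Ck_on j UNIV (\<lambda>x. x \<bullet> (k *\<^sub>R b) - k * (a \<bullet> b))" "Ck_on j UNIV (\<lambda>x. k * (c \<bullet> b) - x \<bullet> (k *\<^sub>R b))" for j b
    by (intro Ck_on_diff Ck_on_inner Ck_on_const open_UNIV)+
  then have q: "Ck_on j UNIV (\<lambda>x. k * (x \<bullet> b - a \<bullet> b))" "Ck_on j UNIV (\<lambda>x. k * (c \<bullet> b - x \<bullet> b))" for j b
    by (simp_all add: right_diff_distrib)
  show ?thesis unfolding smooth_on_def box_bump_def
    by (intro allI Ck_on_prod Ck_on_mult Ck_on_exp_recip q open_UNIV)
qed

lemma box_bump_eq_0:
  assumes "0 \<le> k" "x \<notin> box a c" shows "box_bump a c k x = 0"
proof -
  from assms(2) obtain b where b: "b \<in> Basis" "x \<bullet> b \<le> a \<bullet> b \<or> c \<bullet> b \<le> x \<bullet> b" by (auto simp: mem_box not_less)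
  then have "k * (x \<bullet> b - a \<bullet> b) \<le> 0 \<or> k * (c \<bullet> b - x \<bullet> b) \<le> 0"
    using assms(1) by (auto simp: mult_le_0_iff)
  then show ?thesis unfolding box_bump_def using b(1)
    by (intro prod_zero) (auto intro!: bexI[of _ b] simp: exp_recip_eq_0)
qed

lemma box_bump_bounds: "0 \<le> box_bump a c k x" "box_bump a c k x \<le> 1"
  unfolding box_bump_def
  by (auto intro!: prod_nonneg prod_le_1 mult_le_one simp: exp_recip_nonneg exp_recip_0_le_1)

lemma box_bump_tendsto: "(\<lambda>k. box_bump a c (real (Suc k)) x) \<longlonglongrightarrow> indicator (box a c) x"
proof (cases "x \<in> box a c")
  case False
  then show ?thesis by (simp add: box_bump_eq_0)
next
  case True
  have "(\<lambda>k. exp_recip 0 (real (Suc k) * t)) \<longlonglongrightarrow> 1" if "0 < t" for t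
  proof -
    have "(\<lambda>k. 1 / real (Suc k)) \<longlonglongrightarrow> 0" by (rule LIMSEQ_Suc[OF lim_1_over_n])
    then have "(\<lambda>k. exp (- (1 / t) * (1 / real (Suc k)))) \<longlonglongrightarrow> exp (- (1 / t) * 0)"
      by (intro tendsto_intros)
    then show ?thesis using that by (simp add: exp_recip_def mult.commute)
  qed
  then have "(\<lambda>k. box_bump a c (real (Suc k)) x) \<longlonglongrightarrow> (\<Prod>b\<in>(Basis::'a set). 1 * 1)"
    unfolding box_bump_def using True
    by (intro tendsto_prod tendsto_mult) (auto simp: mem_box)
  then show ?thesis using True by simp
qed

lemma test_function_box_bump:
  assumes "cbox a c \<subseteq> U" "0 \<le> k" shows "test_function U (box_bump a c k)"
  unfolding test_function_def
  using smooth_box_bump box_bump_eq_0[OF assms(2) contra_subsetD[OF box_subset_cbox]] assms(1)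
  by (intro conjI exI[of _ "cbox a c"]) (auto simp: compact_cbox)

text \<open>Boxes are closed under intersection and generate the Borel sets, so it suffices that the
  sets with zero integral are closed under complements and disjoint unions. For complements the
  total integral must be zero, which is what the support condition gives.\<close>

lemma AE_0_if_box_integrals_0:
  fixes h :: "'a::euclidean_space \<Rightarrow> real"
  assumes h: "integrable lborel h" and supp: "\<And>x. x \<notin> box A C \<Longrightarrow> h x = 0"
    and box: "\<And>a c. (LINT x:box a c|lborel. h x) = 0"
  shows "AE x in lborel. h x = 0"
proof (rule sigma_finite_measure.density_zero[OF lborel.sigma_finite_measure_axioms h])
  fix B :: "'a set" assume "B \<in> sets lborel"
  then have Bs: "B \<in> sigma_sets UNIV (range (\<lambda>(a, b). box a b :: 'a set))"
    by (simp add: borel_eq_box)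
  have stable: "Int_stable (range (\<lambda>(a, b). box a b :: 'a set))"
    by (auto simp: Int_stable_def box_Int_box)
  have si: "set_integrable lborel D h" if "D \<in> sets borel" for D
    using h that unfolding set_integrable_def by (intro integrable_mult_indicator) auto
  have B: "D \<in> sets borel" if "D \<in> sigma_sets UNIV (range (\<lambda>(a, b). box a b :: 'a set))" for D
    using that by (simp add: borel_eq_box)
  have all: "(LINT x|lborel. h x) = 0"
  proof -
    have "(LINT x|lborel. h x) = (LINT x:box A C|lborel. h x)"
      unfolding set_lebesgue_integral_def
      by (rule Bochner_Integration.integral_cong) (use supp in \<open>auto simp: indicator_def\<close>)
    then show ?thesis using box by simp
  qed
  have "range (\<lambda>(a, b). box a b :: 'a set) \<subseteq> Pow UNIV" by auto
  with stable show "(LINT x:B|lborel. h x) = 0" using Bs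
  proof (induction rule: sigma_sets_induct_disjoint)
    case (basic D)
    then show ?case using box by auto
  next
    case empty
    show ?case by (simp add: set_lebesgue_integral_def)
  next
    case (compl D)
    have "(LINT x:UNIV - D|lborel. h x) = (LINT x|lborel. h x) - (LINT x:D|lborel. h x)"
    proof -
      have "(LINT x:UNIV - D|lborel. h x) = (LINT x|lborel. h x - indicator D x *\<^sub>R h x)"
        unfolding set_lebesgue_integral_def by (rule Bochner_Integration.integral_cong) (auto simp: indicator_def)
      also have "\<dots> = (LINT x|lborel. h x) - (LINT x:D|lborel. h x)"
        unfolding set_lebesgue_integral_def
        by (rule Bochner_Integration.integral_diff[OF h]) (use si[OF B[OF compl(1)]] in \<open>simp add: set_integrable_def\<close>)
      finally show ?thesis .
    qed
    then show ?case using compl all by simp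
  next
    case (union D)
    have [measurable]: "D i \<in> sets borel" for i using union(2) B by blast
    have "(LINT x:(\<Union>i. D i)|lborel. h x) = (\<Sum>i. (LINT x:(D i)|lborel. h x))"
      using union(1) by (intro lebesgue_integral_countable_add si) (auto simp: disjoint_family_on_def)
    then show ?case using union by simp
  qed
qed

text \<open>The fundamental lemma of the calculus of variations. Box bumps are admissible test
  functions, and dominated convergence turns the hypothesis into vanishing integrals over all boxes
  whose closure lies in \<open>U\<close>. The result on closed cells extends to \<open>U\<close> by
  a countable cover.\<close>

lemma weak_derivative_0:
  fixes h :: "'a::euclidean_space \<Rightarrow> real"
  assumes U: "open U"
    and h: "\<And>K. compact K \<Longrightarrow> K \<subseteq> U \<Longrightarrow> set_integrable lebesgue K h"
    and 0: "\<And>\<psi>. test_function U \<psi> \<Longrightarrow> (LINT x:U|lebesgue. \<psi> x * h x) = 0"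
  shows "AE x in lebesgue. x \<in> U \<longrightarrow> h x = 0"
proof -
  have cell: "AE x in lebesgue. x \<in> cbox A C \<longrightarrow> h x = 0" if AC: "cbox A C \<subseteq> U" for A C
  proof -
    have i: "integrable lebesgue (\<lambda>x. indicator (box A C) x *\<^sub>R h x)"
      using set_integrable_subset[OF h[OF compact_cbox AC], of "box A C"] box_subset_cbox
      by (auto simp: set_integrable_def)
    \<comment> \<open>\<open>h\<close> is only Lebesgue measurable; the argument on boxes is run for
      a Borel function that agrees with it almost everywhere on the box.\<close>
    then obtain g where g: "g \<in> borel_measurable lborel" "AE x in lborel. indicator (box A C) x *\<^sub>R h x = g x"
      using completion_ex_borel_measurable_real[of "\<lambda>x. indicator (box A C) x *\<^sub>R h x" lborel] by auto
    define g' where "g' x = indicator (box A C) x * g x" for x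
    have g'm: "g' \<in> borel_measurable lborel" unfolding g'_def using g(1) by measurable
    have g'h: "AE x in lebesgue. g' x = indicator (box A C) x *\<^sub>R h x"
      using AE_completion[OF g(2)] by eventually_elim (auto simp: g'_def indicator_def)
    have "integrable lebesgue g'"
      using i g'h g'm by (subst integrable_cong_AE[OF _ _ g'h]) (auto intro: measurable_completion)
    then have ig': "integrable lborel g'" using g'm by (simp add: integrable_completion)
    have "AE x in lborel. g' x = 0"
    proof (rule AE_0_if_box_integrals_0[OF ig', of A C])
      show "g' x = 0" if "x \<notin> box A C" for x using that by (simp add: g'_def)
      fix a c :: 'a
      obtain a' c' where ac: "box a c \<inter> box A C = box a' c'" by (rule that[OF box_Int_box])
      have "(LINT x:box a c|lebesgue. g' x) = (LINT x:box a c|lborel. g' x)"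
        unfolding set_lebesgue_integral_def
      proof (rule integral_completion)
        show "(\<lambda>x. indicator (box a c) x *\<^sub>R g' x) \<in> borel_measurable lborel"
          by (rule borel_measurable_scaleR[OF _ g'm]) simp
      qed
      then have "(LINT x:box a c|lborel. g' x) = (LINT x:box a c|lebesgue. g' x)" ..
      also have "\<dots> = (LINT x:box a' c'|lebesgue. h x)"
        unfolding set_lebesgue_integral_def
      proof (rule integral_cong_AE)
        show "(\<lambda>x. indicator (box a c) x *\<^sub>R g' x) \<in> borel_measurable lebesgue"
          by (intro measurable_completion borel_measurable_scaleR[OF _ g'm]) simp
        have "(\<lambda>x. indicator (box a c) x *\<^sub>R (indicator (box A C) x *\<^sub>R h x)) \<in> borel_measurable lebesgue"
          by (rule borel_measurable_scaleR[OF borel_measurable_indicator borel_measurable_integrable[OF i]]) simp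
        also have "(\<lambda>x. indicator (box a c) x *\<^sub>R (indicator (box A C) x *\<^sub>R h x)) = (\<lambda>x. indicator (box a' c') x *\<^sub>R h x)"
          by (auto simp: indicator_def simp flip: ac)
        finally show "(\<lambda>x. indicator (box a' c') x *\<^sub>R h x) \<in> borel_measurable lebesgue" .
        show "AE x in lebesgue. indicator (box a c) x *\<^sub>R g' x = indicator (box a' c') x *\<^sub>R h x"
          using g'h by eventually_elim (auto simp: indicator_def simp flip: ac)
      qed
      also have "\<dots> = 0"
      proof (cases "box a' c' = {}")
        case True
        then show ?thesis by (simp add: set_lebesgue_integral_def)
      next
        case False
        \<comment> \<open>The closure of a nonempty open box is the closed box, so the inclusion
          passes to closed boxes. Hence the support of the test functions stays in
          \<open>U\<close>.\<close>
        have "box a' c' \<subseteq> box A C" using ac by blast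
        moreover from this have ne: "box A C \<noteq> {}" using False by blast
        ultimately have "cbox a' c' \<subseteq> cbox A C"
          using closure_mono[of "box a' c'" "box A C"] by (simp only: closure_box[OF False] closure_box[OF ne])
        then have sub: "cbox a' c' \<subseteq> U" using AC by blast
        have ik: "integrable lebesgue (\<lambda>x. indicator (cbox a' c') x *\<^sub>R h x)"
          using h[OF compact_cbox sub] by (simp add: set_integrable_def)
        have "(\<lambda>k. LINT x|lebesgue. box_bump a' c' (real (Suc k)) x * (indicator (cbox a' c') x *\<^sub>R h x))
           \<longlonglongrightarrow> (LINT x|lebesgue. indicator (box a' c') x * (indicator (cbox a' c') x *\<^sub>R h x))"
        proof (rule integral_dominated_convergence[where w="\<lambda>x. \<bar>indicator (cbox a' c') x *\<^sub>R h x\<bar>"])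
          have "box_bump a' c' k \<in> borel_measurable lebesgue" for k
            using smooth_on_GDERIV(3)[OF smooth_box_bump[of a' c' k]]
            by (intro measurable_completion) (simp add: borel_measurable_continuous_onI)
          then show "(\<lambda>x. box_bump a' c' (real (Suc k)) x * (indicator (cbox a' c') x *\<^sub>R h x)) \<in> borel_measurable lebesgue" for k
            using borel_measurable_integrable[OF ik] by (intro borel_measurable_times)
          show "(\<lambda>x. indicator (box a' c') x * (indicator (cbox a' c') x *\<^sub>R h x)) \<in> borel_measurable lebesgue"
            by (rule borel_measurable_times[OF borel_measurable_indicator borel_measurable_integrable[OF ik]]) simp
          show "integrable lebesgue (\<lambda>x. \<bar>indicator (cbox a' c') x *\<^sub>R h x\<bar>)" using ik by (rule integrable_abs)
          show "AE x in lebesgue. (\<lambda>k. box_bump a' c' (real (Suc k)) x * (indicator (cbox a' c') x *\<^sub>R h x))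
             \<longlonglongrightarrow> indicator (box a' c') x * (indicator (cbox a' c') x *\<^sub>R h x)"
            by (intro AE_I2 tendsto_mult box_bump_tendsto tendsto_const)
          show "AE x in lebesgue. norm (box_bump a' c' (real (Suc k)) x * (indicator (cbox a' c') x *\<^sub>R h x)) \<le> \<bar>indicator (cbox a' c') x *\<^sub>R h x\<bar>" for k
            by (auto simp: abs_mult abs_of_nonneg[OF box_bump_bounds(1)] box_bump_bounds(2) intro!: AE_I2 mult_left_le_one_le box_bump_bounds)
        qed
        moreover have "(LINT x|lebesgue. box_bump a' c' (real (Suc k)) x * (indicator (cbox a' c') x *\<^sub>R h x)) = 0" for k
        proof -
          have "(\<lambda>x. box_bump a' c' (real (Suc k)) x * (indicator (cbox a' c') x *\<^sub>R h x)) =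
              (\<lambda>x. indicator U x *\<^sub>R (box_bump a' c' (real (Suc k)) x * h x))"
            using box_bump_eq_0[of "real (Suc k)" _ a' c'] sub box_subset_cbox[of a' c']
            by (auto simp: indicator_def fun_eq_iff)
          then show ?thesis
            using 0[OF test_function_box_bump[OF sub, of "real (Suc k)"]] by (simp add: set_lebesgue_integral_def)
        qed
        ultimately have "(LINT x|lebesgue. indicator (box a' c') x * (indicator (cbox a' c') x *\<^sub>R h x)) = 0"
          by (simp add: LIMSEQ_const_iff)
        also have "(\<lambda>x. indicator (box a' c') x * (indicator (cbox a' c') x *\<^sub>R h x)) = (\<lambda>x. indicator (box a' c') x *\<^sub>R h x)"
          using box_subset_cbox[of a' c'] by (auto simp: indicator_def fun_eq_iff)
        finally show ?thesis by (simp add: set_lebesgue_integral_def)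
      qed
      finally show "(LINT x:box a c|lborel. g' x) = 0" .
    qed
    then have "AE x in lebesgue. g' x = 0" by (rule AE_completion)
    then have 1: "AE x in lebesgue. x \<in> box A C \<longrightarrow> h x = 0"
      using g'h by eventually_elim (auto simp: indicator_def)
    have "negligible (cbox A C - box A C)"
      using negligible_frontier_interval[of A C] by (simp add: frontier_cbox)
    then have "cbox A C - box A C \<in> null_sets lebesgue" by (simp add: negligible_iff_null_sets)
    from AE_not_in[OF this] 1 show ?thesis by eventually_elim auto
  qed
  \<comment> \<open>Countability of the cells keeps the union of the exceptional null sets
    null.\<close>
  obtain \<D> where D: "countable \<D>" "\<And>X. X \<in> \<D> \<Longrightarrow> \<exists>a b. X = cbox a b" "\<And>X. X \<in> \<D> \<Longrightarrow> X \<subseteq> U" "\<Union>\<D> = U"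
    using open_countable_Union_open_cbox[OF U] by (metis PowD subset_iff)
  have "AE x in lebesgue. \<forall>X\<in>\<D>. x \<in> X \<longrightarrow> h x = 0"
    unfolding AE_ball_countable[OF D(1)]
  proof
    fix X assume X: "X \<in> \<D>"
    then obtain a b where "X = cbox a b" using D(2) by blast
    then show "AE x in lebesgue. x \<in> X \<longrightarrow> h x = 0" using cell D(3)[OF X] by simp
  qed
  then show ?thesis by eventually_elim (use D(4) in blast)
qed

lemma test_function_mult_integrable:
  fixes G :: "'a::euclidean_space \<Rightarrow> 'b::euclidean_space"
  assumes G: "\<And>K. compact K \<Longrightarrow> K \<subseteq> U \<Longrightarrow> set_integrable lebesgue K G"
    and "test_function U \<psi>"
  shows "set_integrable lebesgue U (\<lambda>x. \<psi> x *\<^sub>R G x)"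
proof -
  obtain K where K: "compact K" "K \<subseteq> U" "\<And>x. x \<notin> K \<Longrightarrow> \<psi> x = 0" "continuous_on UNIV \<psi>"
    using test_functionD[OF assms(2)] by metis
  obtain B where B: "\<And>x. x \<in> K \<Longrightarrow> \<bar>\<psi> x\<bar> \<le> B"
    by (rule bounded_image_compact_real[OF K(1) continuous_on_subset[OF K(4) subset_UNIV]], rule that)
  have "set_borel_measurable lebesgue K \<psi>"
    unfolding set_borel_measurable_def
    by (intro measurable_completion)
       (use borel_measurable_continuous_on_indicator[OF borel_compact[OF K(1)] continuous_on_subset[OF K(4) subset_UNIV]] in simp)
  then have "set_integrable lebesgue K (\<lambda>x. \<psi> x *\<^sub>R G x)"
    using B by (intro set_integrable_bounded_mult G K) auto
  moreover have "(\<lambda>x. indicator K x *\<^sub>R \<psi> x *\<^sub>R G x) = (\<lambda>x. indicator U x *\<^sub>R \<psi> x *\<^sub>R G x)"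
    using K(2,3) by (auto simp: indicator_def fun_eq_iff)
  ultimately show ?thesis by (simp only: set_integrable_def)
qed

lemma weak_gradient_unique:
  fixes G G' :: "'a::euclidean_space \<Rightarrow> 'a"
  assumes U: "open U" and G: "has_weak_gradient U u G" and G': "has_weak_gradient U u G'"
  shows "AE x in lebesgue. x \<in> U \<longrightarrow> G x = G' x"
proof -
  have loc: "set_integrable lebesgue K G" "set_integrable lebesgue K G'" if "compact K" "K \<subseteq> U" for K
    using that G G' by (auto simp: has_weak_gradient_def)
  have "AE x in lebesgue. x \<in> U \<longrightarrow> (G x - G' x) \<bullet> e = 0" for e
  proof (rule weak_derivative_0[OF U])
    show "set_integrable lebesgue K (\<lambda>x. (G x - G' x) \<bullet> e)" if "compact K" "K \<subseteq> U" for K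
      by (intro set_integrable_scaleR_inner set_integral_diff loc that)
    fix \<psi> :: "'a \<Rightarrow> real" assume \<psi>: "test_function U \<psi>"
    note i = test_function_mult_integrable[OF loc(1) \<psi>] test_function_mult_integrable[OF loc(2) \<psi>]
    have "(LINT x:U|lebesgue. \<psi> x *\<^sub>R G x) = (LINT x:U|lebesgue. \<psi> x *\<^sub>R G' x)"
      using G G' \<psi> unfolding has_weak_gradient_def by (metis neg_equal_iff_equal)
    then have "0 = (LINT x:U|lebesgue. \<psi> x *\<^sub>R G x - \<psi> x *\<^sub>R G' x)"
      using set_integral_diff(2)[OF i] by simp
    then have "0 = (LINT x:U|lebesgue. \<psi> x *\<^sub>R G x - \<psi> x *\<^sub>R G' x) \<bullet> e" by (metis inner_zero_left)
    also have "\<dots> = (LINT x|lebesgue. (indicator U x *\<^sub>R (\<psi> x *\<^sub>R G x - \<psi> x *\<^sub>R G' x)) \<bullet> e)"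
      unfolding set_lebesgue_integral_def
      using set_integral_diff(1)[OF i] by (subst integral_inner_left) (auto simp: set_integrable_def)
    also have "\<dots> = (LINT x:U|lebesgue. \<psi> x * ((G x - G' x) \<bullet> e))"
      unfolding set_lebesgue_integral_def
      by (rule Bochner_Integration.integral_cong) (auto simp: inner_diff_left algebra_simps)
    finally show "(LINT x:U|lebesgue. \<psi> x * ((G x - G' x) \<bullet> e)) = 0" by simp
  qed
  then have "AE x in lebesgue. \<forall>e\<in>Basis. x \<in> U \<longrightarrow> (G x - G' x) \<bullet> e = 0"
    by (subst AE_ball_countable) (auto intro: countable_finite)
  then show ?thesis
    by eventually_elim (metis euclidean_all_zero_iff eq_iff_diff_eq_0)
qed

lemma has_weak_gradient_subset:
  assumes "has_weak_gradient U u G" "V \<subseteq> U"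
  shows "has_weak_gradient V u G"
  unfolding has_weak_gradient_def
proof (intro conjI allI impI)
  fix \<psi> assume \<psi>: "test_function V \<psi>"
  then have \<psi>': "test_function U \<psi>" using assms(2) unfolding test_function_def by blast
  obtain K where K: "K \<subseteq> V" "\<And>x. x \<notin> K \<Longrightarrow> \<psi> x = 0" "\<And>x. x \<notin> K \<Longrightarrow> gradient \<psi> x = 0"
    using test_functionD[OF \<psi>] by metis
  have "(LINT x:U|lebesgue. h x) = (LINT x:V|lebesgue. h x)" if "\<And>x. x \<notin> K \<Longrightarrow> h x = 0" for h :: "_ \<Rightarrow> 'a"
    unfolding set_lebesgue_integral_def
    by (rule Bochner_Integration.integral_cong) (use that K(1) assms(2) in \<open>auto simp: indicator_def\<close>)
  from this[of "\<lambda>x. u x *\<^sub>R gradient \<psi> x"] this[of "\<lambda>x. \<psi> x *\<^sub>R G x"]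
  show "(LINT x:V|lebesgue. u x *\<^sub>R gradient \<psi> x) = - (LINT x:V|lebesgue. \<psi> x *\<^sub>R G x)"
    using assms(1) \<psi>' K unfolding has_weak_gradient_def by auto
qed (use assms in \<open>auto simp: has_weak_gradient_def\<close>)

section \<open>$L^p$ limits\<close>

lemma norm_add_powr_le:
  fixes a b :: "'a::real_normed_vector"
  assumes "0 \<le> p"
  shows "norm (a + b) powr p \<le> 2 powr p * (norm a powr p + norm b powr p)"
proof -
  have "norm (a + b) \<le> 2 * max (norm a) (norm b)"
    using norm_triangle_ineq[of a b] by linarith
  then have "norm (a + b) powr p \<le> (2 * max (norm a) (norm b)) powr p"
    using assms by (intro powr_mono2) auto
  also have "\<dots> = 2 powr p * max (norm a) (norm b) powr p" by (simp add: powr_mult)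
  also have "\<dots> \<le> 2 powr p * (norm a powr p + norm b powr p)"
    by (intro mult_left_mono) (auto simp: max_def)
  finally show ?thesis .
qed

text \<open>Either |a - b| is small compared with |b|; then |a|/|b| is near 1, and continuity of t^p
  at 1 gives the \<eta>-term. Or |b| is at most a multiple of |a - b|, and both powers are absorbed
  by the second term.\<close>

lemma powr_diff_bound:
  assumes "0 < p" "0 < \<eta>"
  obtains C :: real where "0 \<le> C"
    "\<And>a b. \<bar>\<bar>a\<bar> powr p - \<bar>b\<bar> powr p\<bar> \<le> \<eta> * \<bar>b\<bar> powr p + C * \<bar>a - b\<bar> powr p"
proof -
  have "isCont (\<lambda>t::real. t powr p) 1" by (intro continuous_intros) auto
  then obtain \<delta> where \<delta>: "0 < \<delta>" "\<And>t::real. \<bar>t - 1\<bar> < \<delta> \<Longrightarrow> \<bar>t powr p - 1\<bar> < \<eta>"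
    using assms(2) unfolding continuous_at_eps_delta dist_real_def by (metis powr_one_eq_one)
  \<comment> \<open>In the second case |b| \<le> |a - b| / \<delta>, so |a| and |b| are both at most
    (1 + 1/\<delta>) |a - b|.\<close>
  define C where "C = (1 + 1 / \<delta>) powr p"
  have "\<bar>\<bar>a\<bar> powr p - \<bar>b\<bar> powr p\<bar> \<le> \<eta> * \<bar>b\<bar> powr p + C * \<bar>a - b\<bar> powr p" for a b :: real
  proof (cases "\<bar>a - b\<bar> < \<delta> * \<bar>b\<bar>")
    case True
    then have b: "0 < \<bar>b\<bar>" using \<delta>(1) by (metis abs_ge_zero abs_zero mult_zero_right not_less zero_less_abs_iff)
    have "\<bar>a\<bar> / \<bar>b\<bar> - 1 = (\<bar>a\<bar> - \<bar>b\<bar>) / \<bar>b\<bar>" using b by (simp add: diff_divide_distrib)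
    then have "\<bar>\<bar>a\<bar> / \<bar>b\<bar> - 1\<bar> = \<bar>\<bar>a\<bar> - \<bar>b\<bar>\<bar> / \<bar>b\<bar>" by (simp only: abs_divide abs_abs)
    also have "\<dots> \<le> \<bar>a - b\<bar> / \<bar>b\<bar>" using b by (intro divide_right_mono abs_triangle_ineq3) auto
    also have "\<dots> < \<delta>" using True b by (simp add: divide_less_eq)
    finally have "\<bar>(\<bar>a\<bar> / \<bar>b\<bar>) powr p - 1\<bar> < \<eta>" by (rule \<delta>(2))
    then have "\<bar>b\<bar> powr p * \<bar>(\<bar>a\<bar> / \<bar>b\<bar>) powr p - 1\<bar> \<le> \<bar>b\<bar> powr p * \<eta>"
      by (intro mult_left_mono) auto
    moreover have "\<bar>b\<bar> powr p * \<bar>(\<bar>a\<bar> / \<bar>b\<bar>) powr p - 1\<bar> = \<bar>\<bar>a\<bar> powr p - \<bar>b\<bar> powr p\<bar>"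
    proof -
      have "\<bar>b\<bar> powr p * \<bar>(\<bar>a\<bar> / \<bar>b\<bar>) powr p - 1\<bar> = \<bar>\<bar>b\<bar> powr p * ((\<bar>a\<bar> / \<bar>b\<bar>) powr p - 1)\<bar>"
        by (simp add: abs_mult)
      also have "\<bar>b\<bar> powr p * ((\<bar>a\<bar> / \<bar>b\<bar>) powr p - 1) = \<bar>a\<bar> powr p - \<bar>b\<bar> powr p"
        using b by (simp add: powr_divide right_diff_distrib)
      finally show ?thesis .
    qed
    moreover have "0 \<le> C * \<bar>a - b\<bar> powr p" by (simp add: C_def)
    ultimately show ?thesis by (simp add: mult.commute)
  next
    case False
    then have 1: "\<bar>b\<bar> \<le> (1 / \<delta>) * \<bar>a - b\<bar>" using \<delta>(1) by (simp add: field_simps)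
    define q where "q = (1 / \<delta>) * \<bar>a - b\<bar>"
    have "0 \<le> q" "\<bar>b\<bar> \<le> q" using \<delta>(1) 1 by (simp_all add: q_def)
    moreover have "(1 + 1 / \<delta>) * \<bar>a - b\<bar> = \<bar>a - b\<bar> + q" unfolding q_def distrib_right by simp
    ultimately have "\<bar>b\<bar> \<le> (1 + 1 / \<delta>) * \<bar>a - b\<bar> \<and> \<bar>a\<bar> \<le> (1 + 1 / \<delta>) * \<bar>a - b\<bar>"
      by linarith
    then have "\<bar>b\<bar> powr p \<le> ((1 + 1 / \<delta>) * \<bar>a - b\<bar>) powr p" "\<bar>a\<bar> powr p \<le> ((1 + 1 / \<delta>) * \<bar>a - b\<bar>) powr p"
      using assms(1) by (auto intro!: powr_mono2)
    moreover have "((1 + 1 / \<delta>) * \<bar>a - b\<bar>) powr p = C * \<bar>a - b\<bar> powr p"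
      using \<delta>(1) by (simp add: C_def powr_mult)
    moreover have "0 \<le> \<eta> * \<bar>b\<bar> powr p" "0 \<le> \<bar>a\<bar> powr p" "0 \<le> \<bar>b\<bar> powr p" using assms(2) by auto
    ultimately show ?thesis by linarith
  qed
  moreover have "0 \<le> C" by (simp add: C_def)
  ultimately show thesis by (rule that[rotated])
qed

lemma Lp_norm_tendsto:
  fixes f :: "nat \<Rightarrow> 'a \<Rightarrow> real" and g :: "'a \<Rightarrow> real"
  assumes p: "0 < p" and [measurable]: "\<And>k. f k \<in> borel_measurable M" "g \<in> borel_measurable M"
    and f: "\<And>k. integrable M (\<lambda>x. \<bar>f k x\<bar> powr p)" and g: "integrable M (\<lambda>x. \<bar>g x\<bar> powr p)"
    and lim: "(\<lambda>k. \<integral>\<^sup>+x. ennreal (\<bar>f k x - g x\<bar> powr p) \<partial>M) \<longlonglongrightarrow> 0"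
  shows "(\<lambda>k. LINT x|M. \<bar>f k x\<bar> powr p) \<longlonglongrightarrow> (LINT x|M. \<bar>g x\<bar> powr p)"
proof -
  define F where "F = (LINT x|M. \<bar>g x\<bar> powr p)"
  have F0: "0 \<le> F" by (simp add: F_def)
  have ie: "integrable M (\<lambda>x. \<bar>f k x - g x\<bar> powr p)" for k
  proof (rule Bochner_Integration.integrable_bound)
    show "integrable M (\<lambda>x. 2 powr p * (\<bar>f k x\<bar> powr p + \<bar>g x\<bar> powr p))"
      by (intro integrable_mult_right Bochner_Integration.integrable_add f g)
    show "AE x in M. norm (\<bar>f k x - g x\<bar> powr p) \<le> norm (2 powr p * (\<bar>f k x\<bar> powr p + \<bar>g x\<bar> powr p))"
      using norm_add_powr_le[of p "f k x" "- g x" for x] p by (auto intro!: AE_I2)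
  qed measurable
  define e where "e k = (LINT x|M. \<bar>f k x - g x\<bar> powr p)" for k
  have "ennreal (e k) = (\<integral>\<^sup>+x. ennreal (\<bar>f k x - g x\<bar> powr p) \<partial>M)" for k
    unfolding e_def by (rule nn_integral_eq_integral[symmetric, OF ie]) auto
  then have "(\<lambda>k. ennreal (e k)) \<longlonglongrightarrow> ennreal 0" using lim by simp
  then have e0: "e \<longlonglongrightarrow> 0" by (rule tendsto_ennrealD) (auto simp: e_def)
  show ?thesis
  proof (rule LIMSEQ_I)
    fix r :: real assume r: "0 < r"
    \<comment> \<open>Chosen so that the \<eta>-term of \<open>powr_diff_bound\<close>, integrated,
      is at most r/2; the added 1 covers F = 0.\<close>
    have "0 < r / (2 * (F + 1))" using r F0 by simp
    then obtain C where C: "0 \<le> C"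
      "\<And>a b. \<bar>\<bar>a\<bar> powr p - \<bar>b\<bar> powr p\<bar> \<le> r / (2 * (F + 1)) * \<bar>b\<bar> powr p + C * \<bar>a - b\<bar> powr p"
      using powr_diff_bound[OF p] by blast
    have "0 < r / (2 * (C + 1))" using r C(1) by simp
    from LIMSEQ_D[OF e0 this] obtain N where N: "\<And>k. N \<le> k \<Longrightarrow> \<bar>e k\<bar> < r / (2 * (C + 1))" by auto
    show "\<exists>N. \<forall>k\<ge>N. norm ((LINT x|M. \<bar>f k x\<bar> powr p) - (LINT x|M. \<bar>g x\<bar> powr p)) < r"
    proof (intro exI allI impI)
      fix k assume k: "N \<le> k"
      have "\<bar>(LINT x|M. \<bar>f k x\<bar> powr p) - (LINT x|M. \<bar>g x\<bar> powr p)\<bar> = \<bar>LINT x|M. \<bar>f k x\<bar> powr p - \<bar>g x\<bar> powr p\<bar>"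
        by (simp add: Bochner_Integration.integral_diff f g)
      also have "\<dots> \<le> (LINT x|M. \<bar>\<bar>f k x\<bar> powr p - \<bar>g x\<bar> powr p\<bar>)" by (rule integral_abs_bound)
      also have "\<dots> \<le> (LINT x|M. r / (2 * (F + 1)) * \<bar>g x\<bar> powr p + C * \<bar>f k x - g x\<bar> powr p)"
        by (intro integral_mono integrable_abs Bochner_Integration.integrable_diff f g
            Bochner_Integration.integrable_add integrable_mult_right ie C)
      also have "\<dots> = r / (2 * (F + 1)) * F + C * e k"
        by (simp add: F_def e_def Bochner_Integration.integral_add g ie)
      also have "\<dots> < r"
      proof -
        have "r / (2 * (F + 1)) * F \<le> r / 2" using r F0 by (simp add: field_simps)
        moreover have "C * e k \<le> C * (r / (2 * (C + 1)))" using N[OF k] C(1) by (intro mult_left_mono) auto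
        moreover have "C * (r / (2 * (C + 1))) < r / 2" using r C(1) by (simp add: field_simps)
        ultimately show ?thesis by linarith
      qed
      finally show "norm ((LINT x|M. \<bar>f k x\<bar> powr p) - (LINT x|M. \<bar>g x\<bar> powr p)) < r" by simp
    qed
  qed
qed

text \<open>By Fatou, the distance from \<open>f k\<close> to the limit is at most the liminf of its
  distances to the members of the subsequence, and these are small by the Cauchy property.\<close>

lemma Lp_limit_AE:
  fixes f :: "nat \<Rightarrow> 'a \<Rightarrow> 'b::euclidean_space"
  assumes p: "0 < p" and [measurable]: "\<And>k. f k \<in> borel_measurable M" "g \<in> borel_measurable M"
    and cauchy: "\<And>e. 0 < e \<Longrightarrow> \<exists>N. \<forall>i\<ge>N. \<forall>j\<ge>N. (\<integral>\<^sup>+x. ennreal (norm (f i x - f j x) powr p) \<partial>M) < ennreal e"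
    and r: "strict_mono r" and ae: "AE x in M. (\<lambda>j. f (r j) x) \<longlonglongrightarrow> g x"
  shows "(\<lambda>k. \<integral>\<^sup>+x. ennreal (norm (f k x - g x) powr p) \<partial>M) \<longlonglongrightarrow> 0"
proof (rule tendsto_0_if_Limsup_eq_0_ennreal)
  have "\<forall>\<^sub>F k in sequentially. (\<integral>\<^sup>+x. ennreal (norm (f k x - g x) powr p) \<partial>M) \<le> ennreal e" if e: "0 < e" for e
  proof -
    from cauchy[OF e]
    obtain N where N: "\<forall>i\<ge>N. \<forall>j\<ge>N. (\<integral>\<^sup>+x. ennreal (norm (f i x - f j x) powr p) \<partial>M) < ennreal e"
      by blast
    have "(\<integral>\<^sup>+x. ennreal (norm (f k x - g x) powr p) \<partial>M) \<le> ennreal e" if k: "N \<le> k" for k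
    proof -
      have "(\<integral>\<^sup>+x. ennreal (norm (f k x - g x) powr p) \<partial>M) = (\<integral>\<^sup>+x. liminf (\<lambda>j. ennreal (norm (f k x - f (r j) x) powr p)) \<partial>M)"
      proof (rule nn_integral_cong_AE)
        show "AE x in M. ennreal (norm (f k x - g x) powr p) = liminf (\<lambda>j. ennreal (norm (f k x - f (r j) x) powr p))"
          using ae
        proof eventually_elim
          case (elim x)
          have "(\<lambda>j. ennreal (norm (f k x - f (r j) x) powr p)) \<longlonglongrightarrow> ennreal (norm (f k x - g x) powr p)"
            using p by (intro tendsto_ennrealI tendsto_powr' tendsto_norm tendsto_diff tendsto_const elim) auto
          then show ?case by (rule lim_imp_Liminf[symmetric, rotated]) simp
        qed
      qed
      also have "\<dots> \<le> liminf (\<lambda>j. \<integral>\<^sup>+x. ennreal (norm (f k x - f (r j) x) powr p) \<partial>M)"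
        by (rule nn_integral_liminf) measurable
      also have "\<dots> \<le> liminf (\<lambda>j. ennreal e)"
      proof (rule Liminf_mono)
        show "\<forall>\<^sub>F j in sequentially. (\<integral>\<^sup>+x. ennreal (norm (f k x - f (r j) x) powr p) \<partial>M) \<le> ennreal e"
          using eventually_ge_at_top[of N]
        proof eventually_elim
          case (elim j)
          then have "N \<le> r j" using seq_suble[OF r, of j] by linarith
          then show ?case using N k by (meson less_imp_le)
        qed
      qed
      also have "\<dots> = ennreal e" by (simp add: Liminf_const)
      finally show ?thesis .
    qed
    then show ?thesis by (auto simp: eventually_sequentially)
  qed
  then have "limsup (\<lambda>k. \<integral>\<^sup>+x. ennreal (norm (f k x - g x) powr p) \<partial>M) \<le> ennreal e" if "0 < e" for e
    using that by (intro Limsup_bounded) auto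
  then show "limsup (\<lambda>k. \<integral>\<^sup>+x. ennreal (norm (f k x - g x) powr p) \<partial>M) = 0"
    using ennreal_le_epsilon[of 0 "limsup (\<lambda>k. \<integral>\<^sup>+x. ennreal (norm (f k x - g x) powr p) \<partial>M)"] by simp
qed

text \<open>Along a subsequence the p-th powers of consecutive distances are at most 4^(-n).
  Weighted by 2^n their sum is integrable, hence finite almost everywhere, say equal to B. Then the
  increments are at most (B 2^(-n))^(1/p), a geometric series, and the subsequence converges
  pointwise.\<close>

lemma Lp_complete:
  fixes f :: "nat \<Rightarrow> 'a \<Rightarrow> 'b::euclidean_space"
  assumes p: "0 < p" and [measurable]: "\<And>k. f k \<in> borel_measurable M"
    and cauchy: "\<And>e. 0 < e \<Longrightarrow> \<exists>N. \<forall>i\<ge>N. \<forall>j\<ge>N. (\<integral>\<^sup>+x. ennreal (norm (f i x - f j x) powr p) \<partial>M) < ennreal e"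
  obtains g where "g \<in> borel_measurable M"
    "(\<lambda>k. \<integral>\<^sup>+x. ennreal (norm (f k x - g x) powr p) \<partial>M) \<longlonglongrightarrow> 0"
proof -
  let ?E = "\<lambda>i j. \<integral>\<^sup>+x. ennreal (norm (f i x - f j x) powr p) \<partial>M"
  let ?P = "\<lambda>n N. \<forall>i\<ge>N. \<forall>j\<ge>N. ?E i j < ennreal ((1/4) ^ n)"
  have "\<exists>r. \<forall>n. ?P n (r n) \<and> r n < r (Suc n)"
  proof (rule dependent_nat_choice)
    show "\<exists>N. ?P 0 N" using cauchy[of 1] by simp
    fix N n assume "?P n N"
    obtain N' where N': "?P (Suc n) N'" using cauchy[of "(1/4) ^ Suc n"] by auto
    then show "\<exists>N'. ?P (Suc n) N' \<and> N < N'" by (intro exI[of _ "max N' (Suc N)"]) auto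
  qed
  then obtain r where r: "\<And>n. ?P n (r n)" "\<And>n. r n < r (Suc n)" by blast
  have sm: "strict_mono r" using r(2) by (simp add: strict_mono_Suc_iff)
  have small: "?E (r (Suc n)) (r n) \<le> ennreal ((1/4) ^ n)" for n
    using r(1)[of n] r(2)[of n] by (meson less_imp_le order_refl)
  let ?d = "\<lambda>n x. norm (f (r (Suc n)) x - f (r n) x)"
  have "(\<integral>\<^sup>+x. (\<Sum>n. ennreal (2 ^ n) * ennreal (?d n x powr p)) \<partial>M) = (\<Sum>n. ennreal (2 ^ n) * ?E (r (Suc n)) (r n))"
    by (subst nn_integral_suminf) (auto simp: nn_integral_cmult)
  also have "\<dots> \<le> (\<Sum>n. ennreal ((1/2) ^ n))"
  proof (rule suminf_le)
    fix n
    have "ennreal (2 ^ n) * ?E (r (Suc n)) (r n) \<le> ennreal (2 ^ n) * ennreal ((1/4) ^ n)"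
      by (intro mult_left_mono small) simp
    also have "\<dots> = ennreal ((1/2) ^ n)"
      by (simp add: ennreal_mult[symmetric] power_mult_distrib[symmetric])
    finally show "ennreal (2 ^ n) * ?E (r (Suc n)) (r n) \<le> ennreal ((1/2) ^ n)" .
  qed auto
  also have "\<dots> = ennreal (\<Sum>n. (1/2) ^ n)" by (rule suminf_ennreal2) (auto simp: summable_geometric)
  also have "\<dots> < \<infinity>" by simp
  finally have "AE x in M. (\<Sum>n. ennreal (2 ^ n) * ennreal (?d n x powr p)) \<noteq> \<infinity>"
    by (intro nn_integral_noteq_infinite) auto
  then have conv: "AE x in M. convergent (\<lambda>n. f (r n) x)"
  proof eventually_elim
    case (elim x)
    then have "\<exists>B\<ge>0. (\<Sum>n. ennreal (2 ^ n) * ennreal (?d n x powr p)) = ennreal B"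
      by (cases "\<Sum>n. ennreal (2 ^ n) * ennreal (?d n x powr p)" rule: ennreal_cases) auto
    then obtain B where B: "0 \<le> B" "(\<Sum>n. ennreal (2 ^ n) * ennreal (?d n x powr p)) = ennreal B" by blast
    have "?d n x \<le> B powr (1/p) * ((1/2) powr (1/p)) ^ n" for n
    proof -
      have "ennreal (2 ^ n * ?d n x powr p) \<le> ennreal B"
        using sum_le_suminf[of "\<lambda>n. ennreal (2 ^ n) * ennreal (?d n x powr p)" "{n}"] B(2)
        by (simp add: ennreal_mult)
      then have "2 ^ n * ?d n x powr p \<le> B" using B(1) by simp
      then have "?d n x powr p \<le> B * (1/2) ^ n" by (simp add: field_simps power_one_over)
      then have "(?d n x powr p) powr (1/p) \<le> (B * (1/2) ^ n) powr (1/p)"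
        using p by (intro powr_mono2) auto
      also have "\<dots> = B powr (1/p) * ((1/2) powr (1/p)) ^ n"
        using B(1) by (simp add: powr_mult powr_power powr_realpow[symmetric] powr_powr mult.commute)
      finally show ?thesis using p by (simp add: powr_powr)
    qed
    moreover have "summable (\<lambda>n. B powr (1/p) * ((1/2) powr (1/p)) ^ n)"
      using p by (intro summable_mult summable_geometric) (use powr_less_mono2[of "1/p" "1/2" 1] in auto)
    ultimately have "summable (\<lambda>n. f (r (Suc n)) x - f (r n) x)"
      using summable_comparison_test'[of "\<lambda>n. B powr (1/p) * ((1/2) powr (1/p)) ^ n" 0 "\<lambda>n. f (r (Suc n)) x - f (r n) x"] by blast
    then have "convergent (\<lambda>n. \<Sum>i<n. f (r (Suc i)) x - f (r i) x)" by (simp add: summable_iff_convergent)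
    then have "convergent (\<lambda>n. f (r n) x - f (r 0) x)" 
    proof -
      have "(\<Sum>i<n. f (r (Suc i)) x - f (r i) x) = f (r n) x - f (r 0) x" for n by (induction n) auto
      then show ?thesis using \<open>convergent (\<lambda>n. \<Sum>i<n. f (r (Suc i)) x - f (r i) x)\<close> by simp
    qed
    then have "convergent (\<lambda>n. (f (r n) x - f (r 0) x) + f (r 0) x)" by (intro convergent_add convergent_const)
    then show ?case by simp
  qed
  define g where "g x = lim (\<lambda>n. f (r n) x)" for x
  have gm: "g \<in> borel_measurable M" unfolding g_def by (rule borel_measurable_lim_metric) measurable
  have "AE x in M. (\<lambda>n. f (r n) x) \<longlonglongrightarrow> g x"
    using conv by eventually_elim (simp add: g_def convergent_LIMSEQ_iff)
  from Lp_limit_AE[OF p _ gm cauchy sm this] show thesis using that[OF gm] by simp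
qed

text \<open>Writing the first factor as a^(p-1) keeps the conjugate exponent out of the statement.
  The bound is Young's inequality normalised by the two integrals; if one of them is zero, the
  product vanishes almost everywhere.\<close>

lemma Hoelder_real:
  fixes a b :: "'a \<Rightarrow> real"
  assumes p: "1 < p" and [measurable]: "a \<in> borel_measurable M" "b \<in> borel_measurable M"
    and nn: "\<And>x. 0 \<le> a x" "\<And>x. 0 \<le> b x"
    and ia: "integrable M (\<lambda>x. a x powr p)" and ib: "integrable M (\<lambda>x. b x powr p)"
  shows "integrable M (\<lambda>x. a x powr (p - 1) * b x)"
    and "(LINT x|M. a x powr (p - 1) * b x) \<le> (LINT x|M. a x powr p) powr (1 - 1/p) * (LINT x|M. b x powr p) powr (1/p)"
proof -
  define A B where "A = (LINT x|M. a x powr p)" and "B = (LINT x|M. b x powr p)"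
  have AB: "0 \<le> A" "0 \<le> B" by (auto simp: A_def B_def)
  \<comment> \<open>Young's inequality with free scales \<open>c\<close> and \<open>d\<close>: both
    are set to 1 to obtain integrability, and to the two integrals to obtain the sharp
    bound.\<close>
  have young: "s powr (p - 1) * t \<le> c powr (1 - 1/p) * d powr (1/p) * ((1 - 1/p) * (s powr p / c) + (1/p) * (t powr p / d))"
    if "0 < c" "0 < d" "0 \<le> s" "0 \<le> t" for c d s t :: real
  proof (cases "s = 0 \<or> t = 0")
    case True
    then have "s powr (p - 1) * t = 0" by auto
    moreover have "0 \<le> c powr (1 - 1/p) * d powr (1/p) * ((1 - 1/p) * (s powr p / c) + (1/p) * (t powr p / d))"
      using p that by (intro mult_nonneg_nonneg add_nonneg_nonneg) auto
    ultimately show ?thesis by (simp only:)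
  next
    case False
    then have st: "0 < s" "0 < t" using that by auto
    have "(s powr p / c) powr (1 - 1/p) * (t powr p / d) powr (1/p) \<le> (1 - 1/p) * (s powr p / c) + (1/p) * (t powr p / d)"
      using p st that by (intro Youngs_inequality_0) auto
    then have "c powr (1 - 1/p) * d powr (1/p) * ((s powr p / c) powr (1 - 1/p) * (t powr p / d) powr (1/p))
      \<le> c powr (1 - 1/p) * d powr (1/p) * ((1 - 1/p) * (s powr p / c) + (1/p) * (t powr p / d))"
      by (intro mult_left_mono) auto
    moreover have "(s powr p / c) powr (1 - 1/p) = s powr (p - 1) / c powr (1 - 1/p)"
      using st that p by (simp add: powr_divide powr_powr algebra_simps)
    moreover have "(t powr p / d) powr (1/p) = t / d powr (1/p)"
      using st that p by (simp add: powr_divide powr_powr)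
    ultimately show ?thesis using that by simp
  qed
  show i: "integrable M (\<lambda>x. a x powr (p - 1) * b x)"
  proof (rule Bochner_Integration.integrable_bound)
    show "integrable M (\<lambda>x. 1 powr (1 - 1/p) * 1 powr (1/p) * ((1 - 1/p) * (a x powr p / 1) + (1/p) * (b x powr p / 1)))"
      by (intro integrable_mult_right Bochner_Integration.integrable_add integrable_divide ia ib)
    show "AE x in M. norm (a x powr (p - 1) * b x) \<le> norm (1 powr (1 - 1/p) * 1 powr (1/p) * ((1 - 1/p) * (a x powr p / 1) + (1/p) * (b x powr p / 1)))"
    proof (rule AE_I2)
      fix x
      have "a x powr (p - 1) * b x \<le> 1 powr (1 - 1/p) * 1 powr (1/p) * ((1 - 1/p) * (a x powr p / 1) + (1/p) * (b x powr p / 1))"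
        by (rule young) (use nn in auto)
      moreover have "0 \<le> a x powr (p - 1) * b x" using nn by simp
      ultimately show "norm (a x powr (p - 1) * b x) \<le> norm (1 powr (1 - 1/p) * 1 powr (1/p) * ((1 - 1/p) * (a x powr p / 1) + (1/p) * (b x powr p / 1)))"
        unfolding real_norm_def by linarith
    qed
  qed measurable
  show "(LINT x|M. a x powr (p - 1) * b x) \<le> (LINT x|M. a x powr p) powr (1 - 1/p) * (LINT x|M. b x powr p) powr (1/p)"
  proof (cases "A = 0 \<or> B = 0")
    case True
    have "AE x in M. a x powr (p - 1) * b x = 0"
    proof (cases "A = 0")
      case True
      then have "AE x in M. a x powr p = 0"
        using integral_nonneg_eq_0_iff_AE[OF ia] by (simp add: A_def)
      then show ?thesis by eventually_elim auto
    next
      case False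
      then have "B = 0" using \<open>A = 0 \<or> B = 0\<close> by simp
      then have "AE x in M. b x powr p = 0"
        using integral_nonneg_eq_0_iff_AE[OF ib] by (simp add: B_def)
      then show ?thesis by eventually_elim auto
    qed
    then have "(LINT x|M. a x powr (p - 1) * b x) = 0" by (rule integral_eq_zero_AE)
    then show ?thesis by simp
  next
    case False
    then have pos: "0 < A" "0 < B" using AB by auto
    let ?c = "A powr (1 - 1/p) * B powr (1/p)"
    have "(LINT x|M. a x powr (p - 1) * b x) \<le> (LINT x|M. ?c * ((1 - 1/p) * (a x powr p / A) + (1/p) * (b x powr p / B)))"
    proof (rule integral_mono[OF i])
      show "integrable M (\<lambda>x. ?c * ((1 - 1/p) * (a x powr p / A) + (1/p) * (b x powr p / B)))"
        by (intro Bochner_Integration.integrable_add integrable_mult_right integrable_divide ia ib)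
    qed (rule young[OF pos nn])
    also have "\<dots> = ?c * ((1 - 1/p) * (A / A) + (1/p) * (B / B))"
      by (simp add: A_def B_def Bochner_Integration.integral_add ia ib)
    also have "\<dots> = ?c" using pos by simp
    finally show ?thesis by (simp add: A_def B_def)
  qed
qed

section \<open>The Hardy inequality for smooth functions\<close>

lemma set_integral_sum:
  fixes f :: "'i \<Rightarrow> 'a \<Rightarrow> 'b::{banach, second_countable_topology}"
  assumes "\<And>i. i \<in> I \<Longrightarrow> set_integrable M A (f i)"
  shows "set_integrable M A (\<lambda>x. \<Sum>i\<in>I. f i x)"
    and "(LINT x:A|M. (\<Sum>i\<in>I. f i x)) = (\<Sum>i\<in>I. LINT x:A|M. f i x)"
  using assms unfolding set_integrable_def set_lebesgue_integral_def scaleR_sum_right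
  by (auto intro!: Bochner_Integration.integrable_sum Bochner_Integration.integral_sum)

text \<open>The quotient A / (A + B), where A is positive exactly for |x| < r2 and B exactly for |x|
  > r1. As r1 < r2, the denominator never vanishes.\<close>

lemma cutoff_exists:
  fixes r1 r2 :: real
  assumes "0 \<le> r1" "r1 < r2"
  obtains \<zeta> :: "'a::euclidean_space \<Rightarrow> real" and d where "\<And>x. GDERIV \<zeta> x :> d x"
    "continuous_on UNIV \<zeta>" "continuous_on UNIV d"
    "\<And>x. norm x \<le> r1 \<Longrightarrow> \<zeta> x = 1 \<and> d x = 0" "\<And>x. r2 \<le> norm x \<Longrightarrow> \<zeta> x = 0 \<and> d x = 0"
proof -
  let ?E = "exp_recip 0" and ?E' = "exp_recip 2"
  have dE: "(?E has_real_derivative ?E' t) (at t)" for t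
    using DERIV_exp_recip[of 0 t] by (simp add: numeral_2_eq_2)
  have cE: "continuous_on UNIV (exp_recip m)" for m
    using DERIV_exp_recip DERIV_isCont continuous_at_imp_continuous_on by blast
  have zE: "?E' t = 0" if "?E t = 0" for t using that by (auto simp: exp_recip_def split: if_splits)
  define A where "A x = ?E (r2\<^sup>2 - x \<bullet> x)" for x :: 'a
  define B where "B x = ?E (x \<bullet> x - r1\<^sup>2)" for x :: 'a
  define dA where "dA x = (?E' (r2\<^sup>2 - x \<bullet> x)) *\<^sub>R (- 2) *\<^sub>R x" for x :: 'a
  define dB where "dB x = (?E' (x \<bullet> x - r1\<^sup>2)) *\<^sub>R 2 *\<^sub>R x" for x :: 'a
  have "GDERIV (\<lambda>x. r2\<^sup>2 - x \<bullet> x) x :> (- 2) *\<^sub>R x" "GDERIV (\<lambda>x. x \<bullet> x - r1\<^sup>2) x :> 2 *\<^sub>R x" for x :: 'a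
    unfolding gderiv_def by (auto intro!: derivative_eq_intros simp: inner_commute)
  from GDERIV_DERIV_compose[OF this(1) dE] GDERIV_DERIV_compose[OF this(2) dE]
  have gA: "GDERIV A x :> dA x" and gB: "GDERIV B x :> dB x" for x
    by (simp_all add: A_def[abs_def] B_def[abs_def] dA_def dB_def)
  have c: "continuous_on UNIV A" "continuous_on UNIV B" "continuous_on UNIV dA" "continuous_on UNIV dB"
    unfolding A_def B_def dA_def dB_def
    by (intro continuous_intros continuous_on_compose2[OF cE] subset_UNIV)+
  have nn: "0 \<le> A x" "0 \<le> B x" for x by (simp_all add: A_def B_def exp_recip_nonneg)
  have sq: "r1\<^sup>2 < r2\<^sup>2" using assms by (intro power_strict_mono) auto
  have pos: "A x + B x \<noteq> 0" for x
  proof -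
    have "0 < r2\<^sup>2 - x \<bullet> x \<or> 0 < x \<bullet> x - r1\<^sup>2" using sq by linarith
    then have "0 < A x \<or> 0 < B x" by (auto simp: A_def B_def exp_recip_pos_iff)
    then show ?thesis using nn[of x] by linarith
  qed
  define \<zeta> where "\<zeta> x = A x * inverse (A x + B x)" for x
  define d where "d x = A x *\<^sub>R (- (inverse (A x + B x))\<^sup>2 *\<^sub>R (dA x + dB x)) + inverse (A x + B x) *\<^sub>R dA x" for x
  show thesis
  proof (rule that[of \<zeta> d])
    show "GDERIV \<zeta> x :> d x" for x
      unfolding \<zeta>_def d_def by (intro GDERIV_mult GDERIV_inverse GDERIV_add gA gB pos)
    show "continuous_on UNIV \<zeta>" "continuous_on UNIV d"
      unfolding \<zeta>_def d_def using pos by (auto intro!: continuous_intros c)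
    show "\<zeta> x = 1 \<and> d x = 0" if "norm x \<le> r1" for x
    proof -
      have "x \<bullet> x \<le> r1\<^sup>2" using that by (simp add: power_mono flip: power2_norm_eq_inner)
      then have "B x = 0" "dB x = 0" by (simp_all add: B_def dB_def exp_recip_eq_0)
      then show ?thesis using pos[of x] by (simp add: \<zeta>_def d_def power2_eq_square)
    qed
    show "\<zeta> x = 0 \<and> d x = 0" if "r2 \<le> norm x" for x
    proof -
      have "r2\<^sup>2 \<le> x \<bullet> x" using that assms by (simp add: power_mono flip: power2_norm_eq_inner)
      then have "A x = 0" "dA x = 0" by (simp_all add: A_def dA_def exp_recip_eq_0)
      then show ?thesis by (simp add: \<zeta>_def d_def)
    qed
  qed
qed

section \<open>Domains around the origin and the flux of a radial field\<close>

locale hardy_domain =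
  fixes \<Omega> :: "'a::euclidean_space set" and p l :: real
  assumes p: "1 < p" and open_\<Omega>: "open \<Omega>" and bounded_\<Omega>: "bounded \<Omega>" and C1: "C1_boundary \<Omega>"
    and zero_in: "0 \<in> \<Omega>" and l_ne: "l \<noteq> p - real DIM('a)"
begin

abbreviation S :: "'a measure" where "S \<equiv> surface_measure (frontier \<Omega>)"
abbreviation \<eta> :: "'a \<Rightarrow> 'a" where "\<eta> \<equiv> outward_normal \<Omega>"

lemma compact_closure: "compact (closure \<Omega>)" using bounded_\<Omega> by (simp add: compact_closure)
lemma compact_frontier: "compact (frontier \<Omega>)" using bounded_\<Omega> by (rule compact_frontier_bounded)
lemma frontier_closure: "frontier \<Omega> \<subseteq> closure \<Omega>" by (simp add: frontier_def)
lemma \<Omega>_closure: "\<Omega> \<subseteq> closure \<Omega>" by (rule closure_subset)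
lemma frontier_disjoint: "x \<in> frontier \<Omega> \<Longrightarrow> x \<notin> \<Omega>" using open_\<Omega> by (simp add: frontier_def interior_open)
lemma hypersurface: "C1_hypersurface (frontier \<Omega>)" using open_\<Omega> C1 by (rule C1_boundary_hypersurface)
lemma is_S: "is_surface_measure (frontier \<Omega>) S"
  by (intro is_surface_measure_surface_measure compact_frontier hypersurface)
lemma sets_S [simp, measurable_cong]: "sets S = sets borel" by (rule sets_surface_measure[OF is_S])
lemma finite_S: "finite_measure S" by (rule finite_surface_measure[OF is_S compact_frontier hypersurface])
lemma frontier_nonzero: "x \<in> frontier \<Omega> \<Longrightarrow> x \<noteq> 0" using zero_in frontier_disjoint by blast
lemma cont_\<eta>: "continuous_on (frontier \<Omega>) \<eta>" by (rule continuous_on_outward_normal[OF open_\<Omega> C1])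
lemma \<Omega>_borel [measurable]: "\<Omega> \<in> sets borel" using open_\<Omega> by simp
lemma frontier_borel [measurable]: "frontier \<Omega> \<in> sets borel" using compact_frontier by (rule borel_compact)
lemma emeasure_\<Omega>: "emeasure lborel \<Omega> < \<infinity>"
  using emeasure_bounded_finite[OF bounded_\<Omega>] by simp

text \<open>A radius fixed once and for all: small spheres and the supports of cutoffs stay inside
  it, and the region near the boundary lies outside it.\<close>

definition \<rho> where "\<rho> = (SOME r. 0 < r \<and> cball (0::'a) r \<subseteq> \<Omega>)"

lemma \<rho>: "0 < \<rho>" "cball 0 \<rho> \<subseteq> \<Omega>"
proof -
  have "\<exists>r. 0 < r \<and> cball (0::'a) r \<subseteq> \<Omega>" using open_contains_cball[of \<Omega>] open_\<Omega> zero_in by blast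
  from someI_ex[OF this] show "0 < \<rho>" "cball 0 \<rho> \<subseteq> \<Omega>" by (auto simp: \<rho>_def)
qed

lemma S_integrable:
  fixes h :: "'a \<Rightarrow> real"
  assumes "continuous_on (frontier \<Omega>) h"
  shows "set_integrable S (frontier \<Omega>) h"
proof -
  obtain B where "\<And>x. x \<in> frontier \<Omega> \<Longrightarrow> \<bar>h x\<bar> \<le> B"
    by (rule bounded_image_compact_real[OF compact_frontier assms], rule that)
  then show ?thesis
    using assms finite_S
    by (intro set_integrable_continuous_finite[where B=B]) (auto simp: less_top[symmetric] finite_measure.emeasure_finite)
qed

text \<open>
  A cutoff splits \<open>H\<close> into a part living away from the origin, to which the divergence theorem in
  \<open>\<Omega>\<close> applies, and a part living in \<open>\<Omega>\<close>, to which the divergence theorem in the exterior of the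
  small ball applies.
\<close>

lemma radial_flux:
  fixes H :: "'a \<Rightarrow> real" and h :: "'a \<Rightarrow> 'a"
  assumes \<epsilon>: "0 < \<epsilon>" "\<epsilon> < \<rho>"
    and cH: "continuous_on (closure \<Omega> - {0}) H"
    and dH: "\<And>x. x \<in> \<Omega> - {0} \<Longrightarrow> GDERIV H x :> h x"
    and ih: "set_integrable lborel (\<Omega> - cball 0 \<epsilon>) h"
  shows "set_integrable lborel (\<Omega> - cball 0 \<epsilon>) (\<lambda>x. real DIM('a) * H x + x \<bullet> h x)"
    and "(LINT x:\<Omega> - cball 0 \<epsilon>|lborel. real DIM('a) * H x + x \<bullet> h x) =
      (LINT x:frontier \<Omega>|S. (x \<bullet> \<eta> x) * H x) - \<epsilon> * (LINT x:sphere 0 \<epsilon>|surface_measure (sphere 0 \<epsilon>). H x)"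
proof -
  let ?X = "\<Omega> - cball 0 \<epsilon>" and ?E = "- cball (0::'a) \<epsilon>"
  \<comment> \<open>Two radii strictly between \<epsilon> and \<rho>: the transition of the cutoff
    must stay away both from the small sphere and from the edge of the ball known to lie in
    \<Omega>.\<close>
  define r1 r2 where "r1 = (2 * \<epsilon> + \<rho>) / 3" and "r2 = (\<epsilon> + 2 * \<rho>) / 3"
  have r: "\<epsilon> < r1" "r1 < r2" "r2 < \<rho>" "0 \<le> r1" using \<epsilon> by (auto simp: r1_def r2_def)
  obtain \<zeta> :: "'a \<Rightarrow> real" and d where z: "\<And>x. GDERIV \<zeta> x :> d x"
    "continuous_on UNIV \<zeta>" "continuous_on UNIV d"
    "\<And>x. norm x \<le> r1 \<Longrightarrow> \<zeta> x = 1 \<and> d x = 0" "\<And>x. r2 \<le> norm x \<Longrightarrow> \<zeta> x = 0 \<and> d x = 0"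
    by (rule cutoff_exists[OF r(4) r(2)], rule that)
  have in_\<Omega>: "x \<in> \<Omega>" if "norm x \<le> \<rho>" for x using \<rho>(2) that by (auto simp: subset_iff)
  have Xb [measurable]: "?X \<in> sets borel" by auto
  have gi: "GDERIV (\<lambda>x. x \<bullet> e) x :> e" for x e :: 'a
    unfolding gderiv_def by (auto intro!: derivative_eq_intros)
  have int_gen: "set_integrable lborel ?X (\<lambda>x. c x *\<^sub>R h x + H x *\<^sub>R v x)"
    if c: "continuous_on UNIV c" and v: "continuous_on UNIV v" for c :: "'a \<Rightarrow> real" and v :: "'a \<Rightarrow> 'a"
  proof -
    let ?K = "closure \<Omega> \<inter> - ball 0 \<epsilon>"
    have K: "compact ?K" using compact_closure by (intro compact_Int_closed) (auto simp: closed_Compl)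
    have sub: "?X \<subseteq> ?K" using \<Omega>_closure by auto
    obtain B where B: "\<And>x. x \<in> ?K \<Longrightarrow> \<bar>c x\<bar> \<le> B"
      by (rule bounded_image_compact_real[OF K continuous_on_subset[OF c subset_UNIV]], rule that)
    have 1: "set_integrable lborel ?X (\<lambda>x. c x *\<^sub>R h x)"
    proof (rule set_integrable_bounded_mult[OF ih, where B=B])
      have "c \<in> borel_measurable borel" using c by (rule borel_measurable_continuous_onI)
      then show "set_borel_measurable lborel ?X c" by (simp add: set_borel_measurable_def)
      show "\<bar>c x\<bar> \<le> B" if "x \<in> ?X" for x using B subsetD[OF sub that] by blast
    qed
    have cK: "continuous_on ?K (\<lambda>x. H x *\<^sub>R v x)"
      using \<epsilon>(1) by (intro continuous_intros continuous_on_subset[OF cH] continuous_on_subset[OF v]) auto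
    obtain B' where B': "\<And>x. x \<in> ?K \<Longrightarrow> \<bar>norm (H x *\<^sub>R v x)\<bar> \<le> B'"
      by (rule bounded_image_compact_real[OF K continuous_on_norm[OF cK]], rule that)
    have "set_integrable lborel ?K (\<lambda>x. H x *\<^sub>R v x)"
      using K cK B' emeasure_compact_finite[OF K]
      by (intro set_integrable_continuous_finite[where B=B']) (auto simp: borel_compact)
    then have 2: "set_integrable lborel ?X (\<lambda>x. H x *\<^sub>R v x)"
      by (rule set_integrable_subset) (use sub in auto)
    show ?thesis by (rule set_integral_add(1)[OF 1 2])
  qed
  \<comment> \<open>\<open>g1 e\<close> and \<open>g2 e\<close> are the gradients of (x \<bullet> e)
    (1 - \<zeta>) H and (x \<bullet> e) \<zeta> H. Adding their e-components over all e gives the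
    divergence of H x, namely n H + x \<bullet> h, as the cutoff terms cancel.\<close>
  define g1 where "g1 e x = ((1 - \<zeta> x) * (x \<bullet> e)) *\<^sub>R h x + H x *\<^sub>R ((1 - \<zeta> x) *\<^sub>R e - (x \<bullet> e) *\<^sub>R d x)" for e x
  define g2 where "g2 e x = (\<zeta> x * (x \<bullet> e)) *\<^sub>R h x + H x *\<^sub>R (\<zeta> x *\<^sub>R e + (x \<bullet> e) *\<^sub>R d x)" for e x
  have i1: "set_integrable lborel ?X (g1 e)" and i2: "set_integrable lborel ?X (g2 e)" for e
    unfolding g1_def g2_def by (rule int_gen; intro continuous_intros z(2,3))+
  have g10: "g1 e x = 0" if "norm x \<le> r1" for e x using z(4)[OF that] by (simp add: g1_def)
  have g20: "g2 e x = 0" if "r2 \<le> norm x" for e x using z(5)[OF that] by (simp add: g2_def)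
  have ind1: "indicator \<Omega> x *\<^sub>R g1 e x = indicator ?X x *\<^sub>R g1 e x" for e x
    using g10[of x e] r(1) by (cases "x \<in> cball 0 \<epsilon>") (auto simp: indicator_def)
  have ind2: "indicator ?E x *\<^sub>R g2 e x = indicator ?X x *\<^sub>R g2 e x" for e x
  proof (cases "x \<in> \<Omega>")
    case False
    then have "\<not> norm x \<le> \<rho>" using in_\<Omega> by blast
    then have "g2 e x = 0" using r(3) by (intro g20) simp
    then show ?thesis by simp
  qed (auto simp: indicator_def)
  have I1: "set_integrable lborel \<Omega> (g1 e)" and I2: "set_integrable lborel ?E (g2 e)" for e
    using i1 i2 by (simp_all only: set_integrable_def ind1 ind2)
  have D1: "(LINT x:?X|lborel. g1 e x \<bullet> e) = (LINT x:frontier \<Omega>|S. (x \<bullet> e) * H x * (\<eta> x \<bullet> e))"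
    if e: "e \<in> Basis" for e
  proof -
    \<comment> \<open>\<open>H\<close> is uncontrolled at the origin; near it 1 - \<zeta> vanishes,
      so 0 is the continuous value there.\<close>
    let ?f = "\<lambda>x. if x = 0 then 0 else (x \<bullet> e) * ((1 - \<zeta> x) * H x)"
    have "(LINT x:\<Omega>|lborel. g1 e x \<bullet> e) = (LINT x:frontier \<Omega>|S. ?f x * (\<eta> x \<bullet> e))"
    proof (rule divergence_theorem[OF open_\<Omega> C1 compact_frontier is_S _ compact_closure _ _ I1 e])
      have op: "openin (top_of_set (closure \<Omega>)) (closure \<Omega> \<inter> - {0})"
        "openin (top_of_set (closure \<Omega>)) (closure \<Omega> \<inter> ball 0 r1)" by (auto intro!: openin_open_Int)
      have "continuous_on (closure \<Omega> \<inter> - {0}) (\<lambda>x. (x \<bullet> e) * ((1 - \<zeta> x) * H x))"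
        by (intro continuous_intros continuous_on_subset[OF cH] continuous_on_subset[OF z(2)]) auto
      then have c1: "continuous_on (closure \<Omega> \<inter> - {0}) ?f" by (rule continuous_on_eq) auto
      have "continuous_on (closure \<Omega> \<inter> ball 0 r1) (\<lambda>x. 0 :: real)" by simp
      then have c2: "continuous_on (closure \<Omega> \<inter> ball 0 r1) ?f" by (rule continuous_on_eq) (use z(4) in auto)
      have eq: "closure \<Omega> = (closure \<Omega> \<inter> - {0}) \<union> (closure \<Omega> \<inter> ball 0 r1)" using r \<epsilon> by auto
      show "continuous_on (closure \<Omega>) ?f"
        using continuous_on_Un_local_open[of "closure \<Omega> \<inter> - {0}" "closure \<Omega> \<inter> ball 0 r1" ?f] op c1 c2
        unfolding eq[symmetric] by blast
      fix x assume x: "x \<in> \<Omega>"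
      show "GDERIV ?f x :> g1 e x"
      proof (cases "norm x < r1")
        case True
        then have "GDERIV ?f x :> 0"
          by (intro GDERIV_cong_open[OF GDERIV_const[of 0], of "ball 0 r1"]) (use z(4) in auto)
        then show ?thesis using g10[of x e] True by simp
      next
        case False
        then have x0: "x \<noteq> 0" using r \<epsilon> by auto
        have "GDERIV (\<lambda>x. (x \<bullet> e) * ((1 - \<zeta> x) * H x)) x :>
          (x \<bullet> e) *\<^sub>R ((1 - \<zeta> x) *\<^sub>R h x + H x *\<^sub>R (0 - d x)) + ((1 - \<zeta> x) * H x) *\<^sub>R e"
          using x x0 by (intro GDERIV_mult GDERIV_diff GDERIV_const gi z(1) dH) auto
        then have "GDERIV ?f x :> (x \<bullet> e) *\<^sub>R ((1 - \<zeta> x) *\<^sub>R h x + H x *\<^sub>R (0 - d x)) + ((1 - \<zeta> x) * H x) *\<^sub>R e"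
          by (rule GDERIV_cong_open[of _ _ _ "- {0}"]) (use x0 in auto)
        then show ?thesis by (rule GDERIV_subst) (simp add: g1_def algebra_simps)
      qed
    qed auto
    also have "\<dots> = (LINT x:frontier \<Omega>|S. (x \<bullet> e) * H x * (\<eta> x \<bullet> e))"
    proof (rule set_lebesgue_integral_cong)
      show "\<forall>x. x \<in> frontier \<Omega> \<longrightarrow> ?f x * (\<eta> x \<bullet> e) = (x \<bullet> e) * H x * (\<eta> x \<bullet> e)"
      proof (intro allI impI)
        fix x assume x: "x \<in> frontier \<Omega>"
        then have "\<not> norm x \<le> \<rho>" using in_\<Omega> frontier_disjoint by blast
        then have "\<zeta> x = 0" using z(5)[of x] r(3) by auto
        then show "?f x * (\<eta> x \<bullet> e) = (x \<bullet> e) * H x * (\<eta> x \<bullet> e)" using frontier_nonzero[OF x] by simp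
      qed
    qed simp
    finally have "(LINT x:\<Omega>|lborel. g1 e x \<bullet> e) = (LINT x:frontier \<Omega>|S. (x \<bullet> e) * H x * (\<eta> x \<bullet> e))" .
    moreover have "indicator \<Omega> x *\<^sub>R (g1 e x \<bullet> e) = indicator ?X x *\<^sub>R (g1 e x \<bullet> e)" for x
      using arg_cong[OF ind1[of x e], of "\<lambda>v. v \<bullet> e"] by simp
    ultimately show ?thesis unfolding set_lebesgue_integral_def by (simp only:)
  qed
  have D2: "(LINT x:?X|lborel. g2 e x \<bullet> e) = (LINT x:sphere 0 \<epsilon>|surface_measure (sphere 0 \<epsilon>). - (1 / \<epsilon>) * ((x \<bullet> e)\<^sup>2 * H x))"
    if e: "e \<in> Basis" for e
  proof -
    \<comment> \<open>Nothing is assumed about \<open>H\<close> outside \<Omega>; the cutoff already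
      vanishes from r2 < \<rho> on, so extending by zero loses nothing.\<close>
    let ?f = "\<lambda>x. if norm x < \<rho> then (x \<bullet> e) * (\<zeta> x * H x) else 0"
    have fr: "frontier ?E = sphere 0 \<epsilon>" using \<epsilon>(1) by (rule frontier_exterior_ball)
    have cl: "closure ?E = - ball 0 \<epsilon>" using \<epsilon>(1) by (simp add: closure_complement)
    have f_eq: "?f x = 0" if "r2 < norm x" for x using z(5)[of x] that by auto
    have "(LINT x:?E|lborel. g2 e x \<bullet> e) = (LINT x:frontier ?E|surface_measure (sphere 0 \<epsilon>). ?f x * (outward_normal ?E x \<bullet> e))"
    proof (rule divergence_theorem[where K="cball 0 \<rho>", OF _ _ _ _ _ _ _ _ I2 e])
      show "open ?E" by (simp add: open_Compl)
      show "C1_boundary ?E" using \<epsilon>(1) by (rule exterior_ball_C1_boundary)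
      show "compact (frontier ?E)" by (simp add: fr)
      show "is_surface_measure (frontier ?E) (surface_measure (sphere 0 \<epsilon>))"
        unfolding fr using \<epsilon>(1) by (rule surface_measure_sphere)
      have op: "openin (top_of_set (closure ?E)) (closure ?E \<inter> ball 0 \<rho>)"
        "openin (top_of_set (closure ?E)) (closure ?E \<inter> - cball 0 r2)" by (auto intro!: openin_open_Int simp: open_Compl)
      have "continuous_on (closure ?E \<inter> ball 0 \<rho>) (\<lambda>x. (x \<bullet> e) * (\<zeta> x * H x))"
        unfolding cl using \<epsilon>(1) \<Omega>_closure in_\<Omega>
        by (intro continuous_intros continuous_on_subset[OF cH] continuous_on_subset[OF z(2)]) auto
      then have c1: "continuous_on (closure ?E \<inter> ball 0 \<rho>) ?f" by (rule continuous_on_eq) auto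
      have "continuous_on (closure ?E \<inter> - cball 0 r2) (\<lambda>x. 0 :: real)" by simp
      then have c2: "continuous_on (closure ?E \<inter> - cball 0 r2) ?f" by (rule continuous_on_eq) (use f_eq in auto)
      have eq: "closure ?E = (closure ?E \<inter> ball 0 \<rho>) \<union> (closure ?E \<inter> - cball 0 r2)" using r by auto
      show "continuous_on (closure ?E) ?f"
        using continuous_on_Un_local_open[of "closure ?E \<inter> ball 0 \<rho>" "closure ?E \<inter> - cball 0 r2" ?f] op c1 c2
        unfolding eq[symmetric] by blast
      fix x assume x: "x \<in> ?E"
      then have x0: "x \<noteq> 0" using \<epsilon>(1) by auto
      show "GDERIV ?f x :> g2 e x"
      proof (cases "norm x \<le> r2")
        case True
        then have x\<Omega>: "x \<in> \<Omega> - {0}" using r in_\<Omega> x0 by auto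
        have "GDERIV (\<lambda>x. (x \<bullet> e) * (\<zeta> x * H x)) x :>
          (x \<bullet> e) *\<^sub>R (\<zeta> x *\<^sub>R h x + H x *\<^sub>R d x) + (\<zeta> x * H x) *\<^sub>R e"
          using x\<Omega> by (intro GDERIV_mult gi z(1) dH)
        then have "GDERIV ?f x :> (x \<bullet> e) *\<^sub>R (\<zeta> x *\<^sub>R h x + H x *\<^sub>R d x) + (\<zeta> x * H x) *\<^sub>R e"
          by (rule GDERIV_cong_open[of _ _ _ "ball 0 \<rho>"]) (use True r in auto)
        then show ?thesis by (rule GDERIV_subst) (simp add: g2_def algebra_simps)
      next
        case False
        then have "GDERIV ?f x :> 0"
          by (intro GDERIV_cong_open[OF GDERIV_const[of 0], of "- cball 0 r2"]) (use f_eq in \<open>auto simp: open_Compl\<close>)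
        then show ?thesis using g20[of x e] False by simp
      qed
    qed auto
    also have "\<dots> = (LINT x:sphere 0 \<epsilon>|surface_measure (sphere 0 \<epsilon>). - (1 / \<epsilon>) * ((x \<bullet> e)\<^sup>2 * H x))"
      unfolding fr
    proof (rule set_lebesgue_integral_cong)
      show "sphere 0 \<epsilon> \<in> sets (surface_measure (sphere (0::'a) \<epsilon>))"
        using sets_surface_measure[OF surface_measure_sphere[OF \<epsilon>(1), where 'a='a]] by simp
      show "\<forall>x. x \<in> sphere 0 \<epsilon> \<longrightarrow> ?f x * (outward_normal ?E x \<bullet> e) = - (1 / \<epsilon>) * ((x \<bullet> e)\<^sup>2 * H x)"
        using \<epsilon> r z(4) by (auto simp: outward_normal_exterior_ball power2_eq_square)
    qed
    finally have "(LINT x:?E|lborel. g2 e x \<bullet> e) =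
      (LINT x:sphere 0 \<epsilon>|surface_measure (sphere 0 \<epsilon>). - (1 / \<epsilon>) * ((x \<bullet> e)\<^sup>2 * H x))" .
    moreover have "indicator ?E x *\<^sub>R (g2 e x \<bullet> e) = indicator ?X x *\<^sub>R (g2 e x \<bullet> e)" for x
      using arg_cong[OF ind2[of x e], of "\<lambda>v. v \<bullet> e"] by simp
    ultimately show ?thesis unfolding set_lebesgue_integral_def by (simp only:)
  qed
  have sum_g: "(\<Sum>e\<in>Basis. g1 e x \<bullet> e + g2 e x \<bullet> e) = real DIM('a) * H x + x \<bullet> h x" for x
  proof -
    have "g1 e x \<bullet> e + g2 e x \<bullet> e = (x \<bullet> e) * (h x \<bullet> e) + H x" if "e \<in> Basis" for e
      using that by (simp add: g1_def g2_def inner_add_left inner_diff_left algebra_simps)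
    then show ?thesis by (simp add: sum.distrib euclidean_inner[of x "h x"])
  qed
  have j1: "set_integrable lborel ?X (\<lambda>x. g1 e x \<bullet> e)" and j2: "set_integrable lborel ?X (\<lambda>x. g2 e x \<bullet> e)" for e
    by (intro set_integrable_scaleR_inner i1 i2)+
  have j: "set_integrable lborel ?X (\<lambda>x. g1 e x \<bullet> e + g2 e x \<bullet> e)" for e
    by (rule set_integral_add(1)[OF j1 j2])
  then have "set_integrable lborel ?X (\<lambda>x. \<Sum>e\<in>Basis. g1 e x \<bullet> e + g2 e x \<bullet> e)"
    by (rule set_integral_sum(1))
  then show "set_integrable lborel ?X (\<lambda>x. real DIM('a) * H x + x \<bullet> h x)" by (simp only: sum_g)
  have "(LINT x:?X|lborel. real DIM('a) * H x + x \<bullet> h x) = (\<Sum>e\<in>Basis. LINT x:?X|lborel. g1 e x \<bullet> e + g2 e x \<bullet> e)"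
    unfolding sum_g[symmetric] by (rule set_integral_sum(2)[OF j])
  also have "\<dots> = (\<Sum>e\<in>Basis. (LINT x:?X|lborel. g1 e x \<bullet> e)) + (\<Sum>e\<in>Basis. (LINT x:?X|lborel. g2 e x \<bullet> e))"
    by (simp add: set_integral_add(2)[OF j1 j2] sum.distrib)
  also have "(\<Sum>e\<in>Basis. (LINT x:?X|lborel. g1 e x \<bullet> e)) = (LINT x:frontier \<Omega>|S. (x \<bullet> \<eta> x) * H x)"
  proof -
    have cHf: "continuous_on (frontier \<Omega>) H"
      by (rule continuous_on_subset[OF cH]) (use frontier_closure frontier_nonzero in auto)
    have "(\<Sum>e\<in>Basis. (LINT x:?X|lborel. g1 e x \<bullet> e)) = (\<Sum>e\<in>Basis. LINT x:frontier \<Omega>|S. (x \<bullet> e) * H x * (\<eta> x \<bullet> e))"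
      by (rule sum.cong[OF refl D1])
    also have "\<dots> = (LINT x:frontier \<Omega>|S. (\<Sum>e\<in>Basis. (x \<bullet> e) * H x * (\<eta> x \<bullet> e)))"
    proof -
      have "set_integrable S (frontier \<Omega>) (\<lambda>x. (x \<bullet> e) * H x * (\<eta> x \<bullet> e))" for e
        by (intro S_integrable continuous_intros cHf cont_\<eta>)
      from set_integral_sum(2)[OF this] show ?thesis by (rule sym)
    qed
    also have "(\<lambda>x. \<Sum>e\<in>Basis. (x \<bullet> e) * H x * (\<eta> x \<bullet> e)) = (\<lambda>x. (x \<bullet> \<eta> x) * H x)"
      by (auto simp: euclidean_inner[of _ "\<eta> _"] sum_distrib_right intro!: sum.cong)
    finally show ?thesis .
  qed
  also have "(\<Sum>e\<in>Basis. (LINT x:?X|lborel. g2 e x \<bullet> e)) = - \<epsilon> * (LINT x:sphere 0 \<epsilon>|surface_measure (sphere 0 \<epsilon>). H x)"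
  proof -
    let ?M = "surface_measure (sphere (0::'a) \<epsilon>)"
    have M: "is_surface_measure (sphere 0 \<epsilon>) ?M" using \<epsilon>(1) by (rule surface_measure_sphere)
    have hyp: "C1_hypersurface (sphere (0::'a) \<epsilon>)"
      using C1_boundary_hypersurface[OF _ exterior_ball_C1_boundary[OF \<epsilon>(1)]] by (simp add: frontier_exterior_ball[OF \<epsilon>(1)] open_Compl)
    have fin: "finite_measure ?M" by (rule finite_surface_measure[OF M _ hyp]) simp
    have cHs: "continuous_on (sphere 0 \<epsilon>) H"
      by (rule continuous_on_subset[OF cH]) (use \<epsilon> in_\<Omega> \<Omega>_closure in auto)
    have isph: "set_integrable ?M (sphere 0 \<epsilon>) (\<lambda>x. - (1 / \<epsilon>) * ((x \<bullet> e)\<^sup>2 * H x))" for e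
    proof -
      have c: "continuous_on (sphere 0 \<epsilon>) (\<lambda>x. - (1 / \<epsilon>) * ((x \<bullet> e)\<^sup>2 * H x))"
        by (intro continuous_intros cHs)
      obtain B where "\<And>x. x \<in> sphere 0 \<epsilon> \<Longrightarrow> \<bar>- (1 / \<epsilon>) * ((x \<bullet> e)\<^sup>2 * H x)\<bar> \<le> B"
        by (rule bounded_image_compact_real[OF compact_sphere c], rule that)
      then show ?thesis
        using c fin sets_surface_measure[OF M]
        by (intro set_integrable_continuous_finite[where B=B]) (auto simp: less_top[symmetric] finite_measure.emeasure_finite borel_closed)
    qed
    have "(\<Sum>e\<in>Basis. (LINT x:?X|lborel. g2 e x \<bullet> e)) = (\<Sum>e\<in>Basis. LINT x:sphere 0 \<epsilon>|?M. - (1 / \<epsilon>) * ((x \<bullet> e)\<^sup>2 * H x))"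
      by (rule sum.cong[OF refl D2])
    also have "\<dots> = (LINT x:sphere 0 \<epsilon>|?M. (\<Sum>e\<in>Basis. - (1 / \<epsilon>) * ((x \<bullet> e)\<^sup>2 * H x)))"
      by (rule set_integral_sum(2)[OF isph, symmetric])
    \<comment> \<open>The normal -x/\<epsilon> turns the components into -(x \<bullet> e)^2 /
      \<epsilon>, and the squares of the coordinates add up to \<epsilon>^2.\<close>
    also have "\<dots> = (LINT x:sphere 0 \<epsilon>|?M. - \<epsilon> * H x)"
    proof (rule set_lebesgue_integral_cong)
      show "sphere 0 \<epsilon> \<in> sets ?M" using sets_surface_measure[OF M] by simp
      have "(\<Sum>e\<in>Basis. - (1 / \<epsilon>) * ((x \<bullet> e)\<^sup>2 * H x)) = - \<epsilon> * H x" if "norm x = \<epsilon>" for x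
      proof -
        have "(\<Sum>e\<in>Basis. - (1 / \<epsilon>) * ((x \<bullet> e)\<^sup>2 * H x)) = - (1 / \<epsilon>) * ((\<Sum>e\<in>Basis. (x \<bullet> e)\<^sup>2) * H x)"
          by (simp add: sum_distrib_left sum_distrib_right)
        also have "(\<Sum>e\<in>Basis. (x \<bullet> e)\<^sup>2) = \<epsilon>\<^sup>2"
          using that euclidean_inner[of x x] by (simp add: power2_eq_square flip: power2_norm_eq_inner)
        finally show ?thesis using \<epsilon>(1) by (simp add: power2_eq_square)
      qed
      then show "\<forall>x. x \<in> sphere 0 \<epsilon> \<longrightarrow> (\<Sum>e\<in>Basis. - (1 / \<epsilon>) * ((x \<bullet> e)\<^sup>2 * H x)) = - \<epsilon> * H x" by simp
    qed
    finally show ?thesis by (simp only: set_integral_mult_right)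
  qed
  finally show "(LINT x:?X|lborel. real DIM('a) * H x + x \<bullet> h x) =
      (LINT x:frontier \<Omega>|S. (x \<bullet> \<eta> x) * H x) - \<epsilon> * (LINT x:sphere 0 \<epsilon>|surface_measure (sphere 0 \<epsilon>). H x)"
    by simp
qed

end

text \<open>At 0 the difference quotient is at most |h|^(p-1) in absolute value, which tends to 0
  because p > 1.\<close>

lemma DERIV_abs_powr:
  fixes t :: real
  assumes "1 < p"
  shows "((\<lambda>t. \<bar>t\<bar> powr p) has_real_derivative p * \<bar>t\<bar> powr (p - 1) * sgn t) (at t)"
proof -
  consider "0 < t" | "t < 0" | "t = 0" by linarith
  then show ?thesis
  proof cases
    case 1
    then have "((\<lambda>t. t powr p) has_real_derivative p * \<bar>t\<bar> powr (p - 1) * sgn t) (at t)"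
      using has_real_derivative_powr[of t p] by simp
    then show ?thesis
      by (rule has_field_derivative_transform_within_open[of _ _ _ "{0<..}"]) (use 1 in auto)
  next
    case 2
    have "((\<lambda>t. (- t) powr p) has_real_derivative (p * (- t) powr (p - 1)) * (- 1)) (at t)"
      by (rule DERIV_chain2[OF has_real_derivative_powr]) (use 2 in \<open>auto intro!: derivative_eq_intros\<close>)
    then have "((\<lambda>t. (- t) powr p) has_real_derivative p * \<bar>t\<bar> powr (p - 1) * sgn t) (at t)"
      using 2 by simp
    then show ?thesis
      by (rule has_field_derivative_transform_within_open[of _ _ _ "{..<0}"]) (use 2 in auto)
  next
    case 3
    have "((\<lambda>h::real. \<bar>h\<bar> powr (p - 1)) \<longlongrightarrow> 0) (at 0)"
      by (rule tendsto_zero_powrI[where b="p - 1"]) (use assms in \<open>auto intro: tendsto_rabs_zero\<close>)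
    moreover have "norm ((\<bar>0 + h\<bar> powr p - \<bar>0\<bar> powr p) / h) \<le> \<bar>h\<bar> powr (p - 1)" for h :: real
      using assms by (cases "h = 0") (auto simp: powr_diff abs_divide)
    ultimately have "((\<lambda>h::real. (\<bar>0 + h\<bar> powr p - \<bar>0\<bar> powr p) / h) \<longlongrightarrow> 0) (at 0)"
      using Lim_null_comparison[of "\<lambda>h::real. (\<bar>0 + h\<bar> powr p - \<bar>0\<bar> powr p) / h" "\<lambda>h. \<bar>h\<bar> powr (p - 1)" "at 0"] by simp
    then show ?thesis using 3 by (simp add: DERIV_def)
  qed
qed

text \<open>The gradient of |\<phi>|^p, as \<open>GDERIV_abs_powr\<close> shows.\<close>

definition dpow :: "real \<Rightarrow> ('a::euclidean_space \<Rightarrow> real) \<Rightarrow> 'a \<Rightarrow> 'a" where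
  "dpow p \<phi> x = (p * \<bar>\<phi> x\<bar> powr (p - 1) * sgn (\<phi> x)) *\<^sub>R gradient \<phi> x"

lemma GDERIV_abs_powr:
  assumes "1 < p" "smooth_on U \<phi>" "x \<in> U"
  shows "GDERIV (\<lambda>x. \<bar>\<phi> x\<bar> powr p) x :> dpow p \<phi> x"
  unfolding dpow_def
  by (rule GDERIV_DERIV_compose[OF smooth_on_GDERIV(1)[OF assms(2,3)] DERIV_abs_powr[OF assms(1)]])

lemma GDERIV_norm_powr:
  fixes x :: "'a::euclidean_space"
  assumes "x \<noteq> 0"
  shows "GDERIV (\<lambda>x. norm x powr a) x :> (a * norm x powr (a - 2)) *\<^sub>R x"
proof -
  have "((\<lambda>t. t powr a) has_real_derivative a * norm x powr (a - 1)) (at (norm x))"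
    by (rule has_real_derivative_powr) (use assms in simp)
  from GDERIV_DERIV_compose[OF GDERIV_norm[OF assms] this] show ?thesis
    by (rule GDERIV_subst) (use assms in \<open>simp add: sgn_div_norm powr_diff power2_eq_square divide_simps\<close>)
qed

text \<open>The right-hand side grows more slowly than the left: for a > 1 both c and d a^(1-1/p)
  are bounded by multiples of a^(1-1/p), and dividing leaves k a^(1/p) \<le> c + d. This becomes the
  a priori bound for the weighted integral outside small balls.\<close>

lemma powr_bound_solve:
  fixes a c d k p :: real
  assumes "1 < p" "0 < k" "0 \<le> a" "0 \<le> c" "0 \<le> d" "k * a \<le> c + d * a powr (1 - 1/p)"
  shows "a \<le> max 1 (((c + d) / k) powr p)"
proof (cases "a \<le> 1")
  case False
  then have a: "1 < a" by simp
  have "1 \<le> a powr (1 - 1/p)" using a assms(1) by (intro ge_one_powr_ge_zero) auto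
  then have "c * 1 \<le> c * a powr (1 - 1/p)" using assms(4) by (rule mult_left_mono)
  then have "k * a \<le> (c + d) * a powr (1 - 1/p)" using assms(6) by (simp add: distrib_right)
  moreover have "a = a powr (1/p) * a powr (1 - 1/p)" using a by (simp flip: powr_add)
  ultimately have "(k * a powr (1/p)) * a powr (1 - 1/p) \<le> (c + d) * a powr (1 - 1/p)" by (simp add: mult.assoc)
  then have "k * a powr (1/p) \<le> c + d" using a by (simp add: mult_le_cancel_right)
  then have "a powr (1/p) \<le> (c + d) / k" using assms(2) by (simp add: field_simps)
  then have "(a powr (1/p)) powr p \<le> ((c + d) / k) powr p" using assms(1) by (intro powr_mono2) auto
  then show ?thesis using a assms(1) by (simp add: powr_powr)
qed auto

section \<open>The inequality outside small balls and its limit\<close>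

context hardy_domain
begin

definition \<kappa> :: real where "\<kappa> = p - l - real DIM('a)"

lemma \<kappa>_ne: "\<kappa> \<noteq> 0" using l_ne by (simp add: \<kappa>_def)

definition W :: "'a \<Rightarrow> real" where "W x = norm x powr (l - p)"

definition mass :: "('a \<Rightarrow> real) \<Rightarrow> real" where
  "mass \<phi> = (LINT x:\<Omega>|lborel. W x * \<bar>\<phi> x\<bar> powr p)"

definition radial :: "('a \<Rightarrow> 'a) \<Rightarrow> real" where
  "radial G = (LINT x:\<Omega>|lborel. norm x powr l * \<bar>(x \<bullet> G x) / norm x\<bar> powr p)"

definition flux :: "('a \<Rightarrow> real) \<Rightarrow> real" where
  "flux \<phi> = (LINT x:frontier \<Omega>|S. (x \<bullet> \<eta> x) * (W x * \<bar>\<phi> x\<bar> powr p))"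

text \<open>The conditions of \<open>hatW_pre\<close> other than the one on small spheres; the
  boundary part of the norm is finite by continuity alone.\<close>

definition smooth_energy :: "('a \<Rightarrow> real) \<Rightarrow> bool" where
  "smooth_energy \<phi> \<longleftrightarrow> smooth_on \<Omega> \<phi> \<and> continuous_on (closure \<Omega>) \<phi> \<and>
     set_integrable lborel \<Omega> (\<lambda>x. norm x powr l * norm (gradient \<phi> x) powr p)"

lemma W_borel [measurable]: "W \<in> borel_measurable borel" unfolding W_def by measurable

lemma W_nonneg: "0 \<le> W x" by (simp add: W_def)

lemma grad_measurable:
  assumes "smooth_on \<Omega> \<phi>"
  shows "(\<lambda>x. indicator \<Omega> x *\<^sub>R gradient \<phi> x) \<in> borel_measurable borel"
    and "(\<lambda>x. indicator \<Omega> x * \<phi> x) \<in> borel_measurable borel"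
  using borel_measurable_continuous_on_indicator[OF \<Omega>_borel smooth_on_GDERIV(2)[OF assms]]
    borel_measurable_continuous_on_indicator[OF \<Omega>_borel smooth_on_GDERIV(3)[OF assms]]
  by simp_all

lemma grad_weight_measurable:
  assumes "smooth_on \<Omega> \<phi>"
  shows "(\<lambda>x. indicator \<Omega> x *\<^sub>R (norm x powr l * norm (gradient \<phi> x) powr p)) \<in> borel_measurable borel"
proof -
  define g where "g x = indicator \<Omega> x *\<^sub>R gradient \<phi> x" for x
  have [measurable]: "g \<in> borel_measurable borel" unfolding g_def by (rule grad_measurable(1)[OF assms])
  have "(\<lambda>x. norm x powr l * norm (g x) powr p) \<in> borel_measurable borel" by measurable
  also have "(\<lambda>x. norm x powr l * norm (g x) powr p) =
    (\<lambda>x. indicator \<Omega> x *\<^sub>R (norm x powr l * norm (gradient \<phi> x) powr p))"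
    using p by (auto simp: g_def indicator_def fun_eq_iff)
  finally show ?thesis .
qed

text \<open>Cauchy-Schwarz: the radial component of G is at most |G| in absolute value.\<close>

lemma radial_integrable:
  assumes G: "(\<lambda>x. indicator \<Omega> x *\<^sub>R G x) \<in> borel_measurable borel"
    and i: "set_integrable lborel \<Omega> (\<lambda>x. norm x powr l * norm (G x) powr p)"
  shows "set_integrable lborel \<Omega> (\<lambda>x. norm x powr l * \<bar>(x \<bullet> G x) / norm x\<bar> powr p)"
    and "radial G \<le> (LINT x:\<Omega>|lborel. norm x powr l * norm (G x) powr p)"
proof -
  have le: "norm x powr l * \<bar>(x \<bullet> G x) / norm x\<bar> powr p \<le> norm x powr l * norm (G x) powr p" for x
  proof -
    have "\<bar>(x \<bullet> G x) / norm x\<bar> \<le> norm (G x)"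
      using Cauchy_Schwarz_ineq2[of x "G x"] by (cases "x = 0") (auto simp: abs_divide divide_le_eq mult.commute)
    then show ?thesis using p by (intro mult_left_mono powr_mono2) auto
  qed
  define g where "g x = indicator \<Omega> x *\<^sub>R G x" for x
  have [measurable]: "g \<in> borel_measurable borel" unfolding g_def by (rule G)
  have "(\<lambda>x. norm x powr l * \<bar>(x \<bullet> g x) / norm x\<bar> powr p) \<in> borel_measurable borel" by measurable
  also have "(\<lambda>x. norm x powr l * \<bar>(x \<bullet> g x) / norm x\<bar> powr p) =
      (\<lambda>x. indicator \<Omega> x *\<^sub>R (norm x powr l * \<bar>(x \<bullet> G x) / norm x\<bar> powr p))"
    using p by (auto simp: g_def indicator_def fun_eq_iff)
  finally have m: "(\<lambda>x. indicator \<Omega> x *\<^sub>R (norm x powr l * \<bar>(x \<bullet> G x) / norm x\<bar> powr p)) \<in> borel_measurable lborel" by simp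
  show r: "set_integrable lborel \<Omega> (\<lambda>x. norm x powr l * \<bar>(x \<bullet> G x) / norm x\<bar> powr p)"
    unfolding set_integrable_def
    by (rule Bochner_Integration.integrable_bound[OF i[unfolded set_integrable_def] m])
       (use le in \<open>auto simp: indicator_def intro!: AE_I2\<close>)
  show "radial G \<le> (LINT x:\<Omega>|lborel. norm x powr l * norm (G x) powr p)"
    unfolding radial_def by (rule set_integral_mono[OF r i le])
qed

text \<open>How the weights are shared between the two Hoelder factors: |x|^((l-p)/p) goes with the
  function and |x|^(l/p) with the radial derivative. In the mixed product the exponents add up to l
  - p + 1, which is \<open>W x\<close> together with the |x| that the radial component divides
  by.\<close>

lemma weighted_split:
  assumes "x \<noteq> 0" "0 \<le> f"
  shows "(norm x powr ((l - p) / p) * f) powr (p - 1) * (norm x powr (l / p) * \<bar>(x \<bullet> G) / norm x\<bar>) = W x * f powr (p - 1) * \<bar>x \<bullet> G\<bar>"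
    and "(norm x powr ((l - p) / p) * f) powr p = W x * f powr p"
    and "(norm x powr (l / p) * \<bar>(x \<bullet> G) / norm x\<bar>) powr p = norm x powr l * \<bar>(x \<bullet> G) / norm x\<bar> powr p"
proof -
  have "(l - p) / p * (p - 1) + l / p = l - p + 1" using p by (simp add: divide_simps) (simp add: algebra_simps)
  then have "norm x powr ((l - p) / p * (p - 1)) * norm x powr (l / p) = norm x powr (l - p + 1)"
    by (simp only: powr_add[symmetric])
  also have "\<dots> = W x * norm x" using assms by (simp add: W_def powr_add)
  finally have eq1: "norm x powr ((l - p) / p * (p - 1)) * norm x powr (l / p) = W x * norm x" .
  have eq2: "(norm x powr ((l - p) / p) * f) powr (p - 1) = norm x powr ((l - p) / p * (p - 1)) * f powr (p - 1)"
    using assms by (simp add: powr_mult powr_powr)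
  have "(norm x powr ((l - p) / p) * f) powr (p - 1) * (norm x powr (l / p) * \<bar>(x \<bullet> G) / norm x\<bar>)
      = (norm x powr ((l - p) / p * (p - 1)) * norm x powr (l / p)) * (f powr (p - 1) * \<bar>(x \<bullet> G) / norm x\<bar>)"
    unfolding eq2 by (simp only: ac_simps)
  also have "\<dots> = (W x * norm x) * (f powr (p - 1) * \<bar>(x \<bullet> G) / norm x\<bar>)" by (simp only: eq1)
  finally have "(norm x powr ((l - p) / p) * f) powr (p - 1) * (norm x powr (l / p) * \<bar>(x \<bullet> G) / norm x\<bar>)
      = (W x * norm x) * (f powr (p - 1) * \<bar>(x \<bullet> G) / norm x\<bar>)" .
  then show "(norm x powr ((l - p) / p) * f) powr (p - 1) * (norm x powr (l / p) * \<bar>(x \<bullet> G) / norm x\<bar>) = W x * f powr (p - 1) * \<bar>x \<bullet> G\<bar>"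
    using assms by (simp add: abs_divide)
  show "(norm x powr ((l - p) / p) * f) powr p = W x * f powr p"
    using assms p by (simp add: powr_mult powr_powr W_def)
  show "(norm x powr (l / p) * \<bar>(x \<bullet> G) / norm x\<bar>) powr p = norm x powr l * \<bar>(x \<bullet> G) / norm x\<bar> powr p"
    using p by (subst powr_mult) (simp_all add: powr_powr)
qed

context
  fixes \<phi> :: "'a \<Rightarrow> real"
  assumes se: "smooth_energy \<phi>"
begin

lemma sm: "smooth_on \<Omega> \<phi>" and cl: "continuous_on (closure \<Omega>) \<phi>"
  and en: "set_integrable lborel \<Omega> (\<lambda>x. norm x powr l * norm (gradient \<phi> x) powr p)"
  using se by (auto simp: smooth_energy_def)

lemma annulus_integrable:
  assumes \<epsilon>: "0 < \<epsilon>"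
  shows "set_integrable lborel (\<Omega> - cball 0 \<epsilon>) (\<lambda>x. W x * \<bar>\<phi> x\<bar> powr p)"
    and "set_integrable lborel (\<Omega> - cball 0 \<epsilon>) (\<lambda>x. W x *\<^sub>R dpow p \<phi> x + \<bar>\<phi> x\<bar> powr p *\<^sub>R (((l - p) * norm x powr (l - p - 2)) *\<^sub>R x))"
proof -
  let ?X = "\<Omega> - cball 0 \<epsilon>" and ?K = "closure \<Omega> \<inter> - ball 0 \<epsilon>"
  have K: "compact ?K" using compact_closure by (intro compact_Int_closed) (auto simp: closed_Compl)
  have sub: "?X \<subseteq> ?K" using \<Omega>_closure by auto
  have nz: "x \<noteq> 0" if "x \<in> ?K" for x using that \<epsilon> by auto
  have cN: "continuous_on ?K (\<lambda>x. norm x powr a)" for a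
    by (intro continuous_intros) (use nz in auto)
  have c\<phi>: "continuous_on ?K \<phi>" by (rule continuous_on_subset[OF cl]) auto
  have c\<phi>p: "continuous_on ?K (\<lambda>x. \<bar>\<phi> x\<bar> powr q)" if "0 < q" for q
    using that by (intro continuous_on_powr' continuous_on_rabs continuous_on_const c\<phi>) auto
  have X_fin: "emeasure lborel ?X < \<infinity>"
    by (rule le_less_trans[OF emeasure_mono emeasure_\<Omega>]) auto
  have int_K: "set_integrable lborel ?X v" if v: "continuous_on ?K v" for v :: "'a \<Rightarrow> 'b::euclidean_space"
  proof -
    obtain B' where B': "\<And>x. x \<in> ?K \<Longrightarrow> \<bar>norm (v x)\<bar> \<le> B'"
      by (rule bounded_image_compact_real[OF K continuous_on_norm[OF v]], rule that)
    have "set_integrable lborel ?K v"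
      using K v B' emeasure_compact_finite[OF K]
      by (intro set_integrable_continuous_finite[where B=B']) (auto simp: borel_compact)
    then show ?thesis by (rule set_integrable_subset) (use sub in auto)
  qed
  show "set_integrable lborel ?X (\<lambda>x. W x * \<bar>\<phi> x\<bar> powr p)"
    unfolding W_def using p by (intro int_K continuous_on_mult cN c\<phi>p) auto
  obtain B where B: "0 \<le> B" "\<And>x. x \<in> ?K \<Longrightarrow> \<bar>norm x powr (- l)\<bar> \<le> B"
    by (rule bounded_image_compact_real[OF K cN], rule that)
  have ig: "set_integrable lborel ?X (gradient \<phi>)"
    unfolding set_integrable_def
  proof (rule Bochner_Integration.integrable_bound)
    have "set_integrable lborel ?X (\<lambda>x. 1 + B * (norm x powr l * norm (gradient \<phi> x) powr p))"
      by (intro set_integral_add set_integrable_mult_right set_integrable_subset[OF en] int_K) (auto intro: continuous_intros)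
    then show "integrable lborel (\<lambda>x. indicator ?X x *\<^sub>R (1 + B * (norm x powr l * norm (gradient \<phi> x) powr p)))"
      by (simp add: set_integrable_def)
    have "continuous_on ?X (gradient \<phi>)"
      by (rule continuous_on_subset[OF smooth_on_GDERIV(2)[OF sm]]) auto
    then show "(\<lambda>x. indicator ?X x *\<^sub>R gradient \<phi> x) \<in> borel_measurable lborel"
      using borel_measurable_continuous_on_indicator[of ?X "gradient \<phi>"] by simp
    \<comment> \<open>The energy controls only the p-th power with a weight: t \<le> 1 + t^p removes
      the power, and |x|^(-l) is bounded by \<open>B\<close> away from the origin.\<close>
    have le: "norm (gradient \<phi> x) \<le> 1 + B * (norm x powr l * norm (gradient \<phi> x) powr p)" if x: "x \<in> ?X" for x
    proof -
      have "norm (gradient \<phi> x) \<le> 1 + norm (gradient \<phi> x) powr p"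
      proof (cases "norm (gradient \<phi> x) \<le> 1")
        case False
        then have "norm (gradient \<phi> x) powr 1 \<le> norm (gradient \<phi> x) powr p" using p by (intro powr_mono) auto
        then show ?thesis using False by simp
      qed (simp add: add_increasing2)
      also have "norm (gradient \<phi> x) powr p = norm x powr (- l) * (norm x powr l * norm (gradient \<phi> x) powr p)"
        using nz[OF subsetD[OF sub x]] by (simp flip: mult.assoc powr_add)
      also have "\<dots> \<le> B * (norm x powr l * norm (gradient \<phi> x) powr p)"
        using B(2)[OF subsetD[OF sub x]] by (intro mult_right_mono) auto
      finally show ?thesis by simp
    qed
    show "AE x in lborel. norm (indicator ?X x *\<^sub>R gradient \<phi> x) \<le> norm (indicator ?X x *\<^sub>R (1 + B * (norm x powr l * norm (gradient \<phi> x) powr p)))"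
    proof (rule AE_I2)
      fix x
      show "norm (indicator ?X x *\<^sub>R gradient \<phi> x) \<le> norm (indicator ?X x *\<^sub>R (1 + B * (norm x powr l * norm (gradient \<phi> x) powr p)))"
        using le[of x] by (cases "x \<in> ?X") auto
    qed
  qed
  have "set_integrable lborel ?X (\<lambda>x. (W x * (p * \<bar>\<phi> x\<bar> powr (p - 1) * sgn (\<phi> x))) *\<^sub>R gradient \<phi> x)"
  proof -
    have c: "continuous_on ?K (\<lambda>x. W x * (p * \<bar>\<phi> x\<bar> powr (p - 1)))"
      unfolding W_def using p by (intro continuous_on_mult continuous_on_const cN c\<phi>p) auto
    obtain B where B: "\<And>x. x \<in> ?K \<Longrightarrow> \<bar>W x * (p * \<bar>\<phi> x\<bar> powr (p - 1))\<bar> \<le> B"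
      by (rule bounded_image_compact_real[OF K c], rule that)
    show ?thesis
    proof (rule set_integrable_bounded_mult[OF ig, where B=B])
      have m: "(\<lambda>x. indicator ?X x *\<^sub>R \<phi> x) \<in> borel_measurable borel"
        by (rule borel_measurable_continuous_on_indicator) (auto intro: continuous_on_subset[OF smooth_on_GDERIV(3)[OF sm]])
      then have "(\<lambda>x. W x * (p * \<bar>indicator ?X x *\<^sub>R \<phi> x\<bar> powr (p - 1) * sgn (indicator ?X x *\<^sub>R \<phi> x))) \<in> borel_measurable borel"
        by measurable
      also have "(\<lambda>x. W x * (p * \<bar>indicator ?X x *\<^sub>R \<phi> x\<bar> powr (p - 1) * sgn (indicator ?X x *\<^sub>R \<phi> x))) =
         (\<lambda>x. indicator ?X x *\<^sub>R (W x * (p * \<bar>\<phi> x\<bar> powr (p - 1) * sgn (\<phi> x))))"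
        by (auto simp: indicator_def fun_eq_iff)
      finally show "set_borel_measurable lborel ?X (\<lambda>x. W x * (p * \<bar>\<phi> x\<bar> powr (p - 1) * sgn (\<phi> x)))"
        by (simp add: set_borel_measurable_def)
      fix x assume x: "x \<in> ?X"
      have "\<bar>W x * (p * \<bar>\<phi> x\<bar> powr (p - 1) * sgn (\<phi> x))\<bar> \<le> \<bar>W x * (p * \<bar>\<phi> x\<bar> powr (p - 1))\<bar>"
        by (simp add: abs_mult sgn_real_def)
      then show "\<bar>W x * (p * \<bar>\<phi> x\<bar> powr (p - 1) * sgn (\<phi> x))\<bar> \<le> B" using B[OF subsetD[OF sub x]] by linarith
    qed
  qed
  then have 1: "set_integrable lborel ?X (\<lambda>x. W x *\<^sub>R dpow p \<phi> x)" by (simp add: dpow_def)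
  have 2: "set_integrable lborel ?X (\<lambda>x. \<bar>\<phi> x\<bar> powr p *\<^sub>R (((l - p) * norm x powr (l - p - 2)) *\<^sub>R x))"
    using p by (intro int_K continuous_on_scaleR continuous_on_mult continuous_on_const continuous_on_id cN c\<phi>p) auto
  show "set_integrable lborel ?X (\<lambda>x. W x *\<^sub>R dpow p \<phi> x + \<bar>\<phi> x\<bar> powr p *\<^sub>R (((l - p) * norm x powr (l - p - 2)) *\<^sub>R x))"
    by (rule set_integral_add(1)[OF 1 2])
qed

text \<open>\<open>radial_flux\<close> for H = W |\<phi>|^p. The weight is homogeneous of degree l -
  p, so x \<bullet> \<nabla>W = (l - p) W, and together with n from the divergence of x this gives
  -\<kappa>. On the small sphere the weight is the constant \<epsilon>^(l-p).\<close>

lemma annulus_identity: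
  assumes \<epsilon>: "0 < \<epsilon>" "\<epsilon> < \<rho>"
  shows "set_integrable lborel (\<Omega> - cball 0 \<epsilon>) (\<lambda>x. W x * (x \<bullet> dpow p \<phi> x))"
    and "(LINT x:\<Omega> - cball 0 \<epsilon>|lborel. W x * (x \<bullet> dpow p \<phi> x)) = \<kappa> * (LINT x:\<Omega> - cball 0 \<epsilon>|lborel. W x * \<bar>\<phi> x\<bar> powr p)
      + flux \<phi> - \<epsilon> powr (l - p + 1) * (LINT x:sphere 0 \<epsilon>|surface_measure (sphere 0 \<epsilon>). \<bar>\<phi> x\<bar> powr p)"
proof -
  let ?X = "\<Omega> - cball 0 \<epsilon>"
  let ?H = "\<lambda>x. W x * \<bar>\<phi> x\<bar> powr p"
  let ?h = "\<lambda>x. W x *\<^sub>R dpow p \<phi> x + \<bar>\<phi> x\<bar> powr p *\<^sub>R (((l - p) * norm x powr (l - p - 2)) *\<^sub>R x)"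
  have dH: "GDERIV ?H x :> ?h x" if "x \<in> \<Omega> - {0}" for x
    unfolding W_def using that by (intro GDERIV_mult GDERIV_abs_powr[OF p sm] GDERIV_norm_powr) auto
  have cH: "continuous_on (closure \<Omega> - {0}) ?H"
    unfolding W_def
  proof (rule continuous_on_mult)
    show "continuous_on (closure \<Omega> - {0}) (\<lambda>x. norm x powr (l - p))" by (intro continuous_intros) auto
    show "continuous_on (closure \<Omega> - {0}) (\<lambda>x. \<bar>\<phi> x\<bar> powr p)"
      using p by (intro continuous_on_powr' continuous_on_rabs continuous_on_subset[OF cl] continuous_on_const) auto
  qed
  note fl = radial_flux[OF \<epsilon> cH dH annulus_integrable(2)[OF \<epsilon>(1)]]
  have eq: "real DIM('a) * ?H x + x \<bullet> ?h x = W x * (x \<bullet> dpow p \<phi> x) - \<kappa> * ?H x" if "x \<in> ?X" for x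
  proof -
    have x0: "x \<noteq> 0" using that \<epsilon> by auto
    have "norm x powr (l - p - 2) * (x \<bullet> x) = W x"
      using x0 by (simp add: W_def powr_diff powr_numeral flip: power2_norm_eq_inner)
    then have "x \<bullet> ?h x = W x * (x \<bullet> dpow p \<phi> x) + (l - p) * ?H x"
      by (simp add: inner_add_right mult.commute mult.left_commute)
    then show ?thesis by (simp add: \<kappa>_def algebra_simps)
  qed
  have i0: "set_integrable lborel ?X (\<lambda>x. W x * (x \<bullet> dpow p \<phi> x) - \<kappa> * ?H x)"
  proof -
    have "(\<lambda>x. indicator ?X x *\<^sub>R (real DIM('a) * ?H x + x \<bullet> ?h x)) =
      (\<lambda>x. indicator ?X x *\<^sub>R (W x * (x \<bullet> dpow p \<phi> x) - \<kappa> * ?H x))"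
    proof
      fix x show "indicator ?X x *\<^sub>R (real DIM('a) * ?H x + x \<bullet> ?h x) = indicator ?X x *\<^sub>R (W x * (x \<bullet> dpow p \<phi> x) - \<kappa> * ?H x)"
      proof (cases "x \<in> ?X")
        case True
        show ?thesis unfolding eq[OF True] ..
      qed simp
    qed
    then show ?thesis using fl(1) by (simp only: set_integrable_def)
  qed
  have iH: "set_integrable lborel ?X (\<lambda>x. \<kappa> * ?H x)"
    by (rule set_integrable_mult_right) (rule annulus_integrable(1)[OF \<epsilon>(1)])
  have "set_integrable lborel ?X (\<lambda>x. (W x * (x \<bullet> dpow p \<phi> x) - \<kappa> * ?H x) + \<kappa> * ?H x)"
    by (rule set_integral_add(1)[OF i0 iH])
  then show i1: "set_integrable lborel ?X (\<lambda>x. W x * (x \<bullet> dpow p \<phi> x))" by simp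
  have "(LINT x:?X|lborel. W x * (x \<bullet> dpow p \<phi> x)) - \<kappa> * (LINT x:?X|lborel. ?H x)
     = (LINT x:?X|lborel. W x * (x \<bullet> dpow p \<phi> x) - \<kappa> * ?H x)"
    using set_integral_diff(2)[OF i1 iH] by simp
  also have "\<dots> = (LINT x:?X|lborel. real DIM('a) * ?H x + x \<bullet> ?h x)"
    by (rule set_lebesgue_integral_cong) (simp, intro allI impI eq[symmetric])
  also have "\<dots> = flux \<phi> - \<epsilon> * (LINT x:sphere 0 \<epsilon>|surface_measure (sphere 0 \<epsilon>). ?H x)"
    using fl(2) by (simp only: flux_def)
  also have "(LINT x:sphere 0 \<epsilon>|surface_measure (sphere 0 \<epsilon>). ?H x) = (LINT x:sphere 0 \<epsilon>|surface_measure (sphere 0 \<epsilon>). \<epsilon> powr (l - p) * \<bar>\<phi> x\<bar> powr p)"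
    by (rule set_lebesgue_integral_cong)
       (use sets_surface_measure[OF surface_measure_sphere[OF \<epsilon>(1), where 'a='a]] in \<open>auto simp: W_def\<close>)
  finally have fin: "(LINT x:?X|lborel. W x * (x \<bullet> dpow p \<phi> x)) - \<kappa> * (LINT x:?X|lborel. ?H x) =
     flux \<phi> - \<epsilon> * (LINT x:sphere 0 \<epsilon>|surface_measure (sphere 0 \<epsilon>). \<epsilon> powr (l - p) * \<bar>\<phi> x\<bar> powr p)" .
  show "(LINT x:?X|lborel. W x * (x \<bullet> dpow p \<phi> x)) = \<kappa> * (LINT x:?X|lborel. ?H x)
      + flux \<phi> - \<epsilon> powr (l - p + 1) * (LINT x:sphere 0 \<epsilon>|surface_measure (sphere 0 \<epsilon>). \<bar>\<phi> x\<bar> powr p)"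
  proof -
    have "\<epsilon> powr (l - p + 1) = \<epsilon> * \<epsilon> powr (l - p)" using \<epsilon>(1) by (simp add: powr_add)
    then show ?thesis using fin by (simp add: algebra_simps)
  qed
qed

text \<open>The radial energy on the right is taken over all of \<Omega>, so that this factor does
  not depend on \<epsilon>.\<close>

lemma annulus_hoelder:
  assumes \<epsilon>: "0 < \<epsilon>" "\<epsilon> < \<rho>"
  shows "\<bar>LINT x:\<Omega> - cball 0 \<epsilon>|lborel. W x * (x \<bullet> dpow p \<phi> x)\<bar> \<le>
    p * (LINT x:\<Omega> - cball 0 \<epsilon>|lborel. W x * \<bar>\<phi> x\<bar> powr p) powr (1 - 1/p) * radial (gradient \<phi>) powr (1/p)"
proof -
  let ?X = "\<Omega> - cball 0 \<epsilon>"
  have [measurable]: "?X \<in> sets borel" by auto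
  define f0 where "f0 x = indicator \<Omega> x * \<phi> x" for x
  define g0 where "g0 x = indicator \<Omega> x *\<^sub>R gradient \<phi> x" for x
  have [measurable]: "f0 \<in> borel_measurable borel" "g0 \<in> borel_measurable borel"
    unfolding f0_def g0_def by (rule grad_measurable[OF sm])+
  note R = radial_integrable[OF grad_measurable(1)[OF sm] en]
  define a where "a x = norm x powr ((l - p) / p) * \<bar>indicator ?X x * f0 x\<bar>" for x
  define b where "b x = norm x powr (l / p) * \<bar>(x \<bullet> (indicator ?X x *\<^sub>R g0 x)) / norm x\<bar>" for x
  have m [measurable]: "a \<in> borel_measurable lborel" "b \<in> borel_measurable lborel"
    unfolding a_def b_def by measurable
  have x0: "x \<noteq> 0" if "x \<in> ?X" for x using that \<epsilon> by auto
  have ap: "a x powr p = indicator ?X x *\<^sub>R (W x * \<bar>\<phi> x\<bar> powr p)" for x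
    using p weighted_split(2)[OF x0, of x "\<bar>\<phi> x\<bar>"] by (cases "x \<in> ?X") (auto simp: a_def f0_def)
  have bp: "b x powr p = indicator ?X x *\<^sub>R (norm x powr l * \<bar>(x \<bullet> gradient \<phi> x) / norm x\<bar> powr p)" for x
    using p weighted_split(3)[OF x0, of x 0 "gradient \<phi> x"] by (cases "x \<in> ?X") (auto simp: b_def g0_def)
  have ab: "a x powr (p - 1) * b x = indicator ?X x *\<^sub>R (W x * \<bar>\<phi> x\<bar> powr (p - 1) * \<bar>x \<bullet> gradient \<phi> x\<bar>)" for x
    using p weighted_split(1)[OF x0, of x "\<bar>\<phi> x\<bar>" "gradient \<phi> x"] by (cases "x \<in> ?X") (auto simp: a_def b_def f0_def g0_def)
  have ia: "integrable lborel (\<lambda>x. a x powr p)"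
    unfolding ap using annulus_integrable(1)[OF \<epsilon>(1)] by (simp add: set_integrable_def)
  have sR: "set_integrable lborel ?X (\<lambda>x. norm x powr l * \<bar>(x \<bullet> gradient \<phi> x) / norm x\<bar> powr p)"
    by (rule set_integrable_subset[OF R(1)]) auto
  then have ib: "integrable lborel (\<lambda>x. b x powr p)" unfolding bp by (simp add: set_integrable_def)
  have nn: "0 \<le> a x" "0 \<le> b x" for x by (auto simp: a_def b_def)
  note H = Hoelder_real[OF p m nn ia ib]
  have "\<bar>LINT x:?X|lborel. W x * (x \<bullet> dpow p \<phi> x)\<bar> \<le> (LINT x:?X|lborel. \<bar>W x * (x \<bullet> dpow p \<phi> x)\<bar>)"
    unfolding set_lebesgue_integral_def
    by (rule order_trans[OF integral_abs_bound]) (simp add: abs_mult)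
  also have "\<dots> \<le> (LINT x|lborel. p * (a x powr (p - 1) * b x))"
    unfolding set_lebesgue_integral_def
  proof (rule integral_mono)
    show "integrable lborel (\<lambda>x. indicator ?X x *\<^sub>R \<bar>W x * (x \<bullet> dpow p \<phi> x)\<bar>)"
      using set_integrable_abs[OF annulus_identity(1)[OF \<epsilon>]] by (simp add: set_integrable_def)
    show "integrable lborel (\<lambda>x. p * (a x powr (p - 1) * b x))" by (intro integrable_mult_right H(1))
    show "indicator ?X x *\<^sub>R \<bar>W x * (x \<bullet> dpow p \<phi> x)\<bar> \<le> p * (a x powr (p - 1) * b x)" for x
      unfolding ab using p W_nonneg[of x]
      by (cases "x \<in> ?X") (auto simp: dpow_def abs_mult sgn_real_def mult.assoc mult.left_commute)
  qed
  also have "\<dots> = p * (LINT x|lborel. a x powr (p - 1) * b x)" by simp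
  also have "\<dots> \<le> p * ((LINT x|lborel. a x powr p) powr (1 - 1/p) * (LINT x|lborel. b x powr p) powr (1/p))"
    using p by (intro mult_left_mono H(2)) auto
  also have "\<dots> \<le> p * ((LINT x:?X|lborel. W x * \<bar>\<phi> x\<bar> powr p) powr (1 - 1/p) * radial (gradient \<phi>) powr (1/p))"
  proof -
    have "(LINT x|lborel. b x powr p) \<le> radial (gradient \<phi>)"
      unfolding radial_def set_lebesgue_integral_def bp
      by (rule integral_mono) (use sR R(1) in \<open>auto simp: set_integrable_def indicator_def\<close>)
    then have "(LINT x|lborel. b x powr p) powr (1/p) \<le> radial (gradient \<phi>) powr (1/p)"
      using p by (intro powr_mono2) auto
    then show ?thesis using p unfolding ap set_lebesgue_integral_def by (intro mult_left_mono) auto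
  qed
  finally show ?thesis by (simp add: mult.assoc)
qed

text \<open>Integrability and inequality come together. On the sets \<open>X k\<close> the integral
  satisfies an inequality with a sublinear right-hand side, so \<open>powr_bound_solve\<close>
  bounds it uniformly. Monotone convergence then gives the integral over \<Omega>, and the
  inequality passes to the limit because the sphere terms tend to zero.\<close>

lemma hardy_smooth:
  assumes sphere: "((\<lambda>\<epsilon>. \<epsilon> powr (l - p + 1) *
        (LINT x:sphere_in \<Omega> \<epsilon>|surface_measure (sphere_in \<Omega> \<epsilon>). \<bar>\<phi> x\<bar> powr p)) \<longlongrightarrow> 0) (at_right 0)"
  shows "set_integrable lborel \<Omega> (\<lambda>x. W x * \<bar>\<phi> x\<bar> powr p)"
    and "\<bar>\<kappa>\<bar> * mass \<phi> + sgn \<kappa> * flux \<phi> \<le> p * mass \<phi> powr (1 - 1/p) * radial (gradient \<phi>) powr (1/p)"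
proof -
  \<comment> \<open>The shift by 2 keeps every radius, including the first, strictly below
    \<rho>.\<close>
  define \<epsilon> where "\<epsilon> k = \<rho> / real (k + 2)" for k
  have \<epsilon>: "0 < \<epsilon> k" "\<epsilon> k < \<rho>" for k using \<rho>(1) by (auto simp: \<epsilon>_def divide_less_eq)
  have \<epsilon>_mono: "\<epsilon> j \<le> \<epsilon> i" if "i \<le> j" for i j
    unfolding \<epsilon>_def using that \<rho>(1) by (intro divide_left_mono) auto
  have "\<epsilon> \<longlonglongrightarrow> 0"
    unfolding \<epsilon>_def using LIMSEQ_ignore_initial_segment[OF lim_const_over_n[of \<rho>], of 2] by simp
  then have lim\<epsilon>: "filterlim \<epsilon> (at_right 0) sequentially"
    unfolding filterlim_at using \<epsilon>(1) by (auto intro!: always_eventually simp: less_imp_neq[OF \<epsilon>(1), symmetric])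
  define X where "X k = \<Omega> - cball 0 (\<epsilon> k)" for k
  define s where "s k = \<epsilon> k powr (l - p + 1) * (LINT x:sphere 0 (\<epsilon> k)|surface_measure (sphere 0 (\<epsilon> k)). \<bar>\<phi> x\<bar> powr p)" for k
  have "sphere_in \<Omega> (\<epsilon> k) = sphere 0 (\<epsilon> k)" for k
    using \<rho>(2) \<epsilon>(2)[of k] by (auto simp: sphere_in_def subset_iff)
  then have s0: "s \<longlonglongrightarrow> 0" using filterlim_compose[OF sphere lim\<epsilon>] by (simp add: s_def[abs_def])
  then obtain Sb where Sb: "\<And>k. \<bar>s k\<bar> \<le> Sb"
    using convergent_imp_Bseq[of s] by (auto simp: convergent_def Bseq_def)
  define a where "a k = (LINT x:X k|lborel. W x * \<bar>\<phi> x\<bar> powr p)" for k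
  let ?R = "radial (gradient \<phi>) powr (1/p)"
  have iX: "set_integrable lborel (X k) (\<lambda>x. W x * \<bar>\<phi> x\<bar> powr p)" for k
    unfolding X_def by (rule annulus_integrable(1)[OF \<epsilon>(1)])
  have a0: "0 \<le> a k" for k
    unfolding a_def set_lebesgue_integral_def by (intro Bochner_Integration.integral_nonneg) (auto simp: W_nonneg)
  have main: "\<bar>\<kappa>\<bar> * a k + sgn \<kappa> * flux \<phi> \<le> sgn \<kappa> * s k + p * a k powr (1 - 1/p) * ?R" for k
  proof -
    let ?T = "LINT x:X k|lborel. W x * (x \<bullet> dpow p \<phi> x)"
    have T: "?T = \<kappa> * a k + flux \<phi> - s k"
      using annulus_identity(2)[OF \<epsilon>[of k]] by (simp add: X_def a_def s_def)
    have "\<bar>?T\<bar> \<le> p * a k powr (1 - 1/p) * ?R"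
      using annulus_hoelder[OF \<epsilon>[of k]] by (simp add: X_def a_def)
    \<comment> \<open>Multiplication by the sign of \<kappa> turns \<kappa> a into |\<kappa>| a and
      produces the sign in front of the boundary term, so both signs of \<kappa> are treated at
      once.\<close>
    moreover have "sgn \<kappa> * ?T \<le> \<bar>?T\<bar>" by (simp add: sgn_real_def abs_if)
    moreover have "sgn \<kappa> * ?T = \<bar>\<kappa>\<bar> * a k + sgn \<kappa> * flux \<phi> - sgn \<kappa> * s k"
      unfolding T by (simp add: sgn_real_def abs_if algebra_simps)
    ultimately show ?thesis by linarith
  qed
  have Sb0: "0 \<le> Sb" using Sb[of 0] by linarith
  have R0: "0 \<le> p * ?R" using p by simp
  have bound: "a k \<le> max 1 (((Sb + \<bar>flux \<phi>\<bar> + p * ?R) / \<bar>\<kappa>\<bar>) powr p)" for k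
  proof (rule powr_bound_solve[OF p _ a0])
    have "sgn \<kappa> * s k \<le> Sb" "- (sgn \<kappa> * flux \<phi>) \<le> \<bar>flux \<phi>\<bar>"
      using Sb[of k] Sb0 by (auto simp: sgn_real_def)
    then show "\<bar>\<kappa>\<bar> * a k \<le> Sb + \<bar>flux \<phi>\<bar> + p * ?R * a k powr (1 - 1/p)"
      using main[of k] by (simp add: mult.commute mult.left_commute)
  qed (use \<kappa>_ne Sb0 R0 in auto)
  have X_mono: "X i \<subseteq> X j" if "i \<le> j" for i j using \<epsilon>_mono[OF that] by (auto simp: X_def)
  have a_mono: "incseq a"
  proof (rule incseq_SucI)
    fix k
    show "a k \<le> a (Suc k)"
      unfolding a_def set_lebesgue_integral_def
      by (rule integral_mono) (use iX X_mono[of k "Suc k"] W_nonneg in \<open>auto simp: set_integrable_def indicator_def\<close>)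
  qed
  obtain L where L: "a \<longlonglongrightarrow> L"
    using incseq_convergent[OF a_mono, of "max 1 (((Sb + \<bar>flux \<phi>\<bar> + p * ?R) / \<bar>\<kappa>\<bar>) powr p)"] bound by blast
  have conv: "integrable lborel (\<lambda>x. indicator \<Omega> x *\<^sub>R (W x * \<bar>\<phi> x\<bar> powr p))"
    "(LINT x|lborel. indicator \<Omega> x *\<^sub>R (W x * \<bar>\<phi> x\<bar> powr p)) = L"
  proof -
    let ?f = "\<lambda>k x. indicator (X k) x *\<^sub>R (W x * \<bar>\<phi> x\<bar> powr p)"
    have 1: "integrable lborel (?f k)" for k using iX[of k] by (simp add: set_integrable_def)
    have 2: "AE x in lborel. mono (\<lambda>k. ?f k x)"
    proof (rule AE_I2)
      fix x show "mono (\<lambda>k. ?f k x)"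
        using X_mono W_nonneg[of x] by (auto simp: mono_def indicator_def subset_iff)
    qed
    have 3: "AE x in lborel. (\<lambda>k. ?f k x) \<longlonglongrightarrow> indicator \<Omega> x *\<^sub>R (W x * \<bar>\<phi> x\<bar> powr p)"
    proof (rule AE_I2)
      fix x
      show "(\<lambda>k. ?f k x) \<longlonglongrightarrow> indicator \<Omega> x *\<^sub>R (W x * \<bar>\<phi> x\<bar> powr p)"
      proof (cases "x = 0")
        case False
        then have "\<forall>\<^sub>F k in sequentially. \<epsilon> k < norm x"
          using order_tendstoD(2)[OF \<open>\<epsilon> \<longlonglongrightarrow> 0\<close>, of "norm x"] by simp
        then have "\<forall>\<^sub>F k in sequentially. ?f k x = indicator \<Omega> x *\<^sub>R (W x * \<bar>\<phi> x\<bar> powr p)"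
          by eventually_elim (auto simp: X_def indicator_def)
        then show ?thesis by (rule tendsto_eventually)
      qed (simp add: W_def)
    qed
    have 4: "(\<lambda>k. LINT x|lborel. ?f k x) \<longlonglongrightarrow> L" using L by (simp add: a_def[abs_def] set_lebesgue_integral_def)
    define f0 where "f0 x = indicator \<Omega> x * \<phi> x" for x
    have [measurable]: "f0 \<in> borel_measurable borel" unfolding f0_def by (rule grad_measurable(2)[OF sm])
    have "(\<lambda>x. W x * \<bar>f0 x\<bar> powr p) \<in> borel_measurable lborel" by measurable
    also have "(\<lambda>x. W x * \<bar>f0 x\<bar> powr p) = (\<lambda>x. indicator \<Omega> x *\<^sub>R (W x * \<bar>\<phi> x\<bar> powr p))"
      using p by (auto simp: f0_def indicator_def fun_eq_iff)
    finally have 5: "(\<lambda>x. indicator \<Omega> x *\<^sub>R (W x * \<bar>\<phi> x\<bar> powr p)) \<in> borel_measurable lborel" .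
    show "integrable lborel (\<lambda>x. indicator \<Omega> x *\<^sub>R (W x * \<bar>\<phi> x\<bar> powr p))"
      by (rule integrable_monotone_convergence[OF 1 2 3 4 5])
    show "(LINT x|lborel. indicator \<Omega> x *\<^sub>R (W x * \<bar>\<phi> x\<bar> powr p)) = L"
      by (rule integral_monotone_convergence[OF 1 2 3 4 5])
  qed
  show "set_integrable lborel \<Omega> (\<lambda>x. W x * \<bar>\<phi> x\<bar> powr p)" using conv(1) by (simp add: set_integrable_def)
  have mL: "mass \<phi> = L" using conv(2) by (simp add: mass_def set_lebesgue_integral_def)
  have L0: "0 \<le> L" using LIMSEQ_le_const[OF L] a0 by blast
  have "(\<lambda>k. \<bar>\<kappa>\<bar> * a k + sgn \<kappa> * flux \<phi>) \<longlonglongrightarrow> \<bar>\<kappa>\<bar> * L + sgn \<kappa> * flux \<phi>"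
    by (intro tendsto_intros L)
  \<comment> \<open>The limit \<open>L\<close> may be zero; nonnegativity of \<open>a\<close> and
    positivity of 1 - 1/p make the power continuous there as well.\<close>
  moreover have "(\<lambda>k. sgn \<kappa> * s k + p * a k powr (1 - 1/p) * ?R) \<longlonglongrightarrow> sgn \<kappa> * 0 + p * L powr (1 - 1/p) * ?R"
    using a0 p by (intro tendsto_intros s0 tendsto_powr' L) auto
  ultimately have "\<bar>\<kappa>\<bar> * L + sgn \<kappa> * flux \<phi> \<le> sgn \<kappa> * 0 + p * L powr (1 - 1/p) * ?R"
    by (rule LIMSEQ_le) (use main in auto)
  then show "\<bar>\<kappa>\<bar> * mass \<phi> + sgn \<kappa> * flux \<phi> \<le> p * mass \<phi> powr (1 - 1/p) * ?R" by (simp add: mL)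
qed

end

end

section \<open>Estimates by the norm and traces\<close>

context hardy_domain
begin

definition dirichlet :: "('a \<Rightarrow> real) \<Rightarrow> real" where
  "dirichlet \<phi> = (LINT x:\<Omega>|lborel. norm x powr l * norm (gradient \<phi> x) powr p)"

lemma boundary_minus_eq: "boundary_minus \<Omega> p l = {x \<in> frontier \<Omega>. sgn \<kappa> * (x \<bullet> \<eta> x) < 0}"
  by (simp add: boundary_minus_def \<kappa>_def)

lemma boundary_minus_borel [measurable]: "boundary_minus \<Omega> p l \<in> sets borel"
proof -
  have "(\<lambda>x. indicator (frontier \<Omega>) x *\<^sub>R (sgn \<kappa> * (x \<bullet> \<eta> x))) \<in> borel_measurable borel"
    by (intro borel_measurable_continuous_on_indicator continuous_intros cont_\<eta>) simp
  from measurable_sets[OF this, of "{..<0}"]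
  have "frontier \<Omega> \<inter> (\<lambda>x. indicator (frontier \<Omega>) x *\<^sub>R (sgn \<kappa> * (x \<bullet> \<eta> x))) -` {..<0} \<in> sets borel" by auto
  also have "frontier \<Omega> \<inter> (\<lambda>x. indicator (frontier \<Omega>) x *\<^sub>R (sgn \<kappa> * (x \<bullet> \<eta> x))) -` {..<0} = boundary_minus \<Omega> p l"
    by (auto simp: boundary_minus_eq)
  finally show ?thesis .
qed

lemma frontier_powr_cont:
  assumes "continuous_on (closure \<Omega>) \<phi>"
  shows "continuous_on (frontier \<Omega>) (\<lambda>x. W x * \<bar>\<phi> x\<bar> powr p)"
  unfolding W_def
proof (rule continuous_on_mult)
  show "continuous_on (frontier \<Omega>) (\<lambda>x. norm x powr (l - p))"
    by (intro continuous_intros) (use frontier_nonzero in auto)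
  show "continuous_on (frontier \<Omega>) (\<lambda>x. \<bar>\<phi> x\<bar> powr p)"
    using p by (intro continuous_on_powr' continuous_on_rabs continuous_on_subset[OF assms frontier_closure] continuous_on_const) auto
qed

lemma boundary_minus_integrable:
  assumes "continuous_on (closure \<Omega>) \<phi>"
  shows "set_integrable S (boundary_minus \<Omega> p l) (\<lambda>x. \<bar>x \<bullet> \<eta> x\<bar> * norm x powr (l - p) * \<bar>\<phi> x\<bar> powr p)"
proof -
  have "set_integrable S (frontier \<Omega>) (\<lambda>x. \<bar>x \<bullet> \<eta> x\<bar> * (W x * \<bar>\<phi> x\<bar> powr p))"
    by (intro S_integrable continuous_on_mult continuous_on_rabs continuous_on_inner continuous_on_id cont_\<eta> frontier_powr_cont assms)
  then have "set_integrable S (boundary_minus \<Omega> p l) (\<lambda>x. \<bar>x \<bullet> \<eta> x\<bar> * (W x * \<bar>\<phi> x\<bar> powr p))"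
    by (rule set_integrable_subset) (auto simp: boundary_minus_eq[symmetric], simp add: boundary_minus_eq)
  then show ?thesis by (simp add: W_def mult.assoc)
qed

lemma pre_iff: "\<phi> \<in> hatW_pre \<Omega> p l \<longleftrightarrow> smooth_energy \<phi> \<and>
    ((\<lambda>\<epsilon>. \<epsilon> powr (l - p + 1) * (LINT x:sphere_in \<Omega> \<epsilon>|surface_measure (sphere_in \<Omega> \<epsilon>). \<bar>\<phi> x\<bar> powr p)) \<longlongrightarrow> 0) (at_right 0)"
  using set_integrable_lebesgue_lborel(1)[OF grad_weight_measurable[of \<phi>]] boundary_minus_integrable[of \<phi>]
  unfolding hatW_pre_def smooth_energy_def hatW_finite_norm_def by auto

lemma pre_energy: "\<phi> \<in> hatW_pre \<Omega> p l \<Longrightarrow> smooth_energy \<phi>"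
  by (simp add: pre_iff)

lemma hatW_norm_eq:
  assumes "smooth_energy \<phi>"
  shows "hatW_norm \<Omega> p l \<phi> = dirichlet \<phi> powr (1/p) + (((p - 1) / p) powr (p - 1) *
     (LINT x:boundary_minus \<Omega> p l|S. \<bar>x \<bullet> \<eta> x\<bar> * (W x * \<bar>\<phi> x\<bar> powr p))) powr (1/p)"
  using set_integrable_lebesgue_lborel(2)[OF grad_weight_measurable[of \<phi>]] assms
  by (simp add: hatW_norm_def dirichlet_def smooth_energy_def W_def mult.assoc)

lemma dirichlet_nonneg: "0 \<le> dirichlet \<phi>"
  unfolding dirichlet_def set_lebesgue_integral_def by (intro Bochner_Integration.integral_nonneg) auto

lemma radial_nonneg: "0 \<le> radial G"
  unfolding radial_def set_lebesgue_integral_def by (intro Bochner_Integration.integral_nonneg) auto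

lemma mass_nonneg: "0 \<le> mass \<phi>"
  unfolding mass_def set_lebesgue_integral_def
  by (intro Bochner_Integration.integral_nonneg) (auto simp: W_nonneg)

lemma dirichlet_le_norm:
  assumes "smooth_energy \<phi>" shows "dirichlet \<phi> \<le> hatW_norm \<Omega> p l \<phi> powr p"
proof -
  have "dirichlet \<phi> powr (1/p) \<le> hatW_norm \<Omega> p l \<phi>" by (simp add: hatW_norm_eq[OF assms])
  then have "(dirichlet \<phi> powr (1/p)) powr p \<le> hatW_norm \<Omega> p l \<phi> powr p" using p by (intro powr_mono2) auto
  then show ?thesis using p dirichlet_nonneg by (simp add: powr_powr)
qed

lemma hatW_norm_nonneg: "smooth_energy \<phi> \<Longrightarrow> 0 \<le> hatW_norm \<Omega> p l \<phi>"
  by (simp add: hatW_norm_eq)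

lemma flux_lower:
  assumes c: "continuous_on (closure \<Omega>) \<phi>"
  shows "- (LINT x:boundary_minus \<Omega> p l|S. \<bar>x \<bullet> \<eta> x\<bar> * (W x * \<bar>\<phi> x\<bar> powr p)) \<le> sgn \<kappa> * flux \<phi>"
proof -
  let ?h = "\<lambda>x. W x * \<bar>\<phi> x\<bar> powr p" and ?m = "boundary_minus \<Omega> p l"
  have i1: "integrable S (\<lambda>x. indicator (frontier \<Omega>) x *\<^sub>R (sgn \<kappa> * ((x \<bullet> \<eta> x) * ?h x)))"
    using S_integrable[of "\<lambda>x. sgn \<kappa> * ((x \<bullet> \<eta> x) * ?h x)"]
    by (simp add: set_integrable_def continuous_on_mult continuous_on_inner cont_\<eta> frontier_powr_cont[OF c])
  have i2: "integrable S (\<lambda>x. indicator ?m x *\<^sub>R (\<bar>x \<bullet> \<eta> x\<bar> * ?h x))"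
    using boundary_minus_integrable[OF c] by (simp add: set_integrable_def W_def mult.assoc)
  have "- (LINT x|S. indicator ?m x *\<^sub>R (\<bar>x \<bullet> \<eta> x\<bar> * ?h x)) = (LINT x|S. - (indicator ?m x *\<^sub>R (\<bar>x \<bullet> \<eta> x\<bar> * ?h x)))"
    by simp
  also have "\<dots> \<le> (LINT x|S. indicator (frontier \<Omega>) x *\<^sub>R (sgn \<kappa> * ((x \<bullet> \<eta> x) * ?h x)))"
  proof (rule integral_mono[OF Bochner_Integration.integrable_minus[OF i2] i1])
    fix x
    have h0: "0 \<le> ?h x" by (simp add: W_nonneg)
    show "- (indicator ?m x *\<^sub>R (\<bar>x \<bullet> \<eta> x\<bar> * ?h x)) \<le> indicator (frontier \<Omega>) x *\<^sub>R (sgn \<kappa> * ((x \<bullet> \<eta> x) * ?h x))"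
    proof (cases "x \<in> ?m")
      case True
      have "\<bar>sgn \<kappa>\<bar> \<le> 1" by (simp add: sgn_real_def)
      then have "\<bar>sgn \<kappa> * (x \<bullet> \<eta> x)\<bar> \<le> \<bar>x \<bullet> \<eta> x\<bar>" by (simp add: abs_mult mult_left_le_one_le)
      then have "(- \<bar>x \<bullet> \<eta> x\<bar>) * ?h x \<le> (sgn \<kappa> * (x \<bullet> \<eta> x)) * ?h x"
        using h0 by (intro mult_right_mono) auto
      then show ?thesis using True by (simp add: boundary_minus_eq mult.assoc)
    next
      case False
      then have "0 \<le> (sgn \<kappa> * (x \<bullet> \<eta> x)) * ?h x" if "x \<in> frontier \<Omega>"
        using that by (intro mult_nonneg_nonneg[OF _ h0]) (auto simp: boundary_minus_eq)
      then show ?thesis using False by (auto simp: indicator_def mult.assoc)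
    qed
  qed
  also have "\<dots> = sgn \<kappa> * flux \<phi>"
    unfolding flux_def set_lebesgue_integral_def by (simp add: mult.left_commute flip: Bochner_Integration.integral_mult_right_zero)
  finally show ?thesis by (simp add: set_lebesgue_integral_def)
qed

text \<open>Let N be the norm, t the p-th root of the mass, and c the constant in the boundary part
  of the norm. Hardy's inequality gives |\<kappa>| t^p \<le> N^p / c + p t^(p-1) N. If t > N, then
  N^p \<le> N t^(p-1), and division leaves |\<kappa>| t \<le> (1/c + p) N. The summand 1 covers t
  \<le> N.\<close>

definition C0 :: real where "C0 = 1 + (1 / ((p - 1) / p) powr (p - 1) + p) / \<bar>\<kappa>\<bar>"

lemma mass_le_norm:
  assumes \<phi>: "\<phi> \<in> hatW_pre \<Omega> p l"
  shows "mass \<phi> \<le> (C0 * hatW_norm \<Omega> p l \<phi>) powr p"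
proof -
  have se: "smooth_energy \<phi>" using \<phi> by (rule pre_energy)
  define N t c where "N = hatW_norm \<Omega> p l \<phi>" and "t = mass \<phi> powr (1/p)" and "c = ((p - 1) / p) powr (p - 1)"
  define B where "B = (LINT x:boundary_minus \<Omega> p l|S. \<bar>x \<bullet> \<eta> x\<bar> * (W x * \<bar>\<phi> x\<bar> powr p))"
  have c: "0 < c" using p by (simp add: c_def)
  have N0: "0 \<le> N" using hatW_norm_nonneg[OF se] by (simp add: N_def)
  have t0: "0 \<le> t" by (simp add: t_def)
  have B0: "0 \<le> B" unfolding B_def set_lebesgue_integral_def
    by (intro Bochner_Integration.integral_nonneg) (auto simp: W_nonneg)
  have tp: "t powr p = mass \<phi>" "mass \<phi> powr (1 - 1/p) = t powr (p - 1)"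
    using p mass_nonneg by (simp_all add: t_def powr_powr field_simps)
  have "radial (gradient \<phi>) \<le> dirichlet \<phi>"
    using radial_integrable(2)[of "gradient \<phi>"] grad_measurable(1) se by (simp add: smooth_energy_def dirichlet_def)
  then have "radial (gradient \<phi>) powr (1/p) \<le> dirichlet \<phi> powr (1/p)"
    using p radial_nonneg by (intro powr_mono2) auto
  also have "\<dots> \<le> N" by (simp add: N_def hatW_norm_eq[OF se])
  finally have R: "radial (gradient \<phi>) powr (1/p) \<le> N" .
  have "(c * B) powr (1/p) \<le> N" by (simp add: N_def hatW_norm_eq[OF se] c_def B_def)
  then have "((c * B) powr (1/p)) powr p \<le> N powr p" using p by (intro powr_mono2) auto
  then have "c * B \<le> N powr p" using p c B0 by (simp add: powr_powr)
  then have B: "B \<le> N powr p / c" using c by (simp add: field_simps)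
  have "\<bar>\<kappa>\<bar> * mass \<phi> + sgn \<kappa> * flux \<phi> \<le> p * mass \<phi> powr (1 - 1/p) * radial (gradient \<phi>) powr (1/p)"
    using \<phi> hardy_smooth(2)[OF se] by (simp add: pre_iff)
  also have "\<dots> \<le> p * mass \<phi> powr (1 - 1/p) * N" using R p by (intro mult_left_mono) auto
  finally have "\<bar>\<kappa>\<bar> * t powr p \<le> N powr p / c + p * t powr (p - 1) * N"
    using flux_lower[of \<phi>] se B by (simp add: smooth_energy_def tp B_def)
  have "t \<le> C0 * N"
  proof (cases "t \<le> N")
    case True
    have "1 \<le> C0" using p c \<kappa>_ne by (simp add: C0_def c_def[symmetric])
    then have "1 * N \<le> C0 * N" using N0 by (rule mult_right_mono)
    then show ?thesis using True by simp
  next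
    case False
    then have t: "N < t" "0 < t" using N0 by auto
    have "N powr p = N * N powr (p - 1)" using N0 by (cases "N = 0") (auto simp: powr_mult_base)
    also have "\<dots> \<le> N * t powr (p - 1)" using N0 t p by (intro mult_left_mono powr_mono2) auto
    finally have "N powr p / c \<le> N * t powr (p - 1) / c" using c by (intro divide_right_mono) auto
    moreover have "t powr p = t * t powr (p - 1)" using t by (simp add: powr_mult_base)
    ultimately have "(\<bar>\<kappa>\<bar> * t) * t powr (p - 1) \<le> ((1 / c + p) * N) * t powr (p - 1)"
      using \<open>\<bar>\<kappa>\<bar> * t powr p \<le> N powr p / c + p * t powr (p - 1) * N\<close> by (simp add: algebra_simps)
    then have "\<bar>\<kappa>\<bar> * t \<le> (1 / c + p) * N" using t by (simp add: mult_le_cancel_right)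
    then have "t \<le> (1 / c + p) / \<bar>\<kappa>\<bar> * N" using \<kappa>_ne by (simp add: field_simps)
    then show ?thesis using N0 by (simp add: C0_def c_def distrib_right)
  qed
  then have "t powr p \<le> (C0 * N) powr p" using t0 p by (intro powr_mono2) auto
  then show ?thesis by (simp add: tp N_def)
qed

lemma gradient_diff:
  assumes "smooth_on \<Omega> \<phi>" "smooth_on \<Omega> \<psi>" "x \<in> \<Omega>"
  shows "gradient (\<lambda>x. \<phi> x - \<psi> x) x = gradient \<phi> x - gradient \<psi> x"
  using assms by (intro gradient_eq GDERIV_diff smooth_on_GDERIV)

lemma smooth_energy_diff:
  assumes "smooth_energy \<phi>" "smooth_energy \<psi>"
  shows "smooth_energy (\<lambda>x. \<phi> x - \<psi> x)"
proof -
  have s: "smooth_on \<Omega> \<phi>" "smooth_on \<Omega> \<psi>" and i: "set_integrable lborel \<Omega> (\<lambda>x. norm x powr l * norm (gradient \<phi> x) powr p)"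
    "set_integrable lborel \<Omega> (\<lambda>x. norm x powr l * norm (gradient \<psi> x) powr p)"
    using assms by (auto simp: smooth_energy_def)
  have sd: "smooth_on \<Omega> (\<lambda>x. \<phi> x - \<psi> x)" using smooth_on_diff[OF open_\<Omega> s] .
  have "set_integrable lborel \<Omega> (\<lambda>x. norm x powr l * norm (gradient (\<lambda>x. \<phi> x - \<psi> x) x) powr p)"
    unfolding set_integrable_def
  proof (rule Bochner_Integration.integrable_bound)
    show "integrable lborel (\<lambda>x. 2 powr p * (indicator \<Omega> x *\<^sub>R (norm x powr l * norm (gradient \<phi> x) powr p) + indicator \<Omega> x *\<^sub>R (norm x powr l * norm (gradient \<psi> x) powr p)))"
      by (intro integrable_mult_right Bochner_Integration.integrable_add i[unfolded set_integrable_def])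
    show "(\<lambda>x. indicator \<Omega> x *\<^sub>R (norm x powr l * norm (gradient (\<lambda>x. \<phi> x - \<psi> x) x) powr p)) \<in> borel_measurable lborel"
      using grad_weight_measurable[OF sd] by simp
    show "AE x in lborel. norm (indicator \<Omega> x *\<^sub>R (norm x powr l * norm (gradient (\<lambda>x. \<phi> x - \<psi> x) x) powr p))
      \<le> norm (2 powr p * (indicator \<Omega> x *\<^sub>R (norm x powr l * norm (gradient \<phi> x) powr p) + indicator \<Omega> x *\<^sub>R (norm x powr l * norm (gradient \<psi> x) powr p)))"
    proof (rule AE_I2)
      fix x
      have "norm x powr l * norm (gradient \<phi> x - gradient \<psi> x) powr p \<le> norm x powr l * (2 powr p * (norm (gradient \<phi> x) powr p + norm (gradient \<psi> x) powr p))"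
        using norm_add_powr_le[of p "gradient \<phi> x" "- gradient \<psi> x"] p by (intro mult_left_mono) auto
      then show "norm (indicator \<Omega> x *\<^sub>R (norm x powr l * norm (gradient (\<lambda>x. \<phi> x - \<psi> x) x) powr p))
      \<le> norm (2 powr p * (indicator \<Omega> x *\<^sub>R (norm x powr l * norm (gradient \<phi> x) powr p) + indicator \<Omega> x *\<^sub>R (norm x powr l * norm (gradient \<psi> x) powr p)))"
      proof (cases "x \<in> \<Omega>")
        case True
        then show ?thesis using \<open>norm x powr l * norm (gradient \<phi> x - gradient \<psi> x) powr p \<le> _\<close>
          unfolding gradient_diff[OF s True] by (simp add: algebra_simps)
      qed simp
    qed
  qed
  then show ?thesis using assms sd by (simp add: smooth_energy_def continuous_on_diff)
qed

lemma sphere_integrable: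
  assumes "0 < \<epsilon>" "\<epsilon> < \<rho>" "continuous_on (closure \<Omega>) \<phi>"
  shows "set_integrable (surface_measure (sphere 0 \<epsilon>)) (sphere 0 \<epsilon>) (\<lambda>x. \<bar>\<phi> x\<bar> powr p)"
proof -
  let ?M = "surface_measure (sphere (0::'a) \<epsilon>)"
  have M: "is_surface_measure (sphere 0 \<epsilon>) ?M" using assms(1) by (rule surface_measure_sphere)
  have hyp: "C1_hypersurface (sphere (0::'a) \<epsilon>)"
    using C1_boundary_hypersurface[OF _ exterior_ball_C1_boundary[OF assms(1)]] by (simp add: frontier_exterior_ball[OF assms(1)] open_Compl)
  have fin: "finite_measure ?M" by (rule finite_surface_measure[OF M _ hyp]) simp
  have sub: "sphere 0 \<epsilon> \<subseteq> closure \<Omega>" using \<rho>(2) \<Omega>_closure assms(2) by (auto simp: subset_iff)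
  have c: "continuous_on (sphere 0 \<epsilon>) (\<lambda>x. \<bar>\<phi> x\<bar> powr p)"
    using p by (intro continuous_on_powr' continuous_on_rabs continuous_on_subset[OF assms(3) sub] continuous_on_const) auto
  obtain B where "\<And>x. x \<in> sphere 0 \<epsilon> \<Longrightarrow> \<bar>\<bar>\<phi> x\<bar> powr p\<bar> \<le> B"
    by (rule bounded_image_compact_real[OF compact_sphere c], rule that)
  then show ?thesis
    using c fin sets_surface_measure[OF M]
    by (intro set_integrable_continuous_finite[where B=B]) (auto simp: less_top[symmetric] finite_measure.emeasure_finite borel_closed)
qed

text \<open>The Cauchy condition is about differences, while the bound of the mass by the norm holds
  for members of \<open>hatW_pre\<close>. The point to check is the sphere condition, which follows
  from |a - b|^p \<le> 2^p (|a|^p + |b|^p).\<close>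

lemma pre_diff:
  assumes "\<phi> \<in> hatW_pre \<Omega> p l" "\<psi> \<in> hatW_pre \<Omega> p l"
  shows "(\<lambda>x. \<phi> x - \<psi> x) \<in> hatW_pre \<Omega> p l"
proof -
  have se: "smooth_energy \<phi>" "smooth_energy \<psi>" using assms pre_energy by auto
  have cl: "continuous_on (closure \<Omega>) \<phi>" "continuous_on (closure \<Omega>) \<psi>" using se by (auto simp: smooth_energy_def)
  define s where "s f \<epsilon> = \<epsilon> powr (l - p + 1) * (LINT x:sphere_in \<Omega> \<epsilon>|surface_measure (sphere_in \<Omega> \<epsilon>). \<bar>f x\<bar> powr p)" for f :: "'a \<Rightarrow> real" and \<epsilon>
  have s: "(s \<phi> \<longlongrightarrow> 0) (at_right 0)" "(s \<psi> \<longlongrightarrow> 0) (at_right 0)" using assms by (auto simp: pre_iff s_def[abs_def])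
  have "(s (\<lambda>x. \<phi> x - \<psi> x) \<longlongrightarrow> 0) (at_right 0)"
  proof (rule tendsto_sandwich[of "\<lambda>_. 0" _ _ "\<lambda>\<epsilon>. 2 powr p * (s \<phi> \<epsilon> + s \<psi> \<epsilon>)"])
    show "\<forall>\<^sub>F \<epsilon> in at_right 0. 0 \<le> s (\<lambda>x. \<phi> x - \<psi> x) \<epsilon>"
      by (intro always_eventually) (auto simp: s_def set_lebesgue_integral_def intro!: mult_nonneg_nonneg Bochner_Integration.integral_nonneg)
    have "s (\<lambda>x. \<phi> x - \<psi> x) \<epsilon> \<le> 2 powr p * (s \<phi> \<epsilon> + s \<psi> \<epsilon>)" if \<epsilon>: "0 < \<epsilon>" "\<epsilon> < \<rho>" for \<epsilon>
    proof -
      have eq: "sphere_in \<Omega> \<epsilon> = sphere 0 \<epsilon>" using \<rho>(2) \<epsilon>(2) by (auto simp: sphere_in_def subset_iff)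
      let ?M = "surface_measure (sphere (0::'a) \<epsilon>)"
      have "(LINT x:sphere 0 \<epsilon>|?M. \<bar>\<phi> x - \<psi> x\<bar> powr p) \<le> (LINT x:sphere 0 \<epsilon>|?M. 2 powr p * (\<bar>\<phi> x\<bar> powr p + \<bar>\<psi> x\<bar> powr p))"
      proof (rule set_integral_mono)
        show "set_integrable ?M (sphere 0 \<epsilon>) (\<lambda>x. \<bar>\<phi> x - \<psi> x\<bar> powr p)"
          by (rule sphere_integrable[OF \<epsilon>]) (intro continuous_on_diff cl)
        show "set_integrable ?M (sphere 0 \<epsilon>) (\<lambda>x. 2 powr p * (\<bar>\<phi> x\<bar> powr p + \<bar>\<psi> x\<bar> powr p))"
          by (intro set_integrable_mult_right set_integral_add(1) sphere_integrable[OF \<epsilon>] cl)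
        show "\<bar>\<phi> x - \<psi> x\<bar> powr p \<le> 2 powr p * (\<bar>\<phi> x\<bar> powr p + \<bar>\<psi> x\<bar> powr p)" for x
          using norm_add_powr_le[of p "\<phi> x" "- \<psi> x"] p by auto
      qed
      also have "\<dots> = 2 powr p * ((LINT x:sphere 0 \<epsilon>|?M. \<bar>\<phi> x\<bar> powr p) + (LINT x:sphere 0 \<epsilon>|?M. \<bar>\<psi> x\<bar> powr p))"
        by (simp add: set_integral_add(2)[OF sphere_integrable[OF \<epsilon> cl(1)] sphere_integrable[OF \<epsilon> cl(2)]])
      finally have "\<epsilon> powr (l - p + 1) * (LINT x:sphere 0 \<epsilon>|?M. \<bar>\<phi> x - \<psi> x\<bar> powr p)
         \<le> \<epsilon> powr (l - p + 1) * (2 powr p * ((LINT x:sphere 0 \<epsilon>|?M. \<bar>\<phi> x\<bar> powr p) + (LINT x:sphere 0 \<epsilon>|?M. \<bar>\<psi> x\<bar> powr p)))"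
        by (rule mult_left_mono) simp
      then show ?thesis by (simp add: s_def eq algebra_simps)
    qed
    then show "\<forall>\<^sub>F \<epsilon> in at_right 0. s (\<lambda>x. \<phi> x - \<psi> x) \<epsilon> \<le> 2 powr p * (s \<phi> \<epsilon> + s \<psi> \<epsilon>)"
      using \<rho>(1) by (auto simp: eventually_at_right_field)
    show "((\<lambda>\<epsilon>. 2 powr p * (s \<phi> \<epsilon> + s \<psi> \<epsilon>)) \<longlongrightarrow> 0) (at_right 0)"
      using tendsto_mult[OF tendsto_const[of "2 powr p"] tendsto_add[OF s]] by simp
  qed simp
  then show ?thesis using smooth_energy_diff[OF se] by (simp add: pre_iff s_def[abs_def])
qed

end

text \<open>
  Near the boundary the vectors \<open>b\<close> of the local graphs, suitably oriented and glued by bumps, form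
  a smooth field that is transversal to the boundary.
\<close>

lemma transversal_field_exists:
  fixes \<Omega> U :: "'a::euclidean_space set"
  assumes \<Omega>: "open \<Omega>" "C1_boundary \<Omega>" "compact (frontier \<Omega>)" and U: "open U" "frontier \<Omega> \<subseteq> U"
  obtains V :: "'a \<Rightarrow> 'a" and dV :: "'a \<Rightarrow> 'a \<Rightarrow> 'a" and c :: real where
    "\<And>e x. GDERIV (\<lambda>x. V x \<bullet> e) x :> dV e x" "continuous_on UNIV V" "\<And>e. continuous_on UNIV (dV e)"
    "\<And>x. x \<notin> U \<Longrightarrow> V x = 0 \<and> (\<forall>e. dV e x = 0)" "0 < c" "\<And>x. x \<in> frontier \<Omega> \<Longrightarrow> c \<le> V x \<bullet> outward_normal \<Omega> x"
proof (cases "frontier \<Omega> = {}")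
  case True
  show ?thesis by (rule that[of "\<lambda>_. 0" "\<lambda>_ _. 0" 1]) (auto simp: True GDERIV_const)
next
  case False
  let ?P = "\<lambda>z q. 0 < fst q \<and> ball z (fst q) \<subseteq> U \<and> (\<exists>\<gamma> D s. local_graph_domain \<Omega> z (fst q) (fst (snd q)) \<gamma> D s \<and> snd (snd q) = s)"
  have "\<forall>z\<in>frontier \<Omega>. \<exists>q. ?P z q"
  proof
    fix z assume z: "z \<in> frontier \<Omega>"
    then obtain r b \<gamma> D s where L: "local_graph_domain \<Omega> z r b \<gamma> D s" using \<Omega>(2) unfolding C1_boundary_def by blast
    obtain r' where r': "0 < r'" "ball z r' \<subseteq> U" using U z by (meson openE subsetD)
    have "0 < r" using L by (simp add: local_graph_domain_def)
    then have m: "0 < min r r'" "ball z (min r r') \<subseteq> U" "ball z (min r r') \<subseteq> ball z r" using r' by auto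
    then have "local_graph_domain \<Omega> z (min r r') b \<gamma> D s" by (intro local_graph_domain_subset[OF L])
    then show "\<exists>q. ?P z q" using m by (intro exI[of _ "(min r r', b, s)"]) auto
  qed
  from bchoice[OF this] obtain q where q: "\<forall>z\<in>frontier \<Omega>. ?P z (q z)" by (elim exE) (rule that)
  define r b s where "r z = fst (q z)" and "b z = fst (snd (q z))" and "s z = snd (snd (q z))" for z
  have Q: "0 < r z" "ball z (r z) \<subseteq> U" "\<exists>\<gamma> D. local_graph_domain \<Omega> z (r z) (b z) \<gamma> D (s z)" if "z \<in> frontier \<Omega>" for z
    using bspec[OF q that] by (auto simp: r_def b_def s_def)
  obtain Z where Z: "Z \<subseteq> frontier \<Omega>" "finite Z" "frontier \<Omega> \<subseteq> (\<Union>z\<in>Z. ball z (r z))"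
  proof (rule compactE_image[OF \<Omega>(3), of "frontier \<Omega>" "\<lambda>z. ball z (r z)"])
    show "frontier \<Omega> \<subseteq> (\<Union>z\<in>frontier \<Omega>. ball z (r z))" using Q(1) by force
  qed (auto intro: that)
  \<comment> \<open>The sign -s orients b outwards: the normal on a local graph is s (D - b) divided
    by the area factor, so -s b has the positive inner product 1/\<open>area_factor\<close> with
    it.\<close>
  define V where "V x = (\<Sum>z\<in>Z. bump z (r z) x *\<^sub>R (- s z) *\<^sub>R b z)" for x
  define dV where "dV e x = (\<Sum>z\<in>Z. ((- s z) * (b z \<bullet> e)) *\<^sub>R dbump z (r z) x)" for e x
  have dV: "GDERIV (\<lambda>x. V x \<bullet> e) x :> dV e x" for e x
  proof -
    have "GDERIV (\<lambda>x. k * bump z (r z) x) x :> k *\<^sub>R dbump z (r z) x" for k z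
      using GDERIV_mult[OF GDERIV_const[of k] GDERIV_bump] by simp
    then have "GDERIV (\<lambda>x. \<Sum>z\<in>Z. ((- s z) * (b z \<bullet> e)) * bump z (r z) x) x :> dV e x"
      unfolding gderiv_def dV_def inner_sum_right by (intro has_derivative_sum) auto
    moreover have "(\<lambda>x. V x \<bullet> e) = (\<lambda>x. \<Sum>z\<in>Z. ((- s z) * (b z \<bullet> e)) * bump z (r z) x)"
      by (simp add: V_def inner_sum_left mult_ac)
    ultimately show ?thesis by simp
  qed
  have cV: "continuous_on A V" for A unfolding V_def by (intro continuous_intros continuous_bump)
  have cdV: "continuous_on A (dV e)" for A e unfolding dV_def by (intro continuous_intros continuous_dbump)
  have V0: "V x = 0 \<and> (\<forall>e. dV e x = 0)" if "x \<notin> U" for x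
  proof -
    have "bump z (r z) x = 0" "dbump z (r z) x = 0" if z: "z \<in> Z" for z
      using Q(1,2)[of z] z Z(1) \<open>x \<notin> U\<close> by (auto intro!: bump_eq_0 dbump_eq_0)
    then show ?thesis by (simp add: V_def dV_def)
  qed
  have pos: "0 < V x \<bullet> outward_normal \<Omega> x" if x: "x \<in> frontier \<Omega>" for x
  proof -
    \<comment> \<open>Every summand is a bump times something nonnegative, also for those z whose
      ball misses x: there the bump is zero and any second factor may be substituted.\<close>
    have tm: "bump z (r z) x * ((- s z) * (b z \<bullet> outward_normal \<Omega> x)) = bump z (r z) x * (if x \<in> ball z (r z) then \<bar>(- s z) * (b z \<bullet> outward_normal \<Omega> x)\<bar> else 1) \<and>
       (x \<in> ball z (r z) \<longrightarrow> (- s z) * (b z \<bullet> outward_normal \<Omega> x) > 0)" if z: "z \<in> Z" for z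
    proof (cases "x \<in> ball z (r z)")
      case True
      obtain \<gamma> D where L: "local_graph_domain \<Omega> z (r z) (b z) \<gamma> D (s z)" using Q(3) z Z(1) by blast
      then have G: "C1_graph (b z) \<gamma> D" and s: "s z \<in> {-1, 1}" by (auto simp: local_graph_domain_def)
      have "outward_normal \<Omega> x = (s z / area_factor D x) *\<^sub>R (D x - b z)" by (rule outward_normal_local[OF \<Omega>(1,2) L x True])
      moreover have "b z \<bullet> (D x - b z) = -1"
        using C1_graphD(1,6)[OF G] by (simp add: inner_diff_right inner_commute[of "b z" "D x"])
      ultimately have "(- s z) * (b z \<bullet> outward_normal \<Omega> x) = (s z * s z) / area_factor D x"
        by simp
      then have "0 < (- s z) * (b z \<bullet> outward_normal \<Omega> x)" using s area_factor_pos[of D x] by auto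
      then show ?thesis using True by simp
    next
      case False
      then have "bump z (r z) x = 0" using Q(1)[of z] z Z(1) by (intro bump_eq_0) auto
      then show ?thesis using False by simp
    qed
    obtain z where z: "z \<in> Z" "x \<in> ball z (r z)" using subsetD[OF Z(3) x] by blast
    have bp: "0 < bump z (r z) x" using Q(1)[of z] z Z(1) bump_pos_iff[of "r z" z x] by auto
    have "V x \<bullet> outward_normal \<Omega> x = (\<Sum>z\<in>Z. bump z (r z) x * ((- s z) * (b z \<bullet> outward_normal \<Omega> x)))"
      by (simp add: V_def inner_sum_left mult.assoc)
    also have "0 < \<dots>"
    proof (rule sum_pos2[OF Z(2) z(1)])
      show "0 < bump z (r z) x * ((- s z) * (b z \<bullet> outward_normal \<Omega> x))"
        by (rule mult_pos_pos[OF bp mp[OF conjunct2[OF tm[OF z(1)]] z(2)]])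
      show "0 \<le> bump i (r i) x * ((- s i) * (b i \<bullet> outward_normal \<Omega> x))" if "i \<in> Z" for i
        by (subst conjunct1[OF tm[OF that]], rule mult_nonneg_nonneg[OF bump_nonneg]) simp
    qed
    finally show ?thesis .
  qed
  have "continuous_on (frontier \<Omega>) (\<lambda>x. V x \<bullet> outward_normal \<Omega> x)"
    by (intro continuous_intros cV continuous_on_outward_normal \<Omega>)
  from continuous_attains_inf[OF \<Omega>(3) False this] obtain x0 where
    x0: "x0 \<in> frontier \<Omega>" "\<forall>y\<in>frontier \<Omega>. V x0 \<bullet> outward_normal \<Omega> x0 \<le> V y \<bullet> outward_normal \<Omega> y" by blast
  show ?thesis
    by (rule that[of V dV "V x0 \<bullet> outward_normal \<Omega> x0"]) (use dV cV cdV V0 pos x0 in auto)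
qed

lemma set_nn_integral_eq:
  assumes "set_integrable M A k" "\<And>x. 0 \<le> (k x :: real)"
  shows "(\<integral>\<^sup>+x\<in>A. ennreal (k x) \<partial>M) = ennreal (LINT x:A|M. k x)"
proof -
  have "(\<integral>\<^sup>+x\<in>A. ennreal (k x) \<partial>M) = (\<integral>\<^sup>+x. ennreal (indicator A x *\<^sub>R k x) \<partial>M)"
    by (intro nn_integral_cong) (auto simp: indicator_def)
  then show ?thesis using assms unfolding set_lebesgue_integral_def set_integrable_def
    by (simp add: nn_integral_eq_integral)
qed

text \<open>For every \<delta> > 0 one has t \<le> \<delta> + \<delta>^(1-p) t^p. On a set of finite
  measure the first term integrates to as little as desired, and the second tends to zero for fixed
  \<delta>.\<close>

lemma L1_tendsto_of_Lp:
  fixes h :: "nat \<Rightarrow> 'a \<Rightarrow> real"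
  assumes p: "1 < p" and [measurable]: "\<And>k. h k \<in> borel_measurable M" "K \<in> sets M" and K: "emeasure M K < \<infinity>"
    and lim: "(\<lambda>k. \<integral>\<^sup>+x\<in>K. ennreal (\<bar>h k x\<bar> powr p) \<partial>M) \<longlonglongrightarrow> 0"
  shows "(\<lambda>k. \<integral>\<^sup>+x\<in>K. ennreal \<bar>h k x\<bar> \<partial>M) \<longlonglongrightarrow> 0"
proof (rule tendsto_0_if_Limsup_eq_0_ennreal)
  define m where "m = enn2real (emeasure M K)"
  have m: "0 \<le> m" "emeasure M K = ennreal m" using K by (auto simp: m_def)
  have "limsup (\<lambda>k. \<integral>\<^sup>+x\<in>K. ennreal \<bar>h k x\<bar> \<partial>M) \<le> ennreal e" if e: "0 < e" for e
  proof -
    define \<delta> where "\<delta> = e / (m + 1)"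
    have \<delta>: "0 < \<delta>" "\<delta> * m \<le> e" using e m(1) by (auto simp: \<delta>_def field_simps)
    have pt: "ennreal \<bar>t\<bar> \<le> ennreal \<delta> + ennreal (\<delta> powr (1 - p)) * ennreal (\<bar>t\<bar> powr p)" for t :: real
    proof -
      have "\<bar>t\<bar> \<le> \<delta> + \<delta> powr (1 - p) * \<bar>t\<bar> powr p"
      proof (cases "\<bar>t\<bar> \<le> \<delta>")
        case True
        then show ?thesis by (simp add: add_increasing2)
      next
        case False
        then have "\<delta> powr (p - 1) \<le> \<bar>t\<bar> powr (p - 1)" using \<delta> p by (intro powr_mono2) auto
        then have "\<delta> powr (1 - p) * \<delta> powr (p - 1) * \<bar>t\<bar> \<le> \<delta> powr (1 - p) * \<bar>t\<bar> powr (p - 1) * \<bar>t\<bar>"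
          by (intro mult_right_mono mult_left_mono) auto
        moreover have "\<delta> powr (1 - p) * \<delta> powr (p - 1) = 1" using \<delta>(1) by (simp flip: powr_add)
        moreover have "\<bar>t\<bar> powr (p - 1) * \<bar>t\<bar> = \<bar>t\<bar> powr p" using False \<delta>(1) by (simp add: powr_mult_base mult.commute)
        ultimately show ?thesis using \<delta>(1) by (simp add: mult.assoc)
      qed
      then have "ennreal \<bar>t\<bar> \<le> ennreal (\<delta> + \<delta> powr (1 - p) * \<bar>t\<bar> powr p)" by (rule ennreal_leI)
      then show ?thesis using \<delta>(1) by (simp add: ennreal_mult)
    qed
    have "(\<integral>\<^sup>+x\<in>K. ennreal \<bar>h k x\<bar> \<partial>M) \<le> ennreal e + ennreal (\<delta> powr (1 - p)) * (\<integral>\<^sup>+x\<in>K. ennreal (\<bar>h k x\<bar> powr p) \<partial>M)" for k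
    proof -
      have "(\<integral>\<^sup>+x\<in>K. ennreal \<bar>h k x\<bar> \<partial>M) \<le> (\<integral>\<^sup>+x. ennreal \<delta> * indicator K x + ennreal (\<delta> powr (1 - p)) * (ennreal (\<bar>h k x\<bar> powr p) * indicator K x) \<partial>M)"
        by (intro nn_integral_mono) (use pt in \<open>auto simp: indicator_def\<close>)
      also have "\<dots> = ennreal \<delta> * emeasure M K + ennreal (\<delta> powr (1 - p)) * (\<integral>\<^sup>+x\<in>K. ennreal (\<bar>h k x\<bar> powr p) \<partial>M)"
        by (simp add: nn_integral_add nn_integral_cmult)
      also have "ennreal \<delta> * emeasure M K \<le> ennreal e"
        using \<delta> m by (simp add: ennreal_mult[symmetric] ennreal_leI)
      finally show ?thesis by (simp add: add_right_mono)
    qed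
    then have "limsup (\<lambda>k. \<integral>\<^sup>+x\<in>K. ennreal \<bar>h k x\<bar> \<partial>M) \<le> limsup (\<lambda>k. ennreal e + ennreal (\<delta> powr (1 - p)) * (\<integral>\<^sup>+x\<in>K. ennreal (\<bar>h k x\<bar> powr p) \<partial>M))"
      by (intro Limsup_mono always_eventually) auto
    also have "\<dots> = ennreal e + ennreal (\<delta> powr (1 - p)) * 0"
      by (intro lim_imp_Limsup tendsto_add tendsto_const ennreal_tendsto_cmult lim) auto
    finally show ?thesis by simp
  qed
  then show "limsup (\<lambda>k. \<integral>\<^sup>+x\<in>K. ennreal \<bar>h k x\<bar> \<partial>M) = 0"
    using ennreal_le_epsilon[of 0 "limsup (\<lambda>k. \<integral>\<^sup>+x\<in>K. ennreal \<bar>h k x\<bar> \<partial>M)"] by simp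
qed

text \<open>Integrability of the limit comes from its finite L1 distance to one of the integrable
  \<open>h k\<close>; the factor \<zeta> is bounded on the compact set.\<close>

lemma integral_test_tendsto:
  fixes h :: "nat \<Rightarrow> 'a::euclidean_space \<Rightarrow> real" and \<zeta> g :: "'a \<Rightarrow> real"
  assumes K: "compact K" and \<zeta>: "continuous_on UNIV \<zeta>" and [measurable]: "g \<in> borel_measurable borel"
    and h: "\<And>k. set_integrable lborel K (h k)" "\<And>k. h k \<in> borel_measurable borel"
    and lim: "(\<lambda>k. \<integral>\<^sup>+x\<in>K. ennreal \<bar>h k x - g x\<bar> \<partial>lborel) \<longlonglongrightarrow> 0"
  shows "set_integrable lborel K g"
    and "(\<lambda>k. LINT x:K|lborel. \<zeta> x * h k x) \<longlonglongrightarrow> (LINT x:K|lborel. \<zeta> x * g x)"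
proof -
  note [measurable] = h(2)
  have Kb [measurable]: "K \<in> sets borel" using K by (rule borel_compact)
  have [measurable]: "\<zeta> \<in> borel_measurable borel" using \<zeta> by (rule borel_measurable_continuous_onI)
  have "\<forall>\<^sub>F k in sequentially. (\<integral>\<^sup>+x\<in>K. ennreal \<bar>h k x - g x\<bar> \<partial>lborel) < 1"
    by (rule order_tendstoD(2)[OF lim]) simp
  then obtain k where k: "(\<integral>\<^sup>+x\<in>K. ennreal \<bar>h k x - g x\<bar> \<partial>lborel) < 1" by (auto simp: eventually_sequentially)
  have "set_integrable lborel K (\<lambda>x. h k x - g x)"
    unfolding set_integrable_def
  proof (rule integrableI_bounded)
    have "(\<integral>\<^sup>+x. ennreal (norm (indicator K x *\<^sub>R (h k x - g x))) \<partial>lborel) = (\<integral>\<^sup>+x\<in>K. ennreal \<bar>h k x - g x\<bar> \<partial>lborel)"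
      by (intro nn_integral_cong) (auto simp: indicator_def)
    also have "\<dots> < \<infinity>" using k by (rule less_trans) simp
    finally show "(\<integral>\<^sup>+x. ennreal (norm (indicator K x *\<^sub>R (h k x - g x))) \<partial>lborel) < \<infinity>" .
  qed measurable
  from set_integral_diff(1)[OF h(1)[of k] this] show g: "set_integrable lborel K g" by simp
  obtain B where B: "0 \<le> B" "\<And>x. x \<in> K \<Longrightarrow> \<bar>\<zeta> x\<bar> \<le> B"
    by (rule bounded_image_compact_real[OF K continuous_on_subset[OF \<zeta> subset_UNIV]], rule that)
  have bm: "set_borel_measurable lborel K \<zeta>" unfolding set_borel_measurable_def by measurable
  have i: "integrable lborel (\<lambda>x. indicator K x *\<^sub>R (\<zeta> x * h k x))" "integrable lborel (\<lambda>x. indicator K x *\<^sub>R (\<zeta> x * g x))" for k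
    using set_integrable_bounded_mult[OF h(1)[of k] bm B(2)] set_integrable_bounded_mult[OF g bm B(2)]
    by (simp_all add: set_integrable_def)
  show "(\<lambda>k. LINT x:K|lborel. \<zeta> x * h k x) \<longlonglongrightarrow> (LINT x:K|lborel. \<zeta> x * g x)"
    unfolding set_lebesgue_integral_def
  proof (rule tendsto_L1_int[OF i])
    show "(\<lambda>k. \<integral>\<^sup>+x. ennreal (norm (indicator K x *\<^sub>R (\<zeta> x * h k x) - indicator K x *\<^sub>R (\<zeta> x * g x))) \<partial>lborel) \<longlonglongrightarrow> 0"
    proof (rule tendsto_sandwich[of "\<lambda>_. 0" _ _ "\<lambda>k. ennreal B * (\<integral>\<^sup>+x\<in>K. ennreal \<bar>h k x - g x\<bar> \<partial>lborel)"])
      show "(\<lambda>k. ennreal B * (\<integral>\<^sup>+x\<in>K. ennreal \<bar>h k x - g x\<bar> \<partial>lborel)) \<longlonglongrightarrow> 0"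
        using ennreal_tendsto_cmult[OF _ lim, of "ennreal B"] by simp
      have "(\<integral>\<^sup>+x. ennreal (norm (indicator K x *\<^sub>R (\<zeta> x * h k x) - indicator K x *\<^sub>R (\<zeta> x * g x))) \<partial>lborel)
         \<le> ennreal B * (\<integral>\<^sup>+x\<in>K. ennreal \<bar>h k x - g x\<bar> \<partial>lborel)" for k
      proof -
        have "(\<integral>\<^sup>+x. ennreal (norm (indicator K x *\<^sub>R (\<zeta> x * h k x) - indicator K x *\<^sub>R (\<zeta> x * g x))) \<partial>lborel)
         \<le> (\<integral>\<^sup>+x. ennreal B * (ennreal \<bar>h k x - g x\<bar> * indicator K x) \<partial>lborel)"
        proof (rule nn_integral_mono)
          fix x
          show "ennreal (norm (indicator K x *\<^sub>R (\<zeta> x * h k x) - indicator K x *\<^sub>R (\<zeta> x * g x))) \<le> ennreal B * (ennreal \<bar>h k x - g x\<bar> * indicator K x)"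
          proof (cases "x \<in> K")
            case True
            have "\<bar>\<zeta> x * h k x - \<zeta> x * g x\<bar> = \<bar>\<zeta> x\<bar> * \<bar>h k x - g x\<bar>" by (simp add: abs_mult flip: right_diff_distrib)
            also have "\<dots> \<le> B * \<bar>h k x - g x\<bar>" using B(2)[OF True] by (intro mult_right_mono) auto
            finally show ?thesis using True B(1) by (simp add: ennreal_mult[symmetric] ennreal_leI)
          qed simp
        qed
        then show ?thesis by (simp add: nn_integral_cmult)
      qed
      then show "\<forall>\<^sub>F k in sequentially. (\<integral>\<^sup>+x. ennreal (norm (indicator K x *\<^sub>R (\<zeta> x * h k x) - indicator K x *\<^sub>R (\<zeta> x * g x))) \<partial>lborel)
         \<le> ennreal B * (\<integral>\<^sup>+x\<in>K. ennreal \<bar>h k x - g x\<bar> \<partial>lborel)" by simp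
    qed auto
  qed
qed

section \<open>The trace inequality and weak gradients of smooth functions\<close>

context hardy_domain
begin

lemma dpow_measurable:
  assumes "smooth_on \<Omega> \<phi>"
  shows "(\<lambda>x. indicator \<Omega> x *\<^sub>R dpow p \<phi> x) \<in> borel_measurable borel"
proof -
  define f0 where "f0 x = indicator \<Omega> x * \<phi> x" for x
  define g0 where "g0 x = indicator \<Omega> x *\<^sub>R gradient \<phi> x" for x
  have [measurable]: "f0 \<in> borel_measurable borel" "g0 \<in> borel_measurable borel"
    unfolding f0_def g0_def by (rule grad_measurable[OF assms])+
  have "(\<lambda>x. (p * \<bar>f0 x\<bar> powr (p - 1) * sgn (f0 x)) *\<^sub>R g0 x) \<in> borel_measurable borel" by measurable
  also have "(\<lambda>x. (p * \<bar>f0 x\<bar> powr (p - 1) * sgn (f0 x)) *\<^sub>R g0 x) = (\<lambda>x. indicator \<Omega> x *\<^sub>R dpow p \<phi> x)"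
    by (auto simp: f0_def g0_def dpow_def indicator_def fun_eq_iff)
  finally show ?thesis .
qed

text \<open>The product of |\<phi>|^(p-1) and the norm of the gradient is at most the p-th power of
  the larger of the two, hence at most the sum of both p-th powers.\<close>

lemma norm_dpow_le: "norm (dpow p \<phi> x) \<le> p * (\<bar>\<phi> x\<bar> powr p + norm (gradient \<phi> x) powr p)"
proof -
  let ?m = "max \<bar>\<phi> x\<bar> (norm (gradient \<phi> x))"
  have "norm (dpow p \<phi> x) \<le> p * (\<bar>\<phi> x\<bar> powr (p - 1) * norm (gradient \<phi> x))"
    using p by (simp add: dpow_def abs_mult sgn_real_def mult.assoc)
  also have "\<bar>\<phi> x\<bar> powr (p - 1) * norm (gradient \<phi> x) \<le> ?m powr (p - 1) * ?m"
    using p by (intro mult_mono powr_mono2) auto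
  also have "\<dots> = ?m powr p" by (cases "?m = 0") (auto simp: powr_mult_base mult.commute max_def)
  also have "\<dots> \<le> \<bar>\<phi> x\<bar> powr p + norm (gradient \<phi> x) powr p" by (simp add: max_def)
  finally show ?thesis using p by (auto simp: mult_left_mono)
qed

text \<open>The divergence theorem for the field |\<phi>|^p V: on the frontier V \<bullet> \<eta> is
  at least c, while in \<Omega> the divergence is bounded by |\<phi>|^p and the p-th power of the
  gradient. As V vanishes outside \<open>U\<close>, only \<Omega> \<inter> U enters, and
  \<open>C\<close> does not depend on \<phi>.\<close>

lemma trace_inequality:
  assumes U: "open U" "frontier \<Omega> \<subseteq> U"
  obtains C where "0 < C" "\<And>\<phi>. smooth_on \<Omega> \<phi> \<Longrightarrow> continuous_on (closure \<Omega>) \<phi> \<Longrightarrow>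
    (\<integral>\<^sup>+x\<in>frontier \<Omega>. ennreal (\<bar>\<phi> x\<bar> powr p) \<partial>S) \<le> ennreal C *
      ((\<integral>\<^sup>+x\<in>\<Omega> \<inter> U. ennreal (\<bar>\<phi> x\<bar> powr p) \<partial>lborel) + (\<integral>\<^sup>+x\<in>\<Omega> \<inter> U. ennreal (norm (gradient \<phi> x) powr p) \<partial>lborel))"
proof -
  obtain V :: "'a \<Rightarrow> 'a" and dV :: "'a \<Rightarrow> 'a \<Rightarrow> 'a" and c :: real where
    V: "\<And>e x. GDERIV (\<lambda>x. V x \<bullet> e) x :> dV e x" "continuous_on UNIV V" "\<And>e. continuous_on UNIV (dV e)"
    "\<And>x. x \<notin> U \<Longrightarrow> V x = 0 \<and> (\<forall>e. dV e x = 0)" "0 < c" "\<And>x. x \<in> frontier \<Omega> \<Longrightarrow> c \<le> V x \<bullet> \<eta> x"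
    by (rule transversal_field_exists[OF open_\<Omega> C1 compact_frontier U], rule that)
  obtain B1 where B1: "0 \<le> B1" "\<And>x. x \<in> closure \<Omega> \<Longrightarrow> \<bar>norm (V x)\<bar> \<le> B1"
    by (rule bounded_image_compact_real[OF compact_closure continuous_on_norm[OF continuous_on_subset[OF V(2) subset_UNIV]]], rule that)
  define dN where "dN x = (\<Sum>e\<in>Basis. norm (dV e x))" for x
  have cdN: "continuous_on (closure \<Omega>) dN"
    unfolding dN_def by (intro continuous_intros continuous_on_subset[OF V(3)]) auto
  obtain B2 where B2: "0 \<le> B2" "\<And>x. x \<in> closure \<Omega> \<Longrightarrow> \<bar>dN x\<bar> \<le> B2"
    by (rule bounded_image_compact_real[OF compact_closure cdN], rule that)
  \<comment> \<open>The first term bounds V against the gradient of |\<phi>|^p in each of the n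
    directions, \<open>B2\<close> bounds the derivatives of V, the 1 ensures positivity, and c is
    the lower bound of V \<bullet> \<eta>.\<close>
  define C where "C = (real DIM('a) * B1 * p + B2 + 1) / c"
  have C: "0 < C" unfolding C_def using B1 B2 V(5) p by (intro divide_pos_pos add_nonneg_pos add_nonneg_nonneg mult_nonneg_nonneg) auto
  have Ub [measurable]: "U \<in> sets borel" using U by simp
  show thesis
  proof (rule that[OF C])
    fix \<phi> assume sm: "smooth_on \<Omega> \<phi>" and cl: "continuous_on (closure \<Omega>) \<phi>"
    let ?N = "\<lambda>x. \<bar>\<phi> x\<bar> powr p" and ?D = "\<lambda>x. norm (gradient \<phi> x) powr p"
    let ?I = "\<integral>\<^sup>+x\<in>\<Omega> \<inter> U. ennreal (?N x) \<partial>lborel" and ?J = "\<integral>\<^sup>+x\<in>\<Omega> \<inter> U. ennreal (?D x) \<partial>lborel"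
    define f0 where "f0 x = indicator \<Omega> x * \<phi> x" for x
    define g0 where "g0 x = indicator \<Omega> x *\<^sub>R gradient \<phi> x" for x
    have [measurable]: "f0 \<in> borel_measurable borel" "g0 \<in> borel_measurable borel"
      unfolding f0_def g0_def by (rule grad_measurable[OF sm])+
    have cN: "continuous_on (closure \<Omega>) ?N"
      using p by (intro continuous_on_powr' continuous_on_rabs continuous_on_const cl) auto
    have iN: "set_integrable lborel (\<Omega> \<inter> U) ?N"
    proof -
      obtain B where "\<And>x. x \<in> closure \<Omega> \<Longrightarrow> \<bar>?N x\<bar> \<le> B"
        by (rule bounded_image_compact_real[OF compact_closure cN], rule that)
      then have "set_integrable lborel (closure \<Omega>) ?N"
        using cN emeasure_compact_finite[OF compact_closure]
        by (intro set_integrable_continuous_finite[where B=B]) auto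
      then show ?thesis by (rule set_integrable_subset) (use \<Omega>_closure in auto)
    qed
    show "(\<integral>\<^sup>+x\<in>frontier \<Omega>. ennreal (?N x) \<partial>S) \<le> ennreal C * (?I + ?J)"
    \<comment> \<open>An infinite gradient integral makes the bound trivial; in the other case all
      integrals are finite and real arithmetic is available.\<close>
    proof (cases "?J = \<infinity>")
      case True
      then show ?thesis using C by (simp add: ennreal_mult_top)
    next
      case False
      have iD: "set_integrable lborel (\<Omega> \<inter> U) ?D"
        unfolding set_integrable_def
      proof (rule integrableI_bounded)
        have "(\<lambda>x. indicator U x * norm (g0 x) powr p) \<in> borel_measurable lborel" by measurable
        also have "(\<lambda>x. indicator U x * norm (g0 x) powr p) = (\<lambda>x. indicator (\<Omega> \<inter> U) x *\<^sub>R ?D x)"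
          using p by (auto simp: g0_def indicator_def fun_eq_iff)
        finally show "(\<lambda>x. indicator (\<Omega> \<inter> U) x *\<^sub>R ?D x) \<in> borel_measurable lborel" .
        have "(\<integral>\<^sup>+x. ennreal (norm (indicator (\<Omega> \<inter> U) x *\<^sub>R ?D x)) \<partial>lborel) = ?J"
          by (intro nn_integral_cong) (auto simp: indicator_def)
        then show "(\<integral>\<^sup>+x. ennreal (norm (indicator (\<Omega> \<inter> U) x *\<^sub>R ?D x)) \<partial>lborel) < \<infinity>"
          using False by (simp add: less_top)
      qed
      define h where "h e x = (V x \<bullet> e) *\<^sub>R dpow p \<phi> x + ?N x *\<^sub>R dV e x" for e x
      let ?b = "\<lambda>x. (B1 * p + B2) * ?N x + B1 * p * ?D x"
      have ib: "set_integrable lborel (\<Omega> \<inter> U) (\<lambda>x. k1 * ?N x + k2 * ?D x)" for k1 k2 :: real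
        by (intro set_integral_add(1) set_integrable_mult_right iN iD)
      have h_ind: "indicator \<Omega> x *\<^sub>R h e x = indicator (\<Omega> \<inter> U) x *\<^sub>R h e x" for e x
        using V(4)[of x] by (auto simp: indicator_def h_def)
      have h_parts: "\<bar>V x \<bullet> e\<bar> * norm (dpow p \<phi> x) \<le> B1 * p * (?N x + ?D x)" "?N x * norm (dV e x) \<le> B2 * ?N x"
        if x: "x \<in> \<Omega>" and e: "e \<in> Basis" for e x
      proof -
        have xc: "x \<in> closure \<Omega>" using x \<Omega>_closure by blast
        have "\<bar>V x \<bullet> e\<bar> \<le> B1" using Basis_le_norm[OF e, of "V x"] B1(2)[OF xc] by simp
        then have "\<bar>V x \<bullet> e\<bar> * norm (dpow p \<phi> x) \<le> B1 * (p * (?N x + ?D x))"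
          by (intro mult_mono norm_dpow_le B1) auto
        then show "\<bar>V x \<bullet> e\<bar> * norm (dpow p \<phi> x) \<le> B1 * p * (?N x + ?D x)" by (simp add: mult.assoc)
        have "norm (dV e x) \<le> dN x" unfolding dN_def using e by (intro member_le_sum) auto
        then have "norm (dV e x) \<le> B2" using B2(2)[OF xc] by linarith
        then show "?N x * norm (dV e x) \<le> B2 * ?N x" by (simp add: mult.commute mult_right_mono)
      qed
      have h_le: "norm (h e x) \<le> ?b x" if x: "x \<in> \<Omega>" and e: "e \<in> Basis" for e x
      proof -
        have "norm (h e x) \<le> \<bar>V x \<bullet> e\<bar> * norm (dpow p \<phi> x) + ?N x * norm (dV e x)"
          unfolding h_def by (rule order_trans[OF norm_triangle_ineq]) simp
        then show ?thesis using h_parts[OF x e] by (simp add: algebra_simps)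
      qed
      have ih: "set_integrable lborel \<Omega> (h e)" if e: "e \<in> Basis" for e
        unfolding set_integrable_def h_ind
      proof (rule Bochner_Integration.integrable_bound)
        show "integrable lborel (\<lambda>x. indicator (\<Omega> \<inter> U) x *\<^sub>R ?b x)" using ib by (simp add: set_integrable_def)
        have [measurable]: "V \<in> borel_measurable borel" "dV e \<in> borel_measurable borel"
          using V(2,3) by (auto intro: borel_measurable_continuous_onI)
        define q0 where "q0 x = indicator \<Omega> x *\<^sub>R dpow p \<phi> x" for x
        have [measurable]: "q0 \<in> borel_measurable borel" unfolding q0_def by (rule dpow_measurable[OF sm])
        have "(\<lambda>x. indicator U x *\<^sub>R ((V x \<bullet> e) *\<^sub>R q0 x + \<bar>f0 x\<bar> powr p *\<^sub>R dV e x)) \<in> borel_measurable lborel"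
          by measurable
        also have "(\<lambda>x. indicator U x *\<^sub>R ((V x \<bullet> e) *\<^sub>R q0 x + \<bar>f0 x\<bar> powr p *\<^sub>R dV e x)) = (\<lambda>x. indicator (\<Omega> \<inter> U) x *\<^sub>R h e x)"
          using p by (auto simp: q0_def f0_def h_def indicator_def fun_eq_iff)
        finally show "(\<lambda>x. indicator (\<Omega> \<inter> U) x *\<^sub>R h e x) \<in> borel_measurable lborel" .
        show "AE x in lborel. norm (indicator (\<Omega> \<inter> U) x *\<^sub>R h e x) \<le> norm (indicator (\<Omega> \<inter> U) x *\<^sub>R ?b x)"
        proof (rule AE_I2)
          fix x
          show "norm (indicator (\<Omega> \<inter> U) x *\<^sub>R h e x) \<le> norm (indicator (\<Omega> \<inter> U) x *\<^sub>R ?b x)"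
            using h_le[OF _ e, of x] by (cases "x \<in> \<Omega> \<inter> U") auto
        qed
      qed
      have div: "(LINT x:\<Omega>|lborel. h e x \<bullet> e) = (LINT x:frontier \<Omega>|S. (V x \<bullet> e) * ?N x * (\<eta> x \<bullet> e))" if e: "e \<in> Basis" for e
      proof (rule divergence_theorem[OF open_\<Omega> C1 compact_frontier is_S _ compact_closure _ _ ih[OF e] e])
        show "continuous_on (closure \<Omega>) (\<lambda>x. (V x \<bullet> e) * ?N x)"
          by (intro continuous_on_mult cN continuous_on_inner continuous_on_const continuous_on_subset[OF V(2)]) auto
        show "GDERIV (\<lambda>x. (V x \<bullet> e) * ?N x) x :> h e x" if "x \<in> \<Omega>" for x
          unfolding h_def by (intro GDERIV_mult V(1) GDERIV_abs_powr[OF p sm that])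
      qed auto
      have sN: "set_integrable S (frontier \<Omega>) ?N" by (rule S_integrable[OF continuous_on_subset[OF cN frontier_closure]])
      have sVe: "set_integrable S (frontier \<Omega>) (\<lambda>x. (V x \<bullet> e) * ?N x * (\<eta> x \<bullet> e))" for e
        by (intro S_integrable continuous_on_mult continuous_on_inner continuous_on_const cont_\<eta>
          continuous_on_subset[OF cN frontier_closure] continuous_on_subset[OF V(2) subset_UNIV])
      have V\<eta>: "(\<Sum>e\<in>Basis. (V x \<bullet> e) * ?N x * (\<eta> x \<bullet> e)) = ?N x * (V x \<bullet> \<eta> x)" for x
      proof -
        have "(\<Sum>e\<in>Basis. (V x \<bullet> e) * ?N x * (\<eta> x \<bullet> e)) = ?N x * (\<Sum>e\<in>Basis. (V x \<bullet> e) * (\<eta> x \<bullet> e))"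
          by (simp add: sum_distrib_left mult_ac)
        also have "\<dots> = ?N x * (V x \<bullet> \<eta> x)"
          by (rule arg_cong[OF euclidean_inner[of "V x" "\<eta> x", symmetric], of "\<lambda>t. ?N x * t"])
        finally show ?thesis .
      qed
      have "c * (LINT x:frontier \<Omega>|S. ?N x) = (LINT x:frontier \<Omega>|S. c * ?N x)" by simp
      also have "\<dots> \<le> (LINT x:frontier \<Omega>|S. ?N x * (V x \<bullet> \<eta> x))"
      proof (rule set_integral_mono)
        show "set_integrable S (frontier \<Omega>) (\<lambda>x. ?N x * (V x \<bullet> \<eta> x))"
          unfolding V\<eta>[symmetric] by (intro set_integral_sum(1) sVe)
        show "c * ?N x \<le> ?N x * (V x \<bullet> \<eta> x)" if "x \<in> frontier \<Omega>" for x
          using mult_right_mono[OF V(6)[OF that], of "?N x"] by (simp add: mult.commute)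
      qed (intro set_integrable_mult_right sN)
      also have "\<dots> = (\<Sum>e\<in>Basis. LINT x:frontier \<Omega>|S. (V x \<bullet> e) * ?N x * (\<eta> x \<bullet> e))"
        unfolding V\<eta>[symmetric] by (intro set_integral_sum(2) sVe)
      also have "\<dots> = (\<Sum>e\<in>Basis. LINT x:\<Omega>|lborel. h e x \<bullet> e)" by (intro sum.cong div[symmetric]) auto
      also have "\<dots> = (LINT x:\<Omega>|lborel. \<Sum>e\<in>Basis. h e x \<bullet> e)"
        by (rule set_integral_sum(2)[symmetric]) (intro set_integrable_scaleR_inner ih)
      also have "\<dots> \<le> (LINT x:\<Omega> \<inter> U|lborel. (real DIM('a) * B1 * p + B2) * ?N x + (real DIM('a) * B1 * p + B2) * ?D x)"
        unfolding set_lebesgue_integral_def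
      proof (rule integral_mono)
        show "integrable lborel (\<lambda>x. indicator \<Omega> x *\<^sub>R (\<Sum>e\<in>Basis. h e x \<bullet> e))"
          using set_integral_sum(1)[of Basis lborel \<Omega> "\<lambda>e x. h e x \<bullet> e"] set_integrable_scaleR_inner[OF ih]
          by (simp add: set_integrable_def)
        show "integrable lborel (\<lambda>x. indicator (\<Omega> \<inter> U) x *\<^sub>R ((real DIM('a) * B1 * p + B2) * ?N x + (real DIM('a) * B1 * p + B2) * ?D x))"
          using ib by (simp add: set_integrable_def)
        fix x
        show "indicator \<Omega> x *\<^sub>R (\<Sum>e\<in>Basis. h e x \<bullet> e) \<le> indicator (\<Omega> \<inter> U) x *\<^sub>R ((real DIM('a) * B1 * p + B2) * ?N x + (real DIM('a) * B1 * p + B2) * ?D x)"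
        proof (cases "x \<in> \<Omega> \<inter> U")
          case False
          then have "x \<in> \<Omega> \<Longrightarrow> h e x = 0" for e using V(4)[of x] by (auto simp: h_def)
          then show ?thesis using False by (auto simp: indicator_def)
        next
          case True
          then have x: "x \<in> \<Omega>" "x \<in> closure \<Omega>" using \<Omega>_closure by auto
          have "(\<Sum>e\<in>Basis. h e x \<bullet> e) \<le> (\<Sum>e\<in>Basis. B1 * p * (?N x + ?D x) + ?N x * norm (dV e x))"
          proof (rule sum_mono)
            fix e :: 'a assume e: "e \<in> Basis"
            have "h e x \<bullet> e \<le> norm (h e x)" using Basis_le_norm[OF e, of "h e x"] by linarith
            also have "\<dots> \<le> \<bar>V x \<bullet> e\<bar> * norm (dpow p \<phi> x) + ?N x * norm (dV e x)"
              unfolding h_def by (rule order_trans[OF norm_triangle_ineq]) simp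
            finally show "h e x \<bullet> e \<le> B1 * p * (?N x + ?D x) + ?N x * norm (dV e x)"
              using h_parts(1)[OF x(1) e] by linarith
          qed
          also have "\<dots> = real DIM('a) * B1 * p * (?N x + ?D x) + ?N x * dN x"
            by (simp add: sum.distrib dN_def sum_distrib_left)
          also have "\<dots> \<le> real DIM('a) * B1 * p * (?N x + ?D x) + ?N x * B2"
            using B2(2)[OF x(2)] by (intro add_left_mono mult_left_mono) auto
          also have "\<dots> \<le> (real DIM('a) * B1 * p + B2) * ?N x + (real DIM('a) * B1 * p + B2) * ?D x"
            using B2(1) by (simp add: algebra_simps)
          finally show ?thesis using True by simp
        qed
      qed
      also have "\<dots> = (real DIM('a) * B1 * p + B2) * ((LINT x:\<Omega> \<inter> U|lborel. ?N x) + (LINT x:\<Omega> \<inter> U|lborel. ?D x))"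
        by (simp add: set_integral_add(2) iN iD set_integrable_mult_right distrib_left)
      also have "\<dots> \<le> (c * C) * ((LINT x:\<Omega> \<inter> U|lborel. ?N x) + (LINT x:\<Omega> \<inter> U|lborel. ?D x))"
        unfolding C_def using V(5)
        by (intro mult_right_mono) (auto simp: set_lebesgue_integral_def intro!: add_nonneg_nonneg Bochner_Integration.integral_nonneg)
      finally have real: "(LINT x:frontier \<Omega>|S. ?N x) \<le> C * ((LINT x:\<Omega> \<inter> U|lborel. ?N x) + (LINT x:\<Omega> \<inter> U|lborel. ?D x))"
        using V(5) by (simp add: mult.assoc)
      have nn: "0 \<le> (LINT x:\<Omega> \<inter> U|lborel. ?N x)" "0 \<le> (LINT x:\<Omega> \<inter> U|lborel. ?D x)"
        by (auto simp: set_lebesgue_integral_def intro!: Bochner_Integration.integral_nonneg)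
      show ?thesis
        using real C nn by (simp add: set_nn_integral_eq[OF sN] set_nn_integral_eq[OF iN] set_nn_integral_eq[OF iD] ennreal_plus[symmetric] ennreal_mult[symmetric] ennreal_leI del: ennreal_plus)
    qed
  qed
qed

text \<open>Integration by parts is the divergence theorem for \<psi> \<phi>, extended by zero
  outside \<Omega>. The product vanishes near the frontier, so there is no boundary term.\<close>

lemma smooth_weak_gradient:
  assumes sm: "smooth_on \<Omega> \<phi>" and \<psi>: "test_function \<Omega> \<psi>" and e: "e \<in> Basis"
    and K: "compact K" "K \<subseteq> \<Omega>" "\<And>x. x \<notin> K \<Longrightarrow> \<psi> x = 0" "\<And>x. x \<notin> K \<Longrightarrow> gradient \<psi> x = 0"
  shows "(LINT x:K|lborel. (gradient \<psi> x \<bullet> e) * \<phi> x) = - (LINT x:K|lborel. \<psi> x * (gradient \<phi> x \<bullet> e))"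
proof -
  have g\<psi>: "\<And>x. GDERIV \<psi> x :> gradient \<psi> x" "continuous_on UNIV (gradient \<psi>)" "continuous_on UNIV \<psi>"
    using test_functionD[OF \<psi>] by blast+
  note g\<phi> = smooth_on_GDERIV[OF sm]
  let ?f = "\<lambda>x. if x \<in> \<Omega> then \<psi> x * \<phi> x else 0"
  let ?g = "\<lambda>x. \<psi> x *\<^sub>R gradient \<phi> x + \<phi> x *\<^sub>R gradient \<psi> x"
  have int: "set_integrable lborel K k" if k: "continuous_on K k" for k :: "'a \<Rightarrow> 'b::euclidean_space"
  proof -
    obtain B where "\<And>x. x \<in> K \<Longrightarrow> \<bar>norm (k x)\<bar> \<le> B"
      by (rule bounded_image_compact_real[OF K(1) continuous_on_norm[OF k]], rule that)
    then show ?thesis using K(1) k emeasure_compact_finite[OF K(1)]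
      by (intro set_integrable_continuous_finite[where B=B]) (auto simp: borel_compact)
  qed
  have cK: "continuous_on K \<phi>" "continuous_on K (gradient \<phi>)" "continuous_on K \<psi>" "continuous_on K (gradient \<psi>)"
    using continuous_on_subset[OF g\<phi>(3) K(2)] continuous_on_subset[OF g\<phi>(2) K(2)] continuous_on_subset[OF g\<psi>(3)] continuous_on_subset[OF g\<psi>(2)] by auto
  have ind: "indicator \<Omega> x *\<^sub>R ?g x = indicator K x *\<^sub>R ?g x" for x
    using K(2,3,4) by (auto simp: indicator_def)
  have ig: "set_integrable lborel \<Omega> ?g"
    unfolding set_integrable_def ind
    using int[of ?g] cK by (simp add: set_integrable_def continuous_on_add continuous_on_scaleR)
  have "(LINT x:\<Omega>|lborel. ?g x \<bullet> e) = (LINT x:frontier \<Omega>|S. ?f x * (\<eta> x \<bullet> e))"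
  proof (rule divergence_theorem[OF open_\<Omega> C1 compact_frontier is_S _ compact_closure _ _ ig e])
    have op: "openin (top_of_set (closure \<Omega>)) (closure \<Omega> \<inter> \<Omega>)" "openin (top_of_set (closure \<Omega>)) (closure \<Omega> \<inter> - K)"
      using open_\<Omega> K(1) by (auto intro!: openin_open_Int simp: open_Compl compact_imp_closed)
    have "continuous_on (closure \<Omega> \<inter> \<Omega>) (\<lambda>x. \<psi> x * \<phi> x)"
      by (intro continuous_intros continuous_on_subset[OF g\<phi>(3)] continuous_on_subset[OF g\<psi>(3)]) auto
    then have c1: "continuous_on (closure \<Omega> \<inter> \<Omega>) ?f" by (rule continuous_on_eq) auto
    have "continuous_on (closure \<Omega> \<inter> - K) (\<lambda>x. 0 :: real)" by simp
    then have c2: "continuous_on (closure \<Omega> \<inter> - K) ?f" by (rule continuous_on_eq) (use K(3) in auto)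
    have eq: "closure \<Omega> = (closure \<Omega> \<inter> \<Omega>) \<union> (closure \<Omega> \<inter> - K)" using K(2) by auto
    show "continuous_on (closure \<Omega>) ?f"
      using continuous_on_Un_local_open[of "closure \<Omega> \<inter> \<Omega>" "closure \<Omega> \<inter> - K" ?f] op c1 c2
      unfolding eq[symmetric] by blast
    show "GDERIV ?f x :> ?g x" if x: "x \<in> \<Omega>" for x
      by (rule GDERIV_cong_open[OF GDERIV_mult[OF g\<psi>(1) g\<phi>(1)[OF x]] open_\<Omega> x]) auto
  qed auto
  also have "\<dots> = (LINT x:frontier \<Omega>|S. 0)"
    by (rule set_lebesgue_integral_cong) (use frontier_disjoint in auto)
  finally have "0 = (LINT x:\<Omega>|lborel. ?g x \<bullet> e)" by simp
  also have "\<dots> = (LINT x:K|lborel. \<psi> x * (gradient \<phi> x \<bullet> e) + (gradient \<psi> x \<bullet> e) * \<phi> x)"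
    unfolding set_lebesgue_integral_def
  proof (rule Bochner_Integration.integral_cong[OF refl])
    show "indicator \<Omega> x *\<^sub>R (?g x \<bullet> e) = indicator K x *\<^sub>R (\<psi> x * (gradient \<phi> x \<bullet> e) + (gradient \<psi> x \<bullet> e) * \<phi> x)" for x
      using arg_cong[OF ind[of x], of "\<lambda>v. v \<bullet> e"] by (simp add: inner_add_left mult.commute)
  qed
  also have "\<dots> = (LINT x:K|lborel. \<psi> x * (gradient \<phi> x \<bullet> e)) + (LINT x:K|lborel. (gradient \<psi> x \<bullet> e) * \<phi> x)"
    by (rule set_integral_add(2)) (intro int continuous_on_mult continuous_on_inner continuous_on_const cK)+
  finally show ?thesis by simp
qed

end

section \<open>Passage to the limit\<close>

text \<open>Elements of the completion are determined almost everywhere and need not be Borel. This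
  moves their integrals to a Borel representative and to \<open>lborel\<close>, where the estimates
  live.\<close>

lemma lebesgue_AE_eq:
  fixes f g :: "'a::euclidean_space \<Rightarrow> 'b::euclidean_space"
  assumes g: "g \<in> borel_measurable borel" and ae: "AE x in lebesgue. f x = g x"
  shows "integrable lebesgue f \<longleftrightarrow> integrable lborel g" "(LINT x|lebesgue. f x) = (LINT x|lborel. g x)"
proof -
  have gl: "g \<in> borel_measurable lborel" using g by simp
  then have gm: "g \<in> borel_measurable lebesgue" by (rule measurable_completion)
  have ae': "AE x in lebesgue. g x = f x" using ae by eventually_elim simp
  have fm: "f \<in> borel_measurable lebesgue" by (rule borel_measurable_AE[OF gm ae'])
  show "integrable lebesgue f \<longleftrightarrow> integrable lborel g"
    using integrable_cong_AE[OF fm gm ae] integrable_completion[OF gl] by simp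
  show "(LINT x|lebesgue. f x) = (LINT x|lborel. g x)"
    using integral_cong_AE[OF fm gm ae] integral_completion[OF gl] by simp
qed

lemma set_lebesgue_AE_eq:
  fixes f g :: "'a::euclidean_space \<Rightarrow> 'b::euclidean_space"
  assumes g: "(\<lambda>x. indicator A x *\<^sub>R g x) \<in> borel_measurable borel" and ae: "AE x in lebesgue. x \<in> A \<longrightarrow> f x = g x"
  shows "set_integrable lebesgue A f \<longleftrightarrow> set_integrable lborel A g" "(LINT x:A|lebesgue. f x) = (LINT x:A|lborel. g x)"
proof -
  have ae': "AE x in lebesgue. indicator A x *\<^sub>R f x = indicator A x *\<^sub>R g x"
    using ae by eventually_elim (auto simp: indicator_def)
  show "set_integrable lebesgue A f \<longleftrightarrow> set_integrable lborel A g" "(LINT x:A|lebesgue. f x) = (LINT x:A|lborel. g x)"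
    using lebesgue_AE_eq[OF g ae'] by (simp_all add: set_integrable_def set_lebesgue_integral_def)
qed

lemma set_nn_lebesgue_AE_eq:
  assumes "AE x in lebesgue. x \<in> A \<longrightarrow> f x = g x"
  shows "(\<integral>\<^sup>+x\<in>A. f x \<partial>lebesgue) = (\<integral>\<^sup>+x\<in>A. g x \<partial>lborel)"
proof -
  have "(\<integral>\<^sup>+x\<in>A. f x \<partial>lebesgue) = (\<integral>\<^sup>+x\<in>A. g x \<partial>lebesgue)"
    by (rule nn_integral_cong_AE) (use assms in \<open>eventually_elim, auto simp: indicator_def\<close>)
  then show ?thesis by (simp add: nn_integral_completion)
qed

lemma has_weak_gradient_cong_AE:
  assumes v: "v \<in> borel_measurable borel" and ae: "AE x in lebesgue. x \<in> U \<longrightarrow> u x = v x" and U: "open U"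
    and G: "has_weak_gradient U v G"
  shows "has_weak_gradient U u G"
  unfolding has_weak_gradient_def
proof (intro conjI allI impI; (elim conjE)?)
  note [measurable] = v
  note D = G[unfolded has_weak_gradient_def]
  fix K assume K: "compact K" "K \<subseteq> U"
  have [measurable]: "K \<in> sets borel" using K(1) by (rule borel_compact)
  have m: "(\<lambda>x. indicator K x *\<^sub>R v x) \<in> borel_measurable borel" by measurable
  have "AE x in lebesgue. x \<in> K \<longrightarrow> u x = v x" using ae by eventually_elim (use K(2) in blast)
  from set_lebesgue_AE_eq(1)[OF m this] set_integrable_lebesgue_lborel(1)[OF m] K D
  show "set_integrable lebesgue K u" by blast
  show "set_integrable lebesgue K G" using K D by blast
next
  note [measurable] = v
  fix \<psi> assume \<psi>: "test_function U \<psi>"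
  obtain K where c: "continuous_on UNIV (gradient \<psi>)"
    by (rule test_functionD[OF \<psi>], rule that)
  have [measurable]: "gradient \<psi> \<in> borel_measurable borel" using c by (rule borel_measurable_continuous_onI)
  have [measurable]: "U \<in> sets borel" using U by simp
  have m: "(\<lambda>x. indicator U x *\<^sub>R (v x *\<^sub>R gradient \<psi> x)) \<in> borel_measurable borel" by measurable
  have "AE x in lebesgue. x \<in> U \<longrightarrow> u x *\<^sub>R gradient \<psi> x = v x *\<^sub>R gradient \<psi> x" using ae by eventually_elim simp
  from set_lebesgue_AE_eq(2)[OF m this] set_integrable_lebesgue_lborel(2)[OF m]
  have "(LINT x:U|lebesgue. u x *\<^sub>R gradient \<psi> x) = (LINT x:U|lebesgue. v x *\<^sub>R gradient \<psi> x)" by simp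
  then show "(LINT x:U|lebesgue. u x *\<^sub>R gradient \<psi> x) = - (LINT x:U|lebesgue. \<psi> x *\<^sub>R G x)"
    using G \<psi> by (simp add: has_weak_gradient_def)
qed

lemma Lp_null_trans:
  fixes a b c :: "nat \<Rightarrow> 'a \<Rightarrow> 'b::euclidean_space"
  assumes p: "0 \<le> p" and A [measurable]: "A \<in> sets M"
    and "\<And>k. (\<lambda>x. indicator A x *\<^sub>R a k x) \<in> borel_measurable M" "\<And>k. (\<lambda>x. indicator A x *\<^sub>R b k x) \<in> borel_measurable M"
      "\<And>k. (\<lambda>x. indicator A x *\<^sub>R c k x) \<in> borel_measurable M"
    and ab: "(\<lambda>k. \<integral>\<^sup>+x\<in>A. ennreal (norm (a k x - b k x) powr p) \<partial>M) \<longlonglongrightarrow> 0"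
    and bc: "(\<lambda>k. \<integral>\<^sup>+x\<in>A. ennreal (norm (b k x - c k x) powr p) \<partial>M) \<longlonglongrightarrow> 0"
  shows "(\<lambda>k. \<integral>\<^sup>+x\<in>A. ennreal (norm (a k x - c k x) powr p) \<partial>M) \<longlonglongrightarrow> 0"
proof -
  define a' b' c' where "a' k x = indicator A x *\<^sub>R a k x" and "b' k x = indicator A x *\<^sub>R b k x" and "c' k x = indicator A x *\<^sub>R c k x" for k x
  have [measurable]: "a' k \<in> borel_measurable M" "b' k \<in> borel_measurable M" "c' k \<in> borel_measurable M" for k
    using assms(3-5)[of k] by (simp_all add: a'_def[abs_def] b'_def[abs_def] c'_def[abs_def])
  let ?I = "\<lambda>f g k. \<integral>\<^sup>+x\<in>A. ennreal (norm (f k x - g k x :: 'b) powr p) \<partial>M"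
  have eq: "?I a b k = ?I a' b' k" "?I b c k = ?I b' c' k" "?I a c k = ?I a' c' k" for k
    by (intro nn_integral_cong; simp add: a'_def b'_def c'_def indicator_def)+
  have "?I a' c' k \<le> ennreal (2 powr p) * (?I a' b' k + ?I b' c' k)" for k
  proof -
    have "?I a' c' k \<le> (\<integral>\<^sup>+x. ennreal (2 powr p) * (ennreal (norm (a' k x - b' k x) powr p) * indicator A x + ennreal (norm (b' k x - c' k x) powr p) * indicator A x) \<partial>M)"
    proof (rule nn_integral_mono)
      fix x
      have "norm (a' k x - c' k x) powr p \<le> 2 powr p * (norm (a' k x - b' k x) powr p + norm (b' k x - c' k x) powr p)"
        using norm_add_powr_le[OF p, of "a' k x - b' k x" "b' k x - c' k x"] by simp
      then have "ennreal (norm (a' k x - c' k x) powr p) \<le> ennreal (2 powr p) * (ennreal (norm (a' k x - b' k x) powr p) + ennreal (norm (b' k x - c' k x) powr p))"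
        by (simp add: ennreal_leI flip: ennreal_mult ennreal_plus)
      then show "ennreal (norm (a' k x - c' k x) powr p) * indicator A x
        \<le> ennreal (2 powr p) * (ennreal (norm (a' k x - b' k x) powr p) * indicator A x + ennreal (norm (b' k x - c' k x) powr p) * indicator A x)"
        by (auto simp: indicator_def)
    qed
    also have "\<dots> = ennreal (2 powr p) * (?I a' b' k + ?I b' c' k)"
      by (simp add: nn_integral_cmult nn_integral_add)
    finally show ?thesis .
  qed
  moreover have "(\<lambda>k. ennreal (2 powr p) * (?I a' b' k + ?I b' c' k)) \<longlonglongrightarrow> ennreal (2 powr p) * (0 + 0)"
    by (intro ennreal_tendsto_cmult tendsto_add ab[unfolded eq] bc[unfolded eq]) simp
  ultimately show ?thesis unfolding eq
    by (intro tendsto_sandwich[of "\<lambda>_. 0" "?I a' c'" _ "\<lambda>k. ennreal (2 powr p) * (?I a' b' k + ?I b' c' k)"]) auto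
qed

lemma Lp_limit:
  fixes f :: "nat \<Rightarrow> 'a \<Rightarrow> real" and g :: "'a \<Rightarrow> real"
  assumes p: "0 < p" and [measurable]: "\<And>k. f k \<in> borel_measurable M" "g \<in> borel_measurable M"
    and f: "\<And>k. integrable M (\<lambda>x. \<bar>f k x\<bar> powr p)"
    and lim: "(\<lambda>k. \<integral>\<^sup>+x. ennreal (\<bar>f k x - g x\<bar> powr p) \<partial>M) \<longlonglongrightarrow> 0"
  shows "integrable M (\<lambda>x. \<bar>g x\<bar> powr p)"
    and "(\<lambda>k. LINT x|M. \<bar>f k x\<bar> powr p) \<longlonglongrightarrow> (LINT x|M. \<bar>g x\<bar> powr p)"
proof -
  have "\<forall>\<^sub>F k in sequentially. (\<integral>\<^sup>+x. ennreal (\<bar>f k x - g x\<bar> powr p) \<partial>M) < 1"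
    by (rule order_tendstoD(2)[OF lim]) simp
  then obtain k where k: "(\<integral>\<^sup>+x. ennreal (\<bar>f k x - g x\<bar> powr p) \<partial>M) < 1" by (auto simp: eventually_sequentially)
  show i: "integrable M (\<lambda>x. \<bar>g x\<bar> powr p)"
  proof (rule Bochner_Integration.integrable_bound)
    have "integrable M (\<lambda>x. \<bar>f k x - g x\<bar> powr p)"
    proof (rule integrableI_bounded)
      show "(\<integral>\<^sup>+x. ennreal (norm (\<bar>f k x - g x\<bar> powr p)) \<partial>M) < \<infinity>"
        using less_trans[OF k, of \<infinity>] by simp
    qed measurable
    then show "integrable M (\<lambda>x. 2 powr p * (\<bar>f k x\<bar> powr p + \<bar>f k x - g x\<bar> powr p))" using f[of k] by simp
    show "AE x in M. norm (\<bar>g x\<bar> powr p) \<le> norm (2 powr p * (\<bar>f k x\<bar> powr p + \<bar>f k x - g x\<bar> powr p))"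
    proof (rule AE_I2)
      fix x
      show "norm (\<bar>g x\<bar> powr p) \<le> norm (2 powr p * (\<bar>f k x\<bar> powr p + \<bar>f k x - g x\<bar> powr p))"
        using norm_add_powr_le[of p "f k x" "g x - f k x"] p by (simp add: abs_minus_commute)
    qed
  qed measurable
  show "(\<lambda>k. LINT x|M. \<bar>f k x\<bar> powr p) \<longlonglongrightarrow> (LINT x|M. \<bar>g x\<bar> powr p)"
    by (rule Lp_norm_tendsto[OF p _ _ f i lim]) measurable
qed

text \<open>The weight is absorbed into the functions as w^(1/p); being bounded, it preserves the
  L^p convergence.\<close>

lemma Lp_weighted_limit:
  fixes f :: "nat \<Rightarrow> 'a \<Rightarrow> real" and g w :: "'a \<Rightarrow> real"
  assumes p: "0 < p" and [measurable]: "\<And>k. f k \<in> borel_measurable M" "g \<in> borel_measurable M" "w \<in> borel_measurable M"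
    and w: "\<And>x. 0 \<le> w x" "\<And>x. w x \<le> B"
    and f: "\<And>k. integrable M (\<lambda>x. w x * \<bar>f k x\<bar> powr p)"
    and lim: "(\<lambda>k. \<integral>\<^sup>+x. ennreal (\<bar>f k x - g x\<bar> powr p) \<partial>M) \<longlonglongrightarrow> 0"
  shows "integrable M (\<lambda>x. w x * \<bar>g x\<bar> powr p)"
    and "(\<lambda>k. LINT x|M. w x * \<bar>f k x\<bar> powr p) \<longlonglongrightarrow> (LINT x|M. w x * \<bar>g x\<bar> powr p)"
proof -
  have eq: "\<bar>w x powr (1/p) * t\<bar> powr p = w x * \<bar>t\<bar> powr p" for x t
    using p w(1)[of x] by (simp add: abs_mult powr_mult powr_powr)
  have B: "0 \<le> B" using w by (meson order_trans)
  have le: "(\<integral>\<^sup>+x. ennreal (\<bar>w x powr (1/p) * f k x - w x powr (1/p) * g x\<bar> powr p) \<partial>M)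
      \<le> ennreal B * (\<integral>\<^sup>+x. ennreal (\<bar>f k x - g x\<bar> powr p) \<partial>M)" for k
  proof -
    have "(\<integral>\<^sup>+x. ennreal (\<bar>w x powr (1/p) * f k x - w x powr (1/p) * g x\<bar> powr p) \<partial>M)
        \<le> (\<integral>\<^sup>+x. ennreal B * ennreal (\<bar>f k x - g x\<bar> powr p) \<partial>M)"
    proof (rule nn_integral_mono)
      fix x
      have "\<bar>w x powr (1/p) * f k x - w x powr (1/p) * g x\<bar> powr p = w x * \<bar>f k x - g x\<bar> powr p"
        unfolding right_diff_distrib[symmetric] by (rule eq)
      also have "\<dots> \<le> B * \<bar>f k x - g x\<bar> powr p" using w(2)[of x] by (rule mult_right_mono) simp
      finally show "ennreal (\<bar>w x powr (1/p) * f k x - w x powr (1/p) * g x\<bar> powr p) \<le> ennreal B * ennreal (\<bar>f k x - g x\<bar> powr p)"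
        using B by (simp add: ennreal_leI flip: ennreal_mult)
    qed
    then show ?thesis by (simp add: nn_integral_cmult)
  qed
  have 0: "(\<lambda>k. ennreal B * (\<integral>\<^sup>+x. ennreal (\<bar>f k x - g x\<bar> powr p) \<partial>M)) \<longlonglongrightarrow> 0"
    using ennreal_tendsto_cmult[OF _ lim, of "ennreal B"] by simp
  have "(\<lambda>k. \<integral>\<^sup>+x. ennreal (\<bar>w x powr (1/p) * f k x - w x powr (1/p) * g x\<bar> powr p) \<partial>M) \<longlonglongrightarrow> 0"
    by (rule tendsto_sandwich[OF _ _ tendsto_const 0]) (use le in auto)
  from Lp_limit[OF p _ _ _ this] f
  show "integrable M (\<lambda>x. w x * \<bar>g x\<bar> powr p)"
    "(\<lambda>k. LINT x|M. w x * \<bar>f k x\<bar> powr p) \<longlonglongrightarrow> (LINT x|M. w x * \<bar>g x\<bar> powr p)"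
    unfolding eq by simp_all
qed

section \<open>Limits of a Cauchy sequence and of its gradients\<close>

locale hardy_sequence = hardy_domain +
  fixes \<phi> :: "nat \<Rightarrow> 'a \<Rightarrow> real" and u :: "'a \<Rightarrow> real"
  assumes pre: "\<And>k. \<phi> k \<in> hatW_pre \<Omega> p l"
    and Cauchy_norm: "\<And>e. 0 < e \<Longrightarrow> \<exists>N. \<forall>i\<ge>N. \<forall>j\<ge>N. hatW_norm \<Omega> p l (\<lambda>x. \<phi> i x - \<phi> j x) < e"
    and lim_u: "AE x in lebesgue. x \<in> \<Omega> \<longrightarrow> (\<lambda>k. \<phi> k x) \<longlonglongrightarrow> u x"
begin

definition f where "f k x = indicator \<Omega> x * \<phi> k x"
definition g where "g k x = indicator \<Omega> x *\<^sub>R gradient (\<phi> k) x"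
text \<open>A Borel function that equals u almost everywhere on \<Omega>; where the limit does not
  exist its value is irrelevant.\<close>

definition v where "v x = lim (\<lambda>k. f k x)"
definition \<nu> where "\<nu> a = density lborel (\<lambda>x. ennreal (indicator \<Omega> x * norm x powr a))"

lemma sm: "smooth_on \<Omega> (\<phi> k)" and cl: "continuous_on (closure \<Omega>) (\<phi> k)"
  and en: "set_integrable lborel \<Omega> (\<lambda>x. norm x powr l * norm (gradient (\<phi> k) x) powr p)"
  using pre_energy[OF pre[of k]] by (auto simp: smooth_energy_def)

lemma fg_borel [measurable]: "f k \<in> borel_measurable borel" "g k \<in> borel_measurable borel"
  unfolding f_def[abs_def] g_def[abs_def] by (rule grad_measurable[OF sm])+

lemma v_borel [measurable]: "v \<in> borel_measurable borel"
  unfolding v_def[abs_def] by measurable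

lemma AE_lim: "AE x in lebesgue. (\<lambda>k. f k x) \<longlonglongrightarrow> v x \<and> (x \<in> \<Omega> \<longrightarrow> u x = v x)"
  using lim_u
proof eventually_elim
  case (elim x)
  show ?case
  proof (cases "x \<in> \<Omega>")
    case True
    then have "(\<lambda>k. f k x) \<longlonglongrightarrow> u x" using elim by (simp add: f_def)
    then show ?thesis using limI[of "\<lambda>k. f k x" "u x"] by (simp add: v_def)
  next
    case False
    then have "(\<lambda>k. f k x) = (\<lambda>_. 0)" by (simp add: f_def)
    then show ?thesis using False by (simp add: v_def)
  qed
qed

lemma u_eq_v: "AE x in lebesgue. x \<in> \<Omega> \<longrightarrow> u x = v x"
  using AE_lim by eventually_elim simp

lemma sets_\<nu> [simp, measurable_cong]: "sets (\<nu> a) = sets borel" by (simp add: \<nu>_def)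

lemma nn_integral_\<nu>:
  assumes [measurable]: "F \<in> borel_measurable borel" and F: "\<And>x. 0 \<le> F x"
  shows "(\<integral>\<^sup>+x. ennreal (F x) \<partial>\<nu> a) = (\<integral>\<^sup>+x\<in>\<Omega>. ennreal (norm x powr a * F x) \<partial>lborel)"
  unfolding \<nu>_def by (subst nn_integral_density) (auto simp: F ennreal_mult indicator_def intro!: nn_integral_cong)

lemma integral_\<nu>:
  fixes F :: "'a \<Rightarrow> real"
  assumes [measurable]: "F \<in> borel_measurable borel"
  shows "integrable (\<nu> a) F \<longleftrightarrow> set_integrable lborel \<Omega> (\<lambda>x. norm x powr a * F x)"
    "(LINT x|\<nu> a. F x) = (LINT x:\<Omega>|lborel. norm x powr a * F x)"
  unfolding \<nu>_def set_integrable_def set_lebesgue_integral_def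
  by (subst integrable_density integral_density; simp add: mult.assoc)+

lemma Cauchy_of_norm:
  fixes X :: "nat \<Rightarrow> nat \<Rightarrow> ennreal"
  assumes X: "\<And>i j. X i j \<le> ennreal (D * hatW_norm \<Omega> p l (\<lambda>x. \<phi> i x - \<phi> j x) powr p)" and D: "0 \<le> D" and e: "0 < e"
  shows "\<exists>N. \<forall>i\<ge>N. \<forall>j\<ge>N. X i j < ennreal e"
proof -
  \<comment> \<open>With this \<open>?d\<close>, D times its p-th power is D e / (D + 1), which is
    below e also when D = 0.\<close>
  let ?N = "\<lambda>i j. hatW_norm \<Omega> p l (\<lambda>x. \<phi> i x - \<phi> j x)" and ?d = "(e / (D + 1)) powr (1/p)"
  have "0 < ?d" using e D by simp
  from Cauchy_norm[OF this] obtain N where N: "\<And>i j. N \<le> i \<Longrightarrow> N \<le> j \<Longrightarrow> ?N i j < ?d" by blast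
  have "X i j < ennreal e" if ij: "N \<le> i" "N \<le> j" for i j
  proof -
    have "?N i j powr p \<le> ?d powr p"
      using N[OF ij] hatW_norm_nonneg[OF pre_energy[OF pre_diff[OF pre[of i] pre[of j]]]] p by (intro powr_mono2) auto
    also have "?d powr p = e / (D + 1)" using p e D by (simp add: powr_powr)
    finally have "D * ?N i j powr p \<le> D * (e / (D + 1))" using D by (rule mult_left_mono)
    also have "\<dots> < e" using D e by (simp add: field_simps)
    finally have "ennreal (D * ?N i j powr p) < ennreal e" using e by (simp add: ennreal_less_iff D)
    then show ?thesis using X[of i j] by (rule le_less_trans[rotated])
  qed
  then show ?thesis by blast
qed

lemma dist_g: "(\<integral>\<^sup>+x. ennreal (norm (g i x - g j x) powr p) \<partial>\<nu> l) \<le> ennreal (hatW_norm \<Omega> p l (\<lambda>x. \<phi> i x - \<phi> j x) powr p)"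
proof -
  let ?d = "\<lambda>x. \<phi> i x - \<phi> j x"
  have se: "smooth_energy ?d" by (rule pre_energy[OF pre_diff[OF pre pre]])
  have "(\<integral>\<^sup>+x. ennreal (norm (g i x - g j x) powr p) \<partial>\<nu> l) = (\<integral>\<^sup>+x\<in>\<Omega>. ennreal (norm x powr l * norm (g i x - g j x) powr p) \<partial>lborel)"
    by (rule nn_integral_\<nu>) auto
  also have "\<dots> = (\<integral>\<^sup>+x\<in>\<Omega>. ennreal (norm x powr l * norm (gradient ?d x) powr p) \<partial>lborel)"
    by (intro nn_integral_cong) (auto simp: indicator_def g_def gradient_diff[OF sm sm])
  also have "\<dots> = ennreal (dirichlet ?d)"
    unfolding dirichlet_def using se by (intro set_nn_integral_eq) (auto simp: smooth_energy_def)
  also have "\<dots> \<le> ennreal (hatW_norm \<Omega> p l ?d powr p)" by (rule ennreal_leI[OF dirichlet_le_norm[OF se]])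
  finally show ?thesis .
qed

lemma dist_f: "(\<integral>\<^sup>+x. ennreal (norm (f i x - f j x) powr p) \<partial>\<nu> (l - p)) \<le> ennreal (C0 powr p * hatW_norm \<Omega> p l (\<lambda>x. \<phi> i x - \<phi> j x) powr p)"
proof -
  let ?d = "\<lambda>x. \<phi> i x - \<phi> j x"
  have pd: "?d \<in> hatW_pre \<Omega> p l" by (rule pre_diff[OF pre pre])
  have "(\<integral>\<^sup>+x. ennreal (norm (f i x - f j x) powr p) \<partial>\<nu> (l - p)) = (\<integral>\<^sup>+x\<in>\<Omega>. ennreal (norm x powr (l - p) * norm (f i x - f j x) powr p) \<partial>lborel)"
    by (rule nn_integral_\<nu>) auto
  also have "\<dots> = (\<integral>\<^sup>+x\<in>\<Omega>. ennreal (W x * \<bar>?d x\<bar> powr p) \<partial>lborel)"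
    by (intro nn_integral_cong) (auto simp: indicator_def f_def W_def)
  also have "\<dots> = ennreal (mass ?d)"
    unfolding mass_def using pd hardy_smooth(1)[OF pre_energy[OF pd]]
    by (intro set_nn_integral_eq) (auto simp: pre_iff W_nonneg)
  also have "\<dots> \<le> ennreal ((C0 * hatW_norm \<Omega> p l ?d) powr p)" by (rule ennreal_leI[OF mass_le_norm[OF pd]])
  also have "(C0 * hatW_norm \<Omega> p l ?d) powr p = C0 powr p * hatW_norm \<Omega> p l ?d powr p"
    by (rule powr_mult)
  finally show ?thesis .
qed

lemma lim_f: "(\<lambda>k. \<integral>\<^sup>+x. ennreal (norm (f k x - v x) powr p) \<partial>\<nu> (l - p)) \<longlonglongrightarrow> 0"
proof (rule Lp_limit_AE[of p _ _ _ id])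
  show "\<exists>N. \<forall>i\<ge>N. \<forall>j\<ge>N. (\<integral>\<^sup>+x. ennreal (norm (f i x - f j x) powr p) \<partial>\<nu> (l - p)) < ennreal e" if "0 < e" for e
    by (rule Cauchy_of_norm[OF dist_f _ that]) simp
  have "AE x in lborel. (\<lambda>k. f k x) \<longlonglongrightarrow> v x \<and> (x \<in> \<Omega> \<longrightarrow> u x = v x)" using AE_lim unfolding AE_completion_iff .
  then show "AE x in \<nu> (l - p). (\<lambda>j. f (id j) x) \<longlonglongrightarrow> v x"
    unfolding \<nu>_def by (subst AE_density) auto
qed (use p in \<open>auto simp: strict_mono_def\<close>)

text \<open>The limit of the gradients in the weighted L^p space and the candidate for the gradient
  of u; \<open>weak_gradient_limit\<close> identifies it.\<close>

definition G where "G = (SOME G. G \<in> borel_measurable borel \<and>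
  (\<lambda>k. \<integral>\<^sup>+x. ennreal (norm (g k x - G x) powr p) \<partial>\<nu> l) \<longlonglongrightarrow> 0)"

lemma G_borel [measurable]: "G \<in> borel_measurable borel"
  and lim_g: "(\<lambda>k. \<integral>\<^sup>+x. ennreal (norm (g k x - G x) powr p) \<partial>\<nu> l) \<longlonglongrightarrow> 0"
proof -
  have "\<exists>N. \<forall>i\<ge>N. \<forall>j\<ge>N. (\<integral>\<^sup>+x. ennreal (norm (g i x - g j x) powr p) \<partial>\<nu> l) < ennreal e" if "0 < e" for e
    by (rule Cauchy_of_norm[of _ 1, OF _ _ that]) (use dist_g in auto)
  moreover have "g k \<in> borel_measurable (\<nu> l)" for k by measurable
  moreover have "0 < p" using p by simp
  ultimately obtain H where "H \<in> borel_measurable (\<nu> l)" "(\<lambda>k. \<integral>\<^sup>+x. ennreal (norm (g k x - H x) powr p) \<partial>\<nu> l) \<longlonglongrightarrow> 0"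
    using Lp_complete[of p g "\<nu> l"] by blast
  moreover have "borel_measurable (\<nu> l) = (borel_measurable borel :: ('a \<Rightarrow> 'a) set)" by (rule measurable_cong_sets) auto
  ultimately have "\<exists>G. G \<in> borel_measurable borel \<and> (\<lambda>k. \<integral>\<^sup>+x. ennreal (norm (g k x - G x) powr p) \<partial>\<nu> l) \<longlonglongrightarrow> 0"
    by auto
  from someI_ex[OF this] show "G \<in> borel_measurable borel"
    "(\<lambda>k. \<integral>\<^sup>+x. ennreal (norm (g k x - G x) powr p) \<partial>\<nu> l) \<longlonglongrightarrow> 0"
    unfolding G_def by blast+
qed

text \<open>On this part of \<Omega> the norm lies between r and a bound B for \<Omega>, and a power
  is monotone or antitone according to the sign of its exponent; so the smaller end value bounds it
  from below.\<close>

lemma weight_lower: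
  assumes "0 < r"
  obtains c where "0 < c" "\<And>x. x \<in> \<Omega> \<Longrightarrow> r \<le> norm x \<Longrightarrow> c \<le> norm x powr a"
proof -
  obtain B where B: "0 < B" "\<And>x. x \<in> \<Omega> \<Longrightarrow> norm x \<le> B" using bounded_\<Omega> unfolding bounded_pos by blast
  show ?thesis
  proof (rule that)
    show "0 < min (r powr a) (B powr a)" using assms B by simp
    show "min (r powr a) (B powr a) \<le> norm x powr a" if x: "x \<in> \<Omega>" "r \<le> norm x" for x
    proof (cases "0 \<le> a")
      case True
      then have "r powr a \<le> norm x powr a" using x assms by (intro powr_mono2) auto
      then show ?thesis by simp
    next
      case False
      then have "B powr a \<le> norm x powr a" using x assms B(2)[OF x(1)] by (intro powr_mono2') auto
      then show ?thesis by simp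
    qed
  qed
qed

text \<open>The constant is fixed before the set and the function, so that one constant serves a
  whole sequence.\<close>

lemma unweight:
  assumes r: "0 < r"
  obtains c where "0 < c" "\<And>A F. A \<in> sets borel \<Longrightarrow> A \<subseteq> {x \<in> \<Omega>. r \<le> norm x} \<Longrightarrow> F \<in> borel_measurable borel \<Longrightarrow> (\<And>x. 0 \<le> F x) \<Longrightarrow>
    (\<integral>\<^sup>+x\<in>A. ennreal (F x) \<partial>lborel) \<le> ennreal c * (\<integral>\<^sup>+x. ennreal (F x) \<partial>\<nu> a)"
proof -
  obtain c where c: "0 < c" "\<And>x. x \<in> \<Omega> \<Longrightarrow> r \<le> norm x \<Longrightarrow> c \<le> norm x powr a" by (rule weight_lower[OF r, where a=a], rule that)
  show ?thesis
  proof (rule that[of "1 / c"])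
    fix A and F :: "'a \<Rightarrow> real"
    assume A: "A \<in> sets borel" "A \<subseteq> {x \<in> \<Omega>. r \<le> norm x}" and F [measurable]: "F \<in> borel_measurable borel" and F0: "\<And>x. 0 \<le> F x"
    have "(\<integral>\<^sup>+x\<in>A. ennreal (F x) \<partial>lborel) \<le> (\<integral>\<^sup>+x. ennreal (1 / c) * (ennreal (norm x powr a * F x) * indicator \<Omega> x) \<partial>lborel)"
    proof (rule nn_integral_mono)
      fix x
      show "ennreal (F x) * indicator A x \<le> ennreal (1 / c) * (ennreal (norm x powr a * F x) * indicator \<Omega> x)"
      proof (cases "x \<in> A")
        case True
        then have x: "x \<in> \<Omega>" "c \<le> norm x powr a" using A(2) c(2) by auto
        have "F x = 1 / c * (c * F x)" using c(1) by simp
        also have "\<dots> \<le> 1 / c * (norm x powr a * F x)" using x(2) c(1) F0[of x] by (intro mult_left_mono mult_right_mono) auto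
        finally have "ennreal (F x) \<le> ennreal (1 / c * (norm x powr a * F x))" by (rule ennreal_leI)
        also have "\<dots> = ennreal (1 / c) * ennreal (norm x powr a * F x)" using c(1) F0[of x] by (intro ennreal_mult) auto
        finally show ?thesis using True x(1) by simp
      qed simp
    qed
    also have "\<dots> = ennreal (1 / c) * (\<integral>\<^sup>+x. ennreal (F x) \<partial>\<nu> a)"
      by (simp add: nn_integral_cmult nn_integral_\<nu>[OF F F0])
    finally show "(\<integral>\<^sup>+x\<in>A. ennreal (F x) \<partial>lborel) \<le> ennreal (1 / c) * (\<integral>\<^sup>+x. ennreal (F x) \<partial>\<nu> a)" .
  qed (use c in simp)
qed

lemma local_limit:
  assumes r: "0 < r" and A: "A \<in> sets borel" "A \<subseteq> {x \<in> \<Omega>. r \<le> norm x}"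
  shows "(\<lambda>k. \<integral>\<^sup>+x\<in>A. ennreal (norm (f k x - v x) powr p) \<partial>lborel) \<longlonglongrightarrow> 0"
    and "(\<lambda>k. \<integral>\<^sup>+x\<in>A. ennreal (norm (g k x - G x) powr p) \<partial>lborel) \<longlonglongrightarrow> 0"
proof -
  have *: "(\<lambda>k. \<integral>\<^sup>+x\<in>A. ennreal (F k x) \<partial>lborel) \<longlonglongrightarrow> 0"
    if F: "\<And>k. F k \<in> borel_measurable borel" "\<And>k x. 0 \<le> F k x" and lim: "(\<lambda>k. \<integral>\<^sup>+x. ennreal (F k x) \<partial>\<nu> a) \<longlonglongrightarrow> 0" for F a
  proof -
    show ?thesis
    proof (rule unweight[OF r, where a=a])
      fix c :: real
      assume c: "\<And>A F. A \<in> sets borel \<Longrightarrow> A \<subseteq> {x \<in> \<Omega>. r \<le> norm x} \<Longrightarrow> F \<in> borel_measurable borel \<Longrightarrow> (\<And>x. 0 \<le> F x) \<Longrightarrow>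
        (\<integral>\<^sup>+x\<in>A. ennreal (F x) \<partial>lborel) \<le> ennreal c * (\<integral>\<^sup>+x. ennreal (F x) \<partial>\<nu> a)"
      have 0: "(\<lambda>k. ennreal c * (\<integral>\<^sup>+x. ennreal (F k x) \<partial>\<nu> a)) \<longlonglongrightarrow> 0"
        using ennreal_tendsto_cmult[OF _ lim, of "ennreal c"] by simp
      show ?thesis by (rule tendsto_sandwich[OF _ _ tendsto_const 0]) (use c[OF A F] in auto)
    qed
  qed
  show "(\<lambda>k. \<integral>\<^sup>+x\<in>A. ennreal (norm (f k x - v x) powr p) \<partial>lborel) \<longlonglongrightarrow> 0" by (rule *[OF _ _ lim_f]) auto
  show "(\<lambda>k. \<integral>\<^sup>+x\<in>A. ennreal (norm (g k x - G x) powr p) \<partial>lborel) \<longlonglongrightarrow> 0" by (rule *[OF _ _ lim_g]) auto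
qed

text \<open>A compact set avoiding the origin has positive distance from it. There the weighted L^p
  limits are plain L^p limits, hence L1 limits, and can be integrated against continuous
  functions.\<close>

lemma compact_limit:
  assumes K: "compact K" "K \<subseteq> \<Omega> - {0}" and \<zeta>: "continuous_on UNIV \<zeta>" and e: "e \<in> Basis"
  shows "set_integrable lborel K v" "(\<lambda>k. LINT x:K|lborel. \<zeta> x * f k x) \<longlonglongrightarrow> (LINT x:K|lborel. \<zeta> x * v x)"
    "set_integrable lborel K (\<lambda>x. G x \<bullet> e)" "(\<lambda>k. LINT x:K|lborel. \<zeta> x * (g k x \<bullet> e)) \<longlonglongrightarrow> (LINT x:K|lborel. \<zeta> x * (G x \<bullet> e))"
proof -
  have Kb: "K \<in> sets borel" using K(1) by (rule borel_compact)
  obtain r where r: "0 < r" "\<And>x. x \<in> K \<Longrightarrow> r \<le> dist 0 x"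
    using separate_point_closed[OF compact_imp_closed[OF K(1)], of 0] K(2) by blast
  have A: "K \<subseteq> {x \<in> \<Omega>. r \<le> norm x}" using r(2) K(2) by auto
  have fin: "emeasure lborel K < \<infinity>" by (rule emeasure_compact_finite[OF K(1)])
  have Lf: "(\<lambda>k. \<integral>\<^sup>+x\<in>K. ennreal \<bar>f k x - v x\<bar> \<partial>lborel) \<longlonglongrightarrow> 0"
    by (rule L1_tendsto_of_Lp[OF p _ _ fin]) (use Kb local_limit(1)[OF r(1) Kb A] in simp_all)
  have "(\<lambda>k. \<integral>\<^sup>+x\<in>K. ennreal (\<bar>g k x \<bullet> e - G x \<bullet> e\<bar> powr p) \<partial>lborel) \<longlonglongrightarrow> 0"
  proof (rule tendsto_sandwich[OF _ _ tendsto_const local_limit(2)[OF r(1) Kb A]])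
    have "\<bar>g k x \<bullet> e - G x \<bullet> e\<bar> powr p \<le> norm (g k x - G x) powr p" for k x
      using Basis_le_norm[OF e, of "g k x - G x"] p by (intro powr_mono2) (auto simp: inner_diff_left)
    then show "\<forall>\<^sub>F k in sequentially. (\<integral>\<^sup>+x\<in>K. ennreal (\<bar>g k x \<bullet> e - G x \<bullet> e\<bar> powr p) \<partial>lborel) \<le> (\<integral>\<^sup>+x\<in>K. ennreal (norm (g k x - G x) powr p) \<partial>lborel)"
      by (intro always_eventually allI nn_integral_mono mult_right_mono ennreal_leI) auto
  qed auto
  then have Lg: "(\<lambda>k. \<integral>\<^sup>+x\<in>K. ennreal \<bar>g k x \<bullet> e - G x \<bullet> e\<bar> \<partial>lborel) \<longlonglongrightarrow> 0"
    by (intro L1_tendsto_of_Lp[OF p _ _ fin]) (use Kb in simp_all)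
  have K\<Omega>: "K \<subseteq> \<Omega>" using K(2) by auto
  have cf: "continuous_on K (f k)" and cg: "continuous_on K (g k)" for k
  proof -
    show "continuous_on K (f k)"
      by (rule continuous_on_eq[OF continuous_on_subset[OF smooth_on_GDERIV(3)[OF sm[of k]] K\<Omega>]]) (use K\<Omega> in \<open>auto simp: f_def\<close>)
    show "continuous_on K (g k)"
      by (rule continuous_on_eq[OF continuous_on_subset[OF smooth_on_GDERIV(2)[OF sm[of k]] K\<Omega>]]) (use K\<Omega> in \<open>auto simp: g_def\<close>)
  qed
  have i: "set_integrable lborel K (f k)" "set_integrable lborel K (\<lambda>x. g k x \<bullet> e)" for k
    unfolding set_integrable_def
    by (intro borel_integrable_compact K(1) cf cg continuous_on_inner continuous_on_const)+
  show "set_integrable lborel K v" "(\<lambda>k. LINT x:K|lborel. \<zeta> x * f k x) \<longlonglongrightarrow> (LINT x:K|lborel. \<zeta> x * v x)"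
    by (rule integral_test_tendsto[OF K(1) \<zeta> v_borel i(1) fg_borel(1) Lf])+
  show "set_integrable lborel K (\<lambda>x. G x \<bullet> e)" "(\<lambda>k. LINT x:K|lborel. \<zeta> x * (g k x \<bullet> e)) \<longlonglongrightarrow> (LINT x:K|lborel. \<zeta> x * (G x \<bullet> e))"
    by (rule integral_test_tendsto[OF K(1) \<zeta> _ i(2) _ Lg]; measurable)+
qed

text \<open>The integration by parts formula holds for every smooth \<phi> k. Tested functions are
  supported away from the origin, so both sides converge componentwise, and the formula survives for
  \<open>v\<close> and \<open>G\<close>.\<close>

lemma weak_gradient_limit: "has_weak_gradient (\<Omega> - {0}) u G"
proof (rule has_weak_gradient_cong_AE[OF v_borel])
  show "AE x in lebesgue. x \<in> \<Omega> - {0} \<longrightarrow> u x = v x" using u_eq_v by eventually_elim simp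
  show "open (\<Omega> - {0})" using open_\<Omega> by (simp add: open_delete)
  have iK: "set_integrable lborel K v" "set_integrable lborel K G" if K: "compact K" "K \<subseteq> \<Omega> - {0}" for K
  proof -
    show "set_integrable lborel K v"
      using compact_limit(1)[OF K continuous_on_const[of UNIV 0] SOME_Basis] .
    have "set_integrable lborel K (\<lambda>x. \<Sum>e\<in>Basis. (G x \<bullet> e) *\<^sub>R e)"
    proof (rule set_integral_sum(1))
      fix e :: 'a assume "e \<in> Basis"
      from compact_limit(3)[OF K continuous_on_const[of UNIV 0] this]
      show "set_integrable lborel K (\<lambda>x. (G x \<bullet> e) *\<^sub>R e)"
        using integrable_scaleR_left[of e lborel "\<lambda>x. indicator K x * (G x \<bullet> e)"] by (simp add: set_integrable_def)
    qed
    then show "set_integrable lborel K G" by (simp add: euclidean_representation)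
  qed
  show "has_weak_gradient (\<Omega> - {0}) v G"
    unfolding has_weak_gradient_def
  proof (intro conjI allI impI; (elim conjE)?)
    fix K assume K: "compact K" "K \<subseteq> \<Omega> - {0}"
    have [measurable]: "K \<in> sets borel" using K(1) by (rule borel_compact)
    have "(\<lambda>x. indicator K x *\<^sub>R v x) \<in> borel_measurable borel" "(\<lambda>x. indicator K x *\<^sub>R G x) \<in> borel_measurable borel"
      by measurable
    from set_integrable_lebesgue_lborel(1)[OF this(1)] set_integrable_lebesgue_lborel(1)[OF this(2)] iK[OF K]
    show "set_integrable lebesgue K v" "set_integrable lebesgue K G" by simp_all
  next
    fix \<psi> assume \<psi>: "test_function (\<Omega> - {0}) \<psi>"
    obtain K where K: "compact K" "K \<subseteq> \<Omega> - {0}" "\<And>x. x \<notin> K \<Longrightarrow> \<psi> x = 0" "\<And>x. x \<notin> K \<Longrightarrow> gradient \<psi> x = 0"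
      and c: "continuous_on UNIV (gradient \<psi>)" "continuous_on UNIV \<psi>"
      by (rule test_functionD[OF \<psi>], rule that)
    have \<psi>\<Omega>: "test_function \<Omega> \<psi>" using \<psi> unfolding test_function_def by blast
    have [measurable]: "K \<in> sets borel" "gradient \<psi> \<in> borel_measurable borel" "\<psi> \<in> borel_measurable borel"
      using borel_compact[OF K(1)] c by (auto intro: borel_measurable_continuous_onI)
    let ?a = "\<lambda>x. v x *\<^sub>R gradient \<psi> x" and ?b = "\<lambda>x. \<psi> x *\<^sub>R G x"
    have a: "(LINT x:\<Omega> - {0}|lebesgue. h x) = (LINT x:K|lborel. h x)"
      if "\<And>x. x \<notin> K \<Longrightarrow> h x = 0" and h: "(\<lambda>x. indicator K x *\<^sub>R h x) \<in> borel_measurable borel" for h :: "'a \<Rightarrow> 'a"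
    proof -
      have "(LINT x:\<Omega> - {0}|lebesgue. h x) = (LINT x:K|lebesgue. h x)"
        unfolding set_lebesgue_integral_def
        by (intro Bochner_Integration.integral_cong refl) (use that(1) K(2) in \<open>auto simp: indicator_def\<close>)
      then show ?thesis using set_integrable_lebesgue_lborel(2)[OF h] by simp
    qed
    have eq: "(LINT x:\<Omega> - {0}|lebesgue. ?a x) = (LINT x:K|lborel. ?a x)" "(LINT x:\<Omega> - {0}|lebesgue. ?b x) = (LINT x:K|lborel. ?b x)"
      by (intro a; (use K(3,4) in simp)?; measurable)+
    obtain B1 where B1: "\<And>x. x \<in> K \<Longrightarrow> \<bar>\<psi> x\<bar> \<le> B1"
      by (rule bounded_image_compact_real[OF K(1) continuous_on_subset[OF c(2) subset_UNIV]], rule that)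
    have ib: "set_integrable lborel K ?b"
      by (rule set_integrable_bounded_mult[OF iK(2)[OF K(1,2)] _ B1]) (simp_all add: set_borel_measurable_def)
    have ia: "set_integrable lborel K ?a"
    proof -
      have "set_integrable lborel K (\<lambda>x. \<Sum>e\<in>Basis. ((gradient \<psi> x \<bullet> e) *\<^sub>R v x) *\<^sub>R e)"
      proof (rule set_integral_sum(1))
        fix e :: 'a
        obtain B2 where B2: "\<And>x. x \<in> K \<Longrightarrow> \<bar>gradient \<psi> x \<bullet> e\<bar> \<le> B2"
          by (rule bounded_image_compact_real[OF K(1), of "\<lambda>x. gradient \<psi> x \<bullet> e"])
            (intro continuous_on_inner continuous_on_const continuous_on_subset[OF c(1) subset_UNIV], rule that)
        have "set_integrable lborel K (\<lambda>x. (gradient \<psi> x \<bullet> e) *\<^sub>R v x)"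
          by (rule set_integrable_bounded_mult[OF iK(1)[OF K(1,2)] _ B2]) (simp_all add: set_borel_measurable_def)
        then show "set_integrable lborel K (\<lambda>x. ((gradient \<psi> x \<bullet> e) *\<^sub>R v x) *\<^sub>R e)"
          using integrable_scaleR_left[of e lborel "\<lambda>x. indicator K x * ((gradient \<psi> x \<bullet> e) * v x)"] by (simp add: set_integrable_def)
      qed
      moreover have "(\<Sum>e\<in>Basis. ((gradient \<psi> x \<bullet> e) *\<^sub>R v x) *\<^sub>R e) = ?a x" for x
        by (simp add: scaleR_scaleR[symmetric] mult.commute[of _ "v x"] scaleR_sum_right[symmetric] euclidean_representation del: scaleR_scaleR)
      ultimately show ?thesis by simp
    qed
    have inner: "(LINT x:K|lborel. h x) \<bullet> e = (LINT x:K|lborel. h x \<bullet> e)" if "set_integrable lborel K h" for h :: "'a \<Rightarrow> 'a" and e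
      using that integral_inner_left[of e lborel "\<lambda>x. indicator K x *\<^sub>R h x"] by (simp add: set_integrable_def set_lebesgue_integral_def)
    have "(LINT x:K|lborel. ?a x) \<bullet> e = (- (LINT x:K|lborel. ?b x)) \<bullet> e" if e: "e \<in> Basis" for e
    proof -
      have ce: "continuous_on UNIV (\<lambda>x. gradient \<psi> x \<bullet> e)" by (intro continuous_on_inner continuous_on_const c(1))
      have k: "(LINT x:K|lborel. (gradient \<psi> x \<bullet> e) * f k x) = - (LINT x:K|lborel. \<psi> x * (g k x \<bullet> e))" for k
      proof -
        have K\<Omega>: "K \<subseteq> \<Omega>" using K(2) by auto
        have "(LINT x:K|lborel. (gradient \<psi> x \<bullet> e) * f k x) = (LINT x:K|lborel. (gradient \<psi> x \<bullet> e) * \<phi> k x)"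
          "(LINT x:K|lborel. \<psi> x * (g k x \<bullet> e)) = (LINT x:K|lborel. \<psi> x * (gradient (\<phi> k) x \<bullet> e))"
          using K\<Omega> by (auto intro!: set_lebesgue_integral_cong simp: f_def g_def)
        then show ?thesis using smooth_weak_gradient[OF sm[of k] \<psi>\<Omega> e K(1) K\<Omega> K(3,4)] by simp
      qed
      have "(LINT x:K|lborel. (gradient \<psi> x \<bullet> e) * v x) = - (LINT x:K|lborel. \<psi> x * (G x \<bullet> e))"
        using compact_limit(2)[OF K(1,2) ce e] tendsto_minus[OF compact_limit(4)[OF K(1,2) c(2) e]]
        unfolding k by (rule LIMSEQ_unique)
      then show ?thesis by (simp add: inner[OF ia] inner[OF ib] mult.commute)
    qed
    then show "(LINT x:\<Omega> - {0}|lebesgue. ?a x) = - (LINT x:\<Omega> - {0}|lebesgue. ?b x)"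
      unfolding eq by (rule euclidean_eqI)
  qed
qed

lemma hatW_gradient_eq: "AE x in lebesgue. x \<in> \<Omega> \<longrightarrow> hatW_gradient \<Omega> u x = G x"
proof -
  have "has_weak_gradient (\<Omega> - {0}) u (hatW_gradient \<Omega> u)"
    unfolding hatW_gradient_def weak_gradient_def by (rule someI[of "has_weak_gradient (\<Omega> - {0}) u", OF weak_gradient_limit])
  from weak_gradient_unique[OF _ this weak_gradient_limit]
  have "AE x in lebesgue. x \<in> \<Omega> - {0} \<longrightarrow> hatW_gradient \<Omega> u x = G x" using open_\<Omega> by (simp add: open_delete)
  moreover have "AE x in lebesgue. x \<noteq> (0::'a)" by (rule AE_completion[OF AE_lborel_singleton])
  ultimately show ?thesis by eventually_elim auto
qed

end

lemma (in hardy_domain) trace_inequality_diff: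
  assumes U: "open U" "frontier \<Omega> \<subseteq> U"
  shows "\<exists>C>0. \<forall>a b. smooth_on \<Omega> a \<longrightarrow> continuous_on (closure \<Omega>) a \<longrightarrow> smooth_on \<Omega> b \<longrightarrow> continuous_on (closure \<Omega>) b \<longrightarrow>
    (\<integral>\<^sup>+x\<in>frontier \<Omega>. ennreal (norm (a x - b x) powr p) \<partial>S) \<le> ennreal C *
      ((\<integral>\<^sup>+x\<in>\<Omega> \<inter> U. ennreal (norm (a x - b x) powr p) \<partial>lborel) + (\<integral>\<^sup>+x\<in>\<Omega> \<inter> U. ennreal (norm (gradient a x - gradient b x) powr p) \<partial>lborel))"
proof (rule trace_inequality[OF U])
  fix C :: real
  assume "0 < C" and C: "\<And>\<phi>. smooth_on \<Omega> \<phi> \<Longrightarrow> continuous_on (closure \<Omega>) \<phi> \<Longrightarrow>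
    (\<integral>\<^sup>+x\<in>frontier \<Omega>. ennreal (\<bar>\<phi> x\<bar> powr p) \<partial>S) \<le> ennreal C *
      ((\<integral>\<^sup>+x\<in>\<Omega> \<inter> U. ennreal (\<bar>\<phi> x\<bar> powr p) \<partial>lborel) + (\<integral>\<^sup>+x\<in>\<Omega> \<inter> U. ennreal (norm (gradient \<phi> x) powr p) \<partial>lborel))"
  show ?thesis
  proof (intro exI[of _ C] conjI allI impI \<open>0 < C\<close>)
    fix a b assume s: "smooth_on \<Omega> a" "smooth_on \<Omega> b" and c: "continuous_on (closure \<Omega>) a" "continuous_on (closure \<Omega>) b"
    have "(\<integral>\<^sup>+x\<in>\<Omega> \<inter> U. ennreal (norm (gradient (\<lambda>x. a x - b x) x) powr p) \<partial>lborel)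
       = (\<integral>\<^sup>+x\<in>\<Omega> \<inter> U. ennreal (norm (gradient a x - gradient b x) powr p) \<partial>lborel)"
      by (intro nn_integral_cong) (auto simp: indicator_def gradient_diff[OF s])
    then show "(\<integral>\<^sup>+x\<in>frontier \<Omega>. ennreal (norm (a x - b x) powr p) \<partial>S) \<le> ennreal C *
      ((\<integral>\<^sup>+x\<in>\<Omega> \<inter> U. ennreal (norm (a x - b x) powr p) \<partial>lborel) + (\<integral>\<^sup>+x\<in>\<Omega> \<inter> U. ennreal (norm (gradient a x - gradient b x) powr p) \<partial>lborel))"
      using C[OF smooth_on_diff[OF open_\<Omega> s] continuous_on_diff[OF c]] by simp
  qed
qed

section \<open>The trace of the limit function\<close>

context hardy_sequence
begin

text \<open>A neighbourhood of the frontier that stays away from the origin: on \<Omega> \<inter> U0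
  the weights are bounded below, so convergence in the norm implies plain L^p convergence of
  functions and gradients.\<close>

definition U0 :: "'a set" where "U0 = - cball 0 \<rho>"

lemma U0: "open U0" "frontier \<Omega> \<subseteq> U0" "\<Omega> \<inter> U0 \<subseteq> {x \<in> \<Omega>. \<rho> \<le> norm x}" "\<Omega> \<inter> U0 \<subseteq> \<Omega> - {0}"
  using frontier_disjoint \<rho> by (auto simp: U0_def open_Compl subset_iff)

definition b where "b k x = indicator (frontier \<Omega>) x * \<phi> k x"

lemma b_borel [measurable]: "b k \<in> borel_measurable borel"
proof -
  have "(\<lambda>x. indicator (frontier \<Omega>) x *\<^sub>R \<phi> k x) \<in> borel_measurable borel"
    by (rule borel_measurable_continuous_on_indicator[OF frontier_borel continuous_on_subset[OF cl frontier_closure]])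
  then show ?thesis by (simp add: b_def[abs_def])
qed

lemma local_dist:
  assumes "\<And>i j. F i j \<in> borel_measurable borel" "\<And>i j x. 0 \<le> F i j x"
  shows "\<exists>c>0. \<forall>i j. (\<integral>\<^sup>+x\<in>\<Omega> \<inter> U0. ennreal (F i j x) \<partial>lborel) \<le> ennreal c * (\<integral>\<^sup>+x. ennreal (F i j x) \<partial>\<nu> a)"
proof (rule unweight[OF \<rho>(1), where a=a])
  fix c :: real
  assume "0 < c" and c: "\<And>A F. A \<in> sets borel \<Longrightarrow> A \<subseteq> {x \<in> \<Omega>. \<rho> \<le> norm x} \<Longrightarrow> F \<in> borel_measurable borel \<Longrightarrow> (\<And>x. 0 \<le> F x) \<Longrightarrow>
        (\<integral>\<^sup>+x\<in>A. ennreal (F x) \<partial>lborel) \<le> ennreal c * (\<integral>\<^sup>+x. ennreal (F x) \<partial>\<nu> a)"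
  have "\<Omega> \<inter> U0 \<in> sets borel" using open_\<Omega> U0(1) by auto
  from c[OF this U0(3) assms] show ?thesis using \<open>0 < c\<close> by blast
qed

text \<open>The norm contains boundary values only on \<open>boundary_minus\<close>. On the whole
  frontier they are controlled through the interior, by the trace inequality on \<Omega> \<inter>
  U0.\<close>

lemma dist_b: "\<exists>D\<ge>0. \<forall>i j. (\<integral>\<^sup>+x. ennreal (norm (b i x - b j x) powr p) \<partial>S) \<le> ennreal (D * hatW_norm \<Omega> p l (\<lambda>x. \<phi> i x - \<phi> j x) powr p)"
proof -
  obtain C where C: "0 < C" "\<forall>a b. smooth_on \<Omega> a \<longrightarrow> continuous_on (closure \<Omega>) a \<longrightarrow> smooth_on \<Omega> b \<longrightarrow> continuous_on (closure \<Omega>) b \<longrightarrow>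
    (\<integral>\<^sup>+x\<in>frontier \<Omega>. ennreal (norm (a x - b x) powr p) \<partial>S) \<le> ennreal C *
      ((\<integral>\<^sup>+x\<in>\<Omega> \<inter> U0. ennreal (norm (a x - b x) powr p) \<partial>lborel) + (\<integral>\<^sup>+x\<in>\<Omega> \<inter> U0. ennreal (norm (gradient a x - gradient b x) powr p) \<partial>lborel))"
    using trace_inequality_diff[OF U0(1,2)] by blast
  obtain c1 where c1: "0 < c1" "\<And>i j. (\<integral>\<^sup>+x\<in>\<Omega> \<inter> U0. ennreal (norm (f i x - f j x) powr p) \<partial>lborel) \<le> ennreal c1 * (\<integral>\<^sup>+x. ennreal (norm (f i x - f j x) powr p) \<partial>\<nu> (l - p))"
    using local_dist[of "\<lambda>i j x. norm (f i x - f j x) powr p" "l - p"] by auto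
  obtain c2 where c2: "0 < c2" "\<And>i j. (\<integral>\<^sup>+x\<in>\<Omega> \<inter> U0. ennreal (norm (g i x - g j x) powr p) \<partial>lborel) \<le> ennreal c2 * (\<integral>\<^sup>+x. ennreal (norm (g i x - g j x) powr p) \<partial>\<nu> l)"
    using local_dist[of "\<lambda>i j x. norm (g i x - g j x) powr p" l] by auto
  show ?thesis
  \<comment> \<open>\<open>C\<close> comes from the trace inequality, \<open>c1\<close> and
    \<open>c2\<close> from removing the weights of functions and gradients, and the power of
    \<open>C0\<close> from bounding the mass by the norm.\<close>
  proof (intro exI[of _ "C * (c1 * C0 powr p + c2)"] conjI allI)
    show "0 \<le> C * (c1 * C0 powr p + c2)" using C c1 c2 by simp
    fix i j
    let ?n = "hatW_norm \<Omega> p l (\<lambda>x. \<phi> i x - \<phi> j x) powr p"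
    have "(\<integral>\<^sup>+x. ennreal (norm (b i x - b j x) powr p) \<partial>S) = (\<integral>\<^sup>+x\<in>frontier \<Omega>. ennreal (norm (\<phi> i x - \<phi> j x) powr p) \<partial>S)"
      using p by (intro nn_integral_cong) (auto simp: b_def indicator_def)
    also have "\<dots> \<le> ennreal C *
      ((\<integral>\<^sup>+x\<in>\<Omega> \<inter> U0. ennreal (norm (\<phi> i x - \<phi> j x) powr p) \<partial>lborel) + (\<integral>\<^sup>+x\<in>\<Omega> \<inter> U0. ennreal (norm (gradient (\<phi> i) x - gradient (\<phi> j) x) powr p) \<partial>lborel))"
      using C(2) sm cl by blast
    also have "(\<integral>\<^sup>+x\<in>\<Omega> \<inter> U0. ennreal (norm (\<phi> i x - \<phi> j x) powr p) \<partial>lborel) = (\<integral>\<^sup>+x\<in>\<Omega> \<inter> U0. ennreal (norm (f i x - f j x) powr p) \<partial>lborel)"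
      by (intro nn_integral_cong) (auto simp: f_def indicator_def)
    also have "(\<integral>\<^sup>+x\<in>\<Omega> \<inter> U0. ennreal (norm (gradient (\<phi> i) x - gradient (\<phi> j) x) powr p) \<partial>lborel) = (\<integral>\<^sup>+x\<in>\<Omega> \<inter> U0. ennreal (norm (g i x - g j x) powr p) \<partial>lborel)"
      by (intro nn_integral_cong) (auto simp: g_def indicator_def)
    also have "ennreal C * ((\<integral>\<^sup>+x\<in>\<Omega> \<inter> U0. ennreal (norm (f i x - f j x) powr p) \<partial>lborel) + (\<integral>\<^sup>+x\<in>\<Omega> \<inter> U0. ennreal (norm (g i x - g j x) powr p) \<partial>lborel))
       \<le> ennreal C * (ennreal c1 * ennreal (C0 powr p * ?n) + ennreal c2 * ennreal ?n)"
      by (intro mult_left_mono add_mono order_trans[OF c1(2)] order_trans[OF c2(2)] dist_f dist_g) auto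
    also have "\<dots> = ennreal (C * (c1 * (C0 powr p * ?n) + c2 * ?n))"
      using C(1) c1(1) c2(1) by (simp flip: ennreal_mult ennreal_plus)
    also have "C * (c1 * (C0 powr p * ?n) + c2 * ?n) = C * (c1 * C0 powr p + c2) * ?n" by (simp add: algebra_simps)
    finally show "(\<integral>\<^sup>+x. ennreal (norm (b i x - b j x) powr p) \<partial>S) \<le> ennreal (C * (c1 * C0 powr p + c2) * ?n)" .
  qed
qed

definition tr where "tr = (SOME t. t \<in> borel_measurable borel \<and>
  (\<lambda>k. \<integral>\<^sup>+x. ennreal (norm (b k x - t x) powr p) \<partial>S) \<longlonglongrightarrow> 0)"

lemma tr_borel [measurable]: "tr \<in> borel_measurable borel"
  and lim_b: "(\<lambda>k. \<integral>\<^sup>+x. ennreal (norm (b k x - tr x) powr p) \<partial>S) \<longlonglongrightarrow> 0"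
proof -
  obtain D where D: "0 \<le> D" "\<forall>i j. (\<integral>\<^sup>+x. ennreal (norm (b i x - b j x) powr p) \<partial>S) \<le> ennreal (D * hatW_norm \<Omega> p l (\<lambda>x. \<phi> i x - \<phi> j x) powr p)"
    using dist_b by blast
  have "\<exists>N. \<forall>i\<ge>N. \<forall>j\<ge>N. (\<integral>\<^sup>+x. ennreal (norm (b i x - b j x) powr p) \<partial>S) < ennreal e" if "0 < e" for e
    by (rule Cauchy_of_norm[OF _ D(1) that]) (use D(2) in blast)
  moreover have "b k \<in> borel_measurable S" for k by measurable
  moreover have "0 < p" using p by simp
  ultimately obtain H where "H \<in> borel_measurable S" "(\<lambda>k. \<integral>\<^sup>+x. ennreal (norm (b k x - H x) powr p) \<partial>S) \<longlonglongrightarrow> 0"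
    using Lp_complete[of p b S] by blast
  moreover have "borel_measurable S = (borel_measurable borel :: ('a \<Rightarrow> real) set)" by (rule measurable_cong_sets) auto
  ultimately have "\<exists>t. t \<in> borel_measurable borel \<and> (\<lambda>k. \<integral>\<^sup>+x. ennreal (norm (b k x - t x) powr p) \<partial>S) \<longlonglongrightarrow> 0"
    by auto
  from someI_ex[OF this] show "tr \<in> borel_measurable borel"
    "(\<lambda>k. \<integral>\<^sup>+x. ennreal (norm (b k x - tr x) powr p) \<partial>S) \<longlonglongrightarrow> 0"
    unfolding tr_def by blast+
qed

lemma lim_tr: "(\<lambda>k. \<integral>\<^sup>+x\<in>frontier \<Omega>. ennreal (norm (\<phi> k x - tr x) powr p) \<partial>S) \<longlonglongrightarrow> 0"
proof (rule tendsto_sandwich[OF _ _ tendsto_const lim_b])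
  show "\<forall>\<^sub>F k in sequentially. (\<integral>\<^sup>+x\<in>frontier \<Omega>. ennreal (norm (\<phi> k x - tr x) powr p) \<partial>S) \<le> (\<integral>\<^sup>+x. ennreal (norm (b k x - tr x) powr p) \<partial>S)"
    by (intro always_eventually allI nn_integral_mono) (auto simp: b_def indicator_def)
qed auto

lemma near_frontier:
  assumes A: "A \<in> sets borel" "A \<subseteq> \<Omega> \<inter> U0"
  shows "(\<lambda>k. \<integral>\<^sup>+x\<in>A. ennreal (norm (\<phi> k x - v x) powr p) \<partial>lborel) \<longlonglongrightarrow> 0"
    and "(\<lambda>k. \<integral>\<^sup>+x\<in>A. ennreal (norm (gradient (\<phi> k) x - G x) powr p) \<partial>lborel) \<longlonglongrightarrow> 0"
proof -
  have A': "A \<subseteq> {x \<in> \<Omega>. \<rho> \<le> norm x}" using A(2) U0(3) by (rule order_trans)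
  have "(\<integral>\<^sup>+x\<in>A. ennreal (norm (\<phi> k x - v x) powr p) \<partial>lborel) = (\<integral>\<^sup>+x\<in>A. ennreal (norm (f k x - v x) powr p) \<partial>lborel)"
    "(\<integral>\<^sup>+x\<in>A. ennreal (norm (gradient (\<phi> k) x - G x) powr p) \<partial>lborel) = (\<integral>\<^sup>+x\<in>A. ennreal (norm (g k x - G x) powr p) \<partial>lborel)" for k
    using A(2) by (auto intro!: nn_integral_cong simp: f_def g_def indicator_def)
  then show "(\<lambda>k. \<integral>\<^sup>+x\<in>A. ennreal (norm (\<phi> k x - v x) powr p) \<partial>lborel) \<longlonglongrightarrow> 0"
    "(\<lambda>k. \<integral>\<^sup>+x\<in>A. ennreal (norm (gradient (\<phi> k) x - G x) powr p) \<partial>lborel) \<longlonglongrightarrow> 0"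
    using local_limit[OF \<rho>(1) A(1) A'] by simp_all
qed

lemma has_trace_tr: "has_trace \<Omega> p u tr"
  unfolding has_trace_def
proof (intro conjI exI[of _ U0] exI[of _ G] exI[of _ \<phi>] allI)
  have A: "\<Omega> \<inter> U0 \<in> sets borel" using open_\<Omega> U0(1) by auto
  show "set_borel_measurable S (frontier \<Omega>) tr" unfolding set_borel_measurable_def by measurable
  show "has_weak_gradient (\<Omega> \<inter> U0) u G" by (rule has_weak_gradient_subset[OF weak_gradient_limit U0(4)])
  have "(\<integral>\<^sup>+x\<in>\<Omega> \<inter> U0. ennreal (\<bar>\<phi> k x - u x\<bar> powr p) \<partial>lebesgue) = (\<integral>\<^sup>+x\<in>\<Omega> \<inter> U0. ennreal (norm (\<phi> k x - v x) powr p) \<partial>lborel)" for k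
    by (rule set_nn_lebesgue_AE_eq) (use u_eq_v in \<open>eventually_elim, auto\<close>)
  then show "(\<lambda>k. \<integral>\<^sup>+x\<in>\<Omega> \<inter> U0. ennreal (\<bar>\<phi> k x - u x\<bar> powr p) \<partial>lebesgue) \<longlonglongrightarrow> 0"
    using near_frontier(1)[OF A] by simp
  show "(\<lambda>k. \<integral>\<^sup>+x\<in>\<Omega> \<inter> U0. ennreal (norm (gradient (\<phi> k) x - G x) powr p) \<partial>lebesgue) \<longlonglongrightarrow> 0"
    using near_frontier(2)[OF A] by (simp add: nn_integral_completion)
  show "(\<lambda>k. \<integral>\<^sup>+x\<in>frontier \<Omega>. ennreal (\<bar>\<phi> k x - tr x\<bar> powr p) \<partial>S) \<longlonglongrightarrow> 0"
    using lim_tr by simp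
qed (use U0 sm cl in auto)

text \<open>Near the frontier the sequence \<phi> and the sequence given with the other trace
  converge to the same function and, by uniqueness of the weak gradient, have the same limit of
  gradients. Their differences tend to zero there, and the trace inequality carries this over to the
  boundary values.\<close>

lemma trace_unique:
  assumes t: "has_trace \<Omega> p u t"
  shows "AE x in S. x \<in> frontier \<Omega> \<longrightarrow> t x = tr x"
proof -
  obtain U H \<xi> where U: "open U" "frontier \<Omega> \<subseteq> U" and H: "has_weak_gradient (\<Omega> \<inter> U) u H"
    and s: "\<And>k::nat. smooth_on \<Omega> (\<xi> k)" "\<And>k. continuous_on (closure \<Omega>) (\<xi> k)"
    and L: "(\<lambda>k. \<integral>\<^sup>+x\<in>\<Omega> \<inter> U. ennreal (\<bar>\<xi> k x - u x\<bar> powr p) \<partial>lebesgue) \<longlonglongrightarrow> 0"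
      "(\<lambda>k. \<integral>\<^sup>+x\<in>\<Omega> \<inter> U. ennreal (norm (gradient (\<xi> k) x - H x) powr p) \<partial>lebesgue) \<longlonglongrightarrow> 0"
      "(\<lambda>k. \<integral>\<^sup>+x\<in>frontier \<Omega>. ennreal (\<bar>\<xi> k x - t x\<bar> powr p) \<partial>S) \<longlonglongrightarrow> 0"
    using t unfolding has_trace_def by blast
  have tm: "(\<lambda>x. indicator (frontier \<Omega>) x *\<^sub>R t x) \<in> borel_measurable S"
    using t by (simp add: has_trace_def set_borel_measurable_def)
  \<comment> \<open>On this set both descriptions of u are available: that of the given trace on
    \<open>U\<close> and that of \<phi> on \<open>U0\<close>.\<close>
  define A where "A = \<Omega> \<inter> (U \<inter> U0)"
  have A: "A \<in> sets borel" "A \<subseteq> \<Omega> \<inter> U0" "A \<subseteq> \<Omega> \<inter> U" "A \<subseteq> \<Omega>" "open A"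
    using open_\<Omega> U(1) U0(1) by (auto simp: A_def)
  have GH: "AE x in lebesgue. x \<in> A \<longrightarrow> H x = G x"
    by (rule weak_gradient_unique[OF A(5) has_weak_gradient_subset[OF H A(3)]])
      (rule has_weak_gradient_subset[OF weak_gradient_limit], use A(2) U0(4) in blast)
  have m: "(\<lambda>x. indicator A x *\<^sub>R \<psi> x) \<in> borel_measurable lborel" "(\<lambda>x. indicator A x *\<^sub>R gradient \<psi> x) \<in> borel_measurable lborel"
    if "smooth_on \<Omega> \<psi>" for \<psi>
    using borel_measurable_continuous_on_indicator[OF A(1) continuous_on_subset[OF smooth_on_GDERIV(3)[OF that] A(4)]]
      borel_measurable_continuous_on_indicator[OF A(1) continuous_on_subset[OF smooth_on_GDERIV(2)[OF that] A(4)]] by simp_all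
  have mv: "(\<lambda>x. indicator A x *\<^sub>R v x) \<in> borel_measurable lborel" "(\<lambda>x. indicator A x *\<^sub>R G x) \<in> borel_measurable lborel"
    using A(1) by measurable
  have sub: "(\<lambda>k. \<integral>\<^sup>+x\<in>A. F k x \<partial>lborel) \<longlonglongrightarrow> 0"
    if lim: "(\<lambda>k. \<integral>\<^sup>+x\<in>\<Omega> \<inter> U. F' k x \<partial>lebesgue) \<longlonglongrightarrow> 0" and eq: "\<And>k. AE x in lebesgue. x \<in> A \<longrightarrow> F' k x = F k x" for F F' :: "nat \<Rightarrow> 'a \<Rightarrow> ennreal"
  proof (rule tendsto_sandwich[OF _ _ tendsto_const lim])
    have "(\<integral>\<^sup>+x\<in>A. F k x \<partial>lborel) \<le> (\<integral>\<^sup>+x\<in>\<Omega> \<inter> U. F' k x \<partial>lebesgue)" for k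
      unfolding set_nn_lebesgue_AE_eq[OF eq, symmetric] by (intro nn_integral_mono) (use A(3) in \<open>auto simp: indicator_def\<close>)
    then show "\<forall>\<^sub>F k in sequentially. (\<integral>\<^sup>+x\<in>A. F k x \<partial>lborel) \<le> (\<integral>\<^sup>+x\<in>\<Omega> \<inter> U. F' k x \<partial>lebesgue)" by simp
  qed auto
  have p0: "0 \<le> p" using p by simp
  have "(\<lambda>k. \<integral>\<^sup>+x\<in>A. ennreal (norm (v x - \<xi> k x) powr p) \<partial>lborel) \<longlonglongrightarrow> 0"
    by (rule sub[OF L(1)]) (use u_eq_v in \<open>eventually_elim, use A(4) in \<open>auto simp: abs_minus_commute\<close>\<close>)
  from Lp_null_trans[OF p0 _ m(1)[OF sm] mv(1) m(1)[OF s(1)] near_frontier(1)[OF A(1,2)] this] A(1)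
  have 1: "(\<lambda>k. \<integral>\<^sup>+x\<in>A. ennreal (norm (\<phi> k x - \<xi> k x) powr p) \<partial>lborel) \<longlonglongrightarrow> 0" by simp
  have "(\<lambda>k. \<integral>\<^sup>+x\<in>A. ennreal (norm (G x - gradient (\<xi> k) x) powr p) \<partial>lborel) \<longlonglongrightarrow> 0"
    by (rule sub[OF L(2)]) (use GH in \<open>eventually_elim, auto simp: norm_minus_commute\<close>)
  from Lp_null_trans[OF p0 _ m(2)[OF sm] mv(2) m(2)[OF s(1)] near_frontier(2)[OF A(1,2)] this] A(1)
  have 2: "(\<lambda>k. \<integral>\<^sup>+x\<in>A. ennreal (norm (gradient (\<phi> k) x - gradient (\<xi> k) x) powr p) \<partial>lborel) \<longlonglongrightarrow> 0" by simp
  have UU: "open (U \<inter> U0)" "frontier \<Omega> \<subseteq> U \<inter> U0" using U U0 by auto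
  obtain C where C: "\<forall>a b. smooth_on \<Omega> a \<longrightarrow> continuous_on (closure \<Omega>) a \<longrightarrow> smooth_on \<Omega> b \<longrightarrow> continuous_on (closure \<Omega>) b \<longrightarrow>
    (\<integral>\<^sup>+x\<in>frontier \<Omega>. ennreal (norm (a x - b x) powr p) \<partial>S) \<le> ennreal C *
      ((\<integral>\<^sup>+x\<in>A. ennreal (norm (a x - b x) powr p) \<partial>lborel) + (\<integral>\<^sup>+x\<in>A. ennreal (norm (gradient a x - gradient b x) powr p) \<partial>lborel))"
    using trace_inequality_diff[OF UU] unfolding A_def by blast
  have 3: "(\<lambda>k. \<integral>\<^sup>+x\<in>frontier \<Omega>. ennreal (norm (\<phi> k x - \<xi> k x) powr p) \<partial>S) \<longlonglongrightarrow> 0"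
  proof (rule tendsto_sandwich[OF _ _ tendsto_const])
    show "(\<lambda>k. ennreal C * ((\<integral>\<^sup>+x\<in>A. ennreal (norm (\<phi> k x - \<xi> k x) powr p) \<partial>lborel)
        + (\<integral>\<^sup>+x\<in>A. ennreal (norm (gradient (\<phi> k) x - gradient (\<xi> k) x) powr p) \<partial>lborel))) \<longlonglongrightarrow> 0"
      using ennreal_tendsto_cmult[OF _ tendsto_add[OF 1 2], of "ennreal C"] by simp
    show "\<forall>\<^sub>F k in sequentially. (\<integral>\<^sup>+x\<in>frontier \<Omega>. ennreal (norm (\<phi> k x - \<xi> k x) powr p) \<partial>S) \<le>
      ennreal C * ((\<integral>\<^sup>+x\<in>A. ennreal (norm (\<phi> k x - \<xi> k x) powr p) \<partial>lborel)
        + (\<integral>\<^sup>+x\<in>A. ennreal (norm (gradient (\<phi> k) x - gradient (\<xi> k) x) powr p) \<partial>lborel))"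
      using C sm cl s by (intro always_eventually allI) blast
  qed auto
  have mS: "(\<lambda>x. indicator (frontier \<Omega>) x *\<^sub>R \<psi> x) \<in> borel_measurable S" if "continuous_on (closure \<Omega>) \<psi>" for \<psi> :: "'a \<Rightarrow> real"
    using borel_measurable_continuous_on_indicator[OF frontier_borel continuous_on_subset[OF that frontier_closure]] by simp
  have fS: "frontier \<Omega> \<in> sets S" by simp
  have mtr: "(\<lambda>x. indicator (frontier \<Omega>) x *\<^sub>R tr x) \<in> borel_measurable S" by measurable
  have 4: "(\<lambda>k. \<integral>\<^sup>+x\<in>frontier \<Omega>. ennreal (norm (tr x - \<phi> k x) powr p) \<partial>S) \<longlonglongrightarrow> 0"
    using lim_tr by (simp add: abs_minus_commute)
  have 5: "(\<lambda>k. \<integral>\<^sup>+x\<in>frontier \<Omega>. ennreal (norm (\<xi> k x - t x) powr p) \<partial>S) \<longlonglongrightarrow> 0" using L(3) by simp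
  have "(\<lambda>k::nat. \<integral>\<^sup>+x\<in>frontier \<Omega>. ennreal (norm (tr x - t x) powr p) \<partial>S) \<longlonglongrightarrow> 0"
    by (rule Lp_null_trans[OF p0 fS mtr mS[OF s(2)] tm Lp_null_trans[OF p0 fS mtr mS[OF cl] mS[OF s(2)] 4 3] 5])
  then have z: "(\<integral>\<^sup>+x\<in>frontier \<Omega>. ennreal (norm (tr x - t x) powr p) \<partial>S) = 0"
    by (simp add: tendsto_const_iff)
  \<comment> \<open>Measurability of t is known only after restriction to the frontier.\<close>
  define t0 where "t0 x = indicator (frontier \<Omega>) x *\<^sub>R t x" for x
  have [measurable]: "t0 \<in> borel_measurable S" using tm by (simp add: t0_def[abs_def])
  have "(\<integral>\<^sup>+x\<in>frontier \<Omega>. ennreal (norm (tr x - t0 x) powr p) \<partial>S) = (\<integral>\<^sup>+x\<in>frontier \<Omega>. ennreal (norm (tr x - t x) powr p) \<partial>S)"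
    by (intro nn_integral_cong) (auto simp: t0_def indicator_def)
  also note z
  finally have z0: "(\<integral>\<^sup>+x\<in>frontier \<Omega>. ennreal (norm (tr x - t0 x) powr p) \<partial>S) = 0" .
  have "(\<lambda>x. ennreal (norm (tr x - t0 x) powr p) * indicator (frontier \<Omega>) x) \<in> borel_measurable S" by measurable
  from iffD1[OF nn_integral_0_iff_AE[OF this] z0]
  have "AE x in S. ennreal (norm (tr x - t0 x) powr p) * indicator (frontier \<Omega>) x = 0" .
  then show ?thesis
    by eventually_elim (auto simp: t0_def indicator_def powr_eq_0_iff split: if_splits)
qed

section \<open>Limits of the terms of the inequality\<close>

lemma mass_limit: "set_integrable lborel \<Omega> (\<lambda>x. W x * \<bar>v x\<bar> powr p)" "(\<lambda>k. mass (\<phi> k)) \<longlonglongrightarrow> mass v"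
proof -
  have eq: "(LINT x|\<nu> (l - p). \<bar>f k x\<bar> powr p) = mass (\<phi> k)" "integrable (\<nu> (l - p)) (\<lambda>x. \<bar>f k x\<bar> powr p)" for k
  proof -
    have *: "indicator \<Omega> x *\<^sub>R (norm x powr (l - p) * \<bar>f k x\<bar> powr p) = indicator \<Omega> x *\<^sub>R (W x * \<bar>\<phi> k x\<bar> powr p)" for x
      by (simp add: indicator_def f_def W_def)
    have fm: "(\<lambda>x. \<bar>f k x\<bar> powr p) \<in> borel_measurable borel" by measurable
    show "(LINT x|\<nu> (l - p). \<bar>f k x\<bar> powr p) = mass (\<phi> k)"
      unfolding integral_\<nu>(2)[OF fm] mass_def set_lebesgue_integral_def * ..
    have "set_integrable lborel \<Omega> (\<lambda>x. W x * \<bar>\<phi> k x\<bar> powr p)"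
      using pre[of k] hardy_smooth(1)[OF pre_energy[OF pre]] by (auto simp: pre_iff)
    then show "integrable (\<nu> (l - p)) (\<lambda>x. \<bar>f k x\<bar> powr p)"
      unfolding integral_\<nu>(1)[OF fm] set_integrable_def * .
  qed
  have vm: "(\<lambda>x. \<bar>v x\<bar> powr p) \<in> borel_measurable borel" by measurable
  have p0: "0 < p" using p by simp
  have m: "f k \<in> borel_measurable (\<nu> a)" "v \<in> borel_measurable (\<nu> a)" for k a by measurable
  note L = Lp_limit[OF p0 m eq(2) lim_f[unfolded real_norm_def]]
  show "set_integrable lborel \<Omega> (\<lambda>x. W x * \<bar>v x\<bar> powr p)" "(\<lambda>k. mass (\<phi> k)) \<longlonglongrightarrow> mass v"
    using L unfolding integral_\<nu>[OF vm] eq(1) mass_def W_def by simp_all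
qed

lemma radial_limit: "(\<lambda>k. radial (gradient (\<phi> k))) \<longlonglongrightarrow> radial G"
proof -
  define r where "r h x = (x \<bullet> h x) / norm x" for h :: "'a \<Rightarrow> 'a" and x
  have [measurable]: "r (g k) \<in> borel_measurable borel" "r G \<in> borel_measurable borel" for k
    unfolding r_def[abs_def] by measurable
  have eq: "(LINT x|\<nu> l. \<bar>r (g k) x\<bar> powr p) = radial (gradient (\<phi> k))" "integrable (\<nu> l) (\<lambda>x. \<bar>r (g k) x\<bar> powr p)" for k
  proof -
    have *: "indicator \<Omega> x *\<^sub>R (norm x powr l * \<bar>r (g k) x\<bar> powr p) = indicator \<Omega> x *\<^sub>R (norm x powr l * \<bar>(x \<bullet> gradient (\<phi> k) x) / norm x\<bar> powr p)" for x
      by (simp add: indicator_def g_def r_def)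
    have fm: "(\<lambda>x. \<bar>r (g k) x\<bar> powr p) \<in> borel_measurable borel" by measurable
    show "(LINT x|\<nu> l. \<bar>r (g k) x\<bar> powr p) = radial (gradient (\<phi> k))"
      unfolding integral_\<nu>(2)[OF fm] radial_def set_lebesgue_integral_def * ..
    show "integrable (\<nu> l) (\<lambda>x. \<bar>r (g k) x\<bar> powr p)"
      unfolding integral_\<nu>(1)[OF fm] set_integrable_def *
      using radial_integrable(1)[OF grad_measurable(1)[OF sm] en] by (simp add: set_integrable_def)
  qed
  have le: "\<bar>r (g k) x - r G x\<bar> \<le> norm (g k x - G x)" for k x
  proof (cases "x = 0")
    case False
    have "r (g k) x - r G x = (x \<bullet> (g k x - G x)) / norm x" by (simp add: r_def inner_diff_right diff_divide_distrib)
    then show ?thesis using Cauchy_Schwarz_ineq2[of x "g k x - G x"] False by (simp add: divide_le_eq mult.commute)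
  qed (simp add: r_def)
  have lim: "(\<lambda>k. \<integral>\<^sup>+x. ennreal (\<bar>r (g k) x - r G x\<bar> powr p) \<partial>\<nu> l) \<longlonglongrightarrow> 0"
  proof (rule tendsto_sandwich[OF _ _ tendsto_const lim_g])
    show "\<forall>\<^sub>F k in sequentially. (\<integral>\<^sup>+x. ennreal (\<bar>r (g k) x - r G x\<bar> powr p) \<partial>\<nu> l) \<le> (\<integral>\<^sup>+x. ennreal (norm (g k x - G x) powr p) \<partial>\<nu> l)"
      using p by (intro always_eventually allI nn_integral_mono ennreal_leI powr_mono2 le) auto
  qed auto
  have p0: "0 < p" using p by simp
  have m: "r (g k) \<in> borel_measurable (\<nu> l)" "r G \<in> borel_measurable (\<nu> l)" for k by measurable
  have Gm: "(\<lambda>x. \<bar>r G x\<bar> powr p) \<in> borel_measurable borel" by measurable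
  show ?thesis
    using Lp_limit(2)[OF p0 m eq(2) lim] unfolding eq(1) integral_\<nu>(2)[OF Gm] by (simp add: radial_def r_def)
qed

definition w where "w x = indicator (frontier \<Omega>) x * ((x \<bullet> \<eta> x) * W x)"

lemma cont_weight: "continuous_on (frontier \<Omega>) (\<lambda>x. (x \<bullet> \<eta> x) * W x)"
  unfolding W_def
  by (intro continuous_on_mult continuous_on_inner continuous_on_id cont_\<eta> continuous_on_powr continuous_on_norm continuous_on_const)
    (use frontier_nonzero in auto)

lemma w_borel [measurable]: "w \<in> borel_measurable borel"
  using borel_measurable_continuous_on_indicator[OF frontier_borel cont_weight] by (simp add: w_def[abs_def])

lemma flux_eq: "flux h = (LINT x|S. w x * \<bar>h x\<bar> powr p)"
  by (simp add: flux_def set_lebesgue_integral_def w_def mult.assoc)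

text \<open>The weight (x \<bullet> \<eta>) W may change sign along the frontier. Its positive and
  negative parts are nonnegative and bounded there, and \<open>Lp_weighted_limit\<close> applies to
  each of them.\<close>

lemma flux_limit: "(\<lambda>k. flux (\<phi> k)) \<longlonglongrightarrow> flux tr"
proof -
  define W1 where "W1 s x = max 0 (s * w x)" for s x
  have [measurable]: "W1 s \<in> borel_measurable borel" for s unfolding W1_def[abs_def] by measurable
  obtain B where B: "0 \<le> B" "\<And>x. x \<in> frontier \<Omega> \<Longrightarrow> \<bar>(x \<bullet> \<eta> x) * W x\<bar> \<le> B"
    by (rule bounded_image_compact_real[OF compact_frontier cont_weight], rule that)
  have wB: "\<bar>w x\<bar> \<le> B" for x using B by (cases "x \<in> frontier \<Omega>") (auto simp: w_def)
  have W1B: "0 \<le> W1 s x" "s \<in> {-1, 1} \<Longrightarrow> W1 s x \<le> B" for s x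
    using wB[of x] B(1) by (auto simp: W1_def)
  have i: "integrable S (\<lambda>x. W1 s x * \<bar>b k x\<bar> powr p)" for s k
  proof -
    have "set_integrable S (frontier \<Omega>) (\<lambda>x. max 0 (s * ((x \<bullet> \<eta> x) * W x)) * \<bar>\<phi> k x\<bar> powr p)"
      using p by (intro S_integrable continuous_on_mult continuous_on_max continuous_on_const cont_weight
        continuous_on_powr' continuous_on_rabs continuous_on_subset[OF cl frontier_closure]) auto
    moreover have "indicator (frontier \<Omega>) x *\<^sub>R (max 0 (s * ((x \<bullet> \<eta> x) * W x)) * \<bar>\<phi> k x\<bar> powr p) = W1 s x * \<bar>b k x\<bar> powr p" for x
      using p by (simp add: W1_def w_def b_def indicator_def)
    ultimately show ?thesis by (simp add: set_integrable_def)
  qed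
  have p0: "0 < p" using p by simp
  have m: "b k \<in> borel_measurable S" "tr \<in> borel_measurable S" "W1 s \<in> borel_measurable S" for k s by measurable
  have L: "integrable S (\<lambda>x. W1 s x * \<bar>tr x\<bar> powr p)" "(\<lambda>k. LINT x|S. W1 s x * \<bar>b k x\<bar> powr p) \<longlonglongrightarrow> (LINT x|S. W1 s x * \<bar>tr x\<bar> powr p)"
    if s: "s \<in> {-1, 1}" for s
    by (rule Lp_weighted_limit[OF p0 m W1B(1) W1B(2)[OF s] i lim_b[unfolded real_norm_def]])+
  have split: "w x = W1 1 x - W1 (-1) x" for x by (simp add: W1_def max_def)
  have fb: "flux (\<phi> k) = (LINT x|S. W1 1 x * \<bar>b k x\<bar> powr p) - (LINT x|S. W1 (-1) x * \<bar>b k x\<bar> powr p)" for k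
  proof -
    have "w x * \<bar>\<phi> k x\<bar> powr p = W1 1 x * \<bar>b k x\<bar> powr p - W1 (-1) x * \<bar>b k x\<bar> powr p" for x
      unfolding left_diff_distrib[symmetric] split[symmetric] by (simp add: w_def b_def indicator_def)
    then show ?thesis unfolding flux_eq using Bochner_Integration.integral_diff[OF i[of 1 k] i[of "-1" k]] by simp
  qed
  have ft: "flux tr = (LINT x|S. W1 1 x * \<bar>tr x\<bar> powr p) - (LINT x|S. W1 (-1) x * \<bar>tr x\<bar> powr p)"
    unfolding flux_eq split left_diff_distrib by (rule Bochner_Integration.integral_diff) (auto intro: L)
  show ?thesis unfolding fb ft by (intro tendsto_diff L) auto
qed

lemma hardy_limit: "\<bar>\<kappa>\<bar> * mass v + sgn \<kappa> * flux tr \<le> p * mass v powr (1 - 1/p) * radial G powr (1/p)"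
proof (rule LIMSEQ_le)
  show "(\<lambda>k. \<bar>\<kappa>\<bar> * mass (\<phi> k) + sgn \<kappa> * flux (\<phi> k)) \<longlonglongrightarrow> \<bar>\<kappa>\<bar> * mass v + sgn \<kappa> * flux tr"
    by (intro tendsto_intros mass_limit flux_limit)
  have "(\<lambda>k. mass (\<phi> k) powr (1 - 1/p)) \<longlonglongrightarrow> mass v powr (1 - 1/p)"
    using p mass_nonneg by (intro tendsto_powr' mass_limit tendsto_const) auto
  moreover have "(\<lambda>k. radial (gradient (\<phi> k)) powr (1/p)) \<longlonglongrightarrow> radial G powr (1/p)"
    using p radial_nonneg by (intro tendsto_powr' radial_limit tendsto_const) auto
  ultimately show "(\<lambda>k. p * mass (\<phi> k) powr (1 - 1/p) * radial (gradient (\<phi> k)) powr (1/p)) \<longlonglongrightarrow> p * mass v powr (1 - 1/p) * radial G powr (1/p)"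
    by (intro tendsto_mult tendsto_const)
  show "\<exists>N. \<forall>k\<ge>N. \<bar>\<kappa>\<bar> * mass (\<phi> k) + sgn \<kappa> * flux (\<phi> k) \<le> p * mass (\<phi> k) powr (1 - 1/p) * radial (gradient (\<phi> k)) powr (1/p)"
    using hardy_smooth(2)[OF pre_energy[OF pre]] pre by (auto simp: pre_iff)
qed

text \<open>The weight is positive except at the origin, which is a null set; zero mass would force
  u to vanish almost everywhere. This permits the division in the final step.\<close>

lemma mass_pos:
  assumes "\<not> (AE x in lebesgue. x \<in> \<Omega> \<longrightarrow> u x = 0)"
  shows "0 < mass v"
proof (rule ccontr)
  assume "\<not> 0 < mass v"
  then have "(LINT x|lborel. indicator \<Omega> x *\<^sub>R (W x * \<bar>v x\<bar> powr p)) = 0"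
    using mass_nonneg[of v] by (simp add: mass_def set_lebesgue_integral_def)
  then have "AE x in lborel. indicator \<Omega> x *\<^sub>R (W x * \<bar>v x\<bar> powr p) = 0"
    using mass_limit(1) unfolding set_integrable_def
    by (subst (asm) integral_nonneg_eq_0_iff_AE) (auto simp: W_nonneg)
  then have "AE x in lebesgue. indicator \<Omega> x *\<^sub>R (W x * \<bar>v x\<bar> powr p) = 0" by (rule AE_completion)
  moreover have "AE x in lebesgue. x \<noteq> (0::'a)" by (rule AE_completion[OF AE_lborel_singleton])
  ultimately have "AE x in lebesgue. x \<in> \<Omega> \<longrightarrow> u x = 0" using u_eq_v
    by eventually_elim (auto simp: W_def)
  then show False using assms by simp
qed

lemma mass_u: "(LINT x:\<Omega>|lebesgue. norm x powr (l - p) * \<bar>u x\<bar> powr p) = mass v"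
  unfolding mass_def W_def
proof (rule set_lebesgue_AE_eq(2))
  show "AE x in lebesgue. x \<in> \<Omega> \<longrightarrow> norm x powr (l - p) * \<bar>u x\<bar> powr p = norm x powr (l - p) * \<bar>v x\<bar> powr p"
    using u_eq_v by eventually_elim simp
qed measurable

lemma radial_u: "(LINT x:\<Omega>|lebesgue. norm x powr l * \<bar>(x \<bullet> hatW_gradient \<Omega> u x) / norm x\<bar> powr p) = radial G"
  unfolding radial_def
proof (rule set_lebesgue_AE_eq(2))
  show "AE x in lebesgue. x \<in> \<Omega> \<longrightarrow> norm x powr l * \<bar>(x \<bullet> hatW_gradient \<Omega> u x) / norm x\<bar> powr p = norm x powr l * \<bar>(x \<bullet> G x) / norm x\<bar> powr p"
    using hatW_gradient_eq by eventually_elim simp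
qed measurable

lemma flux_u: "(LINT x:frontier \<Omega>|S. norm x powr (l - p) * (x \<bullet> \<eta> x) * \<bar>trace_of \<Omega> p u x\<bar> powr p) = flux tr"
proof -
  define t where "t x = indicator (frontier \<Omega>) x *\<^sub>R trace_of \<Omega> p u x" for x
  have T: "has_trace \<Omega> p u (trace_of \<Omega> p u)"
    unfolding trace_of_def by (rule someI[of "has_trace \<Omega> p u", OF has_trace_tr])
  have [measurable]: "t \<in> borel_measurable S"
    using T by (simp add: has_trace_def set_borel_measurable_def t_def[abs_def])
  have "(LINT x:frontier \<Omega>|S. norm x powr (l - p) * (x \<bullet> \<eta> x) * \<bar>trace_of \<Omega> p u x\<bar> powr p) = (LINT x|S. w x * \<bar>t x\<bar> powr p)"
    unfolding set_lebesgue_integral_def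
    by (intro Bochner_Integration.integral_cong refl) (simp add: w_def W_def t_def indicator_def)
  also have "\<dots> = (LINT x|S. w x * \<bar>tr x\<bar> powr p)"
  proof (rule integral_cong_AE)
    show "AE x in S. w x * \<bar>t x\<bar> powr p = w x * \<bar>tr x\<bar> powr p"
      using trace_unique[OF T] by eventually_elim (simp add: w_def t_def indicator_def)
  qed measurable
  finally show ?thesis by (simp add: flux_eq)
qed

end

theorem theorem4p1:
  fixes \<Omega> :: "'a::euclidean_space set" and p p' l :: real and u :: "'a \<Rightarrow> real"
  assumes "p > 1" and "1 / p + 1 / p' = 1" and "DIM('a) \<ge> 2"
    and "open \<Omega>" and "connected \<Omega>" and "bounded \<Omega>" and "C1_boundary \<Omega>" and "0 \<in> \<Omega>"
    and "l \<noteq> p - real DIM('a)"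
    and "u \<in> hatW \<Omega> p l"
    and "\<not> (AE x in lebesgue. x \<in> \<Omega> \<longrightarrow> u x = 0)"
  shows "(LINT x:\<Omega>|lebesgue.
            norm x powr l * \<bar>(x \<bullet> hatW_gradient \<Omega> u x) / norm x\<bar> powr p) powr (1 / p)
    \<ge> \<bar>(p - l - real DIM('a)) / p\<bar>
         * (LINT x:\<Omega>|lebesgue. norm x powr (l - p) * \<bar>u x\<bar> powr p) powr (1 / p)
      + 1 / p * sgn (p - l - real DIM('a))
         * (LINT x:frontier \<Omega>|surface_measure (frontier \<Omega>).
              norm x powr (l - p) * (x \<bullet> outward_normal \<Omega> x) * \<bar>trace_of \<Omega> p u x\<bar> powr p)
         * (LINT x:\<Omega>|lebesgue. norm x powr (l - p) * \<bar>u x\<bar> powr p) powr (- (1 / p'))"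
proof -
  obtain \<phi> where \<phi>: "\<And>k::nat. \<phi> k \<in> hatW_pre \<Omega> p l"
     "\<forall>e>0. \<exists>N. \<forall>i\<ge>N. \<forall>j\<ge>N. hatW_norm \<Omega> p l (\<lambda>x. \<phi> i x - \<phi> j x) < e"
     "AE x in lebesgue. x \<in> \<Omega> \<longrightarrow> (\<lambda>k. \<phi> k x) \<longlonglongrightarrow> u x"
    using assms(10) unfolding hatW_def by blast
  interpret hardy_sequence \<Omega> p l \<phi> u
    by unfold_locales (use assms \<phi> in auto)
  define A R T where "A = mass v" and "R = radial G" and "T = flux tr"
  have A: "0 < A" unfolding A_def by (rule mass_pos[OF assms(11)])
  have p': "1 / p' = 1 - 1 / p" using assms(2) by simp
  have cancel: "A powr (1 - 1/p) * A powr (- (1 - 1/p)) = 1" using A by (simp flip: powr_add)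
  have A1: "A * A powr (- (1 - 1/p)) = A powr (1/p)" using A by (simp add: powr_mult_base)
  \<comment> \<open>Multiplication by A^(-1/p') brings the limit inequality into the stated form: it
    cancels the power of \<open>A\<close> on the right and turns the factor A on the left into
    A^(1/p).\<close>
  have "(\<bar>\<kappa>\<bar> * A + sgn \<kappa> * T) * A powr (- (1 - 1/p)) \<le> (p * A powr (1 - 1/p) * R powr (1/p)) * A powr (- (1 - 1/p))"
    using hardy_limit unfolding A_def R_def T_def by (rule mult_right_mono) simp
  also have "\<dots> = p * R powr (1/p) * (A powr (1 - 1/p) * A powr (- (1 - 1/p)))" by (simp only: mult_ac)
  finally have "\<bar>\<kappa>\<bar> * (A * A powr (- (1 - 1/p))) + sgn \<kappa> * T * A powr (- (1 - 1/p)) \<le> p * R powr (1/p)"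
    unfolding cancel by (simp only: distrib_right mult.assoc mult_1_right)
  then have "(\<bar>\<kappa>\<bar> * A powr (1/p) + sgn \<kappa> * T * A powr (- (1 - 1/p))) / p \<le> R powr (1/p)"
    unfolding A1 using p by (simp add: divide_le_eq mult.commute)
  moreover have "(\<bar>\<kappa>\<bar> * A powr (1/p) + sgn \<kappa> * T * A powr (- (1 - 1/p))) / p
      = \<bar>\<kappa> / p\<bar> * A powr (1/p) + 1 / p * sgn \<kappa> * T * A powr (- (1 / p'))"
    unfolding p' using p by (simp add: add_divide_distrib)
  ultimately show ?thesis
    unfolding mass_u radial_u flux_u \<kappa>_def[symmetric] A_def[symmetric] R_def[symmetric] T_def[symmetric] by simp
qed

end
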